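(* Let $s\in[1/2,1)$, let $f\in\mathscr D'(\mathbf R^d)$, let $P$ be a polynomial on $\mathbf R^d$, let $\varphi\in\mathcal E^s_{0,\infty}(\mathbf R^d)$, and let $(x_0,\xi_0)\in\mathbf R^d\times(\mathbf R^d\setminus\{0\})$. Then the following is true: (1) If $(x_0,\xi_0)\notin WF_s(f)$, and the distribution $g\in\mathscr S'(\mathbf R^d)$ with $f\sim_{x_0} g$ in the definition of Gevrey regularity of order $s$ at $(x_0,\xi_0)$ can be chosen such that, in addition, $\|\widehat g(\xi)\langle\xi\rangle^{-M}\|_{L^\infty}<\infty$ for some $M>0$, then $(x_0,\xi_0)\notin WF_s(\varphi f)$. (2) $WF_s(P(D)f)\subseteq WF_s(f)$.
   Context: Notation: $\langle\xi\rangle=(1+|\xi|^2)^{1/2}$; $\mathbf N$ denotes the nonnegative integers and $\mathbf Z_+$ the positive integers; $D=-i\partial$, i.e. $D^\alpha=(-i)^{|\alpha|}\partial^\alpha$; the Fourier transform is $(\mathcal Ff)(\xi)=\widehat f(\xi)=(2\pi)^{-d/2}\int f(x)e^{-i\langle x,\xi\rangle}dx$, extended to $\mathscr S'(\mathbf R^d)$. For $x_0\in\mathbf R^d$ and $N\in\mathbf Z_+$, $E_{x_0,N}(x)=e^{-|x-x_0|^2/(4N)}$. An open cone is an open subset of $\mathbf R^d\setminus\{0\}$ invariant under multiplication by positive reals. The convention $0^0=1$ is used. Relation: for $f\in\mathscr D'(X)$, $g\in\mathscr D'(Y)$ ($X,Y\subseteq\mathbf R^d$ open) and $x_0\in X\cap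 Y$, $f\sim_{x_0}g$ means that $f=g$ in an open neighborhood of $x_0$. Wave-front set: let $s\in[1/2,1)$ and $f\in\mathscr D'(\mathbf R^d)$. A point $(x_0,\xi_0)\in\mathbf R^d\times(\mathbf R^d\setminus\{0\})$ is a Gevrey regular point of order $s$ for $f$ if there exist $g\in\mathscr S'(\mathbf R^d)$, an open cone $\Gamma$ containing $\xi_0$, $C>0$ and $N_0\in\mathbf Z_+$ such that $f\sim_{x_0}g$ and, for every integer $N\ge N_0$, $|(\mathcal F(g\,E_{x_0,N}))(\xi)|\le C^{n+1}n^{sn}\langle\xi\rangle^{-n}$ for all $\xi\in\Gamma$ and all $n\in\mathbf N$ with $n\le N$. The set $WF_s(f)$ is the complement in $\mathbf R^d\times(\mathbf R^d\setminus\{0\})$ of the set of Gevrey regular points of order $s$ for $f$. Space: $\mathcal E^s_{0,\infty}(\mathbf R^d)$ consists of all $\varphi\in C^\infty(\mathbf R^d)$ (tempered) with $\widehat\varphi\in L^\infty(\mathbf R^d)$ such that for some $h>0$, $\sup_{\alpha\in\mathbf N^d}\frac{h^{|\alpha|}\,\|\langle\xi\rangle^{|\alpha|}\widehat\varphi(\xi)\|_{L^\infty(\mathbf R^d)}}{\alpha!^s}<\infty$. *)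

theory Defs
  imports "HOL-Analysis.Analysis" "HOL-Probability.Essential_Supremum" "HOL-Library.Poly_Mapping"
begin

section \<open>Multi-indices and partial derivatives\<close>

type_synonym 'n multi_index = "'n \<Rightarrow>\<^sub>0 nat"

definition mi_length :: "'n::finite multi_index \<Rightarrow> nat" where
  "mi_length \<alpha> = (\<Sum>i\<in>UNIV. Poly_Mapping.lookup \<alpha> i)"

definition mi_fact :: "'n::finite multi_index \<Rightarrow> real" where
  "mi_fact \<alpha> = (\<Prod>i\<in>UNIV. fact (Poly_Mapping.lookup \<alpha> i))"

definition monomial :: "'n::finite multi_index \<Rightarrow> real ^ 'n \<Rightarrow> real" where
  "monomial \<beta> x = (\<Prod>i\<in>UNIV. (x $ i) ^ Poly_Mapping.lookup \<beta> i)"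

definition partial_deriv :: "'n::finite \<Rightarrow> (real ^ 'n \<Rightarrow> complex) \<Rightarrow> real ^ 'n \<Rightarrow> complex" where
  "partial_deriv i f x = vector_derivative (\<lambda>t. f (x + t *\<^sub>R axis i 1)) (at 0)"

primrec partial_derivs :: "'n::finite list \<Rightarrow> (real ^ 'n \<Rightarrow> complex) \<Rightarrow> real ^ 'n \<Rightarrow> complex" where
  "partial_derivs [] f = f"
| "partial_derivs (i # js) f = partial_deriv i (partial_derivs js f)"

definition smooth :: "(real ^ 'n::finite \<Rightarrow> complex) \<Rightarrow> bool" where
  "smooth f \<longleftrightarrow> (\<forall>js x. partial_derivs js f differentiable (at x))"

text \<open>The index type carries no order, so the partial derivatives making up the derivative of
  multi-index \<open>\<alpha>\<close> are taken in some unspecified order. This is only ever applied to smooth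
  functions, for which the order is irrelevant.\<close>

definition mi_deriv :: "'n::finite multi_index \<Rightarrow> (real ^ 'n \<Rightarrow> complex) \<Rightarrow> real ^ 'n \<Rightarrow> complex" where
  "mi_deriv \<alpha> f = partial_derivs (SOME js. \<forall>i. count_list js i = Poly_Mapping.lookup \<alpha> i) f"

lemma ex_list_of_multi_index: "\<exists>js. \<forall>i. count_list js i = Poly_Mapping.lookup (\<alpha> :: 'n::finite multi_index) i"
proof -
  have "\<exists>js. \<forall>i. count_list js i = (if i \<in> A then Poly_Mapping.lookup \<alpha> i else 0)" if "finite A" for A
    using that
  proof (induction A)
    case empty
    show ?case by (rule exI[of _ "[]"]) simp
  next
    case (insert a A)
    then obtain js where js: "\<forall>i. count_list js i = (if i \<in> A then Poly_Mapping.lookup \<alpha> i else 0)" by blast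
    have rep: "count_list (replicate k a) i = (if i = a then k else 0)" for k i
      by (induction k) auto
    show ?case
      by (rule exI[of _ "replicate (Poly_Mapping.lookup \<alpha> a) a @ js"])
        (use js insert.hyps in \<open>auto simp: count_list_append rep\<close>)
  qed
  from this[of UNIV] show ?thesis by simp
qed

lemma finite_mi_length_le: "finite {\<alpha> :: 'n::finite multi_index. mi_length \<alpha> \<le> k}"
proof -
  have "Poly_Mapping.lookup \<alpha> i \<le> mi_length \<alpha>" for \<alpha> :: "'n multi_index" and i
    unfolding mi_length_def by (rule member_le_sum) auto
  then have "Poly_Mapping.lookup \<alpha> i \<le> k" if "mi_length \<alpha> \<le> k" for \<alpha> :: "'n multi_index" and i
    using that order_trans by blast
  then have "Poly_Mapping.lookup ` {\<alpha> :: 'n multi_index. mi_length \<alpha> \<le> k} \<subseteq> Pi\<^sub>E UNIV (\<lambda>_. {..k})"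
    by (auto simp: PiE_UNIV_domain)
  then have "finite (Poly_Mapping.lookup ` {\<alpha> :: 'n multi_index. mi_length \<alpha> \<le> k})"
    by (rule finite_subset) (simp add: finite_PiE)
  then show ?thesis
    by (rule finite_imageD) (simp add: inj_on_def)
qed


section \<open>Test functions and distributions\<close>

definition supp :: "(real ^ 'n::finite \<Rightarrow> complex) \<Rightarrow> (real ^ 'n) set" where
  "supp \<psi> = closure {x. \<psi> x \<noteq> 0}"

definition test_fun :: "(real ^ 'n::finite \<Rightarrow> complex) \<Rightarrow> bool" where
  "test_fun \<psi> \<longleftrightarrow> smooth \<psi> \<and> compact (supp \<psi>)"

definition schwartz_fun :: "(real ^ 'n::finite \<Rightarrow> complex) \<Rightarrow> bool" where
  "schwartz_fun \<psi> \<longleftrightarrow>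
     smooth \<psi> \<and> (\<forall>\<alpha> \<beta>. bounded (range (\<lambda>x. monomial \<beta> x *\<^sub>R mi_deriv \<alpha> \<psi> x)))"

definition test_seminorm :: "nat \<Rightarrow> (real ^ 'n::finite \<Rightarrow> complex) \<Rightarrow> real" where
  "test_seminorm k \<psi> = (\<Sum>\<alpha> | mi_length \<alpha> \<le> k. SUP x. norm (mi_deriv \<alpha> \<psi> x))"

definition schwartz_seminorm :: "nat \<Rightarrow> (real ^ 'n::finite \<Rightarrow> complex) \<Rightarrow> real" where
  "schwartz_seminorm k \<psi> =
     (\<Sum>\<alpha> | mi_length \<alpha> \<le> k. \<Sum>\<beta> | mi_length \<beta> \<le> k. SUP x. norm (monomial \<beta> x *\<^sub>R mi_deriv \<alpha> \<psi> x))"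

definition linear_form_on ::
  "((real ^ 'n::finite \<Rightarrow> complex) \<Rightarrow> bool) \<Rightarrow> ((real ^ 'n \<Rightarrow> complex) \<Rightarrow> complex) \<Rightarrow> bool" where
  "linear_form_on S u \<longleftrightarrow>
     (\<forall>\<psi> \<eta>. S \<psi> \<longrightarrow> S \<eta> \<longrightarrow> u (\<lambda>x. \<psi> x + \<eta> x) = u \<psi> + u \<eta>) \<and>
     (\<forall>c \<psi>. S \<psi> \<longrightarrow> u (\<lambda>x. c * \<psi> x) = c * u \<psi>)"

text \<open>Distributions are linear forms on the test functions with the usual seminorm estimates.
  As HOL functions they are also defined on other arguments, but those values never matter.\<close>

type_synonym 'n functional = "(real ^ 'n \<Rightarrow> complex) \<Rightarrow> complex"

definition distribution :: "'n::finite functional \<Rightarrow> bool" where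
  "distribution u \<longleftrightarrow> linear_form_on test_fun u \<and>
     (\<forall>K. compact K \<longrightarrow>
        (\<exists>C k. \<forall>\<psi>. test_fun \<psi> \<and> supp \<psi> \<subseteq> K \<longrightarrow> norm (u \<psi>) \<le> C * test_seminorm k \<psi>))"

definition tempered_distribution :: "'n::finite functional \<Rightarrow> bool" where
  "tempered_distribution u \<longleftrightarrow> linear_form_on schwartz_fun u \<and>
     (\<exists>C k. \<forall>\<psi>. schwartz_fun \<psi> \<longrightarrow> norm (u \<psi>) \<le> C * schwartz_seminorm k \<psi>)"

text \<open>\<open>u\<close> is (the distribution given by) the locally integrable function \<open>G\<close>.\<close>

definition given_by :: "'n::finite functional \<Rightarrow> (real ^ 'n \<Rightarrow> complex) \<Rightarrow> bool" where
  "given_by u G \<longleftrightarrow>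
     (\<forall>K. compact K \<longrightarrow> set_integrable lborel K G) \<and>
     (\<forall>\<psi>. test_fun \<psi> \<longrightarrow> u \<psi> = (LINT x|lborel. G x * \<psi> x))"

definition mult_dist :: "(real ^ 'n::finite \<Rightarrow> complex) \<Rightarrow> 'n functional \<Rightarrow> 'n functional" where
  "mult_dist a u = (\<lambda>\<psi>. u (\<lambda>x. a x * \<psi> x))"

definition deriv_dist :: "'n::finite multi_index \<Rightarrow> 'n functional \<Rightarrow> 'n functional" where
  "deriv_dist \<alpha> u = (\<lambda>\<psi>. (-1) ^ mi_length \<alpha> * u (mi_deriv \<alpha> \<psi>))"

text \<open>\<open>P(D)\<close> with \<open>D = -\<i>\<partial>\<close>; the polynomial is the finitely supported family of its coefficients.\<close>

definition poly_D :: "('n::finite multi_index \<Rightarrow>\<^sub>0 complex) \<Rightarrow> 'n functional \<Rightarrow> 'n functional" where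
  "poly_D P u =
     (\<lambda>\<psi>. \<Sum>\<alpha>\<in>Poly_Mapping.keys P. Poly_Mapping.lookup P \<alpha> * ((- \<i>) ^ mi_length \<alpha> * deriv_dist \<alpha> u \<psi>))"

definition eq_near :: "'n::finite functional \<Rightarrow> real ^ 'n \<Rightarrow> 'n functional \<Rightarrow> bool" where
  "eq_near f x0 g \<longleftrightarrow>
     (\<exists>U. open U \<and> x0 \<in> U \<and> (\<forall>\<psi>. test_fun \<psi> \<and> supp \<psi> \<subseteq> U \<longrightarrow> f \<psi> = g \<psi>))"


section \<open>Fourier transform\<close>

definition fourier :: "(real ^ 'n::finite \<Rightarrow> complex) \<Rightarrow> real ^ 'n \<Rightarrow> complex" where
  "fourier f \<xi> = complex_of_real ((2 * pi) powr (- (real CARD('n) / 2))) *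
     (LINT x|lborel. f x * exp (- \<i> * complex_of_real (x \<bullet> \<xi>)))"

definition fourier_dist :: "'n::finite functional \<Rightarrow> 'n functional" where
  "fourier_dist u = (\<lambda>\<psi>. u (fourier \<psi>))"

definition bracket :: "real ^ 'n::finite \<Rightarrow> real" where
  "bracket \<xi> = sqrt (1 + (norm \<xi>)\<^sup>2)"

definition Linf_norm :: "(real ^ 'n::finite \<Rightarrow> complex) \<Rightarrow> ereal" where
  "Linf_norm G = esssup lborel (\<lambda>\<xi>. ereal (norm (G \<xi>)))"


section \<open>The Gevrey wave-front set\<close>

definition gaussian :: "real ^ 'n::finite \<Rightarrow> nat \<Rightarrow> real ^ 'n \<Rightarrow> complex" where
  "gaussian x0 N x = complex_of_real (exp (- (norm (x - x0))\<^sup>2 / (4 * real N)))"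

definition open_cone :: "(real ^ 'n::finite) set \<Rightarrow> bool" where
  "open_cone \<Gamma> \<longleftrightarrow> open \<Gamma> \<and> 0 \<notin> \<Gamma> \<and> (\<forall>\<xi>\<in>\<Gamma>. \<forall>t>0. t *\<^sub>R \<xi> \<in> \<Gamma>)"

text \<open>The tempered distribution \<open>g\<close> is admissible in the definition of Gevrey regularity of \<open>f\<close>
  at \<open>(x0, \<xi>0)\<close>. The Fourier transform of \<open>g\<close> times a Gaussian is a smooth function; \<open>G\<close> is its
  unique continuous representative, so the bound can be stated pointwise.
  The factor \<open>n\<^bsup>sn\<^esup>\<close> is written as \<open>(n\<^sup>n)\<^sup>s\<close> because \<open>0 powr 0 = 0\<close>, whereas
  here it has to be 1 for \<open>n = 0\<close>.\<close>

definition gevrey_witness ::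
  "real \<Rightarrow> 'n::finite functional \<Rightarrow> real ^ 'n \<Rightarrow> real ^ 'n \<Rightarrow> 'n functional \<Rightarrow> bool" where
  "gevrey_witness s f x0 \<xi>0 g \<longleftrightarrow> tempered_distribution g \<and> eq_near f x0 g \<and>
     (\<exists>\<Gamma> C N0. open_cone \<Gamma> \<and> \<xi>0 \<in> \<Gamma> \<and> C > 0 \<and> N0 \<ge> 1 \<and>
       (\<forall>N\<ge>N0. \<exists>G. continuous_on UNIV G \<and> given_by (fourier_dist (mult_dist (gaussian x0 N) g)) G \<and>
          (\<forall>\<xi>\<in>\<Gamma>. \<forall>n\<le>N.
             norm (G \<xi>) \<le> C ^ (n + 1) * (real n ^ n) powr s / bracket \<xi> ^ n)))"

definition gevrey_regular ::
  "real \<Rightarrow> 'n::finite functional \<Rightarrow> real ^ 'n \<Rightarrow> real ^ 'n \<Rightarrow> bool" where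
  "gevrey_regular s f x0 \<xi>0 \<longleftrightarrow> (\<exists>g. gevrey_witness s f x0 \<xi>0 g)"

definition WF :: "real \<Rightarrow> 'n::finite functional \<Rightarrow> ((real ^ 'n) \<times> (real ^ 'n)) set" where
  "WF s f = (UNIV \<times> (UNIV - {0})) - {(x0, \<xi>0). gevrey_regular s f x0 \<xi>0}"

text \<open>Here \<open>u\<close> is \<open>\<phi>\<close> as a tempered distribution and \<open>G\<close> its Fourier transform.\<close>

definition gevrey_E :: "real \<Rightarrow> (real ^ 'n::finite \<Rightarrow> complex) set" where
  "gevrey_E s = {\<phi>. smooth \<phi> \<and>
     (\<exists>u G. tempered_distribution u \<and> given_by u \<phi> \<and>
        given_by (fourier_dist u) G \<and> Linf_norm G < \<infinity> \<and>
        (\<exists>h>0. (SUP \<alpha> :: 'n multi_index. ereal (h ^ mi_length \<alpha>) *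
                  Linf_norm (\<lambda>\<xi>. complex_of_real (bracket \<xi> ^ mi_length \<alpha>) * G \<xi>) /
                  ereal (mi_fact \<alpha> powr s)) < \<infinity>))}"

end

theory Submission
  imports Defs "HOL-Probability.Characteristic_Functions" "HOL-Probability.Sinc_Integral"
begin

text \<open>For a tempered distribution \<open>g\<close>, the function behind \<open>\<F>(g E)\<close> is, up to a constant,
  \<open>\<xi> \<mapsto> g (E e\<^sub>\<xi>)\<close> with the plane wave \<open>e\<^sub>\<xi>\<close>, so Gevrey regularity is a bound on
  these numbers, and a factor that is itself a Fourier integral of \<open>\<Phi>\<close> turns into a convolution
  with \<open>\<Phi>\<close>.

  For the multiplication with \<open>\<phi>\<close> this convolution is split at \<open>|\<eta>| = c|\<xi>|\<close>: near
  the centre the frequency stays in the cone, and far away the decay of \<open>\<Phi>\<close> beats the growth of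
  the localised transform, which is polynomial uniformly in \<open>N\<close> because the transform of
  \<open>g\<close> has polynomial growth.

  For a derivative and \<open>|\<xi>| \<ge> 1\<close>, write the Gaussian of order \<open>N\<close> as the square of
  the one of order \<open>2N\<close>. One factor supplies the missing power of the frequency, the other a kernel
  of width \<open>1 / sqrt N\<close>, and the same splitting applies. For \<open>|\<xi>| \<le> 1\<close> the
  kernel does not separate frequencies inside the cone from those outside; there the derivative is
  recovered from finite differences with step \<open>1/N\<close> along half-lines in the cone.\<close>

section \<open>Partial derivatives\<close>

text \<open>The obstacle is the coupling of \<open>n\<close> and \<open>N\<close>: the window of
  order \<open>N\<close> only controls powers \<open>n \<le> N\<close>, and every constant must be
  uniform in \<open>N\<close>. For a general tempered distribution the localised transform may grow
  like \<open>N ^ k\<close>, and only the factor exp(-2N|\<eta>|^2) of the kernel pays for that;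
  this needs |\<eta>| bounded below in the far region, hence |\<xi>| \<ge> 1. For smaller |\<xi>|
  the weight is at most \<open>2 ^ n\<close>, so boundedness suffices, and finite differences can
  exploit that the cone contains whole half-lines. For the product with \<phi> the kernel \<Phi>
  does not depend on \<open>N\<close> and cannot absorb a power of \<open>N\<close>; this is the
  role of the growth hypothesis on the transform of \<open>g\<close>. Estimates use unnormalised
  Fourier integrals and 1 + |\<xi>| in place of the bracket; both changes only affect the constant
  in \<open>C ^ (n + 1)\<close>.\<close>

lemma partial_deriv_eq:
  assumes "(f has_derivative f') (at x)"
  shows "partial_deriv i f x = f' (axis i 1)"
proof -
  have "((\<lambda>t. f (x + t *\<^sub>R axis i 1)) has_derivative (\<lambda>t. f' (t *\<^sub>R axis i 1))) (at 0)"
    by (rule has_derivative_compose[of _ _ 0 UNIV f f', simplified])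
      (use assms in \<open>auto intro!: derivative_eq_intros\<close>)
  moreover have "f' (t *\<^sub>R axis i 1) = t *\<^sub>R f' (axis i 1)" for t
    using assms by (simp add: has_derivative_bounded_linear linear_simps)
  ultimately have "((\<lambda>t. f (x + t *\<^sub>R axis i 1)) has_vector_derivative f' (axis i 1)) (at 0)"
    by (simp add: has_vector_derivative_def)
  then show ?thesis
    by (simp add: partial_deriv_def vector_derivative_at)
qed

lemma has_derivative_partial_sum:
  assumes "f differentiable at x"
  shows "(f has_derivative (\<lambda>v. \<Sum>i\<in>UNIV. (v $ i) *\<^sub>R partial_deriv i f x)) (at x)"
proof -
  obtain f' where f': "(f has_derivative f') (at x)"
    using assms by (auto simp: differentiable_def)
  have lin: "linear f'"
    using f' has_derivative_linear by blast
  have "f' v = (\<Sum>i\<in>UNIV. (v $ i) *\<^sub>R partial_deriv i f x)" for v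
  proof -
    have "f' v = f' (\<Sum>i\<in>UNIV. (v $ i) *\<^sub>R axis i 1)"
      using basis_expansion[of v] by (simp add: scalar_mult_eq_scaleR)
    then show ?thesis
      by (simp add: linear_sum[OF lin] linear_cmul[OF lin] partial_deriv_eq[OF f'])
  qed
  then show ?thesis
    using f' by presburger
qed

lemma has_vector_derivative_line:
  assumes "f differentiable at (x + t *\<^sub>R v)"
  shows "((\<lambda>t. f (x + t *\<^sub>R v)) has_vector_derivative
    (\<Sum>i\<in>UNIV. (v $ i) *\<^sub>R partial_deriv i f (x + t *\<^sub>R v))) (at t within S)"
proof -
  have "((\<lambda>t. f (x + t *\<^sub>R v)) has_derivative
      (\<lambda>h. \<Sum>i\<in>UNIV. ((h *\<^sub>R v) $ i) *\<^sub>R partial_deriv i f (x + t *\<^sub>R v))) (at t within S)"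
    by (rule has_derivative_compose[of "\<lambda>t. x + t *\<^sub>R v", OF _ has_derivative_partial_sum[OF assms]])
      (auto intro!: derivative_eq_intros)
  then show ?thesis
    by (simp add: has_vector_derivative_def scaleR_right.sum)
qed

lemma sum_axis_scaleR:
  "(\<Sum>j\<in>UNIV. (axis i 1 $ j) *\<^sub>R (g j :: complex)) = g (i::'n::finite)"
proof -
  have "(\<Sum>j\<in>UNIV. (axis i 1 $ j) *\<^sub>R g j) = (\<Sum>j\<in>UNIV. if j = i then g j else 0)"
    by (rule sum.cong) (auto simp: axis_def)
  then show ?thesis by simp
qed

lemma has_vector_derivative_axis:
  assumes "f differentiable at (x + t *\<^sub>R axis i 1)"
  shows "((\<lambda>t. f (x + t *\<^sub>R axis i 1)) has_vector_derivative
    partial_deriv i f (x + t *\<^sub>R axis i 1)) (at t within S)"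
  using has_vector_derivative_line[OF assms, of S] by (simp only: sum_axis_scaleR)

lemma vector_derivative_bound:
  fixes f :: "real \<Rightarrow> 'a::real_normed_vector"
  assumes "convex S"
    and "\<And>t. (f has_vector_derivative f' t) (at t within S)"
    and "\<And>t. t \<in> S \<Longrightarrow> norm (f' t) \<le> B"
    and "x \<in> S" "y \<in> S"
  shows "norm (f x - f y) \<le> B * norm (x - y)"
proof (rule differentiable_bound[OF assms(1) _ _ assms(4,5)])
  show "(f has_derivative (\<lambda>h. h *\<^sub>R f' t)) (at t within S)" if "t \<in> S" for t
    using assms(2) by (simp add: has_vector_derivative_def)
  show "onorm (\<lambda>h. h *\<^sub>R f' t) \<le> B" if "t \<in> S" for t
    by (rule onorm_le) (use assms(3)[OF that] in \<open>auto simp: mult.commute[of B] intro: mult_left_mono\<close>)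
qed

text \<open>The mean value inequality on a segment. Only points of the segment enter, which matters
  where the bound on the derivatives depends on the position.\<close>

lemma norm_diff_line_le:
  fixes f :: "real ^ 'n::finite \<Rightarrow> complex"
  assumes d: "\<And>y. f differentiable at y"
    and B: "\<And>t i. t \<in> {0..1} \<Longrightarrow> norm (partial_deriv i f (x + t *\<^sub>R v)) \<le> B"
  shows "norm (f (x + v) - f x) \<le> real CARD('n) * B * norm v"
proof -
  have "norm (f (x + 1 *\<^sub>R v) - f (x + 0 *\<^sub>R v)) \<le> (real CARD('n) * B * norm v) * norm ((1::real) - 0)"
  proof (rule vector_derivative_bound[where f = "\<lambda>t. f (x + t *\<^sub>R v)" and S = "{0..1}",
        OF _ has_vector_derivative_line[OF d]])
    fix t :: real assume t: "t \<in> {0..1}"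
    have "norm (\<Sum>i\<in>UNIV. (v $ i) *\<^sub>R partial_deriv i f (x + t *\<^sub>R v)) \<le>
        (\<Sum>i\<in>(UNIV::'n set). norm v * B)"
      by (rule sum_norm_le) (auto intro!: mult_mono B t component_le_norm_cart)
    then show "norm (\<Sum>i\<in>UNIV. (v $ i) *\<^sub>R partial_deriv i f (x + t *\<^sub>R v)) \<le> real CARD('n) * B * norm v"
      by (simp add: mult_ac)
  qed auto
  then show ?thesis by simp
qed

text \<open>Schwarz's theorem: the mixed second difference over a square of side \<open>h\<close> is
  symmetric in the two directions, and divided by h^2 it tends to either of the two iterated
  derivatives.\<close>

lemma partial_deriv_commute:
  fixes f :: "real ^ 'n::finite \<Rightarrow> complex"
  assumes f: "\<And>x. f differentiable at x"
    and fi: "\<And>i x. partial_deriv i f differentiable at x"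
    and c: "\<And>i j. continuous_on UNIV (partial_deriv i (partial_deriv j f))"
  shows "partial_deriv i (partial_deriv j f) x = partial_deriv j (partial_deriv i f) x"
proof -
  define \<Delta> where "\<Delta> i j h = f (x + h *\<^sub>R axis j 1 + h *\<^sub>R axis i 1) - f (x + h *\<^sub>R axis j 1)
     - (f (x + h *\<^sub>R axis i 1) - f x)" for i j h
  have comm: "\<Delta> i j h = \<Delta> j i h" for i j h
    by (simp add: \<Delta>_def algebra_simps)
  have lim: "((\<lambda>h. \<Delta> i j h / complex_of_real (h\<^sup>2)) \<longlongrightarrow> partial_deriv i (partial_deriv j f) x) (at_right 0)" for i j
  proof (rule tendstoI)
    fix e :: real assume e: "e > 0"
    define D where "D = partial_deriv i (partial_deriv j f) x"
    have "continuous (at x) (partial_deriv i (partial_deriv j f))"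
      using c by (simp add: continuous_on_eq_continuous_at)
    then obtain d where d: "d > 0" and
      dd: "\<And>y. dist y x < d \<Longrightarrow> dist (partial_deriv i (partial_deriv j f) y) D < e / 2"
      unfolding D_def continuous_at_eps_delta using e half_gt_zero by blast
    have "norm (\<Delta> i j h / complex_of_real (h\<^sup>2) - D) < e" if h: "0 < h" "h < d / 2" for h
    proof -
      have near: "norm (partial_deriv i (partial_deriv j f) (x + s *\<^sub>R axis j 1 + t *\<^sub>R axis i 1) - D) \<le> e / 2"
        if "s \<in> {0..h}" "t \<in> {0..h}" for s t
      proof -
        have "norm (s *\<^sub>R axis j (1::real) + t *\<^sub>R (axis i 1 :: real ^ 'n)) \<le> \<bar>s\<bar> + \<bar>t\<bar>"
          by (rule order_trans[OF norm_triangle_ineq]) simp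
        also have "\<dots> < d" using that h by auto
        finally have "dist (x + s *\<^sub>R axis j 1 + t *\<^sub>R axis i 1) x < d"
          by (simp add: dist_norm add.assoc)
        then show ?thesis using dd[of "x + s *\<^sub>R axis j 1 + t *\<^sub>R axis i 1"] by (simp add: dist_norm)
      qed
      \<comment> \<open>Subtracting the value expected for a constant second derivative
        \<open>D\<close> leaves a smallness statement, to which the mean value inequality applies
        once in each direction.\<close>
      define p where "p s = f (x + h *\<^sub>R axis i 1 + s *\<^sub>R axis j 1) - f (x + s *\<^sub>R axis j 1)
         - complex_of_real (s * h) * D" for s
      have p': "(p has_vector_derivative (partial_deriv j f (x + h *\<^sub>R axis i 1 + s *\<^sub>R axis j 1)
           - partial_deriv j f (x + s *\<^sub>R axis j 1) - h * D)) (at s within S)" for s S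
        unfolding p_def
        by (auto intro!: derivative_eq_intros has_vector_derivative_axis f)
      have q: "norm (partial_deriv j f (x + h *\<^sub>R axis i 1 + s *\<^sub>R axis j 1)
           - partial_deriv j f (x + s *\<^sub>R axis j 1) - h * D) \<le> h * (e/2)" if s: "s \<in> {0..h}" for s
      proof -
        define q where "q t = partial_deriv j f (x + s *\<^sub>R axis j 1 + t *\<^sub>R axis i 1) - complex_of_real t * D" for t
        have q': "(q has_vector_derivative (partial_deriv i (partial_deriv j f)
            (x + s *\<^sub>R axis j 1 + t *\<^sub>R axis i 1) - D)) (at t within S)" for t S
          unfolding q_def
          by (auto intro!: derivative_eq_intros has_vector_derivative_axis fi)
        have "norm (q h - q 0) \<le> (e/2) * norm (h - 0)"
          by (rule vector_derivative_bound[where S="{0..h}", OF _ q']) (use near s h in auto)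
        then show ?thesis using h by (simp add: q_def algebra_simps)
      qed
      have "norm (p h - p 0) \<le> (h * (e/2)) * norm (h - 0)"
        by (rule vector_derivative_bound[where S="{0..h}", OF _ p']) (use q h in auto)
      then have "norm (\<Delta> i j h - complex_of_real (h\<^sup>2) * D) \<le> h\<^sup>2 * (e/2)"
        using h by (simp add: p_def \<Delta>_def algebra_simps power2_eq_square)
      moreover have "\<Delta> i j h / complex_of_real (h\<^sup>2) - D = (\<Delta> i j h - complex_of_real (h\<^sup>2) * D) / complex_of_real (h\<^sup>2)"
        using h by (simp add: field_simps)
      ultimately have "norm (\<Delta> i j h / complex_of_real (h\<^sup>2) - D) \<le> e/2"
        using h by (simp add: norm_divide divide_simps mult_ac norm_power)
      then show ?thesis using e by linarith
    qed
    then show "\<forall>\<^sub>F h in at_right 0. dist (\<Delta> i j h / complex_of_real (h\<^sup>2)) (partial_deriv i (partial_deriv j f) x) < e"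
      unfolding eventually_at_right_field D_def[symmetric] dist_norm
      using d by (intro exI[of _ "d/2"]) auto
  qed
  show ?thesis
    using tendsto_unique[OF _ lim[of i j] lim[of j i, unfolded comm[of j i]]] by simp
qed

section \<open>Reordering iterated derivatives\<close>

lemma partial_derivs_append: "partial_derivs (xs @ ys) f = partial_derivs xs (partial_derivs ys f)"
  by (induction xs) auto

lemma smooth_partial_derivs: "smooth f \<Longrightarrow> smooth (partial_derivs js f)"
  unfolding smooth_def by (metis partial_derivs_append)

lemma smooth_partial_deriv: "smooth f \<Longrightarrow> smooth (partial_deriv i f)"
  using smooth_partial_derivs[of f "[i]"] by simp

lemma smooth_differentiable: "smooth f \<Longrightarrow> f differentiable at x"
  unfolding smooth_def by (metis partial_derivs.simps(1))

lemma smooth_continuous: "smooth f \<Longrightarrow> continuous_on S f"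
  by (meson smooth_differentiable continuous_at_imp_continuous_on differentiable_imp_continuous_within)

lemma smooth_measurable [measurable_dest]: "smooth f \<Longrightarrow> f \<in> borel_measurable borel"
  by (intro borel_measurable_continuous_onI smooth_continuous)

lemma smooth_partial_deriv_commute:
  "smooth f \<Longrightarrow> partial_deriv i (partial_deriv j f) = partial_deriv j (partial_deriv i f)"
  by (rule ext, rule partial_deriv_commute)
    (auto intro: smooth_partial_deriv smooth_differentiable smooth_continuous)

text \<open>Bridges the unspecified order chosen in \<open>mi_deriv\<close>: commuting adjacent
  derivatives moves the head of one list to the front of the other.\<close>

lemma partial_derivs_mset_cong:
  assumes "smooth f" "mset xs = mset ys"
  shows "partial_derivs xs f = partial_derivs ys f"
  using assms(2)
proof (induction xs arbitrary: ys)
  case (Cons x xs)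
  have move: "partial_derivs (us @ [x] @ vs) f = partial_derivs ([x] @ us @ vs) f" for us vs
  proof (induction us)
    case (Cons u us)
    then show ?case
      using smooth_partial_deriv_commute[OF smooth_partial_derivs[OF assms(1), of "us @ vs"], of u x]
      by simp
  qed simp
  obtain us vs where ys: "ys = us @ [x] @ vs"
    using Cons.prems by (metis append_Cons append_Nil list.set_intros(1) mset_eq_setD split_list)
  with Cons.prems have "mset xs = mset (us @ vs)" by simp
  from Cons.IH[OF this] show ?case
    unfolding ys move by simp
qed auto

text \<open>Names the choice hidden in \<open>mi_deriv\<close>, so that multi-indices can be traded
  for lists, which suit induction.\<close>

definition list_of_mi :: "'n::finite multi_index \<Rightarrow> 'n list" where
  "list_of_mi \<alpha> = (SOME js. \<forall>i. count_list js i = Poly_Mapping.lookup \<alpha> i)"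

lemma mi_deriv_list_of_mi: "mi_deriv \<alpha> f = partial_derivs (list_of_mi \<alpha>) f"
  by (simp add: mi_deriv_def list_of_mi_def)

lemma count_list_of_mi: "count_list (list_of_mi \<alpha>) i = Poly_Mapping.lookup \<alpha> i"
  unfolding list_of_mi_def using someI_ex[OF ex_list_of_multi_index[of \<alpha>]] by blast

lemma sum_count_list: "(\<Sum>i\<in>UNIV. count_list js i) = length (js :: 'n::finite list)"
proof (induction js)
  case (Cons j js)
  have "(\<Sum>i\<in>UNIV. count_list (j # js) i) = (\<Sum>i\<in>UNIV. count_list js i + (if i = j then 1 else 0))"
    by (rule sum.cong) auto
  then show ?case using Cons by (simp add: sum.distrib)
qed auto

lemma length_list_of_mi: "length (list_of_mi \<alpha>) = mi_length \<alpha>"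
  unfolding mi_length_def count_list_of_mi[symmetric] by (rule sum_count_list[symmetric])

lemma partial_derivs_eq_mi_deriv:
  assumes "smooth f"
  obtains \<alpha> where "mi_length \<alpha> = length js" "partial_derivs js f = mi_deriv \<alpha> f"
proof -
  define \<alpha> :: "'a multi_index" where "\<alpha> = Abs_poly_mapping (count_list js)"
  have l: "Poly_Mapping.lookup \<alpha> = count_list js"
    unfolding \<alpha>_def by (rule lookup_Abs_poly_mapping) simp
  have "mset js = mset (list_of_mi \<alpha>)"
    by (rule multiset_eqI) (simp add: count_mset count_list_of_mi l)
  from partial_derivs_mset_cong[OF assms this] show ?thesis
    using that[of \<alpha>] by (simp add: mi_deriv_list_of_mi mi_length_def l sum_count_list)
qed

text \<open>Differentiability and size of all derivatives up to order \<open>k\<close> under one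
  pointwise weight. Boundedness, polynomial growth and Schwartz decay are instances with different
  \<open>w\<close>; lists instead of multi-indices make the notion recursive in
  \<open>k\<close>.\<close>

definition derivs_le :: "nat \<Rightarrow> (real ^ 'n::finite \<Rightarrow> real) \<Rightarrow> (real ^ 'n \<Rightarrow> complex) \<Rightarrow> bool" where
  "derivs_le k w f \<longleftrightarrow> (\<forall>js x. length js \<le> k \<longrightarrow>
     partial_derivs js f differentiable at x \<and> norm (partial_derivs js f x) \<le> w x)"

lemma derivs_leD:
  assumes "derivs_le k w f"
  shows "length js \<le> k \<Longrightarrow> norm (partial_derivs js f x) \<le> w x"
    and "length js \<le> k \<Longrightarrow> partial_derivs js f differentiable at x"
    and "norm (f x) \<le> w x" and "f differentiable at x" and "0 \<le> w x"
proof -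
  have "norm (partial_derivs [] f x) \<le> w x \<and> partial_derivs [] f differentiable at x"
    using assms unfolding derivs_le_def by (metis list.size(3) zero_le)
  then show "norm (f x) \<le> w x" "f differentiable at x" by auto
  then show "0 \<le> w x" using norm_ge_zero order_trans by blast
qed (use assms in \<open>auto simp: derivs_le_def\<close>)

lemma derivs_le_0: "derivs_le 0 w f \<longleftrightarrow> (\<forall>x. f differentiable at x \<and> norm (f x) \<le> w x)"
  by (auto simp: derivs_le_def)

text \<open>The recursion strips the derivative that is applied first, which is the last entry of
  the list, so that sum and product rules are used once per step.\<close>

lemma derivs_le_Suc:
  "derivs_le (Suc k) w f \<longleftrightarrow> (\<forall>x. f differentiable at x \<and> norm (f x) \<le> w x) \<and>
     (\<forall>i. derivs_le k w (partial_deriv i f))" (is "?L \<longleftrightarrow> ?R")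
proof
  assume L: ?L
  have "derivs_le k w (partial_deriv i f)" for i
    unfolding derivs_le_def
  proof (intro allI impI)
    fix js :: "'a list" and x
    assume "length js \<le> k"
    then have "length (js @ [i]) \<le> Suc k" by simp
    with L have "partial_derivs (js @ [i]) f differentiable at x \<and> norm (partial_derivs (js @ [i]) f x) \<le> w x"
      unfolding derivs_le_def by blast
    then show "partial_derivs js (partial_deriv i f) differentiable at x \<and>
        norm (partial_derivs js (partial_deriv i f) x) \<le> w x"
      by (simp add: partial_derivs_append)
  qed
  then show ?R using derivs_leD[OF L] by blast
next
  assume R: ?R
  show ?L
    unfolding derivs_le_def
  proof (intro allI impI)
    fix js :: "'a list" and x assume l: "length js \<le> Suc k"
    show "partial_derivs js f differentiable at x \<and> norm (partial_derivs js f x) \<le> w x"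
    proof (cases js rule: rev_cases)
      case (snoc ys y)
      with l R show ?thesis by (auto simp: partial_derivs_append derivs_le_def)
    qed (use R in auto)
  qed
qed

lemma derivs_le_mono:
  assumes "derivs_le k w f" "l \<le> k" "\<And>x. w x \<le> v x"
  shows "derivs_le l v f"
  using assms unfolding derivs_le_def by (meson order_trans)

section \<open>Sum and product rules for weighted bounds\<close>

lemma partial_deriv_add:
  assumes "f differentiable at x" "g differentiable at x"
  shows "partial_deriv i (\<lambda>x. f x + g x) x = partial_deriv i f x + partial_deriv i g x"
proof -
  obtain f' g' where h: "(f has_derivative f') (at x)" "(g has_derivative g') (at x)"
    using assms by (auto simp: differentiable_def)
  from partial_deriv_eq[OF has_derivative_add[OF this]] show ?thesis
    by (simp add: partial_deriv_eq[OF h(1)] partial_deriv_eq[OF h(2)])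
qed

lemma partial_deriv_mult:
  assumes "f differentiable at x" "g differentiable at x"
  shows "partial_deriv i (\<lambda>x. f x * g x) x = f x * partial_deriv i g x + partial_deriv i f x * g x"
proof -
  obtain f' g' where h: "(f has_derivative f') (at x)" "(g has_derivative g') (at x)"
    using assms by (auto simp: differentiable_def)
  from partial_deriv_eq[OF has_derivative_mult[OF this]] show ?thesis
    by (simp add: partial_deriv_eq[OF h(1)] partial_deriv_eq[OF h(2)])
qed

lemma partial_deriv_const [simp]: "partial_deriv i (\<lambda>x. c) = (\<lambda>x. 0)"
  by (rule ext, subst partial_deriv_eq[OF has_derivative_const]) simp

lemma partial_derivs_const: "partial_derivs js (\<lambda>x. c) = (if js = [] then (\<lambda>x. c) else (\<lambda>x. 0))"
  by (induction js) auto

lemma partial_deriv_cmult: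
  assumes "f differentiable at x"
  shows "partial_deriv i (\<lambda>x. c * f x) x = c * partial_deriv i f x"
  using partial_deriv_mult[of "\<lambda>x. c" x f i] assms by simp

lemma derivs_le_zero: "(\<And>x. 0 \<le> w x) \<Longrightarrow> derivs_le k w (\<lambda>x. 0)"
  by (induction k) (auto simp: derivs_le_0 derivs_le_Suc)

lemma derivs_le_const: "(\<And>x. norm c \<le> w x) \<Longrightarrow> derivs_le k w (\<lambda>x. c)"
proof (induction k)
  case (Suc k)
  have "0 \<le> w x" for x using Suc.prems[of x] norm_ge_zero[of c] by linarith
  with Suc show ?case by (auto simp: derivs_le_Suc intro: derivs_le_zero)
qed (auto simp: derivs_le_0)

lemma derivs_le_add:
  assumes "derivs_le k w f" "derivs_le k v g"
  shows "derivs_le k (\<lambda>x. w x + v x) (\<lambda>x. f x + g x)"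
  using assms
proof (induction k arbitrary: f g)
  case 0
  then show ?case
    by (auto simp: derivs_le_0 intro: norm_triangle_mono)
next
  case (Suc k)
  have "partial_deriv i (\<lambda>x. f x + g x) = (\<lambda>x. partial_deriv i f x + partial_deriv i g x)" for i
    using Suc.prems by (intro ext partial_deriv_add) (auto simp: derivs_le_Suc)
  with Suc show ?case
    by (auto simp: derivs_le_Suc intro: norm_triangle_mono)
qed

text \<open>Each application of the product rule doubles the number of terms, hence
  \<open>2 ^ k\<close>.\<close>

lemma derivs_le_mult:
  assumes "derivs_le k w f" "derivs_le k v g"
  shows "derivs_le k (\<lambda>x. 2 ^ k * w x * v x) (\<lambda>x. f x * g x)"
  using assms
proof (induction k arbitrary: f g)
  case 0
  have "0 \<le> w x" for x using 0(1) derivs_leD(5) by blast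
  with 0 show ?case
    by (auto simp: derivs_le_0 norm_mult intro!: mult_mono)
next
  case (Suc k)
  have nn: "0 \<le> w x" "0 \<le> v x" for x using Suc.prems derivs_leD(5) by blast+
  have d: "f differentiable at x" "g differentiable at x" "norm (f x) \<le> w x" "norm (g x) \<le> v x" for x
    using Suc.prems by (auto simp: derivs_le_Suc)
  have fg: "derivs_le k w f" "derivs_le k v g"
    using Suc.prems by (auto intro: derivs_le_mono)
  have pd: "partial_deriv i (\<lambda>x. f x * g x) = (\<lambda>x. f x * partial_deriv i g x + partial_deriv i f x * g x)" for i
    by (intro ext partial_deriv_mult d)
  have "derivs_le k (\<lambda>x. 2 ^ k * w x * v x + 2 ^ k * w x * v x)
     (\<lambda>x. f x * partial_deriv i g x + partial_deriv i f x * g x)" for i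
    by (intro derivs_le_add Suc.IH fg) (use Suc.prems in \<open>auto simp: derivs_le_Suc\<close>)
  moreover have "norm (f x * g x) \<le> 2 * 2 ^ k * w x * v x" for x
  proof -
    have "1 * (w x * v x) \<le> (2 * 2 ^ k) * (w x * v x)"
      by (rule mult_right_mono) (use nn one_le_power[of "2::real" "Suc k"] in auto)
    moreover have "norm (f x * g x) \<le> w x * v x"
      unfolding norm_mult by (intro mult_mono d nn) auto
    ultimately show ?thesis by (simp add: mult_ac)
  qed
  ultimately show ?case
    using d by (auto simp: derivs_le_Suc pd mult_ac)
qed

lemma derivs_le_cmult:
  assumes "derivs_le k w f"
  shows "derivs_le k (\<lambda>x. norm c * w x) (\<lambda>x. c * f x)"
  using assms
proof (induction k arbitrary: f)
  case (Suc k)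
  have "partial_deriv i (\<lambda>x. c * f x) = (\<lambda>x. c * partial_deriv i f x)" for i
    using Suc.prems by (intro ext partial_deriv_cmult) (auto simp: derivs_le_Suc)
  with Suc show ?case
    by (auto simp: derivs_le_Suc norm_mult intro: mult_left_mono)
qed (auto simp: derivs_le_0 norm_mult intro: mult_left_mono)

lemma finite_lists_length_le': "finite {js :: 'n::finite list. length js \<le> k}"
  using finite_lists_length_le[of "UNIV :: 'n set" k] by simp

lemma smooth_derivs_le:
  assumes "smooth f"
  shows "derivs_le k (\<lambda>x. \<Sum>js | length js \<le> k. norm (partial_derivs js f x)) f"
  unfolding derivs_le_def
  using assms by (auto simp: smooth_def intro!: member_le_sum finite_lists_length_le')

text \<open>The weight is an arbitrary function, so smoothness of compound functions reduces to the
  closure rules of \<open>derivs_le\<close>.\<close>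

lemma smooth_iff: "smooth f \<longleftrightarrow> (\<forall>k. \<exists>w. derivs_le k w f)"
proof
  assume "\<forall>k. \<exists>w. derivs_le k w f"
  then have "partial_derivs js f differentiable at x" for js x
    using derivs_leD(2)[of "length js"] by blast
  then show "smooth f" by (simp add: smooth_def)
qed (use smooth_derivs_le in blast)

lemma smoothI: "(\<And>k. derivs_le k (w k) f) \<Longrightarrow> smooth f"
  by (auto simp: smooth_iff)

lemma smooth_derivs_le_iff:
  assumes "smooth f"
  shows "derivs_le k w f \<longleftrightarrow> (\<forall>js x. length js \<le> k \<longrightarrow> norm (partial_derivs js f x) \<le> w x)"
  using assms by (auto simp: smooth_def derivs_le_def)

lemma smooth_const [simp]: "smooth (\<lambda>x. c)"
  by (rule smoothI, rule derivs_le_const, rule order_refl)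

lemma smooth_add: "smooth f \<Longrightarrow> smooth g \<Longrightarrow> smooth (\<lambda>x. f x + g x)"
  by (rule smoothI) (rule derivs_le_add; rule smooth_derivs_le)

lemma smooth_mult: "smooth f \<Longrightarrow> smooth g \<Longrightarrow> smooth (\<lambda>x. f x * g x)"
  by (rule smoothI) (rule derivs_le_mult; rule smooth_derivs_le)

lemma smooth_cmult: "smooth f \<Longrightarrow> smooth (\<lambda>x. c * f x)"
  by (rule smooth_mult[OF smooth_const])

lemma smooth_diff: "smooth f \<Longrightarrow> smooth g \<Longrightarrow> smooth (\<lambda>x. f x - g x)"
  using smooth_add[of f "\<lambda>x. (-1) * g x"] smooth_cmult[of g "-1"] by simp

lemma partial_derivs_add:
  assumes "smooth f" "smooth g"
  shows "partial_derivs js (\<lambda>x. f x + g x) = (\<lambda>x. partial_derivs js f x + partial_derivs js g x)"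
proof (induction js)
  case (Cons j js)
  show ?case unfolding partial_derivs.simps Cons
    by (rule ext, rule partial_deriv_add) (use assms in \<open>auto simp: smooth_def\<close>)
qed auto

lemma partial_derivs_cmult:
  assumes "smooth f"
  shows "partial_derivs js (\<lambda>x. c * f x) = (\<lambda>x. c * partial_derivs js f x)"
proof (induction js)
  case (Cons j js)
  show ?case unfolding partial_derivs.simps Cons
    by (rule ext, rule partial_deriv_cmult) (use assms in \<open>auto simp: smooth_def\<close>)
qed auto

section \<open>Supports and test functions\<close>

lemma supp_partial_deriv: "supp (partial_deriv i f) \<subseteq> supp f"
proof -
  have "partial_deriv i f x = 0" if x: "x \<notin> supp f" for x
  proof -
    have "open (- supp f)" by (simp add: supp_def open_Compl)
    moreover have "f y = 0" if "y \<in> - supp f" for y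
      using that closure_subset[of "{x. f x \<noteq> 0}"] by (auto simp: supp_def)
    ultimately have "(f has_derivative (\<lambda>_. 0)) (at x)"
      using x by (intro has_derivative_transform_within_open[OF has_derivative_const[of 0], of "- supp f"]) auto
    from partial_deriv_eq[OF this] show ?thesis .
  qed
  then have "{x. partial_deriv i f x \<noteq> 0} \<subseteq> supp f" by blast
  then show ?thesis
    by (simp add: supp_def closure_minimal)
qed

lemma supp_partial_derivs: "supp (partial_derivs js f) \<subseteq> supp f"
  by (induction js) (use supp_partial_deriv in auto)

lemma test_fun_subset:
  assumes "smooth f" "supp f \<subseteq> supp g" "test_fun g"
  shows "test_fun f"
proof -
  have "supp f = supp g \<inter> supp f" using assms(2) by blast
  moreover have "closed (supp f)" by (simp add: supp_def)
  ultimately have "compact (supp f)"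
    using assms(3) compact_Int_closed[of "supp g" "supp f"] by (simp add: test_fun_def)
  then show ?thesis using assms(1) by (simp add: test_fun_def)
qed

lemma supp_mult: "supp (\<lambda>x. a x * f x) \<subseteq> supp f"
  unfolding supp_def by (rule closure_mono) auto

lemma test_fun_mult: "smooth a \<Longrightarrow> test_fun f \<Longrightarrow> test_fun (\<lambda>x. a x * f x)"
  by (rule test_fun_subset[OF _ supp_mult]) (simp_all add: test_fun_def smooth_mult)

lemma test_fun_partial_derivs: "test_fun f \<Longrightarrow> test_fun (partial_derivs js f)"
  by (rule test_fun_subset[OF _ supp_partial_derivs])
    (auto simp: test_fun_def intro: smooth_partial_derivs)

section \<open>Schwartz functions and tempered distributions\<close>

text \<open>One parameter serves both as the number of derivatives and as the order of decay, so
  that continuity of a functional becomes a single inequality.\<close>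

definition schwartz_le :: "nat \<Rightarrow> real \<Rightarrow> (real ^ 'n::finite \<Rightarrow> complex) \<Rightarrow> bool" where
  "schwartz_le k B f \<longleftrightarrow> derivs_le k (\<lambda>x. B / (1 + norm x) ^ k) f"

lemma one_plus_norm_pos [simp]: "0 < (1 + norm (x::'a::real_normed_vector)) ^ k" "(1 + norm x) ^ k \<noteq> 0"
  "0 \<le> 1 + norm x" "0 < 1 + norm x" "1 + norm x \<noteq> 0" "1 \<le> (1 + norm x) ^ k"
  using add_pos_nonneg[OF zero_less_one norm_ge_zero[of x]]
  by (simp_all add: order_less_imp_not_eq2 one_le_power)

lemma schwartz_leD:
  assumes "schwartz_le k B f" "length js \<le> k"
  shows "(1 + norm x) ^ k * norm (partial_derivs js f x) \<le> B"
  using derivs_leD(1)[OF assms(1)[unfolded schwartz_le_def] assms(2), of x] by (simp add: field_simps)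

lemma schwartz_leI:
  assumes "smooth f" "\<And>js x. length js \<le> k \<Longrightarrow> (1 + norm x) ^ k * norm (partial_derivs js f x) \<le> B"
  shows "schwartz_le k B f"
  unfolding schwartz_le_def smooth_derivs_le_iff[OF assms(1)]
  using assms(2) by (simp add: field_simps)

lemma schwartz_le_nonneg: "schwartz_le k B f \<Longrightarrow> 0 \<le> B"
  using schwartz_leD[of k B f "[]" 0] norm_ge_zero[of "f 0"] by (simp del: norm_ge_zero)

lemma schwartz_le_mono:
  assumes "schwartz_le k B f" "l \<le> k" "B \<le> B'"
  shows "schwartz_le l B' f"
  unfolding schwartz_le_def
proof (rule derivs_le_mono[OF assms(1)[unfolded schwartz_le_def] assms(2)])
  fix x :: "real ^ 'a"
  show "B / (1 + norm x) ^ k \<le> B' / (1 + norm x) ^ l"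
    by (rule frac_le) (use assms schwartz_le_nonneg[OF assms(1)] in \<open>auto intro: power_increasing\<close>)
qed

lemma abs_monomial_le: "\<bar>monomial \<beta> x\<bar> \<le> (1 + norm x) ^ mi_length \<beta>"
proof -
  have "\<bar>monomial \<beta> x\<bar> = (\<Prod>i\<in>UNIV. \<bar>x $ i\<bar> ^ Poly_Mapping.lookup \<beta> i)"
    by (simp add: monomial_def abs_prod power_abs)
  also have "\<dots> \<le> (\<Prod>i\<in>UNIV. (1 + norm x) ^ Poly_Mapping.lookup \<beta> i)"
  proof (rule prod_mono, intro conjI power_mono)
    fix i show "\<bar>x $ i\<bar> \<le> 1 + norm x" using component_le_norm_cart[of x i] by simp
  qed auto
  also have "\<dots> = (1 + norm x) ^ mi_length \<beta>"
    by (simp add: mi_length_def power_sum)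
  finally show ?thesis .
qed

lemma abs_monomial_le_power: "mi_length \<beta> \<le> k \<Longrightarrow> \<bar>monomial \<beta> x\<bar> \<le> (1 + norm x) ^ k"
  by (rule order_trans[OF abs_monomial_le]) (simp add: power_increasing)

lemma monomial_single: "monomial (Poly_Mapping.single i k) x = (x $ i) ^ k"
proof -
  have "monomial (Poly_Mapping.single i k) x = (\<Prod>j\<in>UNIV. if j = i then (x $ i) ^ k else 1)"
    unfolding monomial_def by (rule prod.cong) (auto simp: lookup_single when_def)
  then show ?thesis by simp
qed

lemma mi_length_single: "mi_length (Poly_Mapping.single i k) = k"
proof -
  have "mi_length (Poly_Mapping.single i k) = (\<Sum>j\<in>UNIV. if j = i then k else 0)"
    unfolding mi_length_def by (rule sum.cong) (auto simp: lookup_single when_def)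
  then show ?thesis by simp
qed

text \<open>Comparison with the largest coordinate. It makes the pure powers of the coordinates
  sufficient in place of all monomials, for the seminorms as well as for the decay of Fourier
  integrals.\<close>

lemma weight_le_coords:
  fixes x :: "real ^ 'n::finite"
  shows "(1 + norm x) ^ k \<le> (1 + real CARD('n)) ^ k * (1 + (\<Sum>i\<in>UNIV. \<bar>x $ i\<bar> ^ k))"
proof -
  define m where "m = Max (range (\<lambda>i. \<bar>x $ i\<bar>))"
  have m: "\<bar>x $ i\<bar> \<le> m" for i unfolding m_def by (rule Max_ge) auto
  obtain j where j: "m = \<bar>x $ j\<bar>"
    using Max_in[of "range (\<lambda>i. \<bar>x $ i\<bar>)"] by (auto simp: m_def[symmetric])
  have "norm x \<le> (\<Sum>i\<in>UNIV. \<bar>x $ i\<bar>)" by (rule norm_le_l1_cart)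
  also have "\<dots> \<le> real CARD('n) * m" using sum_bounded_above[of UNIV "\<lambda>i. \<bar>x $ i\<bar>" m] m by simp
  also have "\<dots> \<le> real CARD('n) * max 1 m" by (simp add: mult_left_mono)
  finally have "1 + norm x \<le> (1 + real CARD('n)) * max 1 m"
    by (simp add: algebra_simps)
  then have "(1 + norm x) ^ k \<le> ((1 + real CARD('n)) * max 1 m) ^ k"
    by (rule power_mono) auto
  also have "\<dots> = (1 + real CARD('n)) ^ k * max 1 m ^ k" by (rule power_mult_distrib)
  also have "max 1 m ^ k \<le> 1 + (\<Sum>i\<in>UNIV. \<bar>x $ i\<bar> ^ k)"
  proof (cases "m \<le> 1")
    case True
    then show ?thesis by (simp add: max_def sum_nonneg)
  next
    case False
    have "m ^ k \<le> (\<Sum>i\<in>UNIV. \<bar>x $ i\<bar> ^ k)" unfolding j by (rule member_le_sum) auto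
    with False show ?thesis by (simp add: max_def)
  qed
  finally show ?thesis by (simp add: mult_left_mono)
qed

text \<open>Of the monomials only the constant one and the pure powers are used for the weight, by
  \<open>weight_le_coords\<close>; the order of the partial derivatives is immaterial by
  smoothness.\<close>

lemma schwartz_fun_iff: "schwartz_fun f \<longleftrightarrow> smooth f \<and> (\<forall>k. \<exists>B. schwartz_le k B f)"
proof
  assume f: "schwartz_fun f"
  then have sm: "smooth f" by (simp add: schwartz_fun_def)
  have "\<exists>B. \<forall>x. (1 + norm x) ^ k * norm (partial_derivs js f x) \<le> B" for k js
  proof -
    obtain \<alpha> where \<alpha>: "partial_derivs js f = mi_deriv \<alpha> f"
      using partial_derivs_eq_mi_deriv[OF sm] by metis
    have "\<forall>\<beta>. \<exists>B. \<forall>x. norm (monomial \<beta> x *\<^sub>R partial_derivs js f x) \<le> B"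
      using f unfolding schwartz_fun_def \<alpha> bounded_iff by blast
    then obtain b where b: "\<And>\<beta> x. norm (monomial \<beta> x *\<^sub>R partial_derivs js f x) \<le> b \<beta>" by metis
    \<comment> \<open>An exponent 0 gives the zero multi-index whatever the variable, so
      \<open>undefined\<close> stands for an arbitrary one.\<close>
    have 1: "norm (partial_derivs js f x) \<le> b (Poly_Mapping.single undefined 0)" for x
      using b[of "Poly_Mapping.single undefined 0" x] by (simp only: monomial_single) simp
    have 2: "\<bar>x $ i\<bar> ^ k * norm (partial_derivs js f x) \<le> b (Poly_Mapping.single i k)" for x i
      using b[of "Poly_Mapping.single i k" x] by (simp add: monomial_single power_abs)
    have "(1 + norm x) ^ k * norm (partial_derivs js f x) \<le> (1 + real CARD('a)) ^ k *
        (b (Poly_Mapping.single undefined 0) + (\<Sum>i\<in>UNIV. b (Poly_Mapping.single i k)))" for x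
    proof -
      have "(1 + norm x) ^ k * norm (partial_derivs js f x) \<le>
        (1 + real CARD('a)) ^ k * (1 + (\<Sum>i\<in>UNIV. \<bar>x $ i\<bar> ^ k)) * norm (partial_derivs js f x)"
        by (intro mult_right_mono weight_le_coords) auto
      also have "\<dots> = (1 + real CARD('a)) ^ k * (norm (partial_derivs js f x) +
          (\<Sum>i\<in>UNIV. \<bar>x $ i\<bar> ^ k * norm (partial_derivs js f x)))"
        by (simp add: algebra_simps sum_distrib_left sum_distrib_right)
      also have "\<dots> \<le> (1 + real CARD('a)) ^ k *
        (b (Poly_Mapping.single undefined 0) + (\<Sum>i\<in>UNIV. b (Poly_Mapping.single i k)))"
        by (intro mult_left_mono add_mono sum_mono 1 2) auto
      finally show ?thesis .
    qed
    then show ?thesis by blast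
  qed
  then obtain B where B: "\<And>k js x. (1 + norm x) ^ k * norm (partial_derivs js f x) \<le> B k js" by metis
  have "schwartz_le k (Max (B k ` {js. length js \<le> k})) f" for k
  proof (rule schwartz_leI[OF sm])
    fix js :: "'a list" and x assume "length js \<le> k"
    then have "B k js \<le> Max (B k ` {js. length js \<le> k})"
      by (intro Max_ge) (auto simp: finite_lists_length_le')
    with B[where k=k and js=js and x=x] show "(1 + norm x) ^ k * norm (partial_derivs js f x) \<le> Max (B k ` {js. length js \<le> k})"
      by linarith
  qed
  with sm show "smooth f \<and> (\<forall>k. \<exists>B. schwartz_le k B f)" by blast
next
  assume f: "smooth f \<and> (\<forall>k. \<exists>B. schwartz_le k B f)"
  have "bounded (range (\<lambda>x. monomial \<beta> x *\<^sub>R mi_deriv \<alpha> f x))" for \<alpha> \<beta>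
  proof -
    obtain B where B: "schwartz_le (max (mi_length \<alpha>) (mi_length \<beta>)) B f" using f by blast
    have "norm (monomial \<beta> x *\<^sub>R mi_deriv \<alpha> f x) \<le> B" for x
    proof -
      have "norm (monomial \<beta> x *\<^sub>R mi_deriv \<alpha> f x) \<le>
          (1 + norm x) ^ max (mi_length \<alpha>) (mi_length \<beta>) * norm (partial_derivs (list_of_mi \<alpha>) f x)"
        unfolding mi_deriv_list_of_mi norm_scaleR
        by (intro mult_right_mono abs_monomial_le_power) auto
      also have "\<dots> \<le> B" by (rule schwartz_leD[OF B]) (simp add: length_list_of_mi)
      finally show ?thesis .
    qed
    then show ?thesis by (auto simp: bounded_iff)
  qed
  with f show "schwartz_fun f" by (simp add: schwartz_fun_def)
qed

lemma schwartz_fun_smooth: "schwartz_fun f \<Longrightarrow> smooth f"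
  by (simp add: schwartz_fun_def)

lemma schwartz_funI: "(\<And>k. \<exists>B. schwartz_le k B f) \<Longrightarrow> schwartz_fun f"
  unfolding schwartz_fun_iff smooth_iff schwartz_le_def by blast

lemma schwartz_seminorm_le:
  fixes f :: "real ^ 'n::finite \<Rightarrow> complex"
  assumes "schwartz_le k B f"
  shows "schwartz_seminorm k f \<le> real (card {\<alpha> :: 'n multi_index. mi_length \<alpha> \<le> k}) ^ 2 * B"
proof -
  have "(SUP x. norm (monomial \<beta> x *\<^sub>R mi_deriv \<alpha> f x)) \<le> B"
    if "mi_length \<alpha> \<le> k" "mi_length \<beta> \<le> k" for \<alpha> \<beta>
  proof (rule cSUP_least)
    fix x
    have "norm (monomial \<beta> x *\<^sub>R mi_deriv \<alpha> f x) \<le> (1 + norm x) ^ k * norm (partial_derivs (list_of_mi \<alpha>) f x)"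
      unfolding mi_deriv_list_of_mi norm_scaleR
      by (intro mult_right_mono abs_monomial_le_power that) auto
    also have "\<dots> \<le> B" by (rule schwartz_leD[OF assms]) (simp add: length_list_of_mi that)
    finally show "norm (monomial \<beta> x *\<^sub>R mi_deriv \<alpha> f x) \<le> B" .
  qed auto
  then have "schwartz_seminorm k f \<le> (\<Sum>\<alpha>::'n multi_index | mi_length \<alpha> \<le> k. \<Sum>\<beta>::'n multi_index | mi_length \<beta> \<le> k. B)"
    unfolding schwartz_seminorm_def by (intro sum_mono) auto
  then show ?thesis by (simp add: power2_eq_square mult.assoc)
qed

text \<open>The constant monomial and the pure powers contribute \<open>1 + CARD('n)\<close> terms,
  each bounded by the seminorm; this is the last factor of the constant, the others come from
  \<open>weight_le_coords\<close>.\<close>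

lemma schwartz_le_seminorm:
  fixes f :: "real ^ 'n::finite \<Rightarrow> complex"
  assumes f: "schwartz_fun f"
  shows "schwartz_le k ((1 + real CARD('n)) ^ Suc k * schwartz_seminorm k f) f"
proof (rule schwartz_leI)
  show sm: "smooth f" using f by (rule schwartz_fun_smooth)
  fix js :: "'n list" and x assume js: "length js \<le> k"
  define S where "S \<alpha> \<beta> = (SUP x. norm (monomial \<beta> x *\<^sub>R mi_deriv \<alpha> f x))" for \<alpha> \<beta>
  have up: "norm (monomial \<beta> x *\<^sub>R mi_deriv \<alpha> f x) \<le> S \<alpha> \<beta>" for \<alpha> \<beta> x
    unfolding S_def
  proof (rule cSUP_upper)
    show "bdd_above (range (\<lambda>x. norm (monomial \<beta> x *\<^sub>R mi_deriv \<alpha> f x)))"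
      using f by (auto simp: schwartz_fun_def bounded_iff bdd_above_def)
  qed auto
  have S0: "0 \<le> S \<alpha> \<beta>" for \<alpha> \<beta>
    using up[of \<beta> 0 \<alpha>] norm_ge_zero order_trans by blast
  obtain \<alpha> where \<alpha>: "mi_length \<alpha> = length js" "partial_derivs js f = mi_deriv \<alpha> f"
    using partial_derivs_eq_mi_deriv[OF sm] by metis
  have le: "S \<alpha> \<beta> \<le> schwartz_seminorm k f" if "mi_length \<beta> \<le> k" for \<beta>
  proof -
    have "S \<alpha> \<beta> \<le> (\<Sum>\<beta>::'n multi_index | mi_length \<beta> \<le> k. S \<alpha> \<beta>)"
      by (rule member_le_sum) (use that S0 in \<open>auto simp: finite_mi_length_le\<close>)
    also have "\<dots> \<le> (\<Sum>\<alpha>::'n multi_index | mi_length \<alpha> \<le> k. \<Sum>\<beta>::'n multi_index | mi_length \<beta> \<le> k. S \<alpha> \<beta>)"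
      by (rule member_le_sum[of \<alpha> _ "\<lambda>\<alpha>. \<Sum>\<beta>::'n multi_index | mi_length \<beta> \<le> k. S \<alpha> \<beta>"])
        (use \<alpha> js S0 in \<open>auto simp: finite_mi_length_le sum_nonneg\<close>)
    finally show ?thesis by (simp add: S_def schwartz_seminorm_def)
  qed
  define s where "s = schwartz_seminorm k f"
  have 1: "norm (partial_derivs js f x) \<le> s"
    using up[of "Poly_Mapping.single undefined 0" x \<alpha>] le[of "Poly_Mapping.single undefined 0"]
    unfolding monomial_single \<alpha>(2) s_def mi_length_single by simp
  have 2: "\<bar>x $ i\<bar> ^ k * norm (partial_derivs js f x) \<le> s" for i
    using up[of "Poly_Mapping.single i k" x \<alpha>] le[of "Poly_Mapping.single i k"]
    unfolding monomial_single \<alpha>(2) s_def mi_length_single by (simp add: power_abs)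
  have "(1 + norm x) ^ k * norm (partial_derivs js f x) \<le>
    (1 + real CARD('n)) ^ k * (1 + (\<Sum>i\<in>UNIV. \<bar>x $ i\<bar> ^ k)) * norm (partial_derivs js f x)"
    by (intro mult_right_mono weight_le_coords) auto
  also have "\<dots> = (1 + real CARD('n)) ^ k * (norm (partial_derivs js f x) +
      (\<Sum>i\<in>UNIV. \<bar>x $ i\<bar> ^ k * norm (partial_derivs js f x)))"
    by (simp add: algebra_simps sum_distrib_left sum_distrib_right)
  also have "\<dots> \<le> (1 + real CARD('n)) ^ k * (s + (\<Sum>i\<in>(UNIV::'n set). s))"
    by (intro mult_left_mono add_mono sum_mono 1 2) auto
  finally show "(1 + norm x) ^ k * norm (partial_derivs js f x) \<le> (1 + real CARD('n)) ^ Suc k * schwartz_seminorm k f"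
    by (simp add: s_def algebra_simps)
qed

text \<open>Continuity against any valid bound \<open>B\<close>, so that suprema need not be
  computed; taking the absolute value makes the constant nonnegative.\<close>

lemma tempered_distributionE:
  assumes "tempered_distribution u"
  obtains C k where "0 \<le> C" "\<And>f B. schwartz_fun f \<Longrightarrow> schwartz_le k B f \<Longrightarrow> norm (u f) \<le> C * B"
proof -
  obtain C k where C: "\<And>\<psi>. schwartz_fun \<psi> \<Longrightarrow> norm (u \<psi>) \<le> C * schwartz_seminorm k \<psi>"
    using assms by (auto simp: tempered_distribution_def)
  have "norm (u f) \<le> (\<bar>C\<bar> * real (card {\<alpha> :: 'a multi_index. mi_length \<alpha> \<le> k}) ^ 2) * B"
    if f: "schwartz_fun f" and B: "schwartz_le k B f" for f B
  proof -
    have "0 \<le> schwartz_seminorm k f"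
      using schwartz_le_nonneg[OF schwartz_le_seminorm[OF f, of k]]
        mult_le_cancel_left_pos[of "(1 + real CARD('a)) ^ Suc k" 0 "schwartz_seminorm k f"]
      by simp
    then have "norm (u f) \<le> \<bar>C\<bar> * schwartz_seminorm k f"
      using C[OF f] by (smt (verit) mult_right_mono)
    also have "\<dots> \<le> \<bar>C\<bar> * (real (card {\<alpha> :: 'a multi_index. mi_length \<alpha> \<le> k}) ^ 2 * B)"
      by (intro mult_left_mono schwartz_seminorm_le B) auto
    finally show ?thesis by (simp add: mult_ac)
  qed
  then show ?thesis using that[of "\<bar>C\<bar> * real (card {\<alpha> :: 'a multi_index. mi_length \<alpha> \<le> k}) ^ 2"] by auto
qed

lemma tempered_distributionI:
  assumes "linear_form_on schwartz_fun u"
    and "\<And>f B. schwartz_fun f \<Longrightarrow> schwartz_le k B f \<Longrightarrow> norm (u f) \<le> C * B"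
  shows "tempered_distribution u"
  unfolding tempered_distribution_def
proof (intro conjI exI allI impI assms(1))
  fix \<psi> :: "real ^ 'a \<Rightarrow> complex" assume "schwartz_fun \<psi>"
  from assms(2)[OF this schwartz_le_seminorm[OF this]]
  show "norm (u \<psi>) \<le> (C * (1 + real CARD('a)) ^ Suc k) * schwartz_seminorm k \<psi>"
    by (simp only: mult.assoc)
qed

section \<open>Operations on Schwartz functions\<close>

lemma schwartz_le_add:
  assumes "schwartz_le k A f" "schwartz_le k B g"
  shows "schwartz_le k (A + B) (\<lambda>x. f x + g x)"
  using derivs_le_add[OF assms[unfolded schwartz_le_def]] by (simp add: schwartz_le_def add_divide_distrib)

lemma schwartz_le_cmult:
  assumes "schwartz_le k A f"
  shows "schwartz_le k (norm c * A) (\<lambda>x. c * f x)"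
  using derivs_le_cmult[OF assms[unfolded schwartz_le_def], of c] by (simp add: schwartz_le_def)

text \<open>Growth of degree \<open>m\<close> is paid with \<open>m\<close> additional orders of
  decay of \<open>f\<close>.\<close>

lemma schwartz_le_mult:
  assumes a: "derivs_le k (\<lambda>x. A * (1 + norm x) ^ m) a" and f: "schwartz_le (k + m) B f"
  shows "schwartz_le k (2 ^ k * A * B) (\<lambda>x. a x * f x)"
proof -
  have "derivs_le k (\<lambda>x. B / (1 + norm x) ^ (k + m)) f"
    using f unfolding schwartz_le_def by (rule derivs_le_mono) auto
  from derivs_le_mult[OF a this] show ?thesis
    by (simp add: schwartz_le_def power_add field_simps)
qed

lemma schwartz_le_partial_deriv:
  assumes "schwartz_le (Suc k) B f"
  shows "schwartz_le k B (partial_deriv i f)"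
proof -
  have "derivs_le k (\<lambda>x. B / (1 + norm x) ^ Suc k) (partial_deriv i f)"
    using assms by (simp add: schwartz_le_def derivs_le_Suc)
  then show ?thesis unfolding schwartz_le_def
    by (rule derivs_le_mono)
      (use schwartz_le_nonneg[OF assms] in \<open>auto intro!: frac_le power_increasing simp del: power_Suc\<close>)
qed

lemma schwartz_fun_add: "schwartz_fun f \<Longrightarrow> schwartz_fun g \<Longrightarrow> schwartz_fun (\<lambda>x. f x + g x)"
  unfolding schwartz_fun_iff using schwartz_le_add smooth_add by blast

lemma schwartz_fun_cmult: "schwartz_fun f \<Longrightarrow> schwartz_fun (\<lambda>x. c * f x)"
  unfolding schwartz_fun_iff using schwartz_le_cmult smooth_cmult by blast

lemma schwartz_fun_diff: "schwartz_fun f \<Longrightarrow> schwartz_fun g \<Longrightarrow> schwartz_fun (\<lambda>x. f x - g x)"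
  using schwartz_fun_add[of f "\<lambda>x. (-1) * g x"] schwartz_fun_cmult[of g "-1"] by simp

lemma schwartz_fun_zero [simp]: "schwartz_fun (\<lambda>x. 0)"
  by (rule schwartz_funI) (auto simp: schwartz_le_def intro!: exI[of _ 0] derivs_le_zero)

lemma schwartz_fun_sum: "(\<And>i. i \<in> I \<Longrightarrow> schwartz_fun (f i)) \<Longrightarrow> schwartz_fun (\<lambda>x. \<Sum>i\<in>I. f i x)"
  by (induction I rule: infinite_finite_induct) (simp_all add: schwartz_fun_add)

lemma schwartz_fun_partial_deriv: "schwartz_fun f \<Longrightarrow> schwartz_fun (partial_deriv i f)"
  unfolding schwartz_fun_iff using schwartz_le_partial_deriv smooth_partial_deriv by blast

lemma schwartz_fun_partial_derivs: "schwartz_fun f \<Longrightarrow> schwartz_fun (partial_derivs js f)"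
  by (induction js) (simp_all add: schwartz_fun_partial_deriv)

text \<open>The multipliers of the Schwartz space; the degree \<open>m\<close> may depend on the
  order \<open>k\<close>.\<close>

definition poly_growth :: "(real ^ 'n::finite \<Rightarrow> complex) \<Rightarrow> bool" where
  "poly_growth a \<longleftrightarrow> (\<forall>k. \<exists>A m. derivs_le k (\<lambda>x. A * (1 + norm x) ^ m) a)"

lemma schwartz_fun_mult:
  assumes "poly_growth a" "schwartz_fun f"
  shows "schwartz_fun (\<lambda>x. a x * f x)"
proof (rule schwartz_funI)
  fix k
  obtain A m where A: "derivs_le k (\<lambda>x. A * (1 + norm x) ^ m) a"
    using assms(1) unfolding poly_growth_def by blast
  obtain B where B: "schwartz_le (k + m) B f"
    using assms(2) unfolding schwartz_fun_iff by blast
  show "\<exists>B. schwartz_le k B (\<lambda>x. a x * f x)"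
    using schwartz_le_mult[OF A B] by blast
qed

lemma test_fun_schwartz:
  assumes "test_fun f"
  shows "schwartz_fun f"
proof (rule schwartz_funI)
  fix k
  have sm: "smooth f" and comp: "compact (supp f)" using assms by (auto simp: test_fun_def)
  have "\<exists>B. \<forall>x. (1 + norm x) ^ k * norm (partial_derivs js f x) \<le> B" for js
  proof -
    have "compact ((\<lambda>x. (1 + norm x) ^ k * norm (partial_derivs js f x)) ` supp f)"
      by (intro compact_continuous_image comp continuous_intros smooth_continuous smooth_partial_derivs sm)
    then obtain B where B: "\<And>x. x \<in> supp f \<Longrightarrow> (1 + norm x) ^ k * norm (partial_derivs js f x) \<le> B"
      by (meson bounded_imp_bdd_above compact_imp_bounded bdd_above.unfold imageI)
    have "partial_derivs js f x = 0" if "x \<notin> supp f" for x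
      using that supp_partial_derivs[of js f] closure_subset[of "{x. partial_derivs js f x \<noteq> 0}"]
      unfolding supp_def[of "partial_derivs js f"] by blast
    then have "(1 + norm x) ^ k * norm (partial_derivs js f x) \<le> max B 0" for x
      using B[of x] by (cases "x \<in> supp f") auto
    then show ?thesis by blast
  qed
  then obtain B where B: "\<And>js x. (1 + norm x) ^ k * norm (partial_derivs js f x) \<le> B js" by metis
  have "schwartz_le k (Max (B ` {js. length js \<le> k})) f"
  proof (rule schwartz_leI[OF sm])
    fix js :: "'a list" and x assume "length js \<le> k"
    then have "B js \<le> Max (B ` {js. length js \<le> k})"
      by (intro Max_ge) (auto simp: finite_lists_length_le')
    with B[where js=js and x=x] show "(1 + norm x) ^ k * norm (partial_derivs js f x) \<le> Max (B ` {js. length js \<le> k})"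
      by linarith
  qed
  then show "\<exists>B. schwartz_le k B f" by blast
qed

section \<open>Linearity and products for tempered distributions\<close>

lemma tempered_add: "tempered_distribution u \<Longrightarrow> schwartz_fun f \<Longrightarrow> schwartz_fun g \<Longrightarrow>
    u (\<lambda>x. f x + g x) = u f + u g"
  by (simp add: tempered_distribution_def linear_form_on_def)

lemma tempered_cmult: "tempered_distribution u \<Longrightarrow> schwartz_fun f \<Longrightarrow> u (\<lambda>x. c * f x) = c * u f"
  by (simp add: tempered_distribution_def linear_form_on_def)

lemma tempered_diff:
  "tempered_distribution u \<Longrightarrow> schwartz_fun f \<Longrightarrow> schwartz_fun g \<Longrightarrow> u (\<lambda>x. f x - g x) = u f - u g"
  using tempered_add[of u f "\<lambda>x. (-1) * g x"] tempered_cmult[of u g "-1"] schwartz_fun_cmult[of g "-1"]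
  by simp

lemma tempered_zero: "tempered_distribution u \<Longrightarrow> u (\<lambda>x. 0) = 0"
  using tempered_cmult[of u "\<lambda>x. 0" 0] by simp

lemma tempered_sum:
  assumes "tempered_distribution u" "\<And>i. i \<in> I \<Longrightarrow> schwartz_fun (f i)"
  shows "u (\<lambda>x. \<Sum>i\<in>I. f i x) = (\<Sum>i\<in>I. u (f i))"
  using assms(2)
  by (induction I rule: infinite_finite_induct)
    (simp_all add: tempered_zero[OF assms(1)] tempered_add[OF assms(1)] schwartz_fun_sum)

lemma tempered_mult_dist:
  assumes a: "poly_growth a" and u: "tempered_distribution u"
  shows "tempered_distribution (mult_dist a u)"
proof -
  obtain C k where C: "0 \<le> C" "\<And>f B. schwartz_fun f \<Longrightarrow> schwartz_le k B f \<Longrightarrow> norm (u f) \<le> C * B"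
    using tempered_distributionE[OF u] by blast
  obtain A m where A: "derivs_le k (\<lambda>x. A * (1 + norm x) ^ m) a" using a unfolding poly_growth_def by blast
  show ?thesis
  proof (rule tempered_distributionI)
    show "linear_form_on schwartz_fun (mult_dist a u)"
      unfolding linear_form_on_def
    proof (intro conjI allI impI)
      fix \<psi> \<eta> :: "real ^ 'a \<Rightarrow> complex" assume "schwartz_fun \<psi>" "schwartz_fun \<eta>"
      then show "mult_dist a u (\<lambda>x. \<psi> x + \<eta> x) = mult_dist a u \<psi> + mult_dist a u \<eta>"
        using tempered_add[OF u schwartz_fun_mult[OF a] schwartz_fun_mult[OF a]]
        by (simp add: mult_dist_def distrib_left)
    next
      fix c and \<psi> :: "real ^ 'a \<Rightarrow> complex" assume "schwartz_fun \<psi>"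
      then show "mult_dist a u (\<lambda>x. c * \<psi> x) = c * mult_dist a u \<psi>"
        using tempered_cmult[OF u schwartz_fun_mult[OF a]]
        by (simp add: mult_dist_def mult.left_commute)
    qed
    fix f :: "real ^ 'a \<Rightarrow> complex" and B
    assume f: "schwartz_fun f" "schwartz_le (k + m) B f"
    from C(2)[OF schwartz_fun_mult[OF a f(1)] schwartz_le_mult[OF A f(2)]]
    show "norm (mult_dist a u f) \<le> (C * 2 ^ k * A) * B" by (simp add: mult_dist_def mult_ac)
  qed
qed

section \<open>Plane waves and Fourier integrals\<close>

definition wave :: "real ^ 'n::finite \<Rightarrow> real ^ 'n \<Rightarrow> complex" where
  "wave \<eta> x = exp (- \<i> * complex_of_real (x \<bullet> \<eta>))"

lemma wave_commute: "wave \<eta> x = wave x \<eta>"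
  by (simp add: wave_def inner_commute)

lemma norm_wave [simp]: "norm (wave \<eta> x) = 1"
  by (simp add: wave_def)

lemma wave_zero [simp]: "wave 0 x = 1" "wave \<eta> 0 = 1"
  by (simp_all add: wave_def)

lemma wave_add: "wave (\<eta> + \<zeta>) x = wave \<eta> x * wave \<zeta> x"
  by (simp add: wave_def inner_add_right exp_add[symmetric] algebra_simps)

lemma wave_add': "wave \<eta> (x + y) = wave \<eta> x * wave \<eta> y"
  by (simp add: wave_commute[of \<eta>] wave_add)

lemma wave_minus_swap: "wave (- \<eta>) x = wave \<eta> (- x)"
  by (simp add: wave_def)

lemma continuous_wave [continuous_intros]:
  "continuous_on S f \<Longrightarrow> continuous_on S g \<Longrightarrow> continuous_on S (\<lambda>x. wave (f x) (g x))"
  unfolding wave_def by (intro continuous_intros)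

lemma measurable_wave [measurable]:
  assumes "f \<in> borel_measurable M" "g \<in> borel_measurable M"
  shows "(\<lambda>x. wave (f x) (g x)) \<in> borel_measurable M"
  unfolding wave_def using assms by measurable

lemma norm_iexp_diff: "norm (exp (- \<i> * complex_of_real a) - exp (- \<i> * complex_of_real b)) \<le> \<bar>a - b\<bar>"
proof -
  have "exp (- \<i> * complex_of_real a) - exp (- \<i> * complex_of_real b) =
     exp (- \<i> * complex_of_real b) * (iexp (b - a) - 1)"
    by (simp add: algebra_simps exp_add[symmetric])
  then show ?thesis using iexp_approx1[of "b - a" 0] by (simp add: norm_mult abs_minus_commute)
qed

lemma norm_wave_diff: "norm (wave \<eta> x - wave \<zeta> x) \<le> norm x * norm (\<eta> - \<zeta>)"
  using norm_iexp_diff[of "x \<bullet> \<eta>" "x \<bullet> \<zeta>"] Cauchy_Schwarz_ineq2[of x "\<eta> - \<zeta>"]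
  by (simp add: wave_def inner_diff_right)

text \<open>Taylor expansion of the exponential on the imaginary axis; it provides the
  differentiability of Fourier integrals.\<close>

lemma norm_wave_diff2:
  "norm (wave \<eta> (x + v) - wave \<eta> x + \<i> * complex_of_real (v \<bullet> \<eta>) * wave \<eta> x) \<le> (norm v)\<^sup>2 * (norm \<eta>)\<^sup>2"
proof -
  have "wave \<eta> (x + v) - wave \<eta> x + \<i> * complex_of_real (v \<bullet> \<eta>) * wave \<eta> x =
     wave \<eta> x * (iexp (- (v \<bullet> \<eta>)) - (\<Sum>k\<le>1. (\<i> * complex_of_real (- (v \<bullet> \<eta>))) ^ k / fact k))"
    by (simp add: wave_add' algebra_simps wave_def[of \<eta> v])
  then have "norm (wave \<eta> (x + v) - wave \<eta> x + \<i> * complex_of_real (v \<bullet> \<eta>) * wave \<eta> x) \<le> (v \<bullet> \<eta>)\<^sup>2 / 2"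
    using iexp_approx1[of "- (v \<bullet> \<eta>)" 1] by (simp add: norm_mult power2_eq_square del: sum.atMost_Suc)
  also have "\<dots> \<le> (v \<bullet> \<eta>)\<^sup>2" by simp
  also have "\<dots> \<le> (norm v)\<^sup>2 * (norm \<eta>)\<^sup>2"
    using power_mono[OF Cauchy_Schwarz_ineq2[of v \<eta>], of 2] by (simp add: power_mult_distrib)
  finally show ?thesis .
qed

text \<open>The Fourier symbol of \<open>partial_derivs js\<close>: each derivative of a plane wave
  brings down one factor.\<close>

definition wave_factor :: "'n list \<Rightarrow> real ^ 'n::finite \<Rightarrow> complex" where
  "wave_factor js \<eta> = prod_list (map (\<lambda>j. - \<i> * complex_of_real (\<eta> $ j)) js)"

lemma wave_factor_simps [simp]:
  "wave_factor [] \<eta> = 1" "wave_factor (j # js) \<eta> = - \<i> * complex_of_real (\<eta> $ j) * wave_factor js \<eta>"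
  by (simp_all add: wave_factor_def)

lemma norm_wave_factor: "length js \<le> k \<Longrightarrow> norm (wave_factor js \<eta>) \<le> (1 + norm \<eta>) ^ k"
proof (induction js arbitrary: k)
  case (Cons j js)
  then obtain l where l: "k = Suc l" "length js \<le> l" by (cases k) auto
  have "norm (wave_factor (j # js) \<eta>) = \<bar>\<eta> $ j\<bar> * norm (wave_factor js \<eta>)"
    by (simp add: norm_mult)
  also have "\<dots> \<le> (1 + norm \<eta>) * (1 + norm \<eta>) ^ l"
    by (intro mult_mono Cons l) (use component_le_norm_cart[of \<eta> j] in auto)
  finally show ?case by (simp add: l)
qed simp

lemma continuous_wave_factor [continuous_intros]:
  "continuous_on S f \<Longrightarrow> continuous_on S (\<lambda>x. wave_factor js (f x))"
  by (induction js) (auto intro!: continuous_intros)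

lemma measurable_wave_factor [measurable]:
  assumes [measurable]: "f \<in> borel_measurable M"
  shows "(\<lambda>x. wave_factor js (f x)) \<in> borel_measurable M"
proof -
  have "wave_factor js \<in> borel_measurable borel"
    by (intro borel_measurable_continuous_onI continuous_intros)
  then show ?thesis using assms by measurable
qed

section \<open>Derivatives of plane waves\<close>

lemma wave_has_derivative:
  "(wave \<eta> has_derivative (\<lambda>v. - \<i> * complex_of_real (v \<bullet> \<eta>) * wave \<eta> x)) (at x within S)"
proof -
  have "((\<lambda>x. - \<i> * complex_of_real (x \<bullet> \<eta>)) has_derivative (\<lambda>v. - \<i> * complex_of_real (v \<bullet> \<eta>))) (at x within S)"
    by (intro has_derivative_mult_right has_derivative_of_real has_derivative_inner_left has_derivative_ident)
  from has_derivative_compose[OF this DERIV_exp[unfolded has_field_derivative_def]]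
  show ?thesis by (simp add: wave_def[abs_def] mult_ac)
qed

lemma inner_axis_1: "axis i 1 \<bullet> (\<eta> :: real ^ 'n::finite) = \<eta> $ i"
  by (simp add: inner_axis inner_commute)

lemma partial_deriv_wave: "partial_deriv i (wave \<eta>) = (\<lambda>x. - \<i> * complex_of_real (\<eta> $ i) * wave \<eta> x)"
  by (rule ext, subst partial_deriv_eq[OF wave_has_derivative]) (simp add: inner_axis_1)

lemma wave_differentiable: "wave \<eta> differentiable at x"
  using wave_has_derivative by (auto simp: differentiable_def)

lemma partial_derivs_wave: "partial_derivs js (wave \<eta>) = (\<lambda>x. wave_factor js \<eta> * wave \<eta> x)"
proof (induction js)
  case (Cons j js)
  show ?case
    by (rule ext) (simp add: Cons partial_deriv_cmult[OF wave_differentiable] partial_deriv_wave)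
qed simp

lemma smooth_wave: "smooth (wave \<eta>)"
  unfolding smooth_def partial_derivs_wave by (auto intro!: derivative_intros wave_differentiable)

lemma derivs_le_wave: "derivs_le k (\<lambda>x. (1 + norm \<eta>) ^ k) (wave \<eta>)"
  unfolding smooth_derivs_le_iff[OF smooth_wave] by (simp add: partial_derivs_wave norm_mult norm_wave_factor)

lemma poly_growth_wave: "poly_growth (wave \<eta>)"
  unfolding poly_growth_def
proof
  fix k show "\<exists>A m. derivs_le k (\<lambda>x. A * (1 + norm x) ^ m) (wave \<eta>)"
    by (rule exI[of _ "(1 + norm \<eta>) ^ k"], rule exI[of _ 0]) (use derivs_le_wave[of k \<eta>] in simp)
qed

lemma schwartz_fun_mult_wave: "schwartz_fun A \<Longrightarrow> schwartz_fun (\<lambda>x. A x * wave \<eta> x)"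
  using schwartz_fun_mult[OF poly_growth_wave, of A \<eta>] by (simp add: mult.commute)

text \<open>The densities used for synthesis with plane waves. Schwartz functions would be too
  narrow: the transform of \<phi> is known only through almost-everywhere bounds, but all its
  moments are finite.\<close>

definition rapid_L1 :: "(real ^ 'n::finite \<Rightarrow> complex) \<Rightarrow> bool" where
  "rapid_L1 W \<longleftrightarrow> W \<in> borel_measurable borel \<and> (\<forall>k. integrable lborel (\<lambda>\<eta>. (1 + norm \<eta>) ^ k * norm (W \<eta>)))"

lemma rapid_L1_measurable [measurable_dest]: "rapid_L1 W \<Longrightarrow> W \<in> borel_measurable borel"
  by (simp add: rapid_L1_def)

lemma rapid_L1_integrable:
  assumes W: "rapid_L1 W" and p [measurable]: "p \<in> borel_measurable borel"
    and le: "\<And>\<eta>. norm (p \<eta>) \<le> C * (1 + norm \<eta>) ^ k"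
  shows "integrable lborel (\<lambda>\<eta>. W \<eta> * p \<eta>)"
proof (rule Bochner_Integration.integrable_bound)
  note [measurable] = rapid_L1_measurable[OF W]
  show "integrable lborel (\<lambda>\<eta>. C * ((1 + norm \<eta>) ^ k * norm (W \<eta>)))"
    using W by (auto simp: rapid_L1_def)
  show "AE \<eta> in lborel. norm (W \<eta> * p \<eta>) \<le> norm (C * ((1 + norm \<eta>) ^ k * norm (W \<eta>)))"
  proof (rule AE_I2)
    fix \<eta> :: "real ^ 'a"
    have "norm (W \<eta> * p \<eta>) \<le> norm (W \<eta>) * (C * (1 + norm \<eta>) ^ k)"
      unfolding norm_mult by (intro mult_left_mono le) auto
    also have "\<dots> \<le> norm (C * ((1 + norm \<eta>) ^ k * norm (W \<eta>)))"
      by (metis abs_ge_self mult.assoc mult.commute real_norm_def)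
    finally show "norm (W \<eta> * p \<eta>) \<le> norm (C * ((1 + norm \<eta>) ^ k * norm (W \<eta>)))" .
  qed
  show "(\<lambda>\<eta>. W \<eta> * p \<eta>) \<in> borel_measurable lborel" by measurable
qed

lemma rapid_L1_mult:
  assumes W: "rapid_L1 W" and p [measurable]: "p \<in> borel_measurable borel"
    and le: "\<And>\<eta>. norm (p \<eta>) \<le> C * (1 + norm \<eta>) ^ k"
  shows "rapid_L1 (\<lambda>\<eta>. p \<eta> * W \<eta>)"
  unfolding rapid_L1_def
proof (intro conjI allI)
  note [measurable] = rapid_L1_measurable[OF W]
  show "(\<lambda>\<eta>. p \<eta> * W \<eta>) \<in> borel_measurable borel" by measurable
  fix l
  have "integrable lborel (\<lambda>\<eta>. W \<eta> * (p \<eta> * complex_of_real ((1 + norm \<eta>) ^ l)))"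
  proof (rule rapid_L1_integrable[OF W, where C=C and k="k+l"])
    fix \<eta> :: "real ^ 'a"
    have "norm (p \<eta> * complex_of_real ((1 + norm \<eta>) ^ l)) = norm (p \<eta>) * (1 + norm \<eta>) ^ l"
      by (simp only: norm_mult norm_of_real abs_of_nonneg[OF zero_le_power[OF one_plus_norm_pos(3)]])
    also have "\<dots> \<le> C * (1 + norm \<eta>) ^ k * (1 + norm \<eta>) ^ l"
      by (intro mult_right_mono le) auto
    finally show "norm (p \<eta> * complex_of_real ((1 + norm \<eta>) ^ l)) \<le> C * (1 + norm \<eta>) ^ (k + l)"
      by (simp add: power_add mult_ac)
  qed measurable
  from integrable_norm[OF this]
  show "integrable lborel (\<lambda>\<eta>. (1 + norm \<eta>) ^ l * norm (p \<eta> * W \<eta>))"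
    by (simp only: norm_mult norm_of_real abs_of_nonneg[OF zero_le_power[OF one_plus_norm_pos(3)]] mult_ac)
qed

lemma rapid_L1_wave_factor: "rapid_L1 W \<Longrightarrow> rapid_L1 (\<lambda>\<eta>. wave_factor js \<eta> * W \<eta>)"
  by (rule rapid_L1_mult[where C=1 and k="length js"]) (auto simp: norm_wave_factor)

lemma rapid_L1_coord: "rapid_L1 W \<Longrightarrow> rapid_L1 (\<lambda>\<eta>. - \<i> * complex_of_real (\<eta> $ i) * W \<eta>)"
  using rapid_L1_wave_factor[of W "[i]"] by simp

text \<open>The Fourier transform without its normalising constant, which thus appears only where
  \<open>fourier\<close> itself has to be treated.\<close>

definition fourier_int :: "(real ^ 'n::finite \<Rightarrow> complex) \<Rightarrow> real ^ 'n \<Rightarrow> complex" where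
  "fourier_int W x = (LINT \<eta>|lborel. W \<eta> * wave \<eta> x)"

lemma fourier_eq: "fourier f \<xi> = complex_of_real ((2 * pi) powr (- (real CARD('n) / 2))) * fourier_int f \<xi>"
  for f :: "real ^ 'n::finite \<Rightarrow> complex"
  by (simp add: fourier_def fourier_int_def wave_def inner_commute)

lemma rapid_L1_integrable_wave: "rapid_L1 W \<Longrightarrow> integrable lborel (\<lambda>\<eta>. W \<eta> * wave \<eta> x)"
  by (rule rapid_L1_integrable[where C=1 and k=0]) auto

text \<open>The remainder in the expansion of a wave is at most |v|^2 |\<eta>|^2, so the second
  moment of \<open>W\<close> bounds the error of the difference quotient by a multiple of
  |v|.\<close>

lemma fourier_int_has_derivative:
  assumes W: "rapid_L1 W"
  shows "(fourier_int W has_derivative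
    (\<lambda>v. \<Sum>i\<in>UNIV. (v $ i) *\<^sub>R fourier_int (\<lambda>\<eta>. - \<i> * complex_of_real (\<eta> $ i) * W \<eta>) x)) (at x)"
    (is "(_ has_derivative ?L) _")
proof (rule has_derivativeI_sandwich[where e=1])
  show "bounded_linear ?L"
    by (intro bounded_linear_sum bounded_linear_compose[OF bounded_linear_scaleR_left bounded_linear_vec_nth])
  define K where "K = (LINT \<eta>|lborel. (1 + norm \<eta>) ^ 2 * norm (W \<eta>))"
  note [measurable] = rapid_L1_measurable[OF W]
  have L: "?L v = (LINT \<eta>|lborel. W \<eta> * (- \<i> * complex_of_real (v \<bullet> \<eta>) * wave \<eta> x))" for v
  proof -
    have "?L v = (LINT \<eta>|lborel. (\<Sum>i\<in>UNIV. (v $ i) *\<^sub>R (- \<i> * complex_of_real (\<eta> $ i) * W \<eta> * wave \<eta> x)))"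
      unfolding fourier_int_def
      by (subst Bochner_Integration.integral_sum)
        (intro integrable_scaleR_right rapid_L1_integrable_wave rapid_L1_coord W, simp only: integral_scaleR_right)
    also have "\<dots> = (LINT \<eta>|lborel. W \<eta> * (- \<i> * complex_of_real (v \<bullet> \<eta>) * wave \<eta> x))"
      by (rule Bochner_Integration.integral_cong)
        (auto simp: inner_vec_def scaleR_conv_of_real sum_distrib_left sum_distrib_right mult_ac)
    finally show ?thesis .
  qed
  have int2: "integrable lborel (\<lambda>\<eta>. W \<eta> * (- \<i> * complex_of_real (v \<bullet> \<eta>) * wave \<eta> x))" for v
  proof (rule rapid_L1_integrable[OF W, where C="norm v" and k=1])
    fix \<eta> :: "real ^ 'a" show "norm (- \<i> * complex_of_real (v \<bullet> \<eta>) * wave \<eta> x) \<le> norm v * (1 + norm \<eta>) ^ 1"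
      using Cauchy_Schwarz_ineq2[of v \<eta>] by (simp add: norm_mult algebra_simps) (smt (verit) norm_ge_zero)
  qed measurable
  show "norm (fourier_int W y - fourier_int W x - ?L (y - x)) / norm (y - x) \<le> K * norm (y - x)"
    if "y \<in> UNIV" "y \<noteq> x" for y
  proof -
    define v where "v = y - x"
    have "fourier_int W y - fourier_int W x - ?L v =
      (LINT \<eta>|lborel. W \<eta> * (wave \<eta> (x + v) - wave \<eta> x + \<i> * complex_of_real (v \<bullet> \<eta>) * wave \<eta> x))"
      unfolding L unfolding fourier_int_def
      by (subst Bochner_Integration.integral_diff[symmetric], (intro rapid_L1_integrable_wave W int2 Bochner_Integration.integrable_diff)+)+
        (simp add: v_def algebra_simps)
    also have "norm \<dots> \<le> (LINT \<eta>|lborel. norm (W \<eta> * (wave \<eta> (x + v) - wave \<eta> x + \<i> * complex_of_real (v \<bullet> \<eta>) * wave \<eta> x)))"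
      by (rule integral_norm_bound)
    also have "\<dots> \<le> (LINT \<eta>|lborel. (norm v)\<^sup>2 * ((1 + norm \<eta>) ^ 2 * norm (W \<eta>)))"
    proof (rule integral_mono')
      show "integrable lborel (\<lambda>\<eta>. (norm v)\<^sup>2 * ((1 + norm \<eta>) ^ 2 * norm (W \<eta>)))"
        using W by (auto simp: rapid_L1_def)
      fix \<eta> :: "real ^ 'a"
      have "(norm v)\<^sup>2 * (norm \<eta>)\<^sup>2 \<le> (norm v)\<^sup>2 * (1 + norm \<eta>)\<^sup>2"
        by (intro mult_left_mono power_mono) auto
      then have "norm (W \<eta>) * norm (wave \<eta> (x + v) - wave \<eta> x + \<i> * complex_of_real (v \<bullet> \<eta>) * wave \<eta> x)
         \<le> norm (W \<eta>) * ((norm v)\<^sup>2 * (1 + norm \<eta>)\<^sup>2)"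
        by (intro mult_left_mono order_trans[OF norm_wave_diff2]) auto
      then show "norm (W \<eta> * (wave \<eta> (x + v) - wave \<eta> x + \<i> * complex_of_real (v \<bullet> \<eta>) * wave \<eta> x)) \<le>
        (norm v)\<^sup>2 * ((1 + norm \<eta>) ^ 2 * norm (W \<eta>))" by (simp add: norm_mult mult_ac)
    qed auto
    also have "\<dots> = (norm v)\<^sup>2 * K" by (simp add: K_def)
    finally show ?thesis using that by (simp add: v_def divide_simps power2_eq_square mult_ac)
  qed
  show "((\<lambda>y. K * norm (y - x)) \<longlongrightarrow> 0) (at x)"
    by (auto intro!: tendsto_eq_intros)
qed auto

lemma partial_deriv_fourier_int:
  assumes "rapid_L1 W"
  shows "partial_deriv i (fourier_int W) = fourier_int (\<lambda>\<eta>. - \<i> * complex_of_real (\<eta> $ i) * W \<eta>)"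
  by (rule ext, subst partial_deriv_eq[OF fourier_int_has_derivative[OF assms]]) (simp only: sum_axis_scaleR)

lemma partial_derivs_fourier_int:
  assumes "rapid_L1 W"
  shows "partial_derivs js (fourier_int W) = fourier_int (\<lambda>\<eta>. wave_factor js \<eta> * W \<eta>)"
  by (induction js)
    (simp_all add: partial_deriv_fourier_int[OF rapid_L1_wave_factor[OF assms]] mult.assoc)

lemma smooth_fourier_int: "rapid_L1 W \<Longrightarrow> smooth (fourier_int W)"
  unfolding smooth_def differentiable_def partial_derivs_fourier_int
  using fourier_int_has_derivative[OF rapid_L1_wave_factor] by blast

lemma derivs_le_fourier_int:
  assumes W: "rapid_L1 W"
  shows "derivs_le k (\<lambda>x. LINT \<eta>|lborel. (1 + norm \<eta>) ^ k * norm (W \<eta>)) (fourier_int W)"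
  unfolding smooth_derivs_le_iff[OF smooth_fourier_int[OF W]]
proof (intro allI impI)
  fix js :: "'a list" and x assume js: "length js \<le> k"
  note [measurable] = rapid_L1_measurable[OF W]
  have "norm (partial_derivs js (fourier_int W) x) \<le> (LINT \<eta>|lborel. norm (wave_factor js \<eta> * W \<eta> * wave \<eta> x))"
    unfolding partial_derivs_fourier_int[OF W] fourier_int_def by (rule integral_norm_bound)
  also have "\<dots> \<le> (LINT \<eta>|lborel. (1 + norm \<eta>) ^ k * norm (W \<eta>))"
    by (rule integral_mono')
      (use W js in \<open>auto simp: rapid_L1_def norm_mult intro!: mult_right_mono norm_wave_factor\<close>)
  finally show "norm (partial_derivs js (fourier_int W) x) \<le> (LINT \<eta>|lborel. (1 + norm \<eta>) ^ k * norm (W \<eta>))" .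
qed

lemma poly_growth_fourier_int: "rapid_L1 W \<Longrightarrow> poly_growth (fourier_int W)"
  unfolding poly_growth_def
proof
  fix k assume "rapid_L1 W"
  from derivs_le_fourier_int[OF this, of k]
  have "derivs_le k (\<lambda>x. (LINT \<eta>|lborel. (1 + norm \<eta>) ^ k * norm (W \<eta>)) * (1 + norm x) ^ 0) (fourier_int W)"
    by simp
  then show "\<exists>A m. derivs_le k (\<lambda>x. A * (1 + norm x) ^ m) (fourier_int W)" by blast
qed

lemma schwartz_fun_mult_fourier_int:
  "rapid_L1 W \<Longrightarrow> schwartz_fun A \<Longrightarrow> schwartz_fun (\<lambda>x. A x * fourier_int W x)"
  using schwartz_fun_mult[OF poly_growth_fourier_int, of W A] by (simp add: mult.commute)

text \<open>A modulus of continuity in the frequency: all derivatives up to order \<open>k\<close>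
  of the difference of two waves are at most this times 1 + |x|. It is continuous, vanishes on the
  diagonal and grows polynomially, which is what dominated convergence will ask for.\<close>

definition wave_gap :: "nat \<Rightarrow> real ^ 'n::finite \<Rightarrow> real ^ 'n \<Rightarrow> real" where
  "wave_gap k \<eta> \<zeta> = (\<Sum>js | length js \<le> k.
     norm (wave_factor js \<eta> - wave_factor js \<zeta>) + norm (wave_factor js \<zeta>) * norm (\<eta> - \<zeta>))"

lemma wave_gap_nonneg: "0 \<le> wave_gap k \<eta> \<zeta>"
  unfolding wave_gap_def by (intro sum_nonneg) auto

lemma wave_gap_self [simp]: "wave_gap k \<eta> \<eta> = 0"
  by (simp add: wave_gap_def)

lemma continuous_wave_gap: "continuous_on S f \<Longrightarrow> continuous_on S g \<Longrightarrow> continuous_on S (\<lambda>x. wave_gap k (f x) (g x))"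
  unfolding wave_gap_def by (intro continuous_intros)

lemma measurable_wave_gap [measurable]:
  assumes [measurable]: "f \<in> borel_measurable M" "g \<in> borel_measurable M"
  shows "(\<lambda>x. wave_gap k (f x) (g x)) \<in> borel_measurable M"
  unfolding wave_gap_def by measurable

lemma norm_wave_gap:
  assumes "length js \<le> k"
  shows "norm (wave_factor js \<eta> * wave \<eta> x - wave_factor js \<zeta> * wave \<zeta> x) \<le> (1 + norm x) * wave_gap k \<eta> \<zeta>"
proof -
  define d where "d = norm (wave_factor js \<eta> - wave_factor js \<zeta>)"
  define e where "e = norm (wave_factor js \<zeta>) * norm (\<eta> - \<zeta>)"
  have de: "0 \<le> d" "0 \<le> e" by (simp_all add: d_def e_def)
  have "wave_factor js \<eta> * wave \<eta> x - wave_factor js \<zeta> * wave \<zeta> x =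
     (wave_factor js \<eta> - wave_factor js \<zeta>) * wave \<eta> x + wave_factor js \<zeta> * (wave \<eta> x - wave \<zeta> x)"
    by (simp add: algebra_simps)
  also have "norm \<dots> \<le> d + norm (wave_factor js \<zeta>) * (norm x * norm (\<eta> - \<zeta>))"
    by (rule order_trans[OF norm_triangle_ineq])
      (simp add: norm_mult d_def mult_left_mono norm_wave_diff)
  also have "\<dots> \<le> (1 + norm x) * (d + e)"
    using de by (simp add: e_def algebra_simps)
  also have "d + e \<le> wave_gap k \<eta> \<zeta>"
    unfolding wave_gap_def d_def e_def
    by (rule member_le_sum[of js _ "\<lambda>js. norm (wave_factor js \<eta> - wave_factor js \<zeta>) + norm (wave_factor js \<zeta>) * norm (\<eta> - \<zeta>)"])
      (use assms in \<open>auto simp: finite_lists_length_le'\<close>)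
  finally show ?thesis by (simp add: mult_left_mono)
qed

text \<open>The condition on \<open>\<zeta>\<close> is the one satisfied by the approximating simple
  functions; it gives a dominating function that depends on \<open>\<eta>\<close> alone.\<close>

lemma wave_gap_le:
  fixes \<eta> :: "real ^ 'n::finite"
  assumes "norm \<zeta> \<le> 2 * norm \<eta>"
  shows "wave_gap k \<eta> \<zeta> \<le> real (card {js :: 'n list. length js \<le> k}) * 5 * 2 ^ k * (1 + norm \<eta>) ^ Suc k"
proof -
  define t where "t = 1 + norm \<eta>"
  have t: "1 \<le> t" by (simp add: t_def)
  have "norm (wave_factor js \<eta> - wave_factor js \<zeta>) + norm (wave_factor js \<zeta>) * norm (\<eta> - \<zeta>) \<le> 5 * 2 ^ k * t ^ Suc k"
    if "length js \<le> k" for js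
  proof -
    have a: "norm (wave_factor js \<eta>) \<le> t ^ k" unfolding t_def by (rule norm_wave_factor[OF that])
    have "norm (wave_factor js \<zeta>) \<le> (1 + norm \<zeta>) ^ k" by (rule norm_wave_factor[OF that])
    also have "\<dots> \<le> (2 * t) ^ k" by (rule power_mono) (use assms in \<open>auto simp: t_def\<close>)
    finally have b: "norm (wave_factor js \<zeta>) \<le> 2 ^ k * t ^ k" by (simp add: power_mult_distrib)
    have c: "norm (\<eta> - \<zeta>) \<le> 3 * t"
    proof -
      have "norm (\<eta> - \<zeta>) \<le> norm \<eta> + norm \<zeta>" by (rule norm_triangle_ineq4)
      with assms show ?thesis by (simp add: t_def)
    qed
    have "norm (wave_factor js \<eta> - wave_factor js \<zeta>) + norm (wave_factor js \<zeta>) * norm (\<eta> - \<zeta>)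
      \<le> (t ^ k + 2 ^ k * t ^ k) + 2 ^ k * t ^ k * (3 * t)"
      by (intro add_mono mult_mono order_trans[OF norm_triangle_ineq4] a b c) (use t in auto)
    also have "\<dots> \<le> 5 * 2 ^ k * t ^ Suc k"
    proof -
      have "t ^ k \<le> 2 ^ k * t ^ k" using t by (simp add: mult_le_cancel_right1)
      moreover have "2 ^ k * t ^ k \<le> 2 ^ k * t ^ Suc k" using t by (intro mult_left_mono power_increasing) auto
      ultimately show ?thesis by (simp add: algebra_simps)
    qed
    finally show ?thesis .
  qed
  then have "wave_gap k \<eta> \<zeta> \<le> (\<Sum>js | length (js :: 'n list) \<le> k. 5 * 2 ^ k * t ^ Suc k)"
    unfolding wave_gap_def by (intro sum_mono) auto
  then show ?thesis by (simp add: t_def mult_ac)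
qed

lemma derivs_le_wave_diff: "derivs_le k (\<lambda>x. wave_gap k \<eta> \<zeta> * (1 + norm x) ^ 1) (\<lambda>x. wave \<eta> x - wave \<zeta> x)"
proof -
  have eq: "(\<lambda>x. wave \<eta> x - wave \<zeta> x) = (\<lambda>x. wave \<eta> x + (-1) * wave \<zeta> x)" by simp
  have sm: "smooth (\<lambda>x. wave \<eta> x - wave \<zeta> x)" by (intro smooth_diff smooth_wave)
  have "partial_derivs js (\<lambda>x. wave \<eta> x - wave \<zeta> x) x = wave_factor js \<eta> * wave \<eta> x - wave_factor js \<zeta> * wave \<zeta> x" for js x
    unfolding eq
    by (simp only: partial_derivs_add[OF smooth_wave smooth_cmult[OF smooth_wave]] partial_derivs_cmult[OF smooth_wave] partial_derivs_wave) simp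
  then show ?thesis
    unfolding smooth_derivs_le_iff[OF sm]
    using norm_wave_gap by (simp only: power_one_right mult.commute[of "wave_gap k \<eta> \<zeta>"]) blast
qed

text \<open>The weight 1 + |x| is the growth of a difference of two waves; the Schwartz function
  \<open>A\<close> absorbs it with one extra order of decay.\<close>

lemma tempered_wave_bounds:
  assumes u: "tempered_distribution u" and A: "schwartz_fun A"
  obtains C k where "0 \<le> C"
    "\<And>a E. derivs_le k (\<lambda>x. E * (1 + norm x) ^ 1) a \<Longrightarrow> schwartz_fun (\<lambda>x. A x * a x) \<Longrightarrow>
       norm (u (\<lambda>x. A x * a x)) \<le> C * E"
proof -
  obtain C k where C: "0 \<le> C" "\<And>f B. schwartz_fun f \<Longrightarrow> schwartz_le k B f \<Longrightarrow> norm (u f) \<le> C * B"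
    using tempered_distributionE[OF u] by blast
  obtain B where B: "schwartz_le (k + 1) B A" using A unfolding schwartz_fun_iff by blast
  have "norm (u (\<lambda>x. A x * a x)) \<le> (C * 2 ^ k * B) * E"
    if "derivs_le k (\<lambda>x. E * (1 + norm x) ^ 1) a" "schwartz_fun (\<lambda>x. A x * a x)" for a E
  proof -
    have "schwartz_le k (2 ^ k * E * B) (\<lambda>x. A x * a x)"
      using schwartz_le_mult[OF that(1) B] by (simp add: mult.commute)
    from C(2)[OF that(2) this] show ?thesis by (simp add: mult_ac)
  qed
  then show ?thesis
    using C(1) schwartz_le_nonneg[OF B] by (intro that[of "C * 2 ^ k * B" k]) auto
qed

lemma tempered_wave_growth:
  assumes u: "tempered_distribution u" and A: "schwartz_fun A"
  obtains C k where "0 \<le> C" "\<And>\<eta>. norm (u (\<lambda>x. A x * wave \<eta> x)) \<le> C * (1 + norm \<eta>) ^ k"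
proof -
  obtain C k where C: "0 \<le> C" "\<And>a E. derivs_le k (\<lambda>x. E * (1 + norm x) ^ 1) a \<Longrightarrow> schwartz_fun (\<lambda>x. A x * a x) \<Longrightarrow>
       norm (u (\<lambda>x. A x * a x)) \<le> C * E"
    using tempered_wave_bounds[OF u A] by blast
  have "derivs_le k (\<lambda>x. (1 + norm \<eta>) ^ k * (1 + norm x) ^ 1) (wave \<eta>)" for \<eta>
    by (rule derivs_le_mono[OF derivs_le_wave[of k \<eta>]]) (auto simp: distrib_left intro!: mult_nonneg_nonneg)
  then have "norm (u (\<lambda>x. A x * wave \<eta> x)) \<le> C * (1 + norm \<eta>) ^ k" for \<eta>
    by (intro C(2) schwartz_fun_mult_wave A)
  with C(1) that show ?thesis by blast
qed

text \<open>A change of the frequency alters the value by at most a multiple of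
  \<open>wave_gap\<close>, which is continuous and 0 on the diagonal.\<close>

lemma continuous_tempered_wave:
  assumes u: "tempered_distribution u" and A: "schwartz_fun A"
  shows "continuous_on UNIV (\<lambda>\<eta>. u (\<lambda>x. A x * wave \<eta> x))"
proof -
  obtain C k where C: "0 \<le> C" "\<And>a E. derivs_le k (\<lambda>x. E * (1 + norm x) ^ 1) a \<Longrightarrow> schwartz_fun (\<lambda>x. A x * a x) \<Longrightarrow>
       norm (u (\<lambda>x. A x * a x)) \<le> C * E"
    using tempered_wave_bounds[OF u A] by blast
  have "isCont (\<lambda>\<eta>. u (\<lambda>x. A x * wave \<eta> x)) \<zeta>" for \<zeta>
  proof -
    have le: "norm (u (\<lambda>x. A x * wave \<eta> x) - u (\<lambda>x. A x * wave \<zeta> x)) \<le> C * wave_gap k \<eta> \<zeta>" for \<eta>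
    proof -
      have "u (\<lambda>x. A x * wave \<eta> x) - u (\<lambda>x. A x * wave \<zeta> x) = u (\<lambda>x. A x * (wave \<eta> x - wave \<zeta> x))"
        by (simp add: tempered_diff[OF u, symmetric] schwartz_fun_mult_wave[OF A] right_diff_distrib)
      also have "norm \<dots> \<le> C * wave_gap k \<eta> \<zeta>"
        by (rule C(2)[OF derivs_le_wave_diff])
          (simp add: right_diff_distrib schwartz_fun_diff schwartz_fun_mult_wave A)
      finally show ?thesis .
    qed
    have "continuous_on UNIV (\<lambda>\<eta>. C * wave_gap k \<eta> \<zeta>)"
      by (intro continuous_on_mult continuous_on_const continuous_wave_gap continuous_on_id)
    then have "((\<lambda>\<eta>. C * wave_gap k \<eta> \<zeta>) \<longlongrightarrow> 0) (at \<zeta>)"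
      by (simp add: continuous_on_eq_continuous_at isCont_def) (metis mult_zero_right wave_gap_self)
    then have "((\<lambda>\<eta>. u (\<lambda>x. A x * wave \<eta> x) - u (\<lambda>x. A x * wave \<zeta> x)) \<longlongrightarrow> 0) (at \<zeta>)"
      by (rule Lim_null_comparison[rotated]) (use le in auto)
    then show ?thesis unfolding isCont_def by (rule LIM_zero_cancel)
  qed
  then show ?thesis by (simp add: continuous_on_eq_continuous_at)
qed

text \<open>With finitely many values the integral is a finite sum, through which a linear
  functional can be pulled.\<close>

lemma integral_mult_simple:
  fixes W :: "'a \<Rightarrow> complex" and q :: "'a \<Rightarrow> 'b" and F :: "'b \<Rightarrow> complex"
  assumes W: "integrable M W" and q: "simple_function M q" and sp: "space M = UNIV"
  shows "(LINT \<eta>|M. W \<eta> * F (q \<eta>)) = (\<Sum>v\<in>range q. (LINT \<eta>|M. W \<eta> * indicator (q -` {v}) \<eta>) * F v)"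
proof -
  have fin: "finite (range q)" and m: "q -` {v} \<in> sets M" for v
    using q simple_functionD[OF q] sp by (auto simp: simple_function_def)
  have int: "integrable M (\<lambda>\<eta>. W \<eta> * indicator (q -` {v}) \<eta> * F v)" for v
  proof (rule integrable_mult_left)
    have "(\<lambda>\<eta>. W \<eta> * indicator (q -` {v}) \<eta>) = (\<lambda>\<eta>. indicator (q -` {v}) \<eta> *\<^sub>R W \<eta>)"
      by (auto simp: fun_eq_iff indicator_def)
    then show "integrable M (\<lambda>\<eta>. W \<eta> * indicator (q -` {v}) \<eta>)"
      using integrable_mult_indicator[OF m W, of v] by simp
  qed
  have "(LINT \<eta>|M. W \<eta> * F (q \<eta>)) = (LINT \<eta>|M. (\<Sum>v\<in>range q. W \<eta> * indicator (q -` {v}) \<eta> * F v))"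
  proof (rule Bochner_Integration.integral_cong)
    fix \<eta>
    have "(\<Sum>v\<in>range q. W \<eta> * indicator (q -` {v}) \<eta> * F v) = (\<Sum>v\<in>range q. if v = q \<eta> then W \<eta> * F v else 0)"
      by (rule sum.cong) (auto simp: indicator_def)
    then show "W \<eta> * F (q \<eta>) = (\<Sum>v\<in>range q. W \<eta> * indicator (q -` {v}) \<eta> * F v)"
      using fin by simp
  qed simp
  also have "\<dots> = (\<Sum>v\<in>range q. (LINT \<eta>|M. W \<eta> * indicator (q -` {v}) \<eta>) * F v)"
    by (subst Bochner_Integration.integral_sum[OF int]) (simp cong: sum.cong)
  finally show ?thesis .
qed

text \<open>Approximate the Fourier integral by finite sums of plane waves: replacing the frequency
  by simple functions converging to it perturbs all derivatives by a small multiple of \<open>1 + |x|\<close>.\<close>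

proposition tempered_mult_fourier_int:
  assumes u: "tempered_distribution u" and A: "schwartz_fun A" and W: "rapid_L1 W"
  shows "u (\<lambda>x. A x * fourier_int W x) = (LINT \<eta>|lborel. W \<eta> * u (\<lambda>x. A x * wave \<eta> x))"
proof -
  note [measurable] = rapid_L1_measurable[OF W]
  have W1: "integrable lborel W" using rapid_L1_integrable_wave[OF W, of 0] by simp
  define h where "h \<eta> = u (\<lambda>x. A x * wave \<eta> x)" for \<eta>
  have hc: "continuous_on UNIV h" unfolding h_def by (rule continuous_tempered_wave[OF u A])
  have [measurable]: "h \<in> borel_measurable borel" by (rule borel_measurable_continuous_onI[OF hc])
  obtain Ch kh where Ch: "0 \<le> Ch" "\<And>\<eta>. norm (h \<eta>) \<le> Ch * (1 + norm \<eta>) ^ kh"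
    using tempered_wave_growth[OF u A] unfolding h_def by blast
  obtain C k where C: "0 \<le> C" "\<And>a E. derivs_le k (\<lambda>x. E * (1 + norm x) ^ 1) a \<Longrightarrow> schwartz_fun (\<lambda>x. A x * a x) \<Longrightarrow>
       norm (u (\<lambda>x. A x * a x)) \<le> C * E"
    using tempered_wave_bounds[OF u A] by blast
  obtain q :: "nat \<Rightarrow> real ^ 'a \<Rightarrow> real ^ 'a" where q: "\<And>i. simple_function lborel (q i)"
    "\<And>\<eta>. (\<lambda>i. q i \<eta>) \<longlonglongrightarrow> \<eta>" "\<And>i \<eta>. norm (q i \<eta>) \<le> 2 * norm \<eta>"
    using borel_measurable_implies_sequence_metric[of "\<lambda>\<eta>. \<eta>" lborel 0] by auto
  have [measurable]: "q i \<in> borel_measurable borel" for i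
    using borel_measurable_simple_function[OF q(1)[of i]] by simp
  \<comment> \<open>The mass of \<open>W\<close> on the level sets of the simple function; with
    these coefficients \<open>F i\<close> is a finite combination of plane waves and an integral at
    the same time.\<close>
  define w where "w i v = (LINT \<eta>|lborel. W \<eta> * indicator (q i -` {v}) \<eta>)" for i v
  define F where "F i x = (\<Sum>v\<in>range (q i). w i v * wave v x)" for i x
  have F: "F i x = (LINT \<eta>|lborel. W \<eta> * wave (q i \<eta>) x)" for i x
    unfolding F_def w_def using integral_mult_simple[OF W1 q(1), of "\<lambda>v. wave v x" i] by simp
  have smF: "smooth (F i)" and pdF: "partial_derivs js (F i) x = (LINT \<eta>|lborel. W \<eta> * (wave_factor js (q i \<eta>) * wave (q i \<eta>) x))" for i js x
  proof -
    have *: "smooth (\<lambda>x. \<Sum>v\<in>I. w i v * wave v x) \<and> partial_derivs js (\<lambda>x. \<Sum>v\<in>I. w i v * wave v x) =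
      (\<lambda>x. \<Sum>v\<in>I. w i v * (wave_factor js v * wave v x))" if "finite I" for I
      using that
    proof induction
      case empty
      show ?case by (simp add: partial_derivs_const)
    next
      case (insert v I)
      then show ?case
        by (simp add: smooth_add smooth_cmult smooth_wave partial_derivs_add partial_derivs_cmult partial_derivs_wave)
    qed
    have fin: "finite (range (q i))" using q(1)[of i] by (simp add: simple_function_def)
    show "smooth (F i)" using *[OF fin] by (simp add: F_def[abs_def])
    have "partial_derivs js (F i) x = (\<Sum>v\<in>range (q i). w i v * (wave_factor js v * wave v x))"
      using *[OF fin] by (simp add: F_def[abs_def])
    then show "partial_derivs js (F i) x = (LINT \<eta>|lborel. W \<eta> * (wave_factor js (q i \<eta>) * wave (q i \<eta>) x))"
      unfolding w_def using integral_mult_simple[OF W1 q(1), of "\<lambda>v. wave_factor js v * wave v x" i] by simp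
  qed
  \<comment> \<open>The frequency error of the approximation averaged against \<open>W\<close>. It
    bounds the derivatives of the difference of \<open>F i\<close> and the Fourier integral relative
    to 1 + |x|, and tends to 0 by dominated convergence.\<close>
  define E where "E i = (LINT \<eta>|lborel. norm (W \<eta>) * wave_gap k \<eta> (q i \<eta>))" for i
  define N where "N = real (card {js :: 'a list. length js \<le> k}) * 5 * 2 ^ k"
  have dom: "norm (norm (W \<eta>) * wave_gap k \<eta> (q i \<eta>)) \<le> N * ((1 + norm \<eta>) ^ Suc k * norm (W \<eta>))" for i \<eta>
    using mult_right_mono[OF wave_gap_le[OF q(3)[of i \<eta>], of k], of "norm (W \<eta>)"] wave_gap_nonneg[of k \<eta> "q i \<eta>"]
    by (simp add: N_def mult_ac abs_mult)
  have domint: "integrable lborel (\<lambda>\<eta>. N * ((1 + norm \<eta>) ^ Suc k * norm (W \<eta>)))"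
    using W unfolding rapid_L1_def by (intro integrable_mult_right) blast
  have intE: "integrable lborel (\<lambda>\<eta>. norm (W \<eta>) * wave_gap k \<eta> (q i \<eta>))" for i
    by (rule Bochner_Integration.integrable_bound[OF domint])
      (use dom order_trans[OF _ abs_ge_self] in \<open>auto intro!: AE_I2 simp del: norm_mult power_Suc\<close>)
  have E0: "E \<longlonglongrightarrow> 0"
  proof -
    have "E \<longlonglongrightarrow> (LINT \<eta>::real^'a|lborel. 0)"
      unfolding E_def
    proof (rule integral_dominated_convergence[OF _ _ domint])
      show "AE \<eta> in lborel. (\<lambda>i. norm (W \<eta>) * wave_gap k \<eta> (q i \<eta>)) \<longlonglongrightarrow> 0"
      proof (rule AE_I2)
        fix \<eta> :: "real ^ 'a"
        have "continuous_on UNIV (\<lambda>\<zeta>. norm (W \<eta>) * wave_gap k \<eta> \<zeta>)"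
          by (intro continuous_on_mult continuous_on_const continuous_wave_gap continuous_on_id)
        from continuous_on_tendsto_compose[OF this q(2)[of \<eta>]]
        show "(\<lambda>i. norm (W \<eta>) * wave_gap k \<eta> (q i \<eta>)) \<longlonglongrightarrow> 0" by simp
      qed
    qed (use dom in auto)
    then show ?thesis by simp
  qed
  have sF: "schwartz_fun (\<lambda>x. A x * F i x)" for i
    unfolding F_def sum_distrib_left mult.left_commute[of "A _"]
    by (intro schwartz_fun_sum schwartz_fun_cmult schwartz_fun_mult_wave A)
  have uF: "u (\<lambda>x. A x * F i x) = (LINT \<eta>|lborel. W \<eta> * h (q i \<eta>))" for i
  proof -
    have "u (\<lambda>x. A x * F i x) = (\<Sum>v\<in>range (q i). w i v * h v)"
      unfolding F_def sum_distrib_left mult.left_commute[of "A _"] h_def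
      by (subst tempered_sum[OF u]) (simp_all add: schwartz_fun_cmult schwartz_fun_mult_wave A tempered_cmult[OF u])
    then show ?thesis unfolding w_def using integral_mult_simple[OF W1 q(1), of h i] by simp
  qed
  have "norm (u (\<lambda>x. A x * F i x) - u (\<lambda>x. A x * fourier_int W x)) \<le> C * E i" for i
  proof -
    have "u (\<lambda>x. A x * F i x) - u (\<lambda>x. A x * fourier_int W x) = u (\<lambda>x. A x * (F i x - fourier_int W x))"
      by (simp add: tempered_diff[OF u, symmetric] sF schwartz_fun_mult_fourier_int[OF W A] right_diff_distrib)
    also have "norm \<dots> \<le> C * E i"
    proof (rule C(2))
      have sm: "smooth (\<lambda>x. F i x - fourier_int W x)" by (intro smooth_diff smF smooth_fourier_int W)
      show "schwartz_fun (\<lambda>x. A x * (F i x - fourier_int W x))"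
        by (simp add: right_diff_distrib schwartz_fun_diff sF schwartz_fun_mult_fourier_int[OF W A])
      show "derivs_le k (\<lambda>x. E i * (1 + norm x) ^ 1) (\<lambda>x. F i x - fourier_int W x)"
        unfolding smooth_derivs_le_iff[OF sm]
      proof (intro allI impI)
        fix js :: "'a list" and x assume js: "length js \<le> k"
        have eq: "(\<lambda>x. F i x - fourier_int W x) = (\<lambda>x. F i x + (-1) * fourier_int W x)" by simp
        have i1: "integrable lborel (\<lambda>\<eta>. W \<eta> * (wave_factor js (q i \<eta>) * wave (q i \<eta>) x))"
        proof (rule rapid_L1_integrable[OF W, where C="2 ^ k" and k=k])
          fix \<eta> :: "real ^ 'a"
          have "norm (wave_factor js (q i \<eta>)) \<le> (1 + norm (q i \<eta>)) ^ k" by (rule norm_wave_factor[OF js])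
          also have "\<dots> \<le> (2 * (1 + norm \<eta>)) ^ k"
            by (rule power_mono) (use q(3)[of i \<eta>] in auto)
          finally show "norm (wave_factor js (q i \<eta>) * wave (q i \<eta>) x) \<le> 2 ^ k * (1 + norm \<eta>) ^ k"
            by (simp only: norm_mult norm_wave mult_1_right power_mult_distrib)
        qed measurable
        have i2: "integrable lborel (\<lambda>\<eta>. W \<eta> * (wave_factor js \<eta> * wave \<eta> x))"
          using rapid_L1_integrable_wave[OF rapid_L1_wave_factor[OF W], of js x] by (simp add: mult_ac)
        have "partial_derivs js (\<lambda>x. F i x - fourier_int W x) x =
            partial_derivs js (F i) x - partial_derivs js (fourier_int W) x"
          unfolding eq by (simp only: partial_derivs_add[OF smF smooth_cmult[OF smooth_fourier_int[OF W]]]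
              partial_derivs_cmult[OF smooth_fourier_int[OF W]]) simp
        also have "\<dots> = (LINT \<eta>|lborel. W \<eta> * (wave_factor js (q i \<eta>) * wave (q i \<eta>) x) - W \<eta> * (wave_factor js \<eta> * wave \<eta> x))"
          unfolding pdF partial_derivs_fourier_int[OF W] fourier_int_def
          by (subst Bochner_Integration.integral_diff[OF i1 i2]) (simp add: mult_ac)
        also have "norm \<dots> \<le> (LINT \<eta>|lborel. norm (W \<eta> * (wave_factor js (q i \<eta>) * wave (q i \<eta>) x) - W \<eta> * (wave_factor js \<eta> * wave \<eta> x)))"
          by (rule integral_norm_bound)
        also have "\<dots> \<le> (LINT \<eta>|lborel. (1 + norm x) * (norm (W \<eta>) * wave_gap k \<eta> (q i \<eta>)))"
        proof (rule integral_mono')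
          show "integrable lborel (\<lambda>\<eta>. (1 + norm x) * (norm (W \<eta>) * wave_gap k \<eta> (q i \<eta>)))"
            by (intro integrable_mult_right intE)
          fix \<eta> :: "real ^ 'a"
          show "norm (W \<eta> * (wave_factor js (q i \<eta>) * wave (q i \<eta>) x) - W \<eta> * (wave_factor js \<eta> * wave \<eta> x)) \<le>
            (1 + norm x) * (norm (W \<eta>) * wave_gap k \<eta> (q i \<eta>))"
            using mult_left_mono[OF norm_wave_gap[OF js, of \<eta> x "q i \<eta>"], of "norm (W \<eta>)"]
            by (simp add: norm_mult[symmetric] right_diff_distrib[symmetric] norm_minus_commute mult_ac)
              (simp add: norm_mult norm_minus_commute mult_ac)
        qed (simp add: wave_gap_nonneg)
        also have "\<dots> = E i * (1 + norm x) ^ 1" by (simp add: E_def)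
        finally show "norm (partial_derivs js (\<lambda>x. F i x - fourier_int W x) x) \<le> E i * (1 + norm x) ^ 1" .
      qed
    qed
    finally show ?thesis .
  qed
  then have "(\<lambda>i. u (\<lambda>x. A x * F i x) - u (\<lambda>x. A x * fourier_int W x)) \<longlonglongrightarrow> 0"
    by (intro Lim_null_comparison[OF _ tendsto_mult_right_zero[OF E0, of C]]) auto
  then have "(\<lambda>i. u (\<lambda>x. A x * F i x)) \<longlonglongrightarrow> u (\<lambda>x. A x * fourier_int W x)"
    by (rule LIM_zero_cancel)
  moreover have "(\<lambda>i. LINT \<eta>|lborel. W \<eta> * h (q i \<eta>)) \<longlonglongrightarrow> (LINT \<eta>|lborel. W \<eta> * h \<eta>)"
  proof (rule integral_dominated_convergence[where w = "\<lambda>\<eta>. Ch * 2 ^ kh * ((1 + norm \<eta>) ^ kh * norm (W \<eta>))"])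
    show "integrable lborel (\<lambda>\<eta>. Ch * 2 ^ kh * ((1 + norm \<eta>) ^ kh * norm (W \<eta>)))"
      using W unfolding rapid_L1_def by (intro integrable_mult_right) blast
    show "AE \<eta> in lborel. (\<lambda>i. W \<eta> * h (q i \<eta>)) \<longlonglongrightarrow> W \<eta> * h \<eta>"
      by (intro AE_I2 tendsto_intros continuous_on_tendsto_compose[OF hc q(2)]) auto
    show "AE \<eta> in lborel. norm (W \<eta> * h (q i \<eta>)) \<le> Ch * 2 ^ kh * ((1 + norm \<eta>) ^ kh * norm (W \<eta>))" for i
    proof (rule AE_I2)
      fix \<eta> :: "real ^ 'a"
      have "norm (h (q i \<eta>)) \<le> Ch * (1 + norm (q i \<eta>)) ^ kh" by (rule Ch)
      also have "\<dots> \<le> Ch * (2 * (1 + norm \<eta>)) ^ kh"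
        by (intro mult_left_mono power_mono Ch) (use q(3)[of i \<eta>] in auto)
      finally have "norm (W \<eta>) * norm (h (q i \<eta>)) \<le> norm (W \<eta>) * (Ch * (2 * (1 + norm \<eta>)) ^ kh)"
        by (rule mult_left_mono) simp
      then show "norm (W \<eta> * h (q i \<eta>)) \<le> Ch * 2 ^ kh * ((1 + norm \<eta>) ^ kh * norm (W \<eta>))"
        by (simp only: norm_mult power_mult_distrib mult_ac)
    qed
  qed measurable
  ultimately show ?thesis
    unfolding uF using LIMSEQ_unique unfolding h_def by blast
qed

section \<open>Gaussians\<close>

text \<open>\<open>1 + s / m \<le> exp (s / m)\<close> raised to the power \<open>m\<close>. For
  \<open>m = 0\<close> the constant is 1 because \<open>0 ^ 0 = 1\<close>.\<close>

lemma one_plus_power_le_exp: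
  assumes "0 \<le> (s::real)"
  shows "(1 + s) ^ m \<le> real m ^ m * exp s"
proof (cases "m = 0")
  case False
  have "1 + s \<le> real m * (1 + s / real m)"
    using False assms by (simp add: field_simps)
  also have "\<dots> \<le> real m * exp (s / real m)"
    by (intro mult_left_mono exp_ge_add_one_self) auto
  finally have "(1 + s) ^ m \<le> (real m * exp (s / real m)) ^ m"
    using assms by (intro power_mono) auto
  also have "\<dots> = real m ^ m * exp s"
    using False by (simp add: power_mult_distrib exp_of_nat_mult[symmetric])
  finally show ?thesis .
qed (use assms in auto)

text \<open>Two powers of the weight cost one factor \<open>1 / a\<close> when \<open>a\<close> is
  small; this is where powers of \<open>N\<close> come from once \<open>a\<close> is of order
  \<open>1 / N\<close>. The minimum with 1 keeps one formula for all \<open>a\<close>.\<close>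

lemma weight_gauss_le:
  assumes a: "0 < a" and t: "0 \<le> t"
  shows "(1 + t) ^ (2 * m) * exp (- a * t\<^sup>2) \<le> (2 * real m) ^ m / min a 1 ^ m"
proof -
  define b where "b = min a 1"
  have b: "0 < b" "b \<le> 1" "b \<le> a" using a by (auto simp: b_def)
  have "(1 + t)\<^sup>2 \<le> 2 * (1 + t\<^sup>2)"
    using sum_squares_ge_zero[of "t - 1" 0] by (simp add: power2_eq_square algebra_simps)
  also have "\<dots> \<le> (2 / b) * (1 + b * t\<^sup>2)"
    using b by (simp add: field_simps)
  finally have "((1 + t)\<^sup>2) ^ m \<le> ((2 / b) * (1 + b * t\<^sup>2)) ^ m"
    by (rule power_mono) simp
  also have "\<dots> = (2 / b) ^ m * (1 + b * t\<^sup>2) ^ m" by (rule power_mult_distrib)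
  also have "\<dots> \<le> (2 / b) ^ m * (real m ^ m * exp (b * t\<^sup>2))"
    using b by (intro mult_left_mono one_plus_power_le_exp) auto
  also have "\<dots> \<le> (2 / b) ^ m * (real m ^ m * exp (a * t\<^sup>2))"
    using b by (intro mult_left_mono) (auto intro: mult_right_mono)
  finally have "(1 + t) ^ (2 * m) * exp (- a * t\<^sup>2) \<le> (2 / b) ^ m * (real m ^ m * exp (a * t\<^sup>2)) * exp (- a * t\<^sup>2)"
    by (simp add: power_mult[symmetric] mult_right_mono)
  also have "\<dots> = (2 / b) ^ m * real m ^ m" by (simp add: exp_minus field_simps)
  also have "\<dots> = (2 * real m) ^ m / b ^ m" by (simp add: power_mult_distrib power_divide)
  finally show ?thesis by (simp add: b_def)
qed

definition gauss :: "real \<Rightarrow> real ^ 'n::finite \<Rightarrow> real ^ 'n \<Rightarrow> complex" where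
  "gauss a y x = complex_of_real (exp (- a * (norm (x - y))\<^sup>2))"

lemma gaussian_eq_gauss: "gaussian x0 N = gauss (1 / (4 * real N)) x0"
  by (rule ext) (simp add: gaussian_def gauss_def)

lemma norm_gauss: "norm (gauss a y x) = exp (- a * (norm (x - y))\<^sup>2)"
  by (simp add: gauss_def)

lemma measurable_gauss [measurable]: "gauss a y \<in> borel_measurable borel"
  unfolding gauss_def[abs_def] by measurable

lemma gauss_has_derivative:
  "(gauss a y has_derivative (\<lambda>v. complex_of_real (- 2 * a * ((x - y) \<bullet> v)) * gauss a y x)) (at x)"
proof -
  have 1: "((\<lambda>x. - a * ((x - y) \<bullet> (x - y))) has_derivative (\<lambda>v. - 2 * a * ((x - y) \<bullet> v))) (at x)"
    by (auto intro!: derivative_eq_intros simp: inner_commute algebra_simps)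
  have "((\<lambda>x. complex_of_real (exp (- a * ((x - y) \<bullet> (x - y))))) has_derivative
     (\<lambda>v. complex_of_real (exp (- a * ((x - y) \<bullet> (x - y))) * (- 2 * a * ((x - y) \<bullet> v))))) (at x)"
    by (intro has_derivative_of_real has_derivative_compose[OF 1 DERIV_exp[unfolded has_field_derivative_def]])
  then show ?thesis
    unfolding gauss_def[abs_def] power2_norm_eq_inner by (simp add: mult_ac)
qed

text \<open>The affine factor that differentiation brings down, for the Gaussians as well as for the
  bump functions.\<close>

definition coord :: "real \<Rightarrow> 'n::finite \<Rightarrow> real ^ 'n \<Rightarrow> real ^ 'n \<Rightarrow> complex" where
  "coord c i y x = complex_of_real (c * (x - y) $ i)"

lemma coord_has_derivative: "(coord c i y has_derivative (\<lambda>v. complex_of_real (c * v $ i))) (at x)"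
proof -
  have "((\<lambda>x. x - y) has_derivative (\<lambda>v. v)) (at x)" by (auto intro!: derivative_eq_intros)
  from bounded_linear.has_derivative[OF bounded_linear_vec_nth[of i] this]
  show ?thesis unfolding coord_def[abs_def] by (intro has_derivative_of_real has_derivative_mult_right)
qed

lemma derivs_le_coord: "derivs_le k (\<lambda>x. \<bar>c\<bar> * (1 + norm (x - y))) (coord c i y)"
proof -
  have le: "norm (coord c i y x) \<le> \<bar>c\<bar> * (1 + norm (x - y))" for x
    using component_le_norm_cart[of "x - y" i]
    by (simp add: coord_def norm_mult abs_mult mult_left_mono flip: of_real_mult of_real_diff)
  have d: "coord c i y differentiable at x" for x
    unfolding differentiable_def by (rule exI, rule coord_has_derivative)
  have pd: "partial_deriv j (coord c i y) = (\<lambda>x. complex_of_real (c * axis j 1 $ i))" for j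
    by (rule ext) (rule partial_deriv_eq[OF coord_has_derivative])
  have c: "derivs_le l (\<lambda>x. \<bar>c\<bar> * (1 + norm (x - y))) (\<lambda>x. complex_of_real (c * axis j 1 $ i))" for l j
  proof (rule derivs_le_const)
    fix x
    have "norm (complex_of_real (c * axis j 1 $ i)) \<le> \<bar>c\<bar> * 1" by (simp add: axis_def)
    also have "\<dots> \<le> \<bar>c\<bar> * (1 + norm (x - y))" by (rule mult_left_mono) auto
    finally show "norm (complex_of_real (c * axis j 1 $ i)) \<le> \<bar>c\<bar> * (1 + norm (x - y))" .
  qed
  show ?thesis
    by (cases k) (auto simp: derivs_le_0 derivs_le_Suc le d pd c simp del: of_real_mult)
qed

lemma partial_deriv_gauss: "partial_deriv i (gauss a y) = (\<lambda>x. coord (- 2 * a) i y x * gauss a y x)"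
  by (rule ext, subst partial_deriv_eq[OF gauss_has_derivative])
    (simp add: coord_def inner_axis)

lemma gauss_differentiable: "gauss a y differentiable at x"
  using gauss_has_derivative by (auto simp: differentiable_def)

text \<open>Each derivative produces one factor linear in \<open>x - y\<close> with coefficient
  \<open>- 2 * a\<close>, so an upper bound \<open>A\<close> for \<open>a\<close> gives a constant
  that depends neither on the centre nor on the width.\<close>

lemma derivs_le_gauss:
  "\<exists>G\<ge>1. \<forall>a (y :: real ^ 'n::finite). 0 \<le> a \<and> a \<le> A \<longrightarrow>
     derivs_le k (\<lambda>x. G * (1 + norm (x - y)) ^ k * exp (- a * (norm (x - y))\<^sup>2)) (gauss a y)"
proof (induction k)
  case 0
  show ?case by (intro exI[of _ 1]) (auto simp: derivs_le_0 gauss_differentiable norm_gauss)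
next
  case (Suc k)
  then obtain G where G: "G \<ge> 1" "\<And>a y :: real ^ 'n. 0 \<le> a \<Longrightarrow> a \<le> A \<Longrightarrow>
     derivs_le k (\<lambda>x. G * (1 + norm (x - y)) ^ k * exp (- a * (norm (x - y))\<^sup>2)) (gauss a y)" by blast
  define G' where "G' = max 1 (2 ^ k * (2 * A) * G)"
  have "derivs_le (Suc k) (\<lambda>x. G' * (1 + norm (x - y)) ^ Suc k * exp (- a * (norm (x - y))\<^sup>2)) (gauss a y)"
    if a: "0 \<le> a" "a \<le> A" for a and y :: "real ^ 'n"
    unfolding derivs_le_Suc
  proof (intro conjI allI)
    fix x
    have "1 * 1 * exp (- a * (norm (x - y))\<^sup>2) \<le> G' * (1 + norm (x - y)) ^ Suc k * exp (- a * (norm (x - y))\<^sup>2)"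
      by (intro mult_mono) (auto simp: G'_def simp del: power_Suc)
    then show "norm (gauss a y x) \<le> G' * (1 + norm (x - y)) ^ Suc k * exp (- a * (norm (x - y))\<^sup>2)"
      by (simp add: norm_gauss)
  next
    fix i
    show "derivs_le k (\<lambda>x. G' * (1 + norm (x - y)) ^ Suc k * exp (- a * (norm (x - y))\<^sup>2)) (partial_deriv i (gauss a y))"
      unfolding partial_deriv_gauss
    proof (rule derivs_le_mono[OF derivs_le_mult[OF derivs_le_coord G(2)[OF a]] order_refl])
      fix x
      define t where "t = (1 + norm (x - y)) ^ Suc k * exp (- a * (norm (x - y))\<^sup>2)"
      have t: "0 \<le> t" by (simp add: t_def)
      have "2 ^ k * (2 * a) * G \<le> 2 ^ k * (2 * A) * G" using a G by (intro mult_right_mono mult_left_mono) auto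
      also have "\<dots> \<le> G'" by (simp add: G'_def)
      finally have "(2 ^ k * (2 * a) * G) * t \<le> G' * t" using t by (rule mult_right_mono)
      moreover have "2 ^ k * (\<bar>- 2 * a\<bar> * (1 + norm (x - y))) * (G * (1 + norm (x - y)) ^ k * exp (- a * (norm (x - y))\<^sup>2)) =
         (2 ^ k * (2 * a) * G) * t"
      proof -
        have "\<bar>- 2 * a\<bar> = 2 * a" using a by simp
        then show ?thesis by (simp only: t_def power_Suc mult_ac)
      qed
      ultimately show "2 ^ k * (\<bar>- 2 * a\<bar> * (1 + norm (x - y))) * (G * (1 + norm (x - y)) ^ k * exp (- a * (norm (x - y))\<^sup>2))
        \<le> G' * (1 + norm (x - y)) ^ Suc k * exp (- a * (norm (x - y))\<^sup>2)"
        by (simp only: t_def mult.assoc)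
    qed
  qed (rule gauss_differentiable)
  then show ?case by (intro exI[of _ G']) (auto simp: G'_def)
qed

lemma one_plus_norm_le_mult: "1 + norm (x::'a::real_normed_vector) \<le> (1 + norm y) * (1 + norm (x - y))"
proof -
  have "norm x \<le> norm y + norm (x - y)" using norm_triangle_ineq[of y "x - y"] by simp
  moreover have "0 \<le> norm y * norm (x - y)" by simp
  moreover have "(1 + norm y) * (1 + norm (x - y)) = 1 + norm y + norm (x - y) + norm y * norm (x - y)"
    by (simp add: algebra_simps)
  ultimately show ?thesis by linarith
qed

text \<open>The price in \<open>1 / a\<close> for making a multiplier of polynomial growth decay by
  a wide Gaussian, uniformly in \<open>a\<close> and linearly in \<open>D\<close>. Powers of the
  weight are \<open>k\<close> from the derivatives, \<open>k\<close> from the required decay and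
  \<open>2 * m\<close> from \<open>b\<close>; by \<open>weight_gauss_le\<close> half of them become
  the exponent \<open>k + m\<close>.\<close>

proposition gauss_schwartz_le:
  "\<exists>C\<ge>0. \<forall>a D (y :: real ^ 'n::finite) b. 0 < a \<longrightarrow> a \<le> A \<longrightarrow>
     derivs_le k (\<lambda>x. D * (1 + norm (x - y)) ^ (2 * m)) b \<longrightarrow>
     schwartz_le k (C * D * (1 + norm y) ^ k / min a 1 ^ (k + m)) (\<lambda>x. b x * gauss a y x)"
proof -
  obtain G where G: "G \<ge> 1" "\<And>a y :: real ^ 'n. 0 \<le> a \<Longrightarrow> a \<le> A \<Longrightarrow>
     derivs_le k (\<lambda>x. G * (1 + norm (x - y)) ^ k * exp (- a * (norm (x - y))\<^sup>2)) (gauss a y)"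
    using derivs_le_gauss[of A k] by blast
  define C where "C = 2 ^ k * G * (2 * real (k + m)) ^ (k + m)"
  show ?thesis
  proof (intro exI[of _ C] conjI allI impI)
    show "0 \<le> C" using G by (simp add: C_def)
    fix a D :: real and y :: "real ^ 'n" and b
    assume a: "0 < a" "a \<le> A" and b: "derivs_le k (\<lambda>x. D * (1 + norm (x - y)) ^ (2 * m)) b"
    have "0 \<le> D" using derivs_leD(5)[OF b, of y] by simp
    show "schwartz_le k (C * D * (1 + norm y) ^ k / min a 1 ^ (k + m)) (\<lambda>x. b x * gauss a y x)"
      unfolding schwartz_le_def
    proof (rule derivs_le_mono[OF derivs_le_mult[OF b G(2)] order_refl])
      fix x
      define t where "t = 1 + norm (x - y)"
      define e where "e = exp (- a * (norm (x - y))\<^sup>2)"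
      have w: "t ^ (2 * (k + m)) * e \<le> (2 * real (k + m)) ^ (k + m) / min a 1 ^ (k + m)"
        unfolding t_def e_def by (rule weight_gauss_le) (use a in auto)
      have "(1 + norm x) ^ k \<le> ((1 + norm y) * t) ^ k"
        unfolding t_def by (rule power_mono[OF one_plus_norm_le_mult]) simp
      then have "2 ^ k * (D * t ^ (2 * m)) * (G * t ^ k * e) * (1 + norm x) ^ k \<le>
          2 ^ k * (D * t ^ (2 * m)) * (G * t ^ k * e) * ((1 + norm y) * t) ^ k"
        using G \<open>0 \<le> D\<close> by (intro mult_left_mono) (auto simp: t_def e_def)
      also have "\<dots> = 2 ^ k * D * G * (1 + norm y) ^ k * (t ^ (2 * (k + m)) * e)"
        by (simp add: power_mult_distrib power_add mult_ac power_mult power2_eq_square)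
      also have "\<dots> \<le> 2 ^ k * D * G * (1 + norm y) ^ k * ((2 * real (k + m)) ^ (k + m) / min a 1 ^ (k + m))"
        using G \<open>0 \<le> D\<close> by (intro mult_left_mono w) auto
      also have "\<dots> = C * D * (1 + norm y) ^ k / min a 1 ^ (k + m)" by (simp add: C_def mult_ac)
      finally show "2 ^ k * (D * (1 + norm (x - y)) ^ (2 * m)) *
          (G * (1 + norm (x - y)) ^ k * exp (- a * (norm (x - y))\<^sup>2))
          \<le> C * D * (1 + norm y) ^ k / min a 1 ^ (k + m) / (1 + norm x) ^ k"
        by (subst pos_le_divide_eq) (simp_all add: t_def e_def)
    qed (use a in auto)
  qed
qed

lemma schwartz_fun_gauss: "0 < a \<Longrightarrow> schwartz_fun (gauss a (y :: real ^ 'n::finite))"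
proof (rule schwartz_funI)
  fix k assume a: "0 < a"
  have "derivs_le k (\<lambda>x :: real ^ 'n. 1 * (1 + norm (x - y)) ^ (2 * 0)) (\<lambda>x. 1)"
    by (rule derivs_le_const) simp
  with gauss_schwartz_le[of a k 0, where 'n='n] a
  have "\<exists>B. schwartz_le k B (\<lambda>x. 1 * gauss a y x)" by blast
  then show "\<exists>B. schwartz_le k B (gauss a y)" by simp
qed

section \<open>Integration of products over coordinates\<close>

text \<open>Lebesgue measure is the image of a product measure, so Fubini's theorem factorises the
  integral.\<close>

lemma lborel_prod_Basis:
  fixes F :: "'a::euclidean_space \<Rightarrow> real \<Rightarrow> 'b::{real_normed_field, banach, second_countable_topology}"
  assumes F: "\<And>b. b \<in> Basis \<Longrightarrow> integrable lborel (F b)"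
  shows "integrable lborel (\<lambda>x. \<Prod>b\<in>Basis. F b (x \<bullet> b))"
    and "(LINT x|lborel. (\<Prod>b\<in>Basis. F b (x \<bullet> b))) = (\<Prod>b\<in>Basis. LINT t|lborel. F b t)"
proof -
  interpret product_sigma_finite "\<lambda>_::'a. lborel :: real measure" by standard
  define T where "T = (\<lambda>f. \<Sum>b\<in>Basis. f b *\<^sub>R (b :: 'a))"
  have T [measurable]: "T \<in> measurable (\<Pi>\<^sub>M b\<in>Basis. lborel) borel" unfolding T_def by measurable
  have eq: "(\<Prod>b\<in>Basis. F b (T f \<bullet> b)) = (\<Prod>b\<in>Basis. F b (f b))" for f
    by (rule prod.cong) (simp_all add: T_def)
  have [measurable]: "F b \<in> borel_measurable borel" if "b \<in> Basis" for b
    using borel_measurable_integrable[OF F[OF that]] by simp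
  have m: "(\<lambda>x. \<Prod>b\<in>Basis. F b (x \<bullet> b)) \<in> borel_measurable borel" by measurable
  have l: "lborel = distr (\<Pi>\<^sub>M b\<in>Basis. lborel) borel T" unfolding T_def by (rule lborel_eq)
  show "integrable lborel (\<lambda>x. \<Prod>b\<in>Basis. F b (x \<bullet> b))"
    unfolding l by (subst integrable_distr_eq[OF T m]) (simp only: eq product_integrable_prod[OF finite_Basis F])
  show "(LINT x|lborel. (\<Prod>b\<in>Basis. F b (x \<bullet> b))) = (\<Prod>b\<in>Basis. LINT t|lborel. F b t)"
    by (subst l, subst integral_distr[OF T m]) (simp only: eq product_integral_prod[OF finite_Basis F])
qed

text \<open>The half-line together with its reflection; the origin is a null set.\<close>

lemma integrable_inverse_one_plus_square: "integrable lborel (\<lambda>t::real. 1 / (1 + t\<^sup>2))"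
proof -
  let ?f = "\<lambda>t::real. 1 / (1 + t\<^sup>2)"
  have "set_integrable lborel {0<..} ?f"
    using integrable_I0i_1_div_plus_square
    by (simp add: interval_lebesgue_integrable_def zero_ereal_def[symmetric] einterval_def)
      (simp add: greaterThan_def zero_ereal_def)
  then have 1: "integrable lborel (\<lambda>t. indicator {0<..} t *\<^sub>R ?f t)" by (simp add: set_integrable_def)
  have 2: "integrable lborel (\<lambda>t. indicator {0<..} (0 + (-1) * t) *\<^sub>R ?f (0 + (-1) * t))"
    using lborel_integrable_real_affine[OF 1, of "-1" 0] by simp
  show ?thesis
  proof (rule integrable_cong_AE_imp[OF Bochner_Integration.integrable_add[OF 1 2]])
    have "AE t::real in lborel. t \<noteq> 0" by (rule AE_lborel_singleton)
    then show "AE t in lborel. indicator {0<..} t *\<^sub>R ?f t + indicator {0<..} (0 + (-1) * t) *\<^sub>R ?f (0 + (-1) * t) = ?f t"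
      by eventually_elim (auto simp: indicator_def)
  qed measurable
qed

text \<open>Twice the dimension, because (1 + |x|)^2 dominates 1 + t^2 for every coordinate t of x;
  integrability of the product over the coordinates is then a one-dimensional matter.\<close>

definition decay_deg :: "'n::finite itself \<Rightarrow> nat" where
  "decay_deg _ = 2 * CARD('n)"

lemma integrable_decay: "integrable lborel (\<lambda>x::real ^ 'n::finite. 1 / (1 + norm x) ^ decay_deg TYPE('n))"
proof (rule Bochner_Integration.integrable_bound)
  show "integrable lborel (\<lambda>x::real ^ 'n. \<Prod>b\<in>Basis. 1 / (1 + (x \<bullet> b)\<^sup>2))"
    by (intro lborel_prod_Basis integrable_inverse_one_plus_square)
  show "AE x::real ^ 'n in lborel. norm (1 / (1 + norm x) ^ decay_deg TYPE('n)) \<le> norm (\<Prod>b\<in>Basis. 1 / (1 + (x \<bullet> b)\<^sup>2))"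
  proof (rule AE_I2)
    fix x :: "real ^ 'n"
    have "(\<Prod>b\<in>Basis. 1 + (x \<bullet> b)\<^sup>2) \<le> (\<Prod>b\<in>(Basis :: (real ^ 'n) set). (1 + norm x)\<^sup>2)"
    proof (intro prod_mono conjI)
      fix b :: "real ^ 'n" assume "b \<in> Basis"
      then have "(x \<bullet> b)\<^sup>2 \<le> (norm x)\<^sup>2" using Basis_le_norm[of b x] abs_le_square_iff[of "x \<bullet> b" "norm x"] by simp
      moreover have "(1 + norm x)\<^sup>2 = 1 + 2 * norm x + (norm x)\<^sup>2" by (simp add: power2_eq_square algebra_simps)
      ultimately show "1 + (x \<bullet> b)\<^sup>2 \<le> (1 + norm x)\<^sup>2" by (simp add: add_increasing)
    qed auto
    also have "\<dots> = (1 + norm x) ^ decay_deg TYPE('n)"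
      by (simp add: decay_deg_def power_mult)
    finally have "(\<Prod>b\<in>Basis. 1 + (x \<bullet> b)\<^sup>2) \<le> (1 + norm x) ^ decay_deg TYPE('n)" .
    moreover have "0 < (\<Prod>b\<in>Basis. 1 + (x \<bullet> b)\<^sup>2)" by (rule prod_pos) (simp add: add_pos_nonneg)
    ultimately have "1 / (1 + norm x) ^ decay_deg TYPE('n) \<le> 1 / (\<Prod>b\<in>Basis. 1 + (x \<bullet> b)\<^sup>2)"
      by (intro divide_left_mono) auto
    then show "norm (1 / (1 + norm x) ^ decay_deg TYPE('n)) \<le> norm (\<Prod>b\<in>Basis. 1 / (1 + (x \<bullet> b)\<^sup>2))"
      by (simp add: prod_dividef abs_prod)
  qed
qed measurable

definition decay_mass :: "'n::finite itself \<Rightarrow> real" where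
  "decay_mass _ = (LINT x::real ^ 'n|lborel. 1 / (1 + norm x) ^ decay_deg TYPE('n))"

lemma decay_mass_nonneg: "0 \<le> decay_mass TYPE('n::finite)"
  unfolding decay_mass_def by (intro integral_nonneg_AE AE_I2) simp

lemma integral_decay_le:
  fixes f :: "real ^ 'n::finite \<Rightarrow> complex"
  assumes m: "f \<in> borel_measurable borel"
    and le: "AE x in lborel. norm (f x) \<le> B / (1 + norm x) ^ decay_deg TYPE('n)"
  shows "integrable lborel f" and "norm (LINT x|lborel. f x) \<le> B * decay_mass TYPE('n)"
    and "(LINT x|lborel. norm (f x)) \<le> B * decay_mass TYPE('n)"
proof -
  have i: "integrable lborel (\<lambda>x::real ^ 'n. B / (1 + norm x) ^ decay_deg TYPE('n))"
    using integrable_mult_right[OF integrable_decay, of B] by simp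
  show f: "integrable lborel f"
  proof (rule Bochner_Integration.integrable_bound[OF i])
    show "AE x in lborel. norm (f x) \<le> norm (B / (1 + norm x) ^ decay_deg TYPE('n))"
      using le by eventually_elim (metis abs_ge_self order_trans real_norm_def)
  qed (use m in simp)
  have "(LINT x|lborel. norm (f x)) \<le> (LINT x::real ^ 'n|lborel. B / (1 + norm x) ^ decay_deg TYPE('n))"
    using f i le by (intro integral_mono_AE) auto
  also have "\<dots> = B * decay_mass TYPE('n)"
    unfolding decay_mass_def by (subst integral_mult_right_zero[symmetric]) simp
  finally show "(LINT x|lborel. norm (f x)) \<le> B * decay_mass TYPE('n)" .
  with integral_norm_bound[of lborel f] show "norm (LINT x|lborel. f x) \<le> B * decay_mass TYPE('n)" by linarith
qed

text \<open>Almost-everywhere bounds, since transforms controlled by an essential supremum are known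
  no better.\<close>

lemma rapid_L1I:
  fixes f :: "real ^ 'n::finite \<Rightarrow> complex"
  assumes m [measurable]: "f \<in> borel_measurable borel"
    and le: "\<And>k. \<exists>B. AE x in lborel. norm (f x) \<le> B / (1 + norm x) ^ k"
  shows "rapid_L1 f"
  unfolding rapid_L1_def
proof (intro conjI allI m)
  fix k
  obtain B where B: "AE x in lborel. norm (f x) \<le> B / (1 + norm x) ^ (k + decay_deg TYPE('n))" using le by blast
  have "integrable lborel (\<lambda>x. complex_of_real ((1 + norm x) ^ k) * f x)"
  proof (rule integral_decay_le(1)[where B=B])
    show "AE x in lborel. norm (complex_of_real ((1 + norm x) ^ k) * f x) \<le> B / (1 + norm x) ^ decay_deg TYPE('n)"
      using B
    proof eventually_elim
      case (elim x)
      then show ?case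
        by (simp only: norm_mult norm_of_real abs_of_nonneg[OF zero_le_power[OF one_plus_norm_pos(3)]])
          (simp add: field_simps power_add)
    qed
  qed measurable
  from integrable_norm[OF this] show "integrable lborel (\<lambda>x. (1 + norm x) ^ k * norm (f x))"
    by (simp only: norm_mult norm_of_real abs_of_nonneg[OF zero_le_power[OF one_plus_norm_pos(3)]])
qed

lemma schwartz_fun_rapid_L1:
  assumes "schwartz_fun f"
  shows "rapid_L1 f"
proof (rule rapid_L1I)
  show "f \<in> borel_measurable borel" using schwartz_fun_smooth[OF assms] by (rule smooth_measurable)
  fix k
  obtain B where "schwartz_le k B f" using assms unfolding schwartz_fun_iff by blast
  then have "norm (f x) \<le> B / (1 + norm x) ^ k" for x
    unfolding schwartz_le_def by (rule derivs_leD(3))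
  then show "\<exists>B. AE x in lborel. norm (f x) \<le> B / (1 + norm x) ^ k" by blast
qed

section \<open>The Fourier transform of a Gaussian\<close>

text \<open>A rescaling of the characteristic function of the standard normal distribution;
  \<open>c\<close> is chosen so that (c t)^2 / 2 = b t^2.\<close>

lemma fourier_gauss_real:
  assumes b: "0 < b"
  shows "integrable lborel (\<lambda>t::real. complex_of_real (exp (- b * t\<^sup>2)) * exp (- \<i> * complex_of_real (x * t)))"
    and "(LINT t|lborel. complex_of_real (exp (- b * t\<^sup>2)) * exp (- \<i> * complex_of_real (x * t))) =
      complex_of_real (sqrt (pi / b) * exp (- x\<^sup>2 / (4 * b)))"
proof -
  define c where "c = sqrt (2 * b)"
  have c: "0 < c" "c\<^sup>2 = 2 * b" using b by (auto simp: c_def)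
  define f where "f s t = complex_of_real (std_normal_density t) * iexp (s * t)" for s t
  have fi: "integrable lborel (f s)" for s
  proof (rule Bochner_Integration.integrable_bound[OF integrable_normal_density])
    show "f s \<in> borel_measurable lborel" unfolding f_def by measurable
    show "AE t in lborel. norm (f s t) \<le> norm (std_normal_density t)"
      by (simp add: f_def norm_mult)
  qed simp
  have fs: "(LINT t|lborel. f s t) = complex_of_real (exp (- (s\<^sup>2) / 2))" for s
  proof -
    have "char std_normal_distribution s = (LINT t|lborel. f s t)"
      unfolding char_def f_def by (subst integral_density) (auto simp: scaleR_conv_of_real)
    then show ?thesis by (simp add: char_std_normal_distribution)
  qed
  have eq: "complex_of_real (exp (- b * t\<^sup>2)) * exp (- \<i> * complex_of_real (x * t)) =
     complex_of_real (sqrt (2 * pi)) * f (- x / c) (0 + c * t)" for t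
  proof -
    have "(c * t)\<^sup>2 / 2 = b * t\<^sup>2" using c by (simp add: power_mult_distrib)
    moreover have "- x / c * (c * t) = - (x * t)" using c by simp
    ultimately show ?thesis
      by (simp add: f_def std_normal_density_def)
  qed
  show "integrable lborel (\<lambda>t::real. complex_of_real (exp (- b * t\<^sup>2)) * exp (- \<i> * complex_of_real (x * t)))"
    unfolding eq using c by (intro integrable_mult_right lborel_integrable_real_affine fi) auto
  have "complex_of_real (exp (- (((- x / c)\<^sup>2) / 2))) = c *\<^sub>R (LINT t|lborel. f (- x / c) (0 + c * t))"
    using fs[of "- x / c"] lborel_integral_real_affine[of c "f (- x / c)" 0] c by simp
  then have "(LINT t|lborel. f (- x / c) (0 + c * t)) = complex_of_real (exp (- (((- x / c)\<^sup>2) / 2)) / c)"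
    using c by (simp add: scaleR_conv_of_real field_simps)
  then have "(LINT t|lborel. complex_of_real (exp (- b * t\<^sup>2)) * exp (- \<i> * complex_of_real (x * t))) =
      complex_of_real (sqrt (2 * pi) * (exp (- (((- x / c)\<^sup>2) / 2)) / c))"
    unfolding eq by simp
  moreover have "sqrt (2 * pi) / c = sqrt (pi / b)"
    using b by (simp add: c_def real_sqrt_mult real_sqrt_divide)
  moreover have "((- x / c)\<^sup>2) / 2 = x\<^sup>2 / (4 * b)"
    by (simp add: power_divide c)
  ultimately show "(LINT t|lborel. complex_of_real (exp (- b * t\<^sup>2)) * exp (- \<i> * complex_of_real (x * t))) =
      complex_of_real (sqrt (pi / b) * exp (- x\<^sup>2 / (4 * b)))"
    by (metis minus_divide_left mult.commute times_divide_eq_left times_divide_eq_right)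
qed

text \<open>The Gaussian and the wave both factorise over the coordinates.\<close>

lemma fourier_int_gauss:
  fixes x :: "real ^ 'n::finite"
  assumes b: "0 < b"
  shows "fourier_int (gauss b 0) x = complex_of_real (sqrt (pi / b) ^ CARD('n)) * gauss (1 / (4 * b)) 0 x"
proof -
  have eq: "gauss b 0 \<eta> * wave \<eta> x = (\<Prod>j\<in>Basis. complex_of_real (exp (- b * (\<eta> \<bullet> j)\<^sup>2)) *
     exp (- \<i> * complex_of_real ((x \<bullet> j) * (\<eta> \<bullet> j))))" for \<eta> :: "real ^ 'n"
  proof -
    have 1: "(norm \<eta>)\<^sup>2 = (\<Sum>j\<in>Basis. (\<eta> \<bullet> j)\<^sup>2)"
      unfolding power2_norm_eq_inner euclidean_inner[of \<eta> \<eta>] by (simp add: power2_eq_square)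
    have 2: "x \<bullet> \<eta> = (\<Sum>j\<in>Basis. (x \<bullet> j) * (\<eta> \<bullet> j))" by (rule euclidean_inner)
    show ?thesis
      by (simp add: gauss_def wave_def 1 2 prod.distrib exp_sum sum_distrib_left sum_negf[symmetric] of_real_prod[symmetric] exp_of_real[symmetric])
  qed
  have "fourier_int (gauss b 0) x = (\<Prod>j\<in>Basis. complex_of_real (sqrt (pi / b) * exp (- (x \<bullet> j)\<^sup>2 / (4 * b))))"
    unfolding fourier_int_def eq
    by (subst lborel_prod_Basis(2)[OF fourier_gauss_real(1)[OF b]]) (simp only: fourier_gauss_real(2)[OF b])
  also have "\<dots> = complex_of_real (sqrt (pi / b) ^ CARD('n) * exp (\<Sum>j\<in>Basis. - (x \<bullet> j)\<^sup>2 / (4 * b)))"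
    by (simp add: prod.distrib exp_sum)
  also have "(\<Sum>j\<in>Basis. - (x \<bullet> j)\<^sup>2 / (4 * b)) = - (1 / (4 * b)) * (norm x)\<^sup>2"
    unfolding power2_norm_eq_inner euclidean_inner[of x x]
    by (simp add: power2_eq_square sum_negf sum_divide_distrib[symmetric])
  finally show ?thesis by (simp add: gauss_def[of "1 / (4 * b)" 0 x])
qed

text \<open>The density whose Fourier integral is \<open>gauss a y\<close>. Its modulus is the
  centred normal density with variance \<open>2 * a\<close> in each coordinate; the centre
  \<open>y\<close> only enters through the phase.\<close>

definition gauss_kernel :: "real \<Rightarrow> real ^ 'n::finite \<Rightarrow> real ^ 'n \<Rightarrow> complex" where
  "gauss_kernel a y \<eta> = complex_of_real (sqrt (1 / (4 * pi * a)) ^ CARD('n)) * (gauss (1 / (4 * a)) 0 \<eta> * wave \<eta> (- y))"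

lemma norm_gauss_kernel:
  "0 < a \<Longrightarrow> norm (gauss_kernel a (y :: real ^ 'n::finite) \<eta>) = sqrt (1 / (4 * pi * a)) ^ CARD('n) * exp (- (norm \<eta>)\<^sup>2 / (4 * a))"
  by (simp add: gauss_kernel_def norm_mult norm_gauss norm_power)

lemma schwartz_fun_gauss_kernel:
  assumes "0 < a" shows "schwartz_fun (gauss_kernel a y)"
proof -
  have "schwartz_fun (\<lambda>\<eta>. gauss (1 / (4 * a)) 0 \<eta> * wave (- y) \<eta>)"
    by (intro schwartz_fun_mult_wave schwartz_fun_gauss) (use assms in auto)
  then show ?thesis
    unfolding gauss_kernel_def[abs_def] wave_commute[of _ "- y"] by (rule schwartz_fun_cmult)
qed

lemma fourier_int_gauss_kernel:
  fixes x :: "real ^ 'n::finite"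
  assumes a: "0 < a"
  shows "fourier_int (gauss_kernel a y) x = gauss a y x"
proof -
  define s where "s = sqrt (1 / (4 * pi * a))"
  have s: "s * sqrt (pi / (1 / (4 * a))) = 1"
    using a by (simp add: s_def real_sqrt_mult[symmetric] real_sqrt_divide)
  have "fourier_int (gauss_kernel a y) x = (LINT \<eta>|lborel. complex_of_real (s ^ CARD('n)) * (gauss (1 / (4 * a)) 0 \<eta> * wave \<eta> (x - y)))"
    unfolding fourier_int_def gauss_kernel_def s_def
    using wave_add'[of _ x "- y"] by (intro Bochner_Integration.integral_cong) (auto simp: mult_ac)
  also have "\<dots> = complex_of_real (s ^ CARD('n)) * fourier_int (gauss (1 / (4 * a)) 0) (x - y)"
    unfolding fourier_int_def by (rule integral_mult_right_zero)
  also have "\<dots> = complex_of_real ((s * sqrt (pi / (1 / (4 * a)))) ^ CARD('n)) * gauss (1 / (4 * (1 / (4 * a)))) 0 (x - y)"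
    using a by (subst fourier_int_gauss) (auto simp: power_mult_distrib)
  also have "\<dots> = gauss a y x" unfolding s by (simp add: gauss_def)
  finally show ?thesis .
qed

text \<open>The modulus is the kernel for centre 0, whose integral is its Fourier integral at 0.
  Total mass 1 keeps the estimates near the centre independent of \<open>N\<close>.\<close>

lemma integral_norm_gauss_kernel:
  fixes y :: "real ^ 'n::finite"
  assumes a: "0 < a"
  shows "(LINT \<eta>|lborel. norm (gauss_kernel a y \<eta>)) = 1"
proof -
  have "complex_of_real (LINT \<eta>|lborel. norm (gauss_kernel a y \<eta>)) = (LINT \<eta>|lborel. complex_of_real (norm (gauss_kernel a y \<eta>)))"
    by (rule integral_complex_of_real[symmetric])
  also have "\<dots> = fourier_int (gauss_kernel a (0 :: real ^ 'n)) 0"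
    unfolding fourier_int_def
    by (intro Bochner_Integration.integral_cong) (simp_all add: norm_gauss_kernel[OF a], simp add: gauss_kernel_def gauss_def)
  also have "\<dots> = 1" by (simp add: fourier_int_gauss_kernel[OF a] gauss_def)
  finally show ?thesis by (metis of_real_eq_1_iff)
qed

section \<open>Bump functions\<close>

text \<open>The classical flat function with additional negative powers of \<open>t\<close>, a
  family closed under differentiation up to linear combinations.\<close>

definition flat :: "nat \<Rightarrow> real \<Rightarrow> real" where
  "flat k t = (if t > 0 then exp (- (1 / t)) / t ^ k else 0)"

lemma flat_nonneg: "0 \<le> flat k t"
  by (simp add: flat_def)

text \<open>The exponential beats the power by \<open>one_plus_power_le_exp\<close> at
  \<open>1 / t\<close>. A quadratic bound is what makes the derivative at 0 exist and
  vanish.\<close>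

lemma flat_le_square: "0 \<le> t \<Longrightarrow> flat k t \<le> real (k + 2) ^ (k + 2) * t\<^sup>2"
proof (cases "t = 0")
  case False
  assume "0 \<le> t"
  with False have t: "0 < t" by simp
  have "(1 / t) ^ (k + 2) \<le> (1 + 1 / t) ^ (k + 2)" using t by (intro power_mono) auto
  also have "\<dots> \<le> real (k + 2) ^ (k + 2) * exp (1 / t)"
    by (rule one_plus_power_le_exp) (use t in simp)
  finally have "1 / t ^ (k + 2) \<le> real (k + 2) ^ (k + 2) * exp (1 / t)" by (simp add: power_divide)
  then have "exp (- (1 / t)) \<le> real (k + 2) ^ (k + 2) * t ^ (k + 2)"
    using t by (simp add: exp_minus field_simps)
  then have "exp (- (1 / t)) / t ^ k \<le> real (k + 2) ^ (k + 2) * t\<^sup>2"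
    using t by (subst pos_divide_le_eq) (simp_all add: power_add mult_ac power2_eq_square)
  then show ?thesis using t by (simp add: flat_def)
qed (simp add: flat_def)

lemma DERIV_flat: "(flat k has_real_derivative (flat (k + 2) t - real k * flat (k + 1) t)) (at t)"
proof -
  consider "t > 0" | "t < 0" | "t = 0" by linarith
  then show ?thesis
  proof cases
    case 1
    have "((\<lambda>t. exp (- (1 / t)) / t ^ k) has_real_derivative (exp (- (1 / t)) / t ^ (k + 2) - real k * (exp (- (1 / t)) / t ^ (k + 1)))) (at t)"
    proof -
      have e: "((\<lambda>t. exp (- (1 / t))) has_real_derivative (exp (- (1 / t)) / t\<^sup>2)) (at t)"
        using 1 by (auto intro!: derivative_eq_intros simp: power2_eq_square)
      have p: "((\<lambda>t. t ^ k) has_real_derivative (real k * t ^ (k - 1))) (at t)"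
        using DERIV_pow[of k t] by simp
      have "(exp (- (1 / t)) / t\<^sup>2 * t ^ k - exp (- (1 / t)) * (real k * t ^ (k - 1))) / (t ^ k * t ^ k) =
          exp (- (1 / t)) / t ^ (k + 2) - real k * (exp (- (1 / t)) / t ^ (k + 1))"
        using 1 by (cases k) (simp_all add: field_simps power2_eq_square)
      with DERIV_divide[OF e p] 1 show ?thesis by simp
    qed
    then have "(flat k has_real_derivative (exp (- (1 / t)) / t ^ (k + 2) - real k * (exp (- (1 / t)) / t ^ (k + 1)))) (at t)"
      by (rule has_field_derivative_transform_within_open[of _ _ _ "{0<..}"]) (use 1 in \<open>auto simp: flat_def\<close>)
    with 1 show ?thesis by (simp add: flat_def)
  next
    case 2
    have "(flat k has_real_derivative 0) (at t)"
      by (rule has_field_derivative_transform_within_open[OF DERIV_const[of 0], of "{..<0}"]) (use 2 in \<open>auto simp: flat_def\<close>)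
    with 2 show ?thesis by (simp add: flat_def)
  next
    case 3
    have "((\<lambda>h. (flat k (0 + h) - flat k 0) / h) \<longlongrightarrow> 0) (at 0)"
    proof (rule Lim_null_comparison)
      have "norm ((flat k (0 + h) - flat k 0) / h) \<le> real (k + 2) ^ (k + 2) * \<bar>h\<bar>" if "h \<noteq> 0" for h
      proof (cases "h > 0")
        case True
        with flat_le_square[of h k] show ?thesis
          by (simp add: flat_def field_simps power2_eq_square abs_mult)
      next
        case False
        then have "flat k (0 + h) = 0" "flat k 0 = 0" by (simp_all add: flat_def)
        then show ?thesis by (simp only: diff_self div_0 norm_zero) (rule mult_nonneg_nonneg, simp_all)
      qed
      then show "\<forall>\<^sub>F h in at 0. norm ((flat k (0 + h) - flat k 0) / h) \<le> real (k + 2) ^ (k + 2) * \<bar>h\<bar>"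
        by (auto simp: eventually_at_filter)
      show "((\<lambda>h. real (k + 2) ^ (k + 2) * \<bar>h\<bar>) \<longlongrightarrow> 0) (at 0)"
        by (auto intro!: tendsto_eq_intros)
    qed
    with 3 show ?thesis by (simp add: DERIV_def flat_def)
  qed
qed

definition flat_bump :: "nat \<Rightarrow> real \<Rightarrow> real ^ 'n::finite \<Rightarrow> real ^ 'n \<Rightarrow> complex" where
  "flat_bump k r a x = complex_of_real (flat k (r\<^sup>2 - (norm (x - a))\<^sup>2))"

lemma flat_bump_has_derivative:
  "(flat_bump k r a has_derivative (\<lambda>v. complex_of_real (- 2 * ((x - a) \<bullet> v)) *
     (flat_bump (k + 2) r a x - of_nat k * flat_bump (k + 1) r a x))) (at x)"
proof -
  have 1: "((\<lambda>x. r\<^sup>2 - (x - a) \<bullet> (x - a)) has_derivative (\<lambda>v. - 2 * ((x - a) \<bullet> v))) (at x)"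
    by (auto intro!: derivative_eq_intros simp: inner_commute algebra_simps)
  have "((\<lambda>x. complex_of_real (flat k (r\<^sup>2 - (x - a) \<bullet> (x - a)))) has_derivative
     (\<lambda>v. complex_of_real ((flat (k + 2) (r\<^sup>2 - (x - a) \<bullet> (x - a)) - real k * flat (k + 1) (r\<^sup>2 - (x - a) \<bullet> (x - a))) * (- 2 * ((x - a) \<bullet> v))))) (at x)"
    by (intro has_derivative_of_real has_derivative_compose[OF 1 DERIV_flat[unfolded has_field_derivative_def]])
  then show ?thesis
    unfolding flat_bump_def[abs_def] power2_norm_eq_inner by (simp add: mult_ac)
qed

lemma flat_bump_differentiable: "flat_bump k r a differentiable at x"
  unfolding differentiable_def by (rule exI, rule flat_bump_has_derivative)

lemma partial_deriv_flat_bump: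
  "partial_deriv i (flat_bump k r a) =
    (\<lambda>x. coord (- 2) i a x * (flat_bump (k + 2) r a x + (- of_nat k) * flat_bump (k + 1) r a x))"
  by (rule ext, subst partial_deriv_eq[OF flat_bump_has_derivative]) (simp add: coord_def inner_axis)

text \<open>A derivative leads to the same family with other exponents, times an affine factor;
  hence the induction on the order with \<open>k\<close> arbitrary.\<close>

lemma smooth_flat_bump: "smooth (flat_bump k r a)"
proof -
  have "\<exists>w. derivs_le n w (flat_bump k r a)" for n
  proof (induction n arbitrary: k)
    case 0
    show ?case
      by (intro exI[of _ "\<lambda>x. norm (flat_bump k r a x)"]) (simp add: derivs_le_0 flat_bump_differentiable)
  next
    case (Suc n)
    obtain w1 w2 where w1: "derivs_le n w1 (flat_bump (k + 2) r a)" and w2: "derivs_le n w2 (flat_bump (k + 1) r a)"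
      using Suc.IH by blast
    have "\<exists>w. derivs_le n w (partial_deriv i (flat_bump k r a))" for i
      unfolding partial_deriv_flat_bump
      using derivs_le_mult[OF derivs_le_coord derivs_le_add[OF w1 derivs_le_cmult[OF w2]]] by blast
    then obtain w where w: "\<And>i. derivs_le n (w i) (partial_deriv i (flat_bump k r a))" by metis
    have nn: "0 \<le> w i x" for i x using w derivs_leD(5) by blast
    have "derivs_le n (\<lambda>x. norm (flat_bump k r a x) + (\<Sum>i\<in>UNIV. w i x)) (partial_deriv i (flat_bump k r a))" for i
      by (rule derivs_le_mono[OF w order_refl]) (use nn in \<open>auto intro!: add_increasing member_le_sum\<close>)
    then have "derivs_le (Suc n) (\<lambda>x. norm (flat_bump k r a x) + (\<Sum>i\<in>UNIV. w i x)) (flat_bump k r a)"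
      using nn by (auto simp: derivs_le_Suc sum_nonneg flat_bump_differentiable)
    then show ?case by blast
  qed
  then show ?thesis by (simp add: smooth_iff)
qed

lemma flat_bump_outside:
  assumes "x \<notin> cball a r" "0 \<le> r"
  shows "flat_bump k r a x = 0"
proof -
  have "r \<le> norm (x - a)" using assms(1) by (simp add: dist_norm norm_minus_commute)
  then have "r\<^sup>2 \<le> (norm (x - a))\<^sup>2" using assms(2) by (rule power_mono)
  then show ?thesis by (simp add: flat_bump_def flat_def)
qed

lemma test_fun_flat_bump: "0 \<le> r \<Longrightarrow> test_fun (flat_bump k r a)"
proof -
  assume r: "0 \<le> r"
  have "supp (flat_bump k r a) \<subseteq> cball a r"
    unfolding supp_def by (rule closure_minimal) (use flat_bump_outside[OF _ r] in blast)+
  then have "bounded (supp (flat_bump k r a))" using bounded_cball bounded_subset by blast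
  then show ?thesis
    by (simp add: test_fun_def smooth_flat_bump compact_eq_bounded_closed supp_def)
qed

section \<open>Functions determined by their test integrals\<close>

lemma test_fun_zero_outside: "x \<notin> supp \<psi> \<Longrightarrow> \<psi> x = 0"
  using closure_subset[of "{x. \<psi> x \<noteq> 0}"] by (auto simp: supp_def)

lemma integrable_mult_test_fun:
  assumes G: "continuous_on UNIV G" and \<psi>: "test_fun \<psi>"
  shows "integrable lborel (\<lambda>x. G x * \<psi> x)"
proof -
  have "integrable lborel (\<lambda>x. indicator (supp \<psi>) x *\<^sub>R (G x * \<psi> x))"
    using \<psi> by (intro borel_integrable_compact continuous_intros continuous_on_subset[OF G] smooth_continuous)
      (auto simp: test_fun_def)
  moreover have "(\<lambda>x. indicator (supp \<psi>) x *\<^sub>R (G x * \<psi> x)) = (\<lambda>x. G x * \<psi> x)"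
    using test_fun_zero_outside by (fastforce simp: indicator_def fun_eq_iff)
  ultimately show ?thesis by simp
qed

text \<open>A bump at a point where the two functions differ would detect the difference. This makes
  the continuous representative in the definition of regularity unique.\<close>

lemma continuous_eq_if_test_integrals_eq:
  fixes G H :: "real ^ 'n::finite \<Rightarrow> complex"
  assumes G: "continuous_on UNIV G" and H: "continuous_on UNIV H"
    and eq: "\<And>\<psi>. test_fun \<psi> \<Longrightarrow> (LINT x|lborel. G x * \<psi> x) = (LINT x|lborel. H x * \<psi> x)"
  shows "G = H"
proof (rule ext, rule ccontr)
  fix a assume ne: "G a \<noteq> H a"
  \<comment> \<open>Multiplication by the conjugate of the difference at \<open>a\<close> makes the
    value there real and positive, so that real parts can be compared.\<close>
  define D where "D x = cnj (G a - H a) * (G x - H x)" for x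
  have Dc: "continuous_on UNIV D" unfolding D_def by (intro continuous_intros G H)
  define m where "m = Re (D a)"
  have "D a = complex_of_real ((cmod (G a - H a))\<^sup>2)"
    unfolding D_def complex_norm_square by (rule mult.commute)
  then have m: "m > 0" using ne by (simp add: m_def)
  have "isCont (\<lambda>x. Re (D x)) a"
    using Dc by (auto simp: continuous_on_eq_continuous_at intro: continuous_intros)
  then obtain d where d: "d > 0" "\<And>x. dist x a < d \<Longrightarrow> dist (Re (D x)) m < m / 2"
    unfolding continuous_at_eps_delta m_def using m half_gt_zero unfolding m_def by blast
  define \<psi> where "\<psi> = flat_bump 0 (d / 2) a"
  have \<psi>: "test_fun \<psi>" unfolding \<psi>_def by (rule test_fun_flat_bump) (use d in simp)
  define p where "p x = flat 0 ((d / 2)\<^sup>2 - (norm (x - a))\<^sup>2)" for x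
  have \<psi>p: "\<psi> x = complex_of_real (p x)" for x by (simp add: \<psi>_def p_def flat_bump_def)
  have p0: "0 \<le> p x" for x by (simp add: p_def flat_nonneg)
  have pz: "p x = 0" if "\<not> dist x a < d" for x
    using flat_bump_outside[of x a "d/2" 0] that d
    by (simp add: \<psi>p[symmetric] \<psi>_def dist_commute \<psi>p) (metis \<psi>_def \<psi>p of_real_eq_0_iff)
  have iG: "integrable lborel (\<lambda>x. G x * \<psi> x)" "integrable lborel (\<lambda>x. H x * \<psi> x)"
    "integrable lborel (\<lambda>x. D x * \<psi> x)"
    by (intro integrable_mult_test_fun G H Dc \<psi>)+
  have "(LINT x|lborel. D x * \<psi> x) = cnj (G a - H a) * (LINT x|lborel. G x * \<psi> x - H x * \<psi> x)"
    unfolding D_def by (subst integral_mult_right_zero[symmetric]) (simp add: algebra_simps)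
  also have "\<dots> = 0" using eq[OF \<psi>] by (simp add: Bochner_Integration.integral_diff[OF iG(1,2)])
  finally have "0 = Re (LINT x|lborel. D x * \<psi> x)" by simp
  also have "\<dots> = (LINT x|lborel. Re (D x * \<psi> x))" by (rule integral_Re[symmetric, OF iG(3)])
  also have "\<dots> \<ge> (LINT x|lborel. m / 2 * p x)"
  proof (rule integral_mono)
    show "integrable lborel (\<lambda>x. Re (D x * \<psi> x))" by (rule integrable_Re[OF iG(3)])
    have "integrable lborel (\<lambda>x. Re (complex_of_real (m / 2) * \<psi> x))"
      by (intro integrable_Re integrable_mult_test_fun \<psi> continuous_intros)
    then show "integrable lborel (\<lambda>x. m / 2 * p x)" by (simp add: \<psi>p)
    fix x
    show "m / 2 * p x \<le> Re (D x * \<psi> x)"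
    proof (cases "dist x a < d")
      case True
      from d(2)[OF this] have "m / 2 \<le> Re (D x)" unfolding dist_real_def by linarith
      from mult_right_mono[OF this p0[of x]] show ?thesis by (simp add: \<psi>p)
    qed (simp add: \<psi>p pz)
  qed
  also have "(LINT x|lborel. m / 2 * p x) = m / 2 * (LINT x|lborel. p x)" by (rule integral_mult_right_zero)
  finally have le: "(LINT x|lborel. p x) \<le> 0" using m by (simp add: mult_le_0_iff)
  \<comment> \<open>A lower bound of the bump on the ball of radius \<open>d / 4\<close>, by which
    its integral is positive.\<close>
  define q where "q = flat 0 ((d / 2)\<^sup>2 - (d / 4)\<^sup>2)"
  have q: "q > 0" using d by (simp add: q_def flat_def power2_eq_square)
  have ip: "integrable lborel p"
    using integrable_Re[OF integrable_mult_test_fun[OF continuous_on_const[of UNIV 1] \<psi>]] by (simp add: \<psi>p)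
  have "q * measure lborel (ball a (d / 4)) = (LINT x|lborel. q * indicator (ball a (d / 4)) x)"
    by (subst integral_mult_right_zero) simp
  also have "\<dots> \<le> (LINT x|lborel. p x)"
  proof (rule integral_mono[OF _ ip])
    show "integrable lborel (\<lambda>x. q * indicator (ball a (d / 4)) x)"
      by (intro integrable_mult_right integrable_real_indicator emeasure_lborel_ball_finite) auto
    fix x
    show "q * indicator (ball a (d / 4)) x \<le> p x"
    proof (cases "x \<in> ball a (d / 4)")
      case True
      then have "(norm (x - a))\<^sup>2 \<le> (d / 4)\<^sup>2"
        using d by (intro power_mono) (auto simp: dist_norm norm_minus_commute)
      moreover have "(d / 2)\<^sup>2 - (d / 4)\<^sup>2 > 0" using d by (simp add: power2_eq_square)
      ultimately have "q \<le> p x"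
        unfolding q_def p_def flat_def by (simp add: frac_le)
      with True show ?thesis by simp
    qed (simp add: p0)
  qed
  finally show False using le q content_ball_pos[of "d/4" a] d
    by (smt (verit) mult_pos_pos zero_less_divide_iff)
qed

section \<open>The Fourier transform on Schwartz functions\<close>

lemma one_plus_norm_shift:
  assumes "norm v \<le> 1"
  shows "(1 + norm (x::'a::real_normed_vector)) / 2 \<le> 1 + norm (x + v)"
proof -
  have "(1 + a) / 2 \<le> 1 + b" if "a \<le> b + c" "0 \<le> b" "c \<le> 1" for a b c :: real
    using that by argo
  moreover have "norm x \<le> norm (x + v) + norm v" using norm_triangle_ineq4[of "x + v" v] by simp
  ultimately show ?thesis using assms norm_ge_zero by blast
qed

lemma lborel_integral_shift:
  fixes f :: "real ^ 'n::finite \<Rightarrow> complex"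
  assumes [measurable]: "f \<in> borel_measurable borel"
  shows "(LINT x|lborel. f (c + x)) = (LINT x|lborel. f x)"
    and "integrable lborel f \<Longrightarrow> integrable lborel (\<lambda>x. f (c + x))"
  using integral_distr[of "(+) c" lborel borel f] integrable_distr_eq[of "(+) c" lborel borel f]
  by (simp_all add: lborel_distr_plus)

text \<open>Translates have equal integrals, so difference quotients integrate to 0. A shift by at
  most 1 changes 1 + |x| by a factor 2 at most, which gives the dominating function.\<close>

lemma integral_partial_deriv_eq_0:
  fixes w :: "real ^ 'n::finite \<Rightarrow> complex"
  assumes w: "schwartz_fun w"
  shows "(LINT x|lborel. partial_deriv i w x) = 0"
proof -
  define K where "K = decay_deg TYPE('n)"
  obtain B where B: "schwartz_le (Suc K) B w" using w unfolding schwartz_fun_iff by blast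
  have B0: "0 \<le> B" by (rule schwartz_le_nonneg[OF B])
  have sm: "smooth w" by (rule schwartz_fun_smooth[OF w])
  have pd: "norm (partial_deriv j w x) \<le> B / (1 + norm x) ^ K" for j x
    using schwartz_le_partial_deriv[OF B] unfolding schwartz_le_def by (rule derivs_leD(3))
  have wi: "integrable lborel w"
    using rapid_L1_integrable_wave[OF schwartz_fun_rapid_L1[OF w], of 0] by simp
  define t where "t n = 1 / real (Suc n)" for n
  have t: "0 < t n" "t n \<le> 1" for n by (auto simp: t_def)
  have tn: "t n \<noteq> 0" for n using t(1)[of n] by simp
  have t0: "t \<longlonglongrightarrow> 0" unfolding t_def by (rule LIMSEQ_Suc[OF lim_1_over_n])
  define e where "e = (axis i 1 :: real ^ 'n)"
  define q where "q n x = (w (x + t n *\<^sub>R e) - w x) / complex_of_real (t n)" for n x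
  have q0: "(LINT x|lborel. q n x) = 0" for n
  proof -
    have "(LINT x|lborel. q n x) = (LINT x|lborel. w (t n *\<^sub>R e + x) - w x) / complex_of_real (t n)"
      unfolding q_def by (subst integral_divide_zero) (simp add: add.commute)
    also have "\<dots> = 0"
      using lborel_integral_shift[OF smooth_measurable[OF sm], of "t n *\<^sub>R e"] wi
      by (simp add: Bochner_Integration.integral_diff)
    finally show ?thesis .
  qed
  have "(\<lambda>n. LINT x|lborel. q n x) \<longlonglongrightarrow> (LINT x|lborel. partial_deriv i w x)"
  proof (rule integral_dominated_convergence[where w = "\<lambda>x. real CARD('n) * B * 2 ^ K * (1 / (1 + norm x) ^ K)"])
    note [measurable] = smooth_measurable[OF sm] smooth_measurable[OF smooth_partial_deriv[OF sm]]
    show "partial_deriv i w \<in> borel_measurable lborel" by measurable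
    show "q n \<in> borel_measurable lborel" for n unfolding q_def by measurable
    show "integrable lborel (\<lambda>x::real ^ 'n. real CARD('n) * B * 2 ^ K * (1 / (1 + norm x) ^ K))"
      unfolding K_def by (intro integrable_mult_right integrable_decay)
    show "AE x in lborel. (\<lambda>n. q n x) \<longlonglongrightarrow> partial_deriv i w x"
    proof (rule AE_I2)
      fix x
      have "((\<lambda>t. w (x + t *\<^sub>R e)) has_vector_derivative partial_deriv i w (x + 0 *\<^sub>R e)) (at 0)"
        unfolding e_def by (rule has_vector_derivative_axis[OF smooth_differentiable[OF sm]])
      then have H: "((\<lambda>h. norm (w (x + (0 + h) *\<^sub>R e) - w (x + 0 *\<^sub>R e) - h *\<^sub>R partial_deriv i w x) / norm h) \<longlongrightarrow> 0) (at 0)"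
        by (simp add: has_vector_derivative_def has_derivative_at)
      have "((\<lambda>h. norm ((w (x + (0 + h) *\<^sub>R e) - w (x + 0 *\<^sub>R e)) /\<^sub>R h - partial_deriv i w x)) \<longlongrightarrow> 0) (at 0)"
      proof (rule Lim_transform_eventually[OF H])
        have "norm (z - h *\<^sub>R d) / norm h = norm (z /\<^sub>R h - d)" if "h \<noteq> 0" for z d :: complex and h :: real
        proof -
          have "z /\<^sub>R h - d = (z - h *\<^sub>R d) /\<^sub>R h" using that by (simp add: scaleR_diff_right)
          then show ?thesis by (simp add: divide_inverse mult.commute)
        qed
        then show "\<forall>\<^sub>F h in at 0. norm (w (x + (0 + h) *\<^sub>R e) - w (x + 0 *\<^sub>R e) - h *\<^sub>R partial_deriv i w x) / norm h =
          norm ((w (x + (0 + h) *\<^sub>R e) - w (x + 0 *\<^sub>R e)) /\<^sub>R h - partial_deriv i w x)"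
          by (auto simp: eventually_at_filter)
      qed
      then have "((\<lambda>h. (w (x + (0 + h) *\<^sub>R e) - w (x + 0 *\<^sub>R e)) /\<^sub>R h) \<longlongrightarrow> partial_deriv i w x) (at 0)"
        by (rule LIM_zero_cancel[OF tendsto_norm_zero_cancel])
      then have "(\<lambda>n. (w (x + (0 + t n) *\<^sub>R e) - w (x + 0 *\<^sub>R e)) /\<^sub>R t n) \<longlonglongrightarrow> partial_deriv i w x"
        by (rule filterlim_compose) (use t0 tn in \<open>auto simp: filterlim_at\<close>)
      then show "(\<lambda>n. q n x) \<longlonglongrightarrow> partial_deriv i w x"
        by (simp add: q_def scaleR_conv_of_real divide_inverse mult.commute)
    qed
    show "AE x in lborel. norm (q n x) \<le> real CARD('n) * B * 2 ^ K * (1 / (1 + norm x) ^ K)" for n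
    proof (rule AE_I2)
      fix x
      have "norm (w (x + t n *\<^sub>R e) - w x) \<le> real CARD('n) * (B * 2 ^ K / (1 + norm x) ^ K) * norm (t n *\<^sub>R e)"
      proof (rule norm_diff_line_le)
        fix s j assume s: "s \<in> {0..1::real}"
        have "norm (s *\<^sub>R t n *\<^sub>R e) \<le> 1" using s t[of n] by (simp add: e_def mult_le_one)
        then have "((1 + norm x) / 2) ^ K \<le> (1 + norm (x + s *\<^sub>R t n *\<^sub>R e)) ^ K"
          by (intro power_mono one_plus_norm_shift) auto
        then have "B / (1 + norm (x + s *\<^sub>R t n *\<^sub>R e)) ^ K \<le> B / ((1 + norm x) / 2) ^ K"
          by (intro divide_left_mono B0) (auto intro!: mult_pos_pos zero_less_power add_pos_nonneg)
        then show "norm (partial_deriv j w (x + s *\<^sub>R t n *\<^sub>R e)) \<le> B * 2 ^ K / (1 + norm x) ^ K"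
          using pd[of j "x + s *\<^sub>R t n *\<^sub>R e"] by (simp add: power_divide)
      qed (rule smooth_differentiable[OF sm])
      moreover have "norm (t n *\<^sub>R e) = t n" using t[of n] by (simp add: e_def)
      ultimately show "norm (q n x) \<le> real CARD('n) * B * 2 ^ K * (1 / (1 + norm x) ^ K)"
        using t[of n] by (simp add: q_def norm_divide divide_simps mult_ac)
    qed
  qed
  then show ?thesis using q0 by (simp add: LIMSEQ_const_iff)
qed

text \<open>Integration by parts: the integral of the derivative of \<open>v\<close> times a wave
  vanishes.\<close>

lemma fourier_int_partial_deriv:
  assumes v: "schwartz_fun v"
  shows "fourier_int (partial_deriv i v) x = \<i> * complex_of_real (x $ i) * fourier_int v x"
proof -
  have d: "v differentiable at y" "wave x differentiable at y" for y
    using smooth_differentiable[OF schwartz_fun_smooth[OF v]] wave_differentiable by blast+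
  have pd: "partial_deriv i (\<lambda>\<eta>. v \<eta> * wave x \<eta>) = (\<lambda>\<eta>. - \<i> * complex_of_real (x $ i) * (v \<eta> * wave \<eta> x) + partial_deriv i v \<eta> * wave \<eta> x)"
    by (rule ext, subst partial_deriv_mult[OF d]) (simp add: partial_deriv_wave wave_commute[of x])
  have i: "integrable lborel (\<lambda>\<eta>. v \<eta> * wave \<eta> x)" "integrable lborel (\<lambda>\<eta>. partial_deriv i v \<eta> * wave \<eta> x)"
    by (intro rapid_L1_integrable_wave schwartz_fun_rapid_L1 v schwartz_fun_partial_deriv)+
  have "0 = (LINT \<eta>|lborel. partial_deriv i (\<lambda>\<eta>. v \<eta> * wave x \<eta>) \<eta>)"
    by (rule integral_partial_deriv_eq_0[symmetric, OF schwartz_fun_mult_wave[OF v]])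
  also have "\<dots> = - \<i> * complex_of_real (x $ i) * fourier_int v x + fourier_int (partial_deriv i v) x"
    unfolding pd fourier_int_def
    by (subst Bochner_Integration.integral_add[OF integrable_mult_right[OF i(1)] i(2)], subst integral_mult_right_zero) simp
  finally show ?thesis by (simp add: algebra_simps eq_neg_iff_add_eq_0[symmetric])
qed

lemma fourier_int_partial_deriv_power:
  assumes v: "schwartz_fun v"
  shows "fourier_int (partial_derivs (replicate k i) v) x = (\<i> * complex_of_real (x $ i)) ^ k * fourier_int v x"
  by (induction k) (simp_all add: fourier_int_partial_deriv[OF schwartz_fun_partial_derivs[OF v]])

lemma derivs_le_wave_factor:
  "derivs_le l (\<lambda>\<eta>. (2 ^ l) ^ length js * (1 + norm \<eta>) ^ length js) (wave_factor js :: real ^ 'n::finite \<Rightarrow> complex)"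
proof (induction js)
  case Nil
  have "derivs_le l (\<lambda>\<eta>. 1) (\<lambda>\<eta>. 1 :: complex)" by (rule derivs_le_const) simp
  then show ?case by (simp add: wave_factor_def)
next
  case (Cons j js)
  have "derivs_le l (\<lambda>\<eta>. norm (- \<i>) * (\<bar>1\<bar> * (1 + norm (\<eta> - 0)))) (\<lambda>\<eta>. - \<i> * coord 1 j 0 \<eta>)"
    by (rule derivs_le_cmult[OF derivs_le_coord])
  from derivs_le_mult[OF this Cons.IH] show ?case
    by (simp add: coord_def wave_factor_def mult_ac power_mult_distrib)
qed

text \<open>Quantitative continuity of the Fourier integral on the Schwartz space. Derivatives of
  the transform multiply \<open>v\<close> by \<open>wave_factor\<close>, powers of a coordinate
  become derivatives, and pure powers suffice by \<open>weight_le_coords\<close>.\<close>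

proposition fourier_int_schwartz_le:
  "\<exists>C\<ge>0. \<exists>l. \<forall>v B. schwartz_fun v \<longrightarrow> schwartz_le l B v \<longrightarrow>
     schwartz_le k (C * B) (fourier_int (v :: real ^ 'n::finite \<Rightarrow> complex))"
proof -
  define K where "K = decay_deg TYPE('n)"
  \<comment> \<open>\<open>r\<close> covers the \<open>k\<close> derivatives from integration by
    parts and the decay \<open>K\<close> that makes the result integrable; the additional
    \<open>k\<close> in \<open>l\<close> pays for the growth of \<open>wave_factor\<close>.\<close>
  define r where "r = max k K"
  define l where "l = r + k"
  define M where "M = 2 ^ r * (2 ^ r) ^ k * decay_mass TYPE('n)"
  define C where "C = (1 + real CARD('n)) ^ Suc k * M"
  have M0: "0 \<le> M" by (simp add: M_def decay_mass_nonneg)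
  show ?thesis
  proof (intro exI[of _ C] exI[of _ l] conjI allI impI)
    show "0 \<le> C" by (simp add: C_def M0)
    fix v :: "real ^ 'n \<Rightarrow> complex" and B
    assume v: "schwartz_fun v" and B: "schwartz_le l B v"
    have rv: "rapid_L1 v" by (rule schwartz_fun_rapid_L1[OF v])
    have B0: "0 \<le> B" by (rule schwartz_le_nonneg[OF B])
    show "schwartz_le k (C * B) (fourier_int v)"
    proof (rule schwartz_leI[OF smooth_fourier_int[OF rv]])
      fix js :: "'n list" and x :: "real ^ 'n" assume js: "length js \<le> k"
      define u where "u = (\<lambda>\<eta>. wave_factor js \<eta> * v \<eta>)"
      have wf: "derivs_le r (\<lambda>\<eta>. (2 ^ r) ^ k * (1 + norm \<eta>) ^ k) (wave_factor js :: real ^ 'n \<Rightarrow> complex)"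
        by (rule derivs_le_mono[OF derivs_le_wave_factor order_refl]) (intro mult_mono power_increasing js, auto)
      have ub: "schwartz_le r (2 ^ r * (2 ^ r) ^ k * B) u"
        unfolding u_def by (rule schwartz_le_mult[OF wf B[unfolded l_def]])
      have "poly_growth (wave_factor js :: real ^ 'n \<Rightarrow> complex)"
        unfolding poly_growth_def using derivs_le_wave_factor by blast
      then have us: "schwartz_fun u" unfolding u_def by (rule schwartz_fun_mult[OF _ v])
      have fb: "norm (fourier_int (partial_derivs is u) x) \<le> M * B" if "length is \<le> k" for "is"
      proof -
        have "norm (partial_derivs is u \<eta> * wave \<eta> x) \<le> 2 ^ r * (2 ^ r) ^ k * B / (1 + norm \<eta>) ^ K" for \<eta>
        proof -
          have "length is \<le> r" using that by (simp add: r_def)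
          from schwartz_leD[OF ub this] have "norm (partial_derivs is u \<eta>) \<le> 2 ^ r * (2 ^ r) ^ k * B / (1 + norm \<eta>) ^ r"
            by (simp add: field_simps)
          also have "\<dots> \<le> 2 ^ r * (2 ^ r) ^ k * B / (1 + norm \<eta>) ^ K"
            by (intro divide_left_mono power_increasing) (use B0 in \<open>auto simp: r_def\<close>)
          finally show ?thesis by (simp add: norm_mult)
        qed
        then have "norm (fourier_int (partial_derivs is u) x) \<le> 2 ^ r * (2 ^ r) ^ k * B * decay_mass TYPE('n)"
          unfolding fourier_int_def K_def
          using smooth_measurable[OF smooth_partial_derivs[OF schwartz_fun_smooth[OF us]], of "is"]
          by (intro integral_decay_le(2) AE_I2) auto
        then show ?thesis by (simp add: M_def mult_ac)
      qed
      have 1: "norm (fourier_int u x) \<le> M * B" using fb[of "[]"] by simp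
      have 2: "\<bar>x $ i\<bar> ^ k * norm (fourier_int u x) \<le> M * B" for i
        using fb[of "replicate k i"] by (simp add: fourier_int_partial_deriv_power[OF us] norm_mult norm_power)
      have "(1 + norm x) ^ k * norm (fourier_int u x) \<le>
        (1 + real CARD('n)) ^ k * (1 + (\<Sum>i\<in>UNIV. \<bar>x $ i\<bar> ^ k)) * norm (fourier_int u x)"
        by (intro mult_right_mono weight_le_coords) auto
      also have "\<dots> = (1 + real CARD('n)) ^ k * (norm (fourier_int u x) +
          (\<Sum>i\<in>UNIV. \<bar>x $ i\<bar> ^ k * norm (fourier_int u x)))"
        by (simp add: algebra_simps sum_distrib_left sum_distrib_right)
      also have "\<dots> \<le> (1 + real CARD('n)) ^ k * (M * B + (\<Sum>i\<in>(UNIV::'n set). M * B))"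
        by (intro mult_left_mono add_mono sum_mono 1 2) auto
      also have "\<dots> = C * B" by (simp add: C_def algebra_simps)
      finally show "(1 + norm x) ^ k * norm (partial_derivs js (fourier_int v) x) \<le> C * B"
        by (simp add: partial_derivs_fourier_int[OF rv] u_def)
    qed
  qed
qed

lemma schwartz_fun_fourier_int: 
  assumes v: "schwartz_fun v"
  shows "schwartz_fun (fourier_int v)"
proof (rule schwartz_funI)
  fix k
  obtain C l where C: "\<And>B. schwartz_le l B v \<Longrightarrow> schwartz_le k (C * B) (fourier_int v)"
    using fourier_int_schwartz_le[of k] v by blast
  obtain B where "schwartz_le l B v" using v unfolding schwartz_fun_iff by blast
  from C[OF this] show "\<exists>B. schwartz_le k B (fourier_int v)" by blast
qed

section \<open>Scaled cutoffs and density of test functions\<close>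

lemma scale_has_derivative:
  fixes f :: "real ^ 'n::finite \<Rightarrow> complex"
  assumes "(f has_derivative f') (at (e *\<^sub>R x))"
  shows "((\<lambda>x. f (e *\<^sub>R x)) has_derivative (\<lambda>v. f' (e *\<^sub>R v))) (at x)"
  by (rule has_derivative_compose[where f = "\<lambda>x. e *\<^sub>R x" and g = f])
    (use assms in \<open>auto intro!: derivative_eq_intros\<close>)

lemma partial_derivs_scale:
  fixes f :: "real ^ 'n::finite \<Rightarrow> complex"
  assumes f: "smooth f"
  shows "partial_derivs js (\<lambda>x. f (e *\<^sub>R x)) = (\<lambda>x. complex_of_real (e ^ length js) * partial_derivs js f (e *\<^sub>R x))"
    and "smooth (\<lambda>x. f (e *\<^sub>R x))"
proof -
  have d: "(\<lambda>x. partial_derivs js f (e *\<^sub>R x)) differentiable at x" for js x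
    using f scale_has_derivative unfolding smooth_def differentiable_def by blast
  have 1: "partial_derivs js (\<lambda>x. f (e *\<^sub>R x)) = (\<lambda>x. complex_of_real (e ^ length js) * partial_derivs js f (e *\<^sub>R x))" for js
  proof (induction js)
    case (Cons j js)
    have "partial_deriv j (\<lambda>x. partial_derivs js f (e *\<^sub>R x)) x = complex_of_real e * partial_deriv j (partial_derivs js f) (e *\<^sub>R x)" for x
    proof -
      obtain f' where f': "(partial_derivs js f has_derivative f') (at (e *\<^sub>R x))"
        using f unfolding smooth_def differentiable_def by blast
      have "partial_deriv j (\<lambda>x. partial_derivs js f (e *\<^sub>R x)) x = f' (e *\<^sub>R axis j 1)"
        by (rule partial_deriv_eq[OF scale_has_derivative[OF f']])
      also have "\<dots> = e *\<^sub>R f' (axis j 1)"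
        by (rule linear_cmul[OF has_derivative_linear[OF f']])
      also have "f' (axis j 1) = partial_deriv j (partial_derivs js f) (e *\<^sub>R x)"
        by (rule partial_deriv_eq[OF f', symmetric])
      finally show ?thesis by (simp only: scaleR_conv_of_real[where 'a = complex])
    qed
    then show ?case
      by (intro ext) (simp add: Cons partial_deriv_cmult[OF d] mult_ac)
  qed simp
  then show "partial_derivs js (\<lambda>x. f (e *\<^sub>R x)) = (\<lambda>x. complex_of_real (e ^ length js) * partial_derivs js f (e *\<^sub>R x))" .
  show "smooth (\<lambda>x. f (e *\<^sub>R x))"
    unfolding smooth_def 1 by (auto intro!: derivative_intros d)
qed

lemma test_fun_scale:
  fixes f :: "real ^ 'n::finite \<Rightarrow> complex"
  assumes f: "test_fun f" and e: "e \<noteq> 0"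
  shows "test_fun (\<lambda>x. f (e *\<^sub>R x))"
proof -
  have c: "compact ((\<lambda>y. (1 / e) *\<^sub>R y) ` supp f)"
    using f by (intro compact_continuous_image continuous_intros) (simp add: test_fun_def)
  have "x \<in> (\<lambda>y. (1 / e) *\<^sub>R y) ` supp f" if "f (e *\<^sub>R x) \<noteq> 0" for x
    using test_fun_zero_outside[of "e *\<^sub>R x" f] that e by (intro image_eqI[of _ _ "e *\<^sub>R x"]) auto
  then have "supp (\<lambda>x. f (e *\<^sub>R x)) \<subseteq> (\<lambda>y. (1 / e) *\<^sub>R y) ` supp f"
    unfolding supp_def[of "\<lambda>x. f (e *\<^sub>R x)"] by (intro closure_minimal compact_imp_closed[OF c]) auto
  then have "compact (supp (\<lambda>x. f (e *\<^sub>R x)))"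
    using c bounded_subset compact_imp_bounded by (auto simp: compact_eq_bounded_closed supp_def)
  then show ?thesis using f partial_derivs_scale(2) by (auto simp: test_fun_def)
qed

lemma ex_cutoff: obtains \<theta> :: "real ^ 'n::finite \<Rightarrow> complex" where "test_fun \<theta>" "\<theta> 0 = 1"
proof
  \<comment> \<open>The value of the bump at its centre is \<open>exp (- 1)\<close>, which
    \<open>exp 1\<close> compensates.\<close>
  define \<theta> :: "real ^ 'n \<Rightarrow> complex" where "\<theta> x = complex_of_real (exp 1) * flat_bump 0 1 0 x" for x
  show "test_fun \<theta>" unfolding \<theta>_def[abs_def] by (intro test_fun_mult test_fun_flat_bump) auto
  show "\<theta> 0 = 1" by (simp add: \<theta>_def flat_bump_def flat_def exp_minus flip: of_real_mult)
qed

text \<open>At order 0 the mean value inequality applies because \<theta> is 1 at the origin; every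
  derivative of positive order carries a factor \<open>e\<close> from the scaling. Relative to 1 +
  |x| the cutoff error is thus of order \<open>e\<close>.\<close>

lemma derivs_le_cutoff:
  fixes \<theta> :: "real ^ 'n::finite \<Rightarrow> complex"
  assumes \<theta>: "test_fun \<theta>" "\<theta> 0 = 1"
  obtains M where "\<And>e. 0 < e \<Longrightarrow> e \<le> 1 \<Longrightarrow> derivs_le k (\<lambda>x. (e * M) * (1 + norm x) ^ 1) (\<lambda>x. 1 - \<theta> (e *\<^sub>R x))"
proof -
  have sm: "smooth \<theta>" using \<theta> by (simp add: test_fun_def)
  obtain B where "schwartz_le (Suc k) B \<theta>" using test_fun_schwartz[OF \<theta>(1)] unfolding schwartz_fun_iff by blast
  note B0 = schwartz_le_nonneg[OF this]
  have B: "norm (partial_derivs js \<theta> x) \<le> B" if "length js \<le> Suc k" for js x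
  proof -
    have "1 * norm (partial_derivs js \<theta> x) \<le> (1 + norm x) ^ Suc k * norm (partial_derivs js \<theta> x)"
      by (intro mult_right_mono one_plus_norm_pos(6)) auto
    also have "\<dots> \<le> B" by (rule schwartz_leD[OF \<open>schwartz_le (Suc k) B \<theta>\<close> that])
    finally show ?thesis by simp
  qed
  define M where "M = (real CARD('n) + 1) * B"
  have M: "B \<le> M" "real CARD('n) * B \<le> M" "0 \<le> M" using B0 by (auto simp: M_def algebra_simps)
  show ?thesis
  proof (rule that)
    fix e :: real assume e: "0 < e" "e \<le> 1"
    have eq: "(\<lambda>x. 1 - \<theta> (e *\<^sub>R x)) = (\<lambda>x. 1 + (-1) * \<theta> (e *\<^sub>R x))" by simp
    have sm': "smooth (\<lambda>x. 1 - \<theta> (e *\<^sub>R x))"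
      by (intro smooth_diff smooth_const partial_derivs_scale(2) sm)
    show "derivs_le k (\<lambda>x. (e * M) * (1 + norm x) ^ 1) (\<lambda>x. 1 - \<theta> (e *\<^sub>R x))"
      unfolding smooth_derivs_le_iff[OF sm']
    proof (intro allI impI)
      fix js :: "'n list" and x assume js: "length js \<le> k"
      show "norm (partial_derivs js (\<lambda>x. 1 - \<theta> (e *\<^sub>R x)) x) \<le> (e * M) * (1 + norm x) ^ 1"
      proof (cases js rule: rev_cases)
        case Nil
        have "norm (\<theta> (0 + e *\<^sub>R x) - \<theta> 0) \<le> real CARD('n) * B * norm (e *\<^sub>R x)"
        proof (rule norm_diff_line_le)
          show "norm (partial_deriv i \<theta> (0 + t *\<^sub>R e *\<^sub>R x)) \<le> B" for i t
            using B[of "[i]"] by simp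
        qed (rule smooth_differentiable[OF sm])
        also have "\<dots> \<le> M * (e * norm x)"
          using e M by (simp add: mult_right_mono)
        also have "\<dots> \<le> (e * M) * (1 + norm x)" using e M by (simp add: algebra_simps)
        finally show ?thesis using Nil \<theta>(2) by (simp add: norm_minus_commute)
      next
        case (snoc ys y)
        have "partial_derivs js (\<lambda>x. 1 - \<theta> (e *\<^sub>R x)) x = partial_derivs js (\<lambda>x. 1) x - complex_of_real (e ^ length js) * partial_derivs js \<theta> (e *\<^sub>R x)"
          unfolding eq by (simp only: partial_derivs_add[OF smooth_const smooth_cmult[OF partial_derivs_scale(2)[OF sm]]]
            partial_derivs_cmult[OF partial_derivs_scale(2)[OF sm]] partial_derivs_scale(1)[OF sm]) simp
        moreover have "partial_derivs js (\<lambda>x. 1) x = 0"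
          by (simp add: snoc partial_derivs_const)
        ultimately have "norm (partial_derivs js (\<lambda>x. 1 - \<theta> (e *\<^sub>R x)) x) = e ^ length js * norm (partial_derivs js \<theta> (e *\<^sub>R x))"
          using e by (simp add: norm_mult norm_power)
        also have "\<dots> \<le> e * B"
        proof (rule mult_mono)
          show "e ^ length js \<le> e" using e power_decreasing[of 1 "length js" e] by (simp add: snoc)
          show "norm (partial_derivs js \<theta> (e *\<^sub>R x)) \<le> B" using js by (intro B) simp
        qed (use e in auto)
        also have "\<dots> \<le> e * M" using e M by (intro mult_left_mono) auto
        also have "\<dots> \<le> (e * M) * (1 + norm x) ^ 1"
          using e M by (simp add: distrib_left)
        finally show ?thesis .
      qed
    qed
  qed
qed

lemma inverse_Suc_unit: "0 < 1 / real (Suc n)" "1 / real (Suc n) \<le> 1"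
  by auto

text \<open>The cutoffs of \<open>v\<close> converge to \<open>v\<close> at rate \<open>e n\<close>
  in a seminorm that controls \<open>u\<close> after the Fourier integral, while the integrals
  against \<open>G\<close> converge by domination. Hence a density known on test functions is valid
  for Schwartz functions.\<close>

proposition fourier_int_density:
  fixes u :: "'n::finite functional" and G v :: "real ^ 'n \<Rightarrow> complex"
  assumes u: "tempered_distribution u" and Gm: "G \<in> borel_measurable borel"
    and G: "AE \<eta> in lborel. norm (G \<eta>) \<le> C * (1 + norm \<eta>) ^ m"
    and test: "\<And>\<psi>. test_fun \<psi> \<Longrightarrow> u (fourier_int \<psi>) = (LINT \<eta>|lborel. G \<eta> * \<psi> \<eta>)"
    and v: "schwartz_fun v"
  shows "u (fourier_int v) = (LINT \<eta>|lborel. G \<eta> * v \<eta>)"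
proof -
  note [measurable] = Gm smooth_measurable[OF schwartz_fun_smooth[OF v]]
  obtain \<theta> :: "real ^ 'n \<Rightarrow> complex" where \<theta>: "test_fun \<theta>" "\<theta> 0 = 1" by (rule ex_cutoff)
  have sm\<theta>: "smooth \<theta>" using \<theta> by (simp add: test_fun_def)
  obtain Cu k where Cu: "0 \<le> Cu" "\<And>f B. schwartz_fun f \<Longrightarrow> schwartz_le k B f \<Longrightarrow> norm (u f) \<le> Cu * B"
    using tempered_distributionE[OF u] by blast
  obtain Cf l where Cf: "0 \<le> Cf" "\<And>v B. schwartz_fun v \<Longrightarrow> schwartz_le l B v \<Longrightarrow> schwartz_le k (Cf * B) (fourier_int (v :: real ^ 'n \<Rightarrow> complex))"
    using fourier_int_schwartz_le[of k, where 'n='n] by blast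
  obtain B where B: "schwartz_le (l + 1) B v" using v unfolding schwartz_fun_iff by blast
  obtain M where M: "\<And>e. 0 < e \<Longrightarrow> e \<le> 1 \<Longrightarrow> derivs_le l (\<lambda>x. (e * M) * (1 + norm x) ^ 1) (\<lambda>x. 1 - \<theta> (e *\<^sub>R x))"
    using derivs_le_cutoff[OF \<theta>] by blast
  define e where "e n = 1 / real (Suc n)" for n
  have e: "0 < e n" "e n \<le> 1" for n unfolding e_def by (rule inverse_Suc_unit)+
  have e0: "e \<longlonglongrightarrow> 0" unfolding e_def by (rule LIMSEQ_Suc[OF lim_1_over_n])
  define \<psi> where "\<psi> n = (\<lambda>x. v x * \<theta> (e n *\<^sub>R x))" for n
  have \<psi>: "test_fun (\<psi> n)" for n
    unfolding \<psi>_def using e[of n] by (intro test_fun_mult test_fun_scale \<theta> schwartz_fun_smooth v) auto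
  note \<psi>s = test_fun_schwartz[OF \<psi>]
  have bd: "norm (u (fourier_int v) - u (fourier_int (\<psi> n))) \<le> Cu * (Cf * (2 ^ l * (e n * M) * B))" for n
  proof -
    have eq: "(\<lambda>x. (1 - \<theta> (e n *\<^sub>R x)) * v x) = (\<lambda>x. v x - \<psi> n x)"
      by (simp add: \<psi>_def algebra_simps)
    have "schwartz_le l (2 ^ l * (e n * M) * B) (\<lambda>x. v x - \<psi> n x)"
      using schwartz_le_mult[OF M[OF e(1)[of n] e(2)[of n]] B] by (simp only: eq)
    moreover have sd: "schwartz_fun (\<lambda>x. v x - \<psi> n x)" by (intro schwartz_fun_diff v \<psi>s)
    ultimately have "schwartz_le k (Cf * (2 ^ l * (e n * M) * B)) (fourier_int (\<lambda>x. v x - \<psi> n x))"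
      by (intro Cf)
    from Cu(2)[OF schwartz_fun_fourier_int[OF sd] this]
    have "norm (u (fourier_int (\<lambda>x. v x - \<psi> n x))) \<le> Cu * (Cf * (2 ^ l * (e n * M) * B))" .
    moreover have "fourier_int (\<lambda>x. v x - \<psi> n x) = (\<lambda>x. fourier_int v x - fourier_int (\<psi> n) x)"
    proof
      fix x
      have "integrable lborel (\<lambda>\<eta>. v \<eta> * wave \<eta> x)" "integrable lborel (\<lambda>\<eta>. \<psi> n \<eta> * wave \<eta> x)"
        by (intro rapid_L1_integrable_wave schwartz_fun_rapid_L1 v \<psi>s)+
      then show "fourier_int (\<lambda>x. v x - \<psi> n x) x = fourier_int v x - fourier_int (\<psi> n) x"
        by (simp add: fourier_int_def left_diff_distrib Bochner_Integration.integral_diff)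
    qed
    ultimately show ?thesis
      by (simp add: tempered_diff[OF u schwartz_fun_fourier_int[OF v] schwartz_fun_fourier_int[OF \<psi>s]])
  qed
  have "(\<lambda>n. Cu * (Cf * (2 ^ l * (e n * M) * B))) \<longlonglongrightarrow> Cu * (Cf * (2 ^ l * (0 * M) * B))"
    by (intro tendsto_intros e0)
  then have lim: "(\<lambda>n. Cu * (Cf * (2 ^ l * (e n * M) * B))) \<longlonglongrightarrow> 0" by simp
  have "(\<lambda>n. u (fourier_int v) - u (fourier_int (\<psi> n))) \<longlonglongrightarrow> 0"
    by (rule Lim_null_comparison[OF always_eventually[OF allI[OF bd]] lim])
  from tendsto_diff[OF tendsto_const[of "u (fourier_int v)"] this]
  have "(\<lambda>n. u (fourier_int (\<psi> n))) \<longlonglongrightarrow> u (fourier_int v)" by simp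
  moreover have "(\<lambda>n. LINT \<eta>|lborel. G \<eta> * \<psi> n \<eta>) \<longlonglongrightarrow> (LINT \<eta>|lborel. G \<eta> * v \<eta>)"
  proof -
    obtain D where D: "schwartz_le 0 D \<theta>" using test_fun_schwartz[OF \<theta>(1)] unfolding schwartz_fun_iff by blast
    then have D': "norm (\<theta> x) \<le> D" for x using derivs_leD(3) unfolding schwartz_le_def by fastforce
    have D0: "0 \<le> D" by (rule schwartz_le_nonneg[OF D])
    show ?thesis
    proof (rule integral_dominated_convergence[where w = "\<lambda>\<eta>. C * D * ((1 + norm \<eta>) ^ m * norm (v \<eta>))"])
      show "(\<lambda>\<eta>. G \<eta> * v \<eta>) \<in> borel_measurable lborel" by measurable
      show "(\<lambda>\<eta>. G \<eta> * \<psi> n \<eta>) \<in> borel_measurable lborel" for n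
        using smooth_measurable[OF schwartz_fun_smooth[OF \<psi>s[of n]]] by measurable
      show "integrable lborel (\<lambda>\<eta>. C * D * ((1 + norm \<eta>) ^ m * norm (v \<eta>)))"
        using schwartz_fun_rapid_L1[OF v] unfolding rapid_L1_def by (intro integrable_mult_right) blast
      show "AE \<eta> in lborel. (\<lambda>n. G \<eta> * \<psi> n \<eta>) \<longlonglongrightarrow> G \<eta> * v \<eta>"
      proof (rule AE_I2)
        fix \<eta> :: "real ^ 'n"
        have "(\<lambda>n. e n *\<^sub>R \<eta>) \<longlonglongrightarrow> 0" using tendsto_scaleR[OF e0 tendsto_const[of \<eta>]] by simp
        with smooth_continuous[OF sm\<theta>, of UNIV] have "(\<lambda>n. \<theta> (e n *\<^sub>R \<eta>)) \<longlonglongrightarrow> \<theta> 0"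
          by (rule continuous_on_tendsto_compose) auto
        then have "(\<lambda>n. G \<eta> * (v \<eta> * \<theta> (e n *\<^sub>R \<eta>))) \<longlonglongrightarrow> G \<eta> * (v \<eta> * 1)"
          unfolding \<theta>(2) by (intro tendsto_intros)
        then show "(\<lambda>n. G \<eta> * \<psi> n \<eta>) \<longlonglongrightarrow> G \<eta> * v \<eta>" by (simp add: \<psi>_def)
      qed
      show "AE \<eta> in lborel. norm (G \<eta> * \<psi> n \<eta>) \<le> C * D * ((1 + norm \<eta>) ^ m * norm (v \<eta>))" for n
        using G
      proof eventually_elim
        case (elim \<eta>)
        have "norm (G \<eta> * \<psi> n \<eta>) = norm (G \<eta>) * (norm (v \<eta>) * norm (\<theta> (e n *\<^sub>R \<eta>)))"
          by (simp add: \<psi>_def norm_mult)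
        also have "\<dots> \<le> (C * (1 + norm \<eta>) ^ m) * (norm (v \<eta>) * D)"
          by (intro mult_mono mult_left_mono elim D') (use order_trans[OF norm_ge_zero elim] D0 in auto)
        finally show ?case by (simp add: mult_ac)
      qed
    qed
  qed
  ultimately show ?thesis
    unfolding test[OF \<psi>] by (rule LIMSEQ_unique)
qed

section \<open>Fourier inversion\<close>

text \<open>Fubini's theorem; no reflection appears because plane waves are symmetric in position
  and frequency.\<close>

lemma fourier_int_swap:
  fixes a b :: "real ^ 'n::finite \<Rightarrow> complex"
  assumes a: "integrable lborel a" and b: "integrable lborel b"
  shows "(LINT x|lborel. a x * fourier_int b x) = (LINT \<eta>|lborel. fourier_int a \<eta> * b \<eta>)"
proof -
  note [measurable] = borel_measurable_integrable[OF a] borel_measurable_integrable[OF b]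
  define f where "f x \<eta> = a x * wave x \<eta> * b \<eta>" for x \<eta>
  have "integrable (lborel \<Otimes>\<^sub>M lborel) (\<lambda>(x, \<eta>). f x \<eta>)"
  proof (rule lborel_pair.Fubini_integrable)
    show "(\<lambda>(x, \<eta>). f x \<eta>) \<in> borel_measurable (lborel \<Otimes>\<^sub>M lborel)"
      unfolding f_def by measurable
    have "(LINT \<eta>|lborel. norm (f x \<eta>)) = norm (a x) * (LINT \<eta>|lborel. norm (b \<eta>))" for x
      unfolding f_def norm_mult norm_wave by simp
    then show "integrable lborel (\<lambda>x. LINT \<eta>|lborel. norm (case (x, \<eta>) of (x, \<eta>) \<Rightarrow> f x \<eta>))"
      using a by (simp add: integrable_norm)
    show "AE x in lborel. integrable lborel (\<lambda>\<eta>. case (x, \<eta>) of (x, \<eta>) \<Rightarrow> f x \<eta>)"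
    proof (rule AE_I2)
      fix x
      show "integrable lborel (\<lambda>\<eta>. case (x, \<eta>) of (x, \<eta>) \<Rightarrow> f x \<eta>)"
        by (rule Bochner_Integration.integrable_bound[OF integrable_mult_right[OF b, of "a x"]])
          (auto simp: f_def norm_mult)
    qed
  qed
  from lborel_pair.Fubini_integral[OF this]
  have "(LINT \<eta>|lborel. LINT x|lborel. f x \<eta>) = (LINT x|lborel. LINT \<eta>|lborel. f x \<eta>)" .
  moreover have "(LINT x|lborel. f x \<eta>) = fourier_int a \<eta> * b \<eta>" for \<eta>
    by (simp add: f_def fourier_int_def)
  moreover have "(LINT \<eta>|lborel. f x \<eta>) = a x * fourier_int b x" for x
    unfolding f_def fourier_int_def
    by (subst integral_mult_right_zero[symmetric]) (simp add: wave_commute mult_ac)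
  ultimately show ?thesis by simp
qed

text \<open>Comparison with the kernel of twice the variance: s exp(-s^2) \<le> exp(-s^2 / 2) spends
  half of the exponent, and the wider kernel has total mass 1.\<close>

lemma gauss_kernel_first_moment:
  assumes a: "0 < a"
  shows "integrable lborel (\<lambda>z :: real ^ 'n::finite. norm z * norm (gauss_kernel a 0 z))"
    and "(LINT z|lborel. norm z * norm (gauss_kernel a (0 :: real ^ 'n) z)) \<le> 2 * sqrt a * sqrt 2 ^ CARD('n)"
proof -
  have le: "norm z * norm (gauss_kernel a (0 :: real ^ 'n) z) \<le> 2 * sqrt a * sqrt 2 ^ CARD('n) * norm (gauss_kernel (2 * a) (0 :: real ^ 'n) z)" for z
  proof -
    define s where "s = norm z / (2 * sqrt a)"
    have "s \<le> 1 + s\<^sup>2 / 2"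
      using sum_squares_ge_zero[of "s - 1" 0] by (simp add: power2_eq_square algebra_simps)
    also have "\<dots> \<le> exp (s\<^sup>2 / 2)" by (rule exp_ge_add_one_self)
    finally have "s * exp (- s\<^sup>2) \<le> exp (s\<^sup>2 / 2) * exp (- s\<^sup>2)" by (rule mult_right_mono) simp
    also have "\<dots> = exp (- (s\<^sup>2 / 2))" by (simp flip: exp_add)
    finally have s: "s * exp (- s\<^sup>2) \<le> exp (- (s\<^sup>2 / 2))" .
    have s2: "s\<^sup>2 = (norm z)\<^sup>2 / (4 * a)" using a by (simp add: s_def power_divide power_mult_distrib)
    have "norm z * exp (- (norm z)\<^sup>2 / (4 * a)) = 2 * sqrt a * (s * exp (- s\<^sup>2))"
      using a by (simp add: s2) (simp add: s_def)
    also have "\<dots> \<le> 2 * sqrt a * exp (- (s\<^sup>2 / 2))" using s a by (intro mult_left_mono) auto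
    also have "s\<^sup>2 / 2 = (norm z)\<^sup>2 / (4 * (2 * a))" by (simp add: s2)
    finally have "sqrt (1 / (4 * pi * a)) ^ CARD('n) * (norm z * exp (- (norm z)\<^sup>2 / (4 * a))) \<le>
       sqrt (1 / (4 * pi * a)) ^ CARD('n) * (2 * sqrt a * exp (- ((norm z)\<^sup>2 / (4 * (2 * a)))))"
      using a by (intro mult_left_mono) auto
    moreover have "sqrt (1 / (4 * pi * a)) ^ CARD('n) = sqrt 2 ^ CARD('n) * sqrt (1 / (4 * pi * (2 * a))) ^ CARD('n)"
    proof -
      have "sqrt (1 / (4 * pi * a)) = sqrt 2 * sqrt (1 / (4 * pi * (2 * a)))"
        using a by (simp flip: real_sqrt_mult)
      then show ?thesis by (simp add: power_mult_distrib)
    qed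
    ultimately show ?thesis using a by (simp add: norm_gauss_kernel mult_ac)
  qed
  have i: "integrable lborel (\<lambda>z. 2 * sqrt a * sqrt 2 ^ CARD('n) * norm (gauss_kernel (2 * a) (0 :: real ^ 'n) z))"
    using schwartz_fun_rapid_L1[OF schwartz_fun_gauss_kernel[of "2 * a" "0 :: real ^ 'n"]] a rapid_L1_integrable_wave[of "gauss_kernel (2 * a) 0" 0]
    by (intro integrable_mult_right integrable_norm) simp
  have [measurable]: "gauss_kernel a (0 :: real ^ 'n) \<in> borel_measurable borel"
    using a by (intro smooth_measurable schwartz_fun_smooth schwartz_fun_gauss_kernel)
  show f: "integrable lborel (\<lambda>z :: real ^ 'n. norm z * norm (gauss_kernel a 0 z))"
    by (rule Bochner_Integration.integrable_bound[OF i]) (use le a in \<open>auto simp: abs_mult\<close>)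
  have "(LINT z|lborel. norm z * norm (gauss_kernel a (0 :: real ^ 'n) z)) \<le> (LINT z|lborel. 2 * sqrt a * sqrt 2 ^ CARD('n) * norm (gauss_kernel (2 * a) (0 :: real ^ 'n) z))"
    by (rule integral_mono[OF f i le])
  also have "\<dots> = 2 * sqrt a * sqrt 2 ^ CARD('n)"
    using a by (simp add: integral_norm_gauss_kernel)
  finally show "(LINT z|lborel. norm z * norm (gauss_kernel a (0 :: real ^ 'n) z)) \<le> 2 * sqrt a * sqrt 2 ^ CARD('n)" .
qed

text \<open>With Gaussian damping the integrals may be swapped, which turns the damping factor into
  an approximate identity; its error is at most the Lipschitz constant of \<theta> times the first
  moment of the kernel.\<close>

theorem fourier_inversion:
  fixes \<theta> :: "real ^ 'n::finite \<Rightarrow> complex"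
  assumes \<theta>: "schwartz_fun \<theta>"
  shows "fourier_int (fourier_int \<theta>) (- y) = complex_of_real ((2 * pi) ^ CARD('n)) * \<theta> y"
proof -
  have sm: "smooth \<theta>" by (rule schwartz_fun_smooth[OF \<theta>])
  note [measurable] = smooth_measurable[OF sm]
  have f: "schwartz_fun (fourier_int \<theta>)" by (rule schwartz_fun_fourier_int[OF \<theta>])
  note [measurable] = smooth_measurable[OF schwartz_fun_smooth[OF f]]
  have \<theta>i: "integrable lborel \<theta>"
    using rapid_L1_integrable_wave[OF schwartz_fun_rapid_L1[OF \<theta>], of 0] by simp
  obtain B where "schwartz_le 1 B \<theta>" using \<theta> unfolding schwartz_fun_iff by blast
  note B0 = schwartz_le_nonneg[OF this]
  have B: "norm (partial_deriv i \<theta> x) \<le> B" for i x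
  proof -
    have "1 * norm (partial_derivs [i] \<theta> x) \<le> (1 + norm x) ^ 1 * norm (partial_derivs [i] \<theta> x)"
      by (intro mult_right_mono one_plus_norm_pos(6)) auto
    also have "\<dots> \<le> B" by (rule schwartz_leD[OF \<open>schwartz_le 1 B \<theta>\<close>]) simp
    finally show ?thesis by simp
  qed
  define L where "L = real CARD('n) * B"
  have L: "norm (\<theta> (y + z) - \<theta> y) \<le> L * norm z" for z
    unfolding L_def by (rule norm_diff_line_le[OF smooth_differentiable[OF sm] B])
  have L0: "0 \<le> L" using B0 by (simp add: L_def)
  define P where "P = complex_of_real ((2 * pi) ^ CARD('n))"
  define e where "e n = 1 / real (Suc n)" for n
  have e: "0 < e n" "e n \<le> 1" for n unfolding e_def by (rule inverse_Suc_unit)+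
  have e0: "e \<longlonglongrightarrow> 0" unfolding e_def by (rule LIMSEQ_Suc[OF lim_1_over_n])
  \<comment> \<open>The inversion integral with damping: the swap evaluates it near \<theta> at
    \<open>y\<close>, and removing the damping leads back to the double transform.\<close>
  define J where "J n = (LINT \<eta>|lborel. fourier_int \<theta> \<eta> * (wave \<eta> (- y) * gauss (e n) 0 \<eta>))" for n
  have J: "J n = P * (LINT z|lborel. \<theta> (y + z) * gauss_kernel (e n) 0 z)" for n
  proof -
    have bi: "integrable lborel (\<lambda>\<eta>. wave \<eta> (- y) * gauss (e n) 0 \<eta>)"
      using rapid_L1_integrable_wave[OF schwartz_fun_rapid_L1[OF schwartz_fun_gauss[OF e(1)]], of n 0 "- y"]
      by (simp add: mult.commute)
    have fb: "fourier_int (\<lambda>\<eta>. wave \<eta> (- y) * gauss (e n) 0 \<eta>) x = P * gauss_kernel (e n) 0 (x - y)" for x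
    proof -
      have "fourier_int (\<lambda>\<eta>. wave \<eta> (- y) * gauss (e n) 0 \<eta>) x = fourier_int (gauss (e n) 0) (x - y)"
        unfolding fourier_int_def using wave_add'[of _ x "- y"] by (simp add: mult_ac)
      also have "\<dots> = complex_of_real (sqrt (pi / e n) ^ CARD('n)) * gauss (1 / (4 * e n)) 0 (x - y)"
        by (rule fourier_int_gauss[OF e(1)])
      \<comment> \<open>Source of one factor 2 pi per dimension: the transform of the damping
        Gaussian is this multiple of a kernel of total mass 1.\<close>
      also have "sqrt (pi / e n) = (2 * pi) * sqrt (1 / (4 * pi * e n))"
      proof -
        have "pi / e n = (2 * pi)\<^sup>2 * (1 / (4 * pi * e n))" using e(1)[of n] by (simp add: power2_eq_square field_simps)
        then have "sqrt (pi / e n) = sqrt ((2 * pi)\<^sup>2 * (1 / (4 * pi * e n)))" by simp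
        also have "\<dots> = (2 * pi) * sqrt (1 / (4 * pi * e n))"
        proof -
          have "sqrt ((2 * pi)\<^sup>2) = 2 * pi" by (rule real_sqrt_unique) auto
          then show ?thesis by (simp only: real_sqrt_mult)
        qed
        finally show ?thesis .
      qed
      finally show ?thesis by (simp add: P_def gauss_kernel_def power_mult_distrib)
    qed
    have "J n = (LINT x|lborel. \<theta> x * fourier_int (\<lambda>\<eta>. wave \<eta> (- y) * gauss (e n) 0 \<eta>) x)"
      unfolding J_def by (rule fourier_int_swap[OF \<theta>i bi, symmetric])
    also have "\<dots> = (LINT x|lborel. P * (\<theta> x * gauss_kernel (e n) 0 (x - y)))"
      unfolding fb by (simp add: mult_ac)
    also have "\<dots> = P * (LINT x|lborel. \<theta> x * gauss_kernel (e n) 0 (x - y))" by (rule integral_mult_right_zero)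
    also have "(LINT x|lborel. \<theta> x * gauss_kernel (e n) 0 (x - y)) = (LINT z|lborel. \<theta> (y + z) * gauss_kernel (e n) 0 (y + z - y))"
    proof (rule lborel_integral_shift(1)[symmetric])
      have [measurable]: "gauss_kernel (e n) (0 :: real ^ 'n) \<in> borel_measurable borel"
        by (intro smooth_measurable schwartz_fun_smooth schwartz_fun_gauss_kernel e)
      show "(\<lambda>x. \<theta> x * gauss_kernel (e n) 0 (x - y)) \<in> borel_measurable borel" by measurable
    qed
    finally show ?thesis by simp
  qed
  have bd: "norm (J n - P * \<theta> y) \<le> norm P * (L * (2 * sqrt (e n) * sqrt 2 ^ CARD('n)))" for n
  proof -
    let ?k = "gauss_kernel (e n) (0 :: real ^ 'n)"
    have ki: "integrable lborel ?k"
      using rapid_L1_integrable_wave[OF schwartz_fun_rapid_L1[OF schwartz_fun_gauss_kernel[OF e(1)]], of n 0 0] by simp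
    note [measurable] = borel_measurable_integrable[OF ki]
    have "fourier_int ?k 0 = 1" by (simp add: fourier_int_gauss_kernel[OF e(1)] gauss_def)
    then have k1: "(LINT z|lborel. ?k z) = 1" by (simp add: fourier_int_def)
    have li: "integrable lborel (\<lambda>z. L * (norm z * norm (?k z)))"
      by (intro integrable_mult_right gauss_kernel_first_moment(1) e)
    have di: "integrable lborel (\<lambda>z. (\<theta> (y + z) - \<theta> y) * ?k z)"
    proof (rule Bochner_Integration.integrable_bound[OF li])
      show "AE z in lborel. norm ((\<theta> (y + z) - \<theta> y) * ?k z) \<le> norm (L * (norm z * norm (?k z)))"
        using L L0 by (auto intro!: AE_I2 mult_right_mono simp: norm_mult abs_mult mult.assoc[symmetric])
    qed measurable
    have "J n - P * \<theta> y = P * ((LINT z|lborel. (\<theta> (y + z) - \<theta> y) * ?k z + \<theta> y * ?k z) - \<theta> y)"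
      unfolding J by (simp add: algebra_simps)
    also have "(LINT z|lborel. (\<theta> (y + z) - \<theta> y) * ?k z + \<theta> y * ?k z) = (LINT z|lborel. (\<theta> (y + z) - \<theta> y) * ?k z) + \<theta> y"
      by (subst Bochner_Integration.integral_add[OF di integrable_mult_right[OF ki]]) (simp add: k1)
    finally have "norm (J n - P * \<theta> y) = norm P * norm (LINT z|lborel. (\<theta> (y + z) - \<theta> y) * ?k z)"
      by (simp add: norm_mult)
    also have "norm (LINT z|lborel. (\<theta> (y + z) - \<theta> y) * ?k z) \<le> (LINT z|lborel. norm ((\<theta> (y + z) - \<theta> y) * ?k z))"
      by (rule integral_norm_bound)
    also have "\<dots> \<le> (LINT z|lborel. L * (norm z * norm (?k z)))"
      by (rule integral_mono[OF integrable_norm[OF di] li])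
        (use L in \<open>auto intro!: mult_right_mono simp: norm_mult mult.assoc[symmetric]\<close>)
    also have "\<dots> = L * (LINT z|lborel. norm z * norm (?k z))" by (rule integral_mult_right_zero)
    also have "\<dots> \<le> L * (2 * sqrt (e n) * sqrt 2 ^ CARD('n))"
      by (intro mult_left_mono gauss_kernel_first_moment e L0)
    finally show ?thesis by (simp add: mult_left_mono)
  qed
  have lim: "(\<lambda>n. norm P * (L * (2 * sqrt (e n) * sqrt 2 ^ CARD('n)))) \<longlonglongrightarrow> 0"
  proof -
    have "(\<lambda>n. sqrt (e n)) \<longlonglongrightarrow> 0" using tendsto_real_sqrt[OF e0] by simp
    then have "(\<lambda>n. norm P * (L * (2 * sqrt (e n) * sqrt 2 ^ CARD('n)))) \<longlonglongrightarrow> norm P * (L * (2 * 0 * sqrt 2 ^ CARD('n)))"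
      by (intro tendsto_intros)
    then show ?thesis by simp
  qed
  have "(\<lambda>n. J n - P * \<theta> y) \<longlonglongrightarrow> 0"
    by (rule Lim_null_comparison[OF always_eventually[OF allI[OF bd]] lim])
  then have "J \<longlonglongrightarrow> P * \<theta> y" by (rule LIM_zero_cancel)
  moreover have "J \<longlonglongrightarrow> fourier_int (fourier_int \<theta>) (- y)"
    unfolding J_def fourier_int_def[of "fourier_int \<theta>"]
  proof (rule integral_dominated_convergence[where w = "\<lambda>\<eta>. norm (fourier_int \<theta> \<eta>)"])
    show "integrable lborel (\<lambda>\<eta>. norm (fourier_int \<theta> \<eta>))"
      using rapid_L1_integrable_wave[OF schwartz_fun_rapid_L1[OF f], of 0] by (intro integrable_norm) simp
    show "AE \<eta> in lborel. (\<lambda>n. fourier_int \<theta> \<eta> * (wave \<eta> (- y) * gauss (e n) 0 \<eta>)) \<longlonglongrightarrow> fourier_int \<theta> \<eta> * wave \<eta> (- y)"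
    proof (rule AE_I2)
      fix \<eta> :: "real ^ 'n"
      have "(\<lambda>n. exp (- e n * (norm (\<eta> - 0))\<^sup>2)) \<longlonglongrightarrow> 1"
        using e0 by (auto intro!: tendsto_eq_intros)
      then have "(\<lambda>n. gauss (e n) 0 \<eta>) \<longlonglongrightarrow> 1"
        unfolding gauss_def using tendsto_of_real by fastforce
      then have "(\<lambda>n. fourier_int \<theta> \<eta> * (wave \<eta> (- y) * gauss (e n) 0 \<eta>)) \<longlonglongrightarrow> fourier_int \<theta> \<eta> * (wave \<eta> (- y) * 1)"
        by (intro tendsto_intros)
      then show "(\<lambda>n. fourier_int \<theta> \<eta> * (wave \<eta> (- y) * gauss (e n) 0 \<eta>)) \<longlonglongrightarrow> fourier_int \<theta> \<eta> * wave \<eta> (- y)" by simp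
    qed
    show "AE \<eta> in lborel. norm (fourier_int \<theta> \<eta> * (wave \<eta> (- y) * gauss (e n) 0 \<eta>)) \<le> norm (fourier_int \<theta> \<eta>)" for n
      using e[of n] by (auto intro!: AE_I2 mult_left_le simp: norm_mult norm_gauss)
  qed measurable
  ultimately show ?thesis unfolding P_def by (rule LIMSEQ_unique[rotated])
qed

section \<open>Reflection invariance of Lebesgue measure\<close>

lemma lborel_reflect:
  "distr lborel borel uminus = (lborel :: (real ^ 'n::finite) measure)"
  by (subst lborel_affine[of "-1" 0]) (auto simp: density_1 one_ennreal_def[symmetric])

lemma lborel_integral_reflect:
  fixes f :: "real ^ 'n::finite \<Rightarrow> complex"
  assumes [measurable]: "f \<in> borel_measurable borel"
  shows "(LINT x|lborel. f (- x)) = (LINT x|lborel. f x)"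
  using integral_distr[of uminus lborel borel f] by (simp add: lborel_reflect)

section \<open>Localised Fourier transforms\<close>

definition loc_ft :: "'n::finite functional \<Rightarrow> real ^ 'n \<Rightarrow> nat \<Rightarrow> real ^ 'n \<Rightarrow> complex" where
  "loc_ft g x0 N \<xi> = g (\<lambda>x. gaussian x0 N x * wave \<xi> x)"

lemma schwartz_fun_gaussian: "1 \<le> N \<Longrightarrow> schwartz_fun (gaussian x0 N)"
  unfolding gaussian_eq_gauss by (rule schwartz_fun_gauss) simp

text \<open>\<open>tempered_mult_fourier_int\<close> with the Gaussian as Schwartz factor and the
  test function as density; the constant is the normalisation of \<open>fourier\<close>.\<close>

lemma given_by_loc_ft:
  fixes g :: "'n::finite functional"
  assumes g: "tempered_distribution g" and N: "1 \<le> N"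
  shows "continuous_on UNIV (loc_ft g x0 N)"
    and "given_by (fourier_dist (mult_dist (gaussian x0 N) g))
      (\<lambda>\<xi>. complex_of_real ((2 * pi) powr (- (real CARD('n) / 2))) * loc_ft g x0 N \<xi>)"
proof -
  define c where "c = complex_of_real ((2 * pi) powr (- (real CARD('n) / 2)))"
  note E = schwartz_fun_gaussian[OF N, of x0]
  show cont: "continuous_on UNIV (loc_ft g x0 N)"
    unfolding loc_ft_def[abs_def] by (rule continuous_tempered_wave[OF g E])
  show "given_by (fourier_dist (mult_dist (gaussian x0 N) g))
      (\<lambda>\<xi>. complex_of_real ((2 * pi) powr (- (real CARD('n) / 2))) * loc_ft g x0 N \<xi>)"
    unfolding given_by_def c_def[symmetric]
  proof (intro conjI allI impI)
    fix K :: "(real ^ 'n) set" assume "compact K"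
    then show "set_integrable lborel K (\<lambda>\<xi>. c * loc_ft g x0 N \<xi>)"
      unfolding set_integrable_def
      by (intro borel_integrable_compact continuous_intros continuous_on_subset[OF cont]) auto
  next
    fix \<psi> :: "real ^ 'n \<Rightarrow> complex" assume "test_fun \<psi>"
    then have W: "rapid_L1 \<psi>" by (intro schwartz_fun_rapid_L1 test_fun_schwartz)
    have "fourier_dist (mult_dist (gaussian x0 N) g) \<psi> = g (\<lambda>x. c * (gaussian x0 N x * fourier_int \<psi> x))"
      by (simp add: fourier_dist_def mult_dist_def fourier_eq[abs_def] c_def mult.left_commute)
    also have "\<dots> = c * g (\<lambda>x. gaussian x0 N x * fourier_int \<psi> x)"
      by (rule tempered_cmult[OF g schwartz_fun_mult_fourier_int[OF W E]])
    also have "g (\<lambda>x. gaussian x0 N x * fourier_int \<psi> x) = (LINT \<eta>|lborel. \<psi> \<eta> * loc_ft g x0 N \<eta>)"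
      unfolding loc_ft_def by (rule tempered_mult_fourier_int[OF g E W])
    finally show "fourier_dist (mult_dist (gaussian x0 N) g) \<psi> = (LINT \<xi>|lborel. c * loc_ft g x0 N \<xi> * \<psi> \<xi>)"
      by (subst (asm) integral_mult_right_zero[symmetric]) (simp add: mult_ac)
  qed
qed

lemma given_by_unique:
  assumes "continuous_on UNIV G" "continuous_on UNIV H" "given_by u G" "given_by u H"
  shows "G = H"
  using assms by (intro continuous_eq_if_test_integrals_eq) (auto simp: given_by_def)

lemma bracket_bounds:
  "1 \<le> bracket \<xi>" "bracket \<xi> \<le> 1 + norm \<xi>" "1 + norm \<xi> \<le> 2 * bracket \<xi>"
proof -
  show b1: "1 \<le> bracket \<xi>" by (simp add: bracket_def)
  have "sqrt (1 + (norm \<xi>)\<^sup>2) \<le> sqrt ((1 + norm \<xi>)\<^sup>2)"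
    by (rule real_sqrt_le_mono) (simp add: power2_eq_square algebra_simps)
  then show "bracket \<xi> \<le> 1 + norm \<xi>" by (simp add: bracket_def)
  have "sqrt ((norm \<xi>)\<^sup>2) \<le> bracket \<xi>" unfolding bracket_def by (rule real_sqrt_le_mono) simp
  with b1 show "1 + norm \<xi> \<le> 2 * bracket \<xi>" by simp
qed

text \<open>The decay with the division cleared and 1 + |\<xi>| in place of the bracket; the two
  weights differ by at most a factor 2 per power, which goes into \<open>C\<close>.\<close>

definition loc_decay :: "real \<Rightarrow> 'n::finite functional \<Rightarrow> real ^ 'n \<Rightarrow> (real ^ 'n) set \<Rightarrow> real \<Rightarrow> nat \<Rightarrow> bool" where
  "loc_decay s g x0 \<Gamma> C N0 \<longleftrightarrow> (\<forall>N\<ge>N0. \<forall>\<xi>\<in>\<Gamma>. \<forall>n\<le>N.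
     (1 + norm \<xi>) ^ n * norm (loc_ft g x0 N \<xi>) \<le> C ^ (n + 1) * (real n ^ n) powr s)"

text \<open>Uniqueness of the continuous representative removes the quantifier over
  \<open>G\<close>. Normalisation and change of weight enter the constant through factors that are
  at least 1, so that the power \<open>n + 1\<close> does no harm to them.\<close>

lemma gevrey_witness_iff:
  fixes g :: "'n::finite functional"
  shows "gevrey_witness s f x0 \<xi>0 g \<longleftrightarrow> tempered_distribution g \<and> eq_near f x0 g \<and>
    (\<exists>\<Gamma> C N0. open_cone \<Gamma> \<and> \<xi>0 \<in> \<Gamma> \<and> C > 0 \<and> N0 \<ge> 1 \<and> loc_decay s g x0 \<Gamma> C N0)" (is "?L \<longleftrightarrow> ?R")
proof -
  define c where "c = (2 * pi) powr (- (real CARD('n) / 2))"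
  have c: "c > 0" by (simp add: c_def)
  show ?thesis
  proof
    assume L: ?L
    then have g: "tempered_distribution g" and e: "eq_near f x0 g" by (auto simp: gevrey_witness_def)
    obtain \<Gamma> C N0 where *: "open_cone \<Gamma>" "\<xi>0 \<in> \<Gamma>" "C > 0" "N0 \<ge> 1"
      and **: "\<And>N. N \<ge> N0 \<Longrightarrow> \<exists>G. continuous_on UNIV G \<and> given_by (fourier_dist (mult_dist (gaussian x0 N) g)) G \<and>
          (\<forall>\<xi>\<in>\<Gamma>. \<forall>n\<le>N. norm (G \<xi>) \<le> C ^ (n + 1) * (real n ^ n) powr s / bracket \<xi> ^ n)"
      using L unfolding gevrey_witness_def by blast
    define C' where "C' = 2 * C * (1 + 1 / c)"
    have "loc_decay s g x0 \<Gamma> C' N0"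
      unfolding loc_decay_def
    proof (intro allI impI ballI)
      fix N \<xi> n assume N: "N0 \<le> N" and \<xi>: "\<xi> \<in> \<Gamma>" and n: "n \<le> N"
      obtain G where G: "continuous_on UNIV G" "given_by (fourier_dist (mult_dist (gaussian x0 N) g)) G"
        "norm (G \<xi>) \<le> C ^ (n + 1) * (real n ^ n) powr s / bracket \<xi> ^ n"
        using **[OF N] \<xi> n by blast
      have N1: "1 \<le> N" using N * by simp
      have "G = (\<lambda>\<xi>. complex_of_real c * loc_ft g x0 N \<xi>)"
        unfolding c_def
        by (intro given_by_unique[OF G(1) _ G(2) given_by_loc_ft(2)[OF g N1]] continuous_intros given_by_loc_ft(1)[OF g N1])
      with G(3) have b: "c * norm (loc_ft g x0 N \<xi>) \<le> C ^ (n + 1) * (real n ^ n) powr s / bracket \<xi> ^ n"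
        using c by (simp add: norm_mult)
      have bp: "0 < bracket \<xi>" using bracket_bounds(1)[of \<xi>] by simp
      define Q where "Q = C ^ (n + 1) * (real n ^ n) powr s"
      have Q: "0 \<le> Q" using * by (simp add: Q_def)
      have "(1 + norm \<xi>) ^ n * norm (loc_ft g x0 N \<xi>) \<le> (2 * bracket \<xi>) ^ n * (Q / bracket \<xi> ^ n / c)"
      proof (intro mult_mono power_mono)
        show "norm (loc_ft g x0 N \<xi>) \<le> Q / bracket \<xi> ^ n / c"
          using b unfolding Q_def[symmetric] by (subst pos_le_divide_eq[OF c]) (simp add: mult.commute)
      qed (use bp bracket_bounds(3)[of \<xi>] in auto)
      also have "\<dots> = 2 ^ n * (1 / c) * Q" using bp by (simp add: power_mult_distrib)
      also have "\<dots> \<le> 2 ^ (n + 1) * (1 + 1 / c) ^ (n + 1) * Q"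
      proof (intro mult_right_mono mult_mono Q)
        have "1 / c \<le> (1 + 1 / c) ^ 1" by simp
        also have "\<dots> \<le> (1 + 1 / c) ^ (n + 1)" using c by (intro power_increasing) auto
        finally show "1 / c \<le> (1 + 1 / c) ^ (n + 1)" .
      qed (use c in auto)
      also have "\<dots> = C' ^ (n + 1) * (real n ^ n) powr s"
        unfolding C'_def Q_def power_mult_distrib by (simp only: mult_ac)
      finally show "(1 + norm \<xi>) ^ n * norm (loc_ft g x0 N \<xi>) \<le> C' ^ (n + 1) * (real n ^ n) powr s" .
    qed
    moreover have "C' > 0" using * c by (simp add: C'_def add_pos_pos)
    ultimately show ?R using g e * by blast
  next
    assume ?R
    then obtain \<Gamma> C N0 where g: "tempered_distribution g" and e: "eq_near f x0 g"
      and *: "open_cone \<Gamma>" "\<xi>0 \<in> \<Gamma>" "C > 0" "N0 \<ge> 1" and d: "loc_decay s g x0 \<Gamma> C N0" by blast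
    define C' where "C' = C * (1 + c)"
    have "\<exists>G. continuous_on UNIV G \<and> given_by (fourier_dist (mult_dist (gaussian x0 N) g)) G \<and>
          (\<forall>\<xi>\<in>\<Gamma>. \<forall>n\<le>N. norm (G \<xi>) \<le> C' ^ (n + 1) * (real n ^ n) powr s / bracket \<xi> ^ n)" if N: "N0 \<le> N" for N
    proof (intro exI conjI ballI allI impI)
      have N1: "1 \<le> N" using N * by simp
      show "given_by (fourier_dist (mult_dist (gaussian x0 N) g)) (\<lambda>\<xi>. complex_of_real c * loc_ft g x0 N \<xi>)"
        unfolding c_def by (rule given_by_loc_ft(2)[OF g N1])
      show "continuous_on UNIV (\<lambda>\<xi>. complex_of_real c * loc_ft g x0 N \<xi>)"
        by (intro continuous_intros given_by_loc_ft(1)[OF g N1])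
      fix \<xi> n assume \<xi>: "\<xi> \<in> \<Gamma>" and n: "n \<le> N"
      have bp: "0 < bracket \<xi>" using bracket_bounds(1)[of \<xi>] by simp
      define Q where "Q = C ^ (n + 1) * (real n ^ n) powr s"
      have Q: "0 \<le> Q" using * by (simp add: Q_def)
      have "bracket \<xi> ^ n * norm (loc_ft g x0 N \<xi>) \<le> (1 + norm \<xi>) ^ n * norm (loc_ft g x0 N \<xi>)"
        using bp bracket_bounds(2)[of \<xi>] by (intro mult_right_mono power_mono) auto
      also have "\<dots> \<le> Q" using d N \<xi> n unfolding loc_decay_def Q_def by blast
      finally have "c * (bracket \<xi> ^ n * norm (loc_ft g x0 N \<xi>)) \<le> c * Q" using c by (intro mult_left_mono) auto
      also have "\<dots> \<le> (1 + c) ^ (n + 1) * Q"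
      proof (rule mult_right_mono[OF _ Q])
        have "c \<le> (1 + c) ^ 1" by simp
        also have "\<dots> \<le> (1 + c) ^ (n + 1)" using c by (intro power_increasing) auto
        finally show "c \<le> (1 + c) ^ (n + 1)" .
      qed
      also have "\<dots> = C' ^ (n + 1) * (real n ^ n) powr s"
        unfolding C'_def Q_def power_mult_distrib by (simp only: mult_ac)
      finally have "c * norm (loc_ft g x0 N \<xi>) * bracket \<xi> ^ n \<le> C' ^ (n + 1) * (real n ^ n) powr s"
        by (simp only: mult_ac)
      then have "c * norm (loc_ft g x0 N \<xi>) \<le> C' ^ (n + 1) * (real n ^ n) powr s / bracket \<xi> ^ n"
        using bp by (subst pos_le_divide_eq) auto
      then show "norm (complex_of_real c * loc_ft g x0 N \<xi>) \<le> C' ^ (n + 1) * (real n ^ n) powr s / bracket \<xi> ^ n"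
        using c by (simp add: norm_mult)
    qed
    moreover have "C' > 0" using * c by (simp add: C'_def)
    ultimately show ?L unfolding gevrey_witness_def using g e * by blast
  qed
qed

lemma gevrey_regularI:
  assumes "tempered_distribution g" "eq_near f x0 g" "open_cone \<Gamma>" "\<xi>0 \<in> \<Gamma>" "C > 0" "N0 \<ge> 1" "loc_decay s g x0 \<Gamma> C N0"
  shows "gevrey_regular s f x0 \<xi>0"
  unfolding gevrey_regular_def gevrey_witness_iff using assms by blast

lemma gevrey_regularE:
  assumes "gevrey_regular s f x0 \<xi>0"
  obtains g \<Gamma> C N0 where "tempered_distribution g" "eq_near f x0 g" "open_cone \<Gamma>" "\<xi>0 \<in> \<Gamma>" "C > 0" "N0 \<ge> 1"
    "loc_decay s g x0 \<Gamma> C N0"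
  using assms unfolding gevrey_regular_def gevrey_witness_iff by blast

lemma loc_decayD:
  "loc_decay s g x0 \<Gamma> C N0 \<Longrightarrow> N0 \<le> N \<Longrightarrow> \<xi> \<in> \<Gamma> \<Longrightarrow> n \<le> N \<Longrightarrow>
     (1 + norm \<xi>) ^ n * norm (loc_ft g x0 N \<xi>) \<le> C ^ (n + 1) * (real n ^ n) powr s"
  by (simp add: loc_decay_def)

text \<open>The second cone property keeps \<open>\<Gamma>'\<close> inside \<open>\<Gamma>\<close> under perturbations proportional to the
  frequency, the third one along half-lines in all directions near \<open>\<xi>0\<close>.\<close>

lemma open_cone_shrink:
  fixes \<xi>0 :: "real ^ 'n::finite"
  assumes \<Gamma>: "open_cone \<Gamma>" and \<xi>0: "\<xi>0 \<in> \<Gamma>"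
  obtains \<Gamma>' c \<tau> where "open_cone \<Gamma>'" "\<xi>0 \<in> \<Gamma>'" "0 < c" "c \<le> 1 / 2"
    "\<And>\<xi> \<eta>. \<xi> \<in> \<Gamma>' \<Longrightarrow> norm \<eta> \<le> c * norm \<xi> \<Longrightarrow> \<xi> + \<eta> \<in> \<Gamma>" "0 < \<tau>"
    "\<And>\<xi> v t. \<xi> \<in> \<Gamma>' \<Longrightarrow> norm (v - \<xi>0) \<le> \<tau> \<Longrightarrow> 0 \<le> t \<Longrightarrow> \<xi> + t *\<^sub>R v \<in> \<Gamma>"
proof -
  have op: "open \<Gamma>" and n0: "0 \<notin> \<Gamma>" and cone: "\<And>\<xi> t. \<xi> \<in> \<Gamma> \<Longrightarrow> t > 0 \<Longrightarrow> t *\<^sub>R \<xi> \<in> \<Gamma>"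
    using \<Gamma> by (auto simp: open_cone_def)
  obtain e where e: "e > 0" "\<And>w. dist w \<xi>0 < e \<Longrightarrow> w \<in> \<Gamma>"
    using op \<xi>0 unfolding open_dist by blast
  have z: "\<xi>0 \<noteq> 0" using n0 \<xi>0 by blast
  define r where "r = norm \<xi>0"
  have r: "r > 0" using z by (simp add: r_def)
  \<comment> \<open>The ball of radius \<open>e\<close> around \<open>\<xi>0\<close> lies in the
    cone, which omits 0.\<close>
  have er: "e \<le> r"
  proof (rule ccontr)
    assume "\<not> e \<le> r"
    then have "dist 0 \<xi>0 < e" by (simp add: r_def dist_norm)
    with e n0 show False by blast
  qed
  \<comment> \<open>Points of the smaller cone are multiples of some \<open>w\<close> with norm at
    most \<open>2 * r\<close> and distance below \<open>e / 4\<close> from \<open>\<xi>0\<close>. A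
    perturbation of relative size \<open>c\<close> moves \<open>w\<close> by at most
    \<open>e / 2\<close> and so stays in the ball of radius \<open>e\<close>.\<close>
  define c where "c = e / (4 * r)"
  have c: "0 < c" "c \<le> 1 / 2" using e r er by (auto simp: c_def field_simps)
  define \<Gamma>' where "\<Gamma>' = (\<Union>t\<in>{0<..}. (\<lambda>w. t *\<^sub>R w) ` ball \<xi>0 (e / 4))"
  have \<Gamma>'E: "\<exists>t w. t > 0 \<and> norm (w - \<xi>0) < e / 4 \<and> \<xi> = t *\<^sub>R w" if "\<xi> \<in> \<Gamma>'" for \<xi>
    using that by (auto simp: \<Gamma>'_def dist_norm norm_minus_commute)
  have "open \<Gamma>'" unfolding \<Gamma>'_def by (intro open_UN ballI open_scaling) auto
  moreover have "0 \<notin> \<Gamma>'"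
  proof
    assume "0 \<in> \<Gamma>'"
    from \<Gamma>'E[OF this] obtain t w where "t > 0" "norm (w - \<xi>0) < e / 4" "0 = t *\<^sub>R w" by blast
    then have "norm \<xi>0 < e / 4" by (auto simp: norm_minus_commute)
    then show False using er e by (simp add: r_def)
  qed
  moreover have "t *\<^sub>R \<xi> \<in> \<Gamma>'" if "\<xi> \<in> \<Gamma>'" "t > 0" for \<xi> t
  proof -
    from that(1) obtain t' w where "t' > 0" "w \<in> ball \<xi>0 (e / 4)" "\<xi> = t' *\<^sub>R w" by (auto simp: \<Gamma>'_def)
    then show ?thesis unfolding \<Gamma>'_def using that(2)
      by (intro UN_I[of "t * t'"] image_eqI[of _ _ w]) auto
  qed
  ultimately have oc: "open_cone \<Gamma>'" by (simp add: open_cone_def)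
  have "\<xi>0 \<in> \<Gamma>'" unfolding \<Gamma>'_def using e by (intro UN_I[of 1] image_eqI[of _ _ \<xi>0]) auto
  moreover have "\<xi> + \<eta> \<in> \<Gamma>" if \<xi>: "\<xi> \<in> \<Gamma>'" and \<eta>: "norm \<eta> \<le> c * norm \<xi>" for \<xi> \<eta>
  proof -
    obtain t w where tw: "t > 0" "norm (w - \<xi>0) < e / 4" "\<xi> = t *\<^sub>R w" using \<Gamma>'E[OF \<xi>] by blast
    have "norm w \<le> r + norm (w - \<xi>0)" using norm_triangle_ineq[of \<xi>0 "w - \<xi>0"] by (simp add: r_def)
    with tw er have w: "norm w \<le> 2 * r" using e by simp
    have "norm ((1 / t) *\<^sub>R \<eta>) = (1 / t) * norm \<eta>" using tw by simp
    also have "\<dots> \<le> (1 / t) * (c * (t * norm w))" using \<eta> tw by (intro mult_left_mono) auto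
    also have "\<dots> = c * norm w" using tw by simp
    also have "\<dots> \<le> c * (2 * r)" using c w by (intro mult_left_mono) auto
    also have "\<dots> = e / 2" using r by (simp add: c_def)
    finally have n: "norm ((1 / t) *\<^sub>R \<eta>) \<le> e / 2" .
    have "norm (w + (1 / t) *\<^sub>R \<eta> - \<xi>0) \<le> norm (w - \<xi>0) + norm ((1 / t) *\<^sub>R \<eta>)"
      using norm_triangle_ineq[of "w - \<xi>0" "(1 / t) *\<^sub>R \<eta>"] by (simp add: algebra_simps)
    also have "\<dots> < e" using n tw(2) e by simp
    finally have "w + (1 / t) *\<^sub>R \<eta> \<in> \<Gamma>" by (intro e) (simp add: dist_norm)
    from cone[OF this tw(1)] show ?thesis using tw by (simp add: scaleR_right_distrib)
  qed
  moreover have "\<xi> + t *\<^sub>R v \<in> \<Gamma>" if \<xi>: "\<xi> \<in> \<Gamma>'" and v: "norm (v - \<xi>0) \<le> e / 2" and t: "0 \<le> t" for \<xi> v t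
  proof -
    obtain q w where qw: "q > 0" "norm (w - \<xi>0) < e / 4" "\<xi> = q *\<^sub>R w" using \<Gamma>'E[OF \<xi>] by blast
    \<comment> \<open>After scaling, the point is a convex combination of \<open>w\<close> and
      \<open>v\<close>, both of which are close to \<open>\<xi>0\<close>.\<close>
    define m where "m = (1 / (q + t)) *\<^sub>R (q *\<^sub>R w + t *\<^sub>R v)"
    have qt: "q + t > 0" using qw t by simp
    have "m - \<xi>0 = (1 / (q + t)) *\<^sub>R (q *\<^sub>R (w - \<xi>0) + t *\<^sub>R (v - \<xi>0))"
    proof -
      have "\<xi>0 = (1 / (q + t)) *\<^sub>R ((q + t) *\<^sub>R \<xi>0)" using qt by simp
      then have "m - \<xi>0 = m - (1 / (q + t)) *\<^sub>R ((q + t) *\<^sub>R \<xi>0)" by simp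
      then show ?thesis by (simp add: m_def algebra_simps)
    qed
    also have "norm \<dots> \<le> (1 / (q + t)) * (q * (e / 2) + t * (e / 2))"
    proof -
      have "norm (q *\<^sub>R (w - \<xi>0) + t *\<^sub>R (v - \<xi>0)) \<le> q * norm (w - \<xi>0) + t * norm (v - \<xi>0)"
        using norm_triangle_ineq[of "q *\<^sub>R (w - \<xi>0)" "t *\<^sub>R (v - \<xi>0)"] qw(1) t by simp
      also have "\<dots> \<le> q * (e / 2) + t * (e / 2)"
        by (intro add_mono mult_left_mono) (use qw v t e in simp_all)
      finally have "(1 / (q + t)) * norm (q *\<^sub>R (w - \<xi>0) + t *\<^sub>R (v - \<xi>0)) \<le> (1 / (q + t)) * (q * (e / 2) + t * (e / 2))"
        using qt by (intro mult_left_mono) auto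
      then show ?thesis using qt by simp
    qed
    also have "\<dots> = e / 2" using qt by (simp add: field_simps)
    also have "\<dots> < e" using e by simp
    finally have "m \<in> \<Gamma>" by (intro e) (simp add: dist_norm)
    from cone[OF this qt] have "(q + t) *\<^sub>R m \<in> \<Gamma>" .
    moreover have "(q + t) *\<^sub>R m = \<xi> + t *\<^sub>R v" using qt qw by (simp add: m_def)
    ultimately show ?thesis by simp
  qed
  ultimately show ?thesis using c e(1) oc by (intro that[of \<Gamma>' c "e / 2"]) auto
qed

section \<open>Linear operations on regular functionals\<close>

lemma open_cone_Int: "open_cone A \<Longrightarrow> open_cone B \<Longrightarrow> open_cone (A \<inter> B)"
  by (auto simp: open_cone_def)

text \<open>Turns a prefactor and a geometric factor into a single constant to the power
  \<open>n + 1\<close>; the added ones make both bases at least 1.\<close>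

lemma absorb_geometric:
  assumes "0 \<le> a" "0 \<le> (b::real)"
  shows "a * b ^ n \<le> ((1 + a) * (1 + b)) ^ (n + 1)"
proof -
  have "a * b ^ n \<le> (1 + a) ^ 1 * (1 + b) ^ n" using assms by (intro mult_mono power_mono) auto
  also have "\<dots> \<le> (1 + a) ^ (n + 1) * (1 + b) ^ (n + 1)"
    using assms by (intro mult_mono power_increasing) auto
  finally show ?thesis by (simp only: power_mult_distrib)
qed

lemma add_power_le:
  assumes "0 \<le> a" "0 \<le> (b::real)"
  shows "a ^ (n + 1) + b ^ (n + 1) \<le> (a + b) ^ (n + 1)"
proof -
  have "a ^ (n + 1) + b ^ (n + 1) \<le> a * (a + b) ^ n + b * (a + b) ^ n"
    using assms by (auto intro!: add_mono mult_left_mono power_mono)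
  then show ?thesis by (simp add: algebra_simps)
qed

text \<open>Lets bounds without the factorial growth be weakened to the required form; for
  \<open>n = 0\<close> the base is \<open>0 ^ 0 = 1\<close>.\<close>

lemma self_power_powr_ge_1: "0 \<le> s \<Longrightarrow> 1 \<le> (real n ^ n) powr s"
  by (cases "n = 0") (auto intro!: ge_one_powr_ge_zero one_le_power)

text \<open>The cones are intersected and the constants added, since a sum of powers is at most the
  power of the sum.\<close>

lemma gevrey_regular_add:
  assumes "gevrey_regular s f1 x0 \<xi>0" "gevrey_regular s f2 x0 \<xi>0"
  shows "gevrey_regular s (\<lambda>\<psi>. f1 \<psi> + f2 \<psi>) x0 \<xi>0"
proof -
  obtain g1 \<Gamma>1 C1 N1 where 1: "tempered_distribution g1" "eq_near f1 x0 g1" "open_cone \<Gamma>1" "\<xi>0 \<in> \<Gamma>1" "C1 > 0" "N1 \<ge> 1"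
    "loc_decay s g1 x0 \<Gamma>1 C1 N1" using gevrey_regularE[OF assms(1)] .
  obtain g2 \<Gamma>2 C2 N2 where 2: "tempered_distribution g2" "eq_near f2 x0 g2" "open_cone \<Gamma>2" "\<xi>0 \<in> \<Gamma>2" "C2 > 0" "N2 \<ge> 1"
    "loc_decay s g2 x0 \<Gamma>2 C2 N2" using gevrey_regularE[OF assms(2)] .
  show ?thesis
  proof (rule gevrey_regularI)
    obtain A k where A: "0 \<le> A" "\<And>f B. schwartz_fun f \<Longrightarrow> schwartz_le k B f \<Longrightarrow> norm (g1 f) \<le> A * B"
      using tempered_distributionE[OF 1(1)] by blast
    obtain B l where B: "0 \<le> B" "\<And>f E. schwartz_fun f \<Longrightarrow> schwartz_le l E f \<Longrightarrow> norm (g2 f) \<le> B * E"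
      using tempered_distributionE[OF 2(1)] by blast
    show "tempered_distribution (\<lambda>\<psi>. g1 \<psi> + g2 \<psi>)"
    proof (rule tempered_distributionI)
      show "linear_form_on schwartz_fun (\<lambda>\<psi>. g1 \<psi> + g2 \<psi>)"
        unfolding linear_form_on_def
        by (simp add: tempered_add[OF 1(1)] tempered_add[OF 2(1)] tempered_cmult[OF 1(1)] tempered_cmult[OF 2(1)] distrib_left)
      fix f :: "real ^ 'a \<Rightarrow> complex" and E assume f: "schwartz_fun f" "schwartz_le (max k l) E f"
      have "norm (g1 f) \<le> A * E" "norm (g2 f) \<le> B * E"
        by (rule A B f(1) schwartz_le_mono[OF f(2)] | simp)+
      then show "norm (g1 f + g2 f) \<le> (A + B) * E"
        by (intro order_trans[OF norm_triangle_ineq]) (simp add: distrib_right)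
    qed
    show "eq_near (\<lambda>\<psi>. f1 \<psi> + f2 \<psi>) x0 (\<lambda>\<psi>. g1 \<psi> + g2 \<psi>)"
    proof -
      obtain U V where "open U" "x0 \<in> U" "\<forall>\<psi>. test_fun \<psi> \<and> supp \<psi> \<subseteq> U \<longrightarrow> f1 \<psi> = g1 \<psi>"
        "open V" "x0 \<in> V" "\<forall>\<psi>. test_fun \<psi> \<and> supp \<psi> \<subseteq> V \<longrightarrow> f2 \<psi> = g2 \<psi>"
        using 1(2) 2(2) unfolding eq_near_def by blast
      then show ?thesis unfolding eq_near_def by (intro exI[of _ "U \<inter> V"]) auto
    qed
    show "open_cone (\<Gamma>1 \<inter> \<Gamma>2)" "\<xi>0 \<in> \<Gamma>1 \<inter> \<Gamma>2" "C1 + C2 > 0" "1 \<le> max N1 N2"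
      using 1 2 open_cone_Int by auto
    show "loc_decay s (\<lambda>\<psi>. g1 \<psi> + g2 \<psi>) x0 (\<Gamma>1 \<inter> \<Gamma>2) (C1 + C2) (max N1 N2)"
      unfolding loc_decay_def
    proof (intro allI impI ballI)
      fix N \<xi> n assume N: "max N1 N2 \<le> N" and \<xi>: "\<xi> \<in> \<Gamma>1 \<inter> \<Gamma>2" and n: "n \<le> N"
      have "(1 + norm \<xi>) ^ n * norm (loc_ft (\<lambda>\<psi>. g1 \<psi> + g2 \<psi>) x0 N \<xi>) \<le>
         (1 + norm \<xi>) ^ n * (norm (loc_ft g1 x0 N \<xi>) + norm (loc_ft g2 x0 N \<xi>))"
        unfolding loc_ft_def by (intro mult_left_mono norm_triangle_ineq) auto
      also have "\<dots> \<le> C1 ^ (n + 1) * (real n ^ n) powr s + C2 ^ (n + 1) * (real n ^ n) powr s"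
        unfolding distrib_left using N \<xi> n
        by (intro add_mono loc_decayD[OF 1(7)] loc_decayD[OF 2(7)]) auto
      also have "\<dots> \<le> (C1 + C2) ^ (n + 1) * (real n ^ n) powr s"
        unfolding distrib_right[symmetric] using 1(5) 2(5) by (intro mult_right_mono add_power_le) auto
      finally show "(1 + norm \<xi>) ^ n * norm (loc_ft (\<lambda>\<psi>. g1 \<psi> + g2 \<psi>) x0 N \<xi>) \<le> (C1 + C2) ^ (n + 1) * (real n ^ n) powr s" .
    qed
  qed
qed

lemma gevrey_regular_cmult:
  assumes "gevrey_regular s f x0 \<xi>0"
  shows "gevrey_regular s (\<lambda>\<psi>. a * f \<psi>) x0 \<xi>0"
proof -
  obtain g \<Gamma> C N0 where 1: "tempered_distribution g" "eq_near f x0 g" "open_cone \<Gamma>" "\<xi>0 \<in> \<Gamma>" "C > 0" "N0 \<ge> 1"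
    "loc_decay s g x0 \<Gamma> C N0" using gevrey_regularE[OF assms(1)] .
  show ?thesis
  proof (rule gevrey_regularI)
    obtain A k where A: "0 \<le> A" "\<And>f B. schwartz_fun f \<Longrightarrow> schwartz_le k B f \<Longrightarrow> norm (g f) \<le> A * B"
      using tempered_distributionE[OF 1(1)] by blast
    show "tempered_distribution (\<lambda>\<psi>. a * g \<psi>)"
    proof (rule tempered_distributionI)
      show "linear_form_on schwartz_fun (\<lambda>\<psi>. a * g \<psi>)"
        unfolding linear_form_on_def
        by (simp add: tempered_add[OF 1(1)] tempered_cmult[OF 1(1)] distrib_left)
      fix f :: "real ^ 'a \<Rightarrow> complex" and E assume f: "schwartz_fun f" "schwartz_le k E f"
      show "norm (a * g f) \<le> (norm a * A) * E"
        unfolding norm_mult mult.assoc by (intro mult_left_mono A f) auto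
    qed
    show "eq_near (\<lambda>\<psi>. a * f \<psi>) x0 (\<lambda>\<psi>. a * g \<psi>)"
    proof -
      obtain U where "open U" "x0 \<in> U" "\<forall>\<psi>. test_fun \<psi> \<and> supp \<psi> \<subseteq> U \<longrightarrow> f \<psi> = g \<psi>"
        using 1(2) unfolding eq_near_def by blast
      then show ?thesis unfolding eq_near_def by (intro exI[of _ U]) auto
    qed
    show "open_cone \<Gamma>" "\<xi>0 \<in> \<Gamma>" "1 \<le> N0" by fact+
    show "(1 + norm a) * C > 0" using 1(5) by (simp add: add_pos_nonneg)
    show "loc_decay s (\<lambda>\<psi>. a * g \<psi>) x0 \<Gamma> ((1 + norm a) * C) N0"
      unfolding loc_decay_def
    proof (intro allI impI ballI)
      fix N \<xi> n assume N: "N0 \<le> N" and \<xi>: "\<xi> \<in> \<Gamma>" and n: "n \<le> N"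
      have "norm a \<le> (1 + norm a) ^ 1" by simp
      also have "\<dots> \<le> (1 + norm a) ^ (n + 1)" by (intro power_increasing) auto
      finally have "norm a * ((1 + norm \<xi>) ^ n * norm (loc_ft g x0 N \<xi>)) \<le> (1 + norm a) ^ (n + 1) * (C ^ (n + 1) * (real n ^ n) powr s)"
        by (intro mult_mono loc_decayD[OF 1(7) N \<xi> n]) auto
      then show "(1 + norm \<xi>) ^ n * norm (loc_ft (\<lambda>\<psi>. a * g \<psi>) x0 N \<xi>) \<le> ((1 + norm a) * C) ^ (n + 1) * (real n ^ n) powr s"
        unfolding loc_ft_def norm_mult power_mult_distrib by (simp only: mult_ac)
    qed
  qed
qed

text \<open>The start of the induction over the monomials of a polynomial. The punctured space
  serves as the cone, so every nonzero direction is covered.\<close>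

lemma gevrey_regular_zero:
  assumes "(\<xi>0 :: real ^ 'n::finite) \<noteq> 0"
  shows "gevrey_regular s (\<lambda>\<psi>. 0) x0 \<xi>0"
proof (rule gevrey_regularI)
  show "tempered_distribution (\<lambda>\<psi> :: real ^ 'n \<Rightarrow> complex. 0)"
    by (rule tempered_distributionI[of _ 0 0]) (auto simp: linear_form_on_def)
  show "eq_near (\<lambda>\<psi>. 0) x0 (\<lambda>\<psi>. 0)" unfolding eq_near_def by (intro exI[of _ UNIV]) auto
  show "open_cone (- {0 :: real ^ 'n})" by (auto simp: open_cone_def)
  show "\<xi>0 \<in> - {0}" using assms by simp
  show "(0::real) < 1" "(1::nat) \<le> 1" by auto
  show "loc_decay s (\<lambda>\<psi>. 0) x0 (- {0}) 1 1" by (auto simp: loc_decay_def loc_ft_def)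
qed

section \<open>Derivatives preserve Gevrey regularity\<close>

primrec log_rem :: "nat \<Rightarrow> real \<Rightarrow> complex" where
  "log_rem 0 t = - \<i> * complex_of_real t"
| "log_rem (Suc m) t = log_rem m t + (1 - exp (- \<i> * complex_of_real t)) ^ Suc m / of_nat (Suc m)"

text \<open>\<open>log_rem m t\<close> is the remainder of the expansion of \<open>log z = -\<i>t\<close> in powers of
  \<open>1 - z\<close> up to degree \<open>m\<close>, where \<open>z = exp (-\<i>t)\<close>; hence the simple derivative.\<close>

lemma log_rem_has_vector_derivative:
  "(log_rem m has_vector_derivative (- \<i> * (1 - exp (- \<i> * complex_of_real t)) ^ m)) (at t within S)"
proof (induction m)
  case 0
  show ?case
    by (auto intro!: derivative_eq_intros simp: log_rem.simps(1)[abs_def])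
next
  case (Suc m)
  define z where "z = exp (- \<i> * complex_of_real t)"
  have "((\<lambda>w. exp (- \<i> * w)) has_field_derivative (- \<i> * exp (- \<i> * complex_of_real t))) (at (complex_of_real t))"
    by (auto intro!: derivative_eq_intros)
  then have "((\<lambda>w. (1 - exp (- \<i> * w)) ^ Suc m / of_nat (Suc m)) has_field_derivative
     (of_nat (Suc m) * (1 - z) ^ m * (- (- \<i> * z)) / of_nat (Suc m))) (at (complex_of_real t))"
    unfolding z_def by (auto intro!: derivative_eq_intros simp del: power_Suc)
  from has_vector_derivative_real_field[OF this, of S]
  have "((\<lambda>t. (1 - exp (- \<i> * complex_of_real t)) ^ Suc m / of_nat (Suc m)) has_vector_derivative
     (of_nat (Suc m) * (1 - z) ^ m * (- (- \<i> * z)) / of_nat (Suc m))) (at t within S)" .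
  from has_vector_derivative_add[OF Suc this]
  have "(log_rem (Suc m) has_vector_derivative
      (- \<i> * (1 - z) ^ m + of_nat (Suc m) * (1 - z) ^ m * (- (- \<i> * z)) / of_nat (Suc m))) (at t within S)"
    by (simp only: log_rem.simps(2)[abs_def] z_def)
  moreover have "- \<i> * (1 - z) ^ m + of_nat (Suc m) * (1 - z) ^ m * (- (- \<i> * z)) / of_nat (Suc m) = - \<i> * (1 - z) ^ Suc m"
    by (simp add: algebra_simps del: of_nat_Suc)
  ultimately show ?case by (simp only: z_def)
qed

section \<open>Finite differences along half-lines\<close>

lemma log_rem_0: "log_rem m 0 = 0"
  by (induction m) auto

lemma norm_one_minus_exp: "norm (1 - exp (- \<i> * complex_of_real t)) \<le> \<bar>t\<bar>"
  using norm_iexp_diff[of 0 t] by simp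

text \<open>Between 0 and t the derivative is bounded by |t|^m; integrating raises the order of
  vanishing to m + 1.\<close>

lemma norm_log_rem: "norm (log_rem m t) \<le> \<bar>t\<bar> ^ Suc m"
proof -
  have "norm (log_rem m t - log_rem m 0) \<le> \<bar>t\<bar> ^ m * norm (t - 0)"
  proof (rule vector_derivative_bound[OF _ log_rem_has_vector_derivative])
    show "convex (closed_segment 0 t)" by (rule convex_closed_segment)
    fix r assume "r \<in> closed_segment 0 t"
    then have "\<bar>r\<bar> \<le> \<bar>t\<bar>" using segment_bound1[of r 0 t] by simp
    then have "norm (1 - exp (- \<i> * complex_of_real r)) \<le> \<bar>t\<bar>"
      using norm_one_minus_exp[of r] by linarith
    then show "norm (- \<i> * (1 - exp (- \<i> * complex_of_real r)) ^ m) \<le> \<bar>t\<bar> ^ m"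
      by (simp add: norm_mult norm_power power_mono)
  qed auto
  then show ?thesis by (simp add: log_rem_0 mult.commute)
qed

lemma wave_shift: "wave w (x - y) = wave w (- y) * wave w x"
  using wave_add'[of w x "- y"] by (simp add: mult.commute)

text \<open>Two bounds for \<open>w\<close>: \<open>d\<close> is small and has to appear as a
  factor, \<open>V\<close> is crude and may enter constants. In the application they are V / N and
  V.\<close>

lemma derivs_le_one_minus_wave:
  fixes w :: "real ^ 'n::finite"
  assumes w: "norm w \<le> d" "norm w \<le> V"
  shows "derivs_le k (\<lambda>x. d * (1 + V) ^ k * (1 + norm (x - y))) (\<lambda>x. 1 - wave w (x - y))"
proof -
  define \<kappa> where "\<kappa> = - wave w (- y)"
  have eq: "(\<lambda>x. 1 - wave w (x - y)) = (\<lambda>x. 1 + \<kappa> * wave w x)"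
    unfolding wave_shift \<kappa>_def by simp
  have sm: "smooth (\<lambda>x. 1 - wave w (x - y))"
    unfolding eq by (intro smooth_add smooth_const smooth_cmult smooth_wave)
  have d0: "0 \<le> d" "0 \<le> V" using w norm_ge_zero[of w] by linarith+
  have V1: "1 \<le> (1 + V) ^ k" using d0 by (intro one_le_power) auto
  show ?thesis
    unfolding smooth_derivs_le_iff[OF sm]
  proof (intro allI impI)
    fix js :: "'n list" and x assume js: "length js \<le> k"
    show "norm (partial_derivs js (\<lambda>x. 1 - wave w (x - y)) x) \<le> d * (1 + V) ^ k * (1 + norm (x - y))"
    proof (cases js)
      case Nil
      have "norm (wave 0 (x - y) - wave w (x - y)) \<le> norm (x - y) * norm (0 - w)" by (rule norm_wave_diff)
      also have "\<dots> \<le> (1 + norm (x - y)) * (d * (1 + V) ^ k)"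
        using w d0 mult_mono[OF w(1) V1] by (intro mult_mono) auto
      finally show ?thesis by (simp add: Nil mult.commute)
    next
      case (Cons j ks)
      have one: "partial_derivs js (\<lambda>x. 1) x = 0" by (simp only: Cons partial_derivs_const) simp
      have "partial_derivs js (\<lambda>x. 1 - wave w (x - y)) x = \<kappa> * (wave_factor js w * wave w x)"
        unfolding eq by (simp only: partial_derivs_add[OF smooth_const smooth_cmult[OF smooth_wave]]
            partial_derivs_cmult[OF smooth_wave] partial_derivs_wave one) simp
      then have "norm (partial_derivs js (\<lambda>x. 1 - wave w (x - y)) x) = \<bar>w $ j\<bar> * norm (wave_factor ks w)"
        by (simp add: norm_mult Cons \<kappa>_def)
      also have "\<dots> \<le> d * (1 + V) ^ k"
      proof (rule mult_mono)
        show "\<bar>w $ j\<bar> \<le> d" using component_le_norm_cart[of w j] w by linarith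
        have "norm (wave_factor ks w) \<le> (1 + norm w) ^ k" by (rule norm_wave_factor) (use js Cons in simp)
        also have "\<dots> \<le> (1 + V) ^ k" using w by (intro power_mono) auto
        finally show "norm (wave_factor ks w) \<le> (1 + V) ^ k" .
      qed (use d0 in auto)
      also have "\<dots> \<le> d * (1 + V) ^ k * (1 + norm (x - y))"
        using d0 by (simp add: distrib_left)
      finally show ?thesis .
    qed
  qed
qed

lemma derivs_le_one_minus_wave_power:
  fixes w :: "real ^ 'n::finite"
  assumes w: "norm w \<le> d" "norm w \<le> V"
  shows "derivs_le k (\<lambda>x. (2 ^ k * (d * (1 + V) ^ k * (1 + norm (x - y)))) ^ m) (\<lambda>x. (1 - wave w (x - y)) ^ m)"
proof (induction m)
  case 0
  show ?case using derivs_le_const[of 1 "\<lambda>x. 1" k] by simp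
next
  case (Suc m)
  from derivs_le_mult[OF derivs_le_one_minus_wave[OF w] Suc] show ?case by simp
qed

text \<open>The first partial derivatives of the remainder are explicit, a component of
  \<open>w\<close> times a power of one minus a wave, so only the value itself has to be estimated
  by \<open>norm_log_rem\<close>.\<close>

lemma derivs_le_log_rem:
  fixes w :: "real ^ 'n::finite"
  assumes w: "norm w \<le> d" "norm w \<le> V"
  shows "derivs_le (Suc k) (\<lambda>x. (2 ^ Suc k * (d * (1 + V) ^ Suc k * (1 + norm (x - y)))) ^ Suc m)
     (\<lambda>x. log_rem m ((x - y) \<bullet> w))"
proof -
  define b where "b x = 2 ^ Suc k * (d * (1 + V) ^ Suc k * (1 + norm (x - y)))" for x
  have d0: "0 \<le> d" "0 \<le> V" using w norm_ge_zero[of w] by linarith+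
  have "1 * (1 * 1) \<le> 2 ^ Suc k * ((1 + V) ^ Suc k * (1 + norm (x - y)))" for x
    using d0 by (intro mult_mono one_le_power) auto
  from mult_left_mono[OF this d0(1)] have db: "d \<le> b x" for x
    by (simp add: b_def mult_ac)
  have b0: "0 \<le> b x" for x using db[of x] d0 by linarith
  have dyb: "norm (x - y) * d \<le> b x" for x
  proof -
    have "1 * (1 * norm (x - y)) \<le> 2 ^ Suc k * ((1 + V) ^ Suc k * (1 + norm (x - y)))"
      using d0 by (intro mult_mono one_le_power) auto
    from mult_left_mono[OF this d0(1)] show ?thesis by (simp add: b_def mult_ac)
  qed
  have hd: "((\<lambda>x. log_rem m ((x - y) \<bullet> w)) has_derivative (\<lambda>v. (v \<bullet> w) *\<^sub>R (- \<i> * (1 - wave w (x - y)) ^ m))) (at x)" for x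
  proof -
    have "((\<lambda>x. (x - y) \<bullet> w) has_derivative (\<lambda>v. v \<bullet> w)) (at x)"
      by (auto intro!: derivative_eq_intros)
    from has_derivative_compose[OF this log_rem_has_vector_derivative[of m "(x - y) \<bullet> w" UNIV, unfolded has_vector_derivative_def]]
    show ?thesis by (simp add: wave_def)
  qed
  have diff: "(\<lambda>x. log_rem m ((x - y) \<bullet> w)) differentiable at x" for x
    unfolding differentiable_def by (rule exI, rule hd)
  have pd: "partial_deriv i (\<lambda>x. log_rem m ((x - y) \<bullet> w)) = (\<lambda>x. (- \<i> * complex_of_real (w $ i)) * (1 - wave w (x - y)) ^ m)" for i
    by (rule ext, subst partial_deriv_eq[OF hd]) (simp add: inner_axis_1 scaleR_conv_of_real mult_ac)
  have "derivs_le k (\<lambda>x. b x ^ Suc m) (partial_deriv i (\<lambda>x. log_rem m ((x - y) \<bullet> w)))" for i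
    unfolding pd
  proof (rule derivs_le_mono)
    show "derivs_le (Suc k) (\<lambda>x. norm (- \<i> * complex_of_real (w $ i)) * b x ^ m) (\<lambda>x. (- \<i> * complex_of_real (w $ i)) * (1 - wave w (x - y)) ^ m)"
      unfolding b_def by (rule derivs_le_cmult[OF derivs_le_one_minus_wave_power[OF w]])
    fix x
    have "\<bar>w $ i\<bar> \<le> b x" using component_le_norm_cart[of w i] w db[of x] by linarith
    then show "norm (- \<i> * complex_of_real (w $ i)) * b x ^ m \<le> b x ^ Suc m"
      using b0 by (simp add: norm_mult mult_right_mono)
  qed simp
  moreover have "norm (log_rem m ((x - y) \<bullet> w)) \<le> b x ^ Suc m" for x
  proof -
    have "\<bar>(x - y) \<bullet> w\<bar> \<le> norm (x - y) * norm w" by (rule Cauchy_Schwarz_ineq2)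
    also have "\<dots> \<le> norm (x - y) * d" using w by (intro mult_left_mono) auto
    also have "\<dots> \<le> b x" by (rule dyb)
    finally have "\<bar>(x - y) \<bullet> w\<bar> ^ Suc m \<le> b x ^ Suc m" by (intro power_mono) auto
    with norm_log_rem[of m "(x - y) \<bullet> w"] show ?thesis by linarith
  qed
  ultimately show ?thesis
    unfolding b_def[symmetric] derivs_le_Suc using diff by blast
qed

text \<open>Moving the centre of the weight from \<open>y\<close> to the origin costs a constant
  factor.\<close>

lemma poly_growthI:
  assumes "\<And>k. \<exists>A m. derivs_le k (\<lambda>x. A * (1 + norm (x - y)) ^ m) a"
  shows "poly_growth a"
  unfolding poly_growth_def
proof
  fix k
  obtain A m where A: "derivs_le k (\<lambda>x. A * (1 + norm (x - y)) ^ m) a" using assms by blast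
  have A0: "0 \<le> A" using derivs_leD(5)[OF A, of y] by simp
  have "derivs_le k (\<lambda>x. (A * (1 + norm y) ^ m) * (1 + norm x) ^ m) a"
  proof (rule derivs_le_mono[OF A order_refl])
    fix x
    have "1 + norm (x - y) \<le> (1 + norm y) * (1 + norm x)"
      using one_plus_norm_le_mult[of "x - y" "- y"] by simp
    then have "(1 + norm (x - y)) ^ m \<le> ((1 + norm y) * (1 + norm x)) ^ m" by (intro power_mono) auto
    from mult_left_mono[OF this A0] show "A * (1 + norm (x - y)) ^ m \<le> (A * (1 + norm y) ^ m) * (1 + norm x) ^ m"
      by (simp add: power_mult_distrib mult.assoc)
  qed
  then show "\<exists>A m. derivs_le k (\<lambda>x. A * (1 + norm x) ^ m) a" by blast
qed

lemma poly_growth_one_minus_wave_power: "poly_growth (\<lambda>x. (1 - wave w (x - y)) ^ m)"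
proof (rule poly_growthI)
  fix k
  have "derivs_le k (\<lambda>x. (2 ^ k * (norm w * (1 + norm w) ^ k)) ^ m * (1 + norm (x - y)) ^ m) (\<lambda>x. (1 - wave w (x - y)) ^ m)"
    using derivs_le_one_minus_wave_power[of w "norm w" "norm w" k y m]
    by (simp only: power_mult_distrib order_refl mult.assoc)
  then show "\<exists>A l. derivs_le k (\<lambda>x. A * (1 + norm (x - y)) ^ l) (\<lambda>x. (1 - wave w (x - y)) ^ m)" by blast
qed

lemma poly_growth_log_rem: "poly_growth (\<lambda>x. log_rem m ((x - y) \<bullet> w))"
proof (rule poly_growthI)
  fix k
  have "derivs_le (Suc k) (\<lambda>x. (2 ^ Suc k * (norm w * (1 + norm w) ^ Suc k)) ^ Suc m * (1 + norm (x - y)) ^ Suc m) (\<lambda>x. log_rem m ((x - y) \<bullet> w))"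
    using derivs_le_log_rem[of w "norm w" "norm w" k y m]
    by (simp only: power_mult_distrib order_refl mult.assoc)
  then have "derivs_le k (\<lambda>x. (2 ^ Suc k * (norm w * (1 + norm w) ^ Suc k)) ^ Suc m * (1 + norm (x - y)) ^ Suc m) (\<lambda>x. log_rem m ((x - y) \<bullet> w))"
    by (rule derivs_le_mono) auto
  then show "\<exists>A l. derivs_le k (\<lambda>x. A * (1 + norm (x - y)) ^ l) (\<lambda>x. log_rem m ((x - y) \<bullet> w))" by blast
qed

lemma schwartz_fun_gaussian_wave: "1 \<le> N \<Longrightarrow> schwartz_fun (\<lambda>x. gaussian x0 N x * wave \<xi> x)"
  by (rule schwartz_fun_mult_wave[OF schwartz_fun_gaussian])

text \<open>Expanding the power shifts the frequency along the half-line in steps of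
  \<open>w\<close>, with coefficients of total modulus 2^j; the centre \<open>x0\<close> only
  contributes phases.\<close>

lemma norm_tempered_one_minus_wave_power:
  fixes g :: "'n::finite functional"
  assumes g: "tempered_distribution g" and N: "1 \<le> N"
    and B: "\<And>l :: nat. norm (loc_ft g x0 N (\<xi> + real l *\<^sub>R w)) \<le> B"
  shows "norm (g (\<lambda>x. (1 - wave w (x - x0)) ^ j * (gaussian x0 N x * wave \<xi> x))) \<le> 2 ^ j * B"
  using B
proof (induction j arbitrary: \<xi>)
  case 0
  show ?case using 0[of 0] by (simp add: loc_ft_def)
next
  case (Suc j)
  define \<kappa> where "\<kappa> = wave w (- x0)"
  define F where "F \<xi> = (\<lambda>x. (1 - wave w (x - x0)) ^ j * (gaussian x0 N x * wave \<xi> x))" for \<xi>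
  have F: "schwartz_fun (F \<xi>)" for \<xi>
    unfolding F_def by (intro schwartz_fun_mult poly_growth_one_minus_wave_power schwartz_fun_gaussian_wave N)
  have "(\<lambda>x. (1 - wave w (x - x0)) ^ Suc j * (gaussian x0 N x * wave \<xi> x)) = (\<lambda>x. F \<xi> x - \<kappa> * F (\<xi> + w) x)"
    unfolding F_def \<kappa>_def power_Suc wave_add by (rule ext) (simp add: algebra_simps wave_shift[of w _ x0])
  then have "g (\<lambda>x. (1 - wave w (x - x0)) ^ Suc j * (gaussian x0 N x * wave \<xi> x)) = g (F \<xi>) - \<kappa> * g (F (\<xi> + w))"
    by (simp add: tempered_diff[OF g F schwartz_fun_cmult[OF F]] tempered_cmult[OF g F])
  also have "norm \<dots> \<le> norm (g (F \<xi>)) + norm (g (F (\<xi> + w)))"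
    by (rule order_trans[OF norm_triangle_ineq4]) (simp add: norm_mult \<kappa>_def)
  also have "\<dots> \<le> 2 ^ j * B + 2 ^ j * B"
  proof (intro add_mono)
    show "norm (g (F \<xi>)) \<le> 2 ^ j * B" unfolding F_def by (rule Suc.IH[OF Suc.prems])
    have "norm (loc_ft g x0 N ((\<xi> + w) + real l *\<^sub>R w)) \<le> B" for l
      using Suc.prems[of "Suc l"] by (simp add: scaleR_left_distrib add_ac)
    then show "norm (g (F (\<xi> + w))) \<le> 2 ^ j * B" unfolding F_def by (rule Suc.IH)
  qed
  also have "2 ^ j * B + 2 ^ j * B = 2 ^ Suc j * B" by simp
  finally show ?case .
qed

text \<open>Consecutive remainders differ by a power of one minus a wave, whose pairing with
  \<open>g\<close> is a finite difference; the contributions add up to at most 2^(m+1) B.\<close>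

lemma norm_tempered_log_rem:
  fixes g :: "'n::finite functional"
  assumes g: "tempered_distribution g" and N: "1 \<le> N"
    and B: "\<And>l :: nat. norm (loc_ft g x0 N (\<xi> + real l *\<^sub>R w)) \<le> B"
  shows "norm (g (\<lambda>x. log_rem 0 ((x - x0) \<bullet> w) * (gaussian x0 N x * wave \<xi> x))) \<le>
    norm (g (\<lambda>x. log_rem m ((x - x0) \<bullet> w) * (gaussian x0 N x * wave \<xi> x))) + 2 ^ Suc m * B"
proof (induction m)
  case 0
  have "0 \<le> B" using B[of 0] norm_ge_zero order_trans by blast
  then show ?case by simp
next
  case (Suc m)
  define h where "h x = gaussian x0 N x * wave \<xi> x" for x
  have h: "schwartz_fun h" unfolding h_def[abs_def] by (rule schwartz_fun_gaussian_wave[OF N])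
  define Z where "Z = (\<lambda>x. (1 - wave w (x - x0)) ^ Suc m * h x)"
  have Z: "schwartz_fun Z" unfolding Z_def by (rule schwartz_fun_mult[OF poly_growth_one_minus_wave_power h])
  have L: "schwartz_fun (\<lambda>x. log_rem (Suc m) ((x - x0) \<bullet> w) * h x)"
    by (rule schwartz_fun_mult[OF poly_growth_log_rem h])
  define q where "q = (1 / of_nat (Suc m) :: complex)"
  have "(\<lambda>x. log_rem m ((x - x0) \<bullet> w) * h x) = (\<lambda>x. log_rem (Suc m) ((x - x0) \<bullet> w) * h x - q * Z x)"
    by (rule ext) (simp add: Z_def wave_def q_def algebra_simps del: of_nat_Suc power_Suc)
  then have "g (\<lambda>x. log_rem m ((x - x0) \<bullet> w) * h x) = g (\<lambda>x. log_rem (Suc m) ((x - x0) \<bullet> w) * h x) - q * g Z"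
    by (simp only: tempered_diff[OF g L schwartz_fun_cmult[OF Z]] tempered_cmult[OF g Z])
  then have "norm (g (\<lambda>x. log_rem m ((x - x0) \<bullet> w) * h x)) \<le> norm (g (\<lambda>x. log_rem (Suc m) ((x - x0) \<bullet> w) * h x)) + norm (q * g Z)"
    by (simp only: norm_triangle_ineq4)
  also have "norm (q * g Z) \<le> 1 * norm (g Z)"
    unfolding norm_mult by (rule mult_right_mono) (auto simp: q_def norm_divide simp del: of_nat_Suc)
  also have "norm (g Z) \<le> 2 ^ Suc m * B"
    unfolding Z_def h_def by (rule norm_tempered_one_minus_wave_power[OF g N B])
  finally show ?case using Suc unfolding h_def[symmetric] by simp
qed

text \<open>Bounds for the localised transform along a half-line control its derivative at the end
  point up to a factor \<open>N\<close>, uniformly in \<open>N\<close>: with step size \<open>1/N\<close>, the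
  remainder of order \<open>2k\<close> is \<open>O(N\<^sup>-\<^sup>2\<^sup>k)\<close>, and weighting the Gaussian with
  \<open>|x - x0|\<^sup>2\<^sup>k\<close> costs only \<open>N\<^sup>k\<close> in the seminorm of order \<open>k\<close>, which
  itself is \<open>O(N\<^sup>k)\<close>.\<close>

proposition tempered_direction_bound:
  fixes g :: "'n::finite functional"
  assumes g: "tempered_distribution g"
  obtains K where "0 \<le> K" "\<And>N v \<xi> B. 1 \<le> N \<Longrightarrow> norm v \<le> V \<Longrightarrow> norm \<xi> \<le> 1 \<Longrightarrow>
    (\<And>l :: nat. norm (loc_ft g x0 N (\<xi> + real l *\<^sub>R ((1 / real N) *\<^sub>R v))) \<le> B) \<Longrightarrow>
    norm (g (\<lambda>x. complex_of_real ((x - x0) \<bullet> v) * (gaussian x0 N x * wave \<xi> x))) \<le> real N * (K + K * B)"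
proof -
  obtain C k0 where C: "0 \<le> C" "\<And>f B. schwartz_fun f \<Longrightarrow> schwartz_le k0 B f \<Longrightarrow> norm (g f) \<le> C * B"
    using tempered_distributionE[OF g] by blast
  \<comment> \<open>One order above the seminorm that controls \<open>g\<close>, the form in which
    \<open>derivs_le_log_rem\<close> delivers its bound; \<open>m\<close> gives the remainder the
    even order \<open>2 * k\<close> that matches the weight in
    \<open>gauss_schwartz_le\<close>.\<close>
  define k where "k = Suc k0"
  define m where "m = 2 * k0 + 1"
  have mk: "Suc m = 2 * k" by (simp add: m_def k_def)
  obtain Cg where Cg: "0 \<le> Cg" "\<And>a D (y :: real ^ 'n) b. 0 < a \<Longrightarrow> a \<le> 1 \<Longrightarrow>
     derivs_le k (\<lambda>x. D * (1 + norm (x - y)) ^ (2 * k)) b \<Longrightarrow>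
     schwartz_le k (Cg * D * (1 + norm y) ^ k / min a 1 ^ (k + k)) (\<lambda>x. b x * gauss a y x)"
    using gauss_schwartz_le[of 1 k k, where 'n='n] by blast
  define D where "D = 2 ^ k * (2 ^ k * (V * (1 + V) ^ k)) ^ (2 * k) * 2 ^ k"
  define K1 where "K1 = C * (Cg * D * (1 + norm x0) ^ k * 4 ^ (2 * k))"
  have D0: "0 \<le> D" unfolding D_def by simp
  have K1: "0 \<le> K1" using C Cg D0 by (simp add: K1_def)
  define K where "K = K1 + 2 ^ Suc m"
  show ?thesis
  proof (rule that)
    show "0 \<le> K" using K1 by (simp add: K_def)
    fix N :: nat and v \<xi> :: "real ^ 'n" and B
    assume N: "1 \<le> N" and v: "norm v \<le> V" and \<xi>: "norm \<xi> \<le> 1"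
      and B: "\<And>l :: nat. norm (loc_ft g x0 N (\<xi> + real l *\<^sub>R ((1 / real N) *\<^sub>R v))) \<le> B"
    have V0: "0 \<le> V" using v norm_ge_zero[of v] by linarith
    have Np: "0 < real N" using N by simp
    define w where "w = (1 / real N) *\<^sub>R v"
    have w1: "norm w \<le> V / real N" unfolding w_def using v Np by (simp add: divide_right_mono)
    have "V / real N \<le> V" using V0 N by (simp add: divide_le_eq mult_le_cancel_left1)
    with w1 have w2: "norm w \<le> V" by linarith
    define b where "b = (\<lambda>x. log_rem m ((x - x0) \<bullet> w) * wave \<xi> x)"
    have b: "derivs_le k (\<lambda>x. (D / real N ^ (2 * k)) * (1 + norm (x - x0)) ^ (2 * k)) b"
      unfolding b_def
    proof (rule derivs_le_mono[OF derivs_le_mult[OF derivs_le_log_rem[OF w1 w2, of k0 x0 m, folded k_def] derivs_le_wave] order_refl])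
      fix x
      have "(1 + norm \<xi>) ^ k \<le> 2 ^ k" using \<xi> by (intro power_mono) auto
      then have "2 ^ k * (2 ^ k * (V / real N * (1 + V) ^ k * (1 + norm (x - x0)))) ^ Suc m * (1 + norm \<xi>) ^ k \<le>
        2 ^ k * (2 ^ k * (V / real N * (1 + V) ^ k * (1 + norm (x - x0)))) ^ Suc m * 2 ^ k"
        using V0 by (intro mult_left_mono) auto
      also have "\<dots> = (D / real N ^ (2 * k)) * (1 + norm (x - x0)) ^ (2 * k)"
        unfolding mk D_def by (simp add: power_mult_distrib power_divide)
      finally show "2 ^ k * (2 ^ k * (V / real N * (1 + V) ^ k * (1 + norm (x - x0)))) ^ Suc m * (1 + norm \<xi>) ^ k \<le>
        (D / real N ^ (2 * k)) * (1 + norm (x - x0)) ^ (2 * k)" .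
    qed
    define a where "a = 1 / (4 * real N)"
    have a: "0 < a" "a \<le> 1" "min a 1 = a" using N by (auto simp: a_def min_def field_simps)
    have s1: "schwartz_le k (Cg * (D / real N ^ (2 * k)) * (1 + norm x0) ^ k / a ^ (k + k)) (\<lambda>x. b x * gauss a x0 x)"
      using Cg(2)[OF a(1,2) b] unfolding a(3) .
    \<comment> \<open>\<open>a ^ (k + k)\<close> is of size N^(-2k) and cancels the smallness of the
      remainder, so \<open>N\<close> disappears from the bound.\<close>
    have s2: "Cg * (D / real N ^ (2 * k)) * (1 + norm x0) ^ k / a ^ (k + k) = Cg * D * (1 + norm x0) ^ k * 4 ^ (2 * k)"
      using Np by (simp add: a_def power_divide power_mult_distrib mult_2)
    have s3: "(\<lambda>x. b x * gauss a x0 x) = (\<lambda>x. log_rem m ((x - x0) \<bullet> w) * (gaussian x0 N x * wave \<xi> x))"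
      by (simp add: b_def gaussian_eq_gauss a_def mult_ac)
    have "schwartz_le k0 (Cg * D * (1 + norm x0) ^ k * 4 ^ (2 * k)) (\<lambda>x. log_rem m ((x - x0) \<bullet> w) * (gaussian x0 N x * wave \<xi> x))"
      by (rule schwartz_le_mono[OF s1[unfolded s2 s3]]) (simp_all add: k_def)
    then have R: "norm (g (\<lambda>x. log_rem m ((x - x0) \<bullet> w) * (gaussian x0 N x * wave \<xi> x))) \<le> K1"
      unfolding K1_def
      by (intro C(2) schwartz_fun_mult poly_growth_log_rem schwartz_fun_gaussian_wave N)
    have B0: "0 \<le> B" using B[of 0] norm_ge_zero order_trans by blast
    have "norm (g (\<lambda>x. log_rem 0 ((x - x0) \<bullet> w) * (gaussian x0 N x * wave \<xi> x))) \<le> K1 + 2 ^ Suc m * B"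
      using norm_tempered_log_rem[OF g N B[folded w_def], of m] R by linarith
    also have "\<dots> \<le> K + K * B"
      using K1 B0 by (intro add_mono mult_right_mono) (auto simp: K_def)
    finally have "norm (g (\<lambda>x. log_rem 0 ((x - x0) \<bullet> w) * (gaussian x0 N x * wave \<xi> x))) \<le> K + K * B" .
    \<comment> \<open>\<open>log_rem 0\<close> is linear; undoing the step size \<open>1 / N\<close>
      costs the factor \<open>N\<close> of the claim.\<close>
    moreover have "g (\<lambda>x. complex_of_real ((x - x0) \<bullet> v) * (gaussian x0 N x * wave \<xi> x)) =
        (\<i> * of_nat N) * g (\<lambda>x. log_rem 0 ((x - x0) \<bullet> w) * (gaussian x0 N x * wave \<xi> x))"
    proof -
      have "complex_of_real ((x - x0) \<bullet> v) = (\<i> * of_nat N) * log_rem 0 ((x - x0) \<bullet> w)" for x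
        using Np by (simp add: w_def)
      then have "(\<lambda>x. complex_of_real ((x - x0) \<bullet> v) * (gaussian x0 N x * wave \<xi> x)) =
        (\<lambda>x. (\<i> * of_nat N) * (log_rem 0 ((x - x0) \<bullet> w) * (gaussian x0 N x * wave \<xi> x)))"
        by (simp only: mult.assoc)
      moreover have "schwartz_fun (\<lambda>x. log_rem 0 ((x - x0) \<bullet> w) * (gaussian x0 N x * wave \<xi> x))"
        by (intro schwartz_fun_mult poly_growth_log_rem schwartz_fun_gaussian_wave N)
      ultimately show ?thesis by (simp only: tempered_cmult[OF g])
    qed
    ultimately show "norm (g (\<lambda>x. complex_of_real ((x - x0) \<bullet> v) * (gaussian x0 N x * wave \<xi> x))) \<le> real N * (K + K * B)"
      by (simp add: norm_mult mult_left_mono)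
  qed
qed

text \<open>Wide Gaussians have Schwartz seminorms of size N^k, by \<open>gauss_schwartz_le\<close>
  with \<open>a = 1 / (4 * real N)\<close>. For a general tempered distribution this power of
  \<open>N\<close> stays in the bound and is left to the Gaussian kernel.\<close>

lemma loc_ft_growth:
  fixes g :: "'n::finite functional"
  assumes g: "tempered_distribution g"
  obtains C k where "0 \<le> C" "\<And>N \<xi>. 1 \<le> N \<Longrightarrow> norm (loc_ft g x0 N \<xi>) \<le> C * real N ^ k * (1 + norm \<xi>) ^ k"
proof -
  obtain C k where C: "0 \<le> C" "\<And>f B. schwartz_fun f \<Longrightarrow> schwartz_le k B f \<Longrightarrow> norm (g f) \<le> C * B"
    using tempered_distributionE[OF g] by blast
  obtain Cg where Cg: "0 \<le> Cg" "\<And>a D (y :: real ^ 'n) b. 0 < a \<Longrightarrow> a \<le> 1 \<Longrightarrow>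
     derivs_le k (\<lambda>x. D * (1 + norm (x - y)) ^ (2 * 0)) b \<Longrightarrow>
     schwartz_le k (Cg * D * (1 + norm y) ^ k / min a 1 ^ (k + 0)) (\<lambda>x. b x * gauss a y x)"
    using gauss_schwartz_le[of 1 k 0, where 'n='n] by blast
  define K where "K = C * (Cg * (1 + norm x0) ^ k * 4 ^ k)"
  have "norm (loc_ft g x0 N \<xi>) \<le> K * real N ^ k * (1 + norm \<xi>) ^ k" if N: "1 \<le> N" for N \<xi>
  proof -
    define a where "a = 1 / (4 * real N)"
    have a: "0 < a" "a \<le> 1" "min a 1 = a" using N by (auto simp: a_def min_def field_simps)
    have "derivs_le k (\<lambda>x. (1 + norm \<xi>) ^ k * (1 + norm (x - x0)) ^ (2 * 0)) (wave \<xi>)"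
      using derivs_le_wave[of k \<xi>] by simp
    from Cg(2)[OF a(1,2) this] have s1: "schwartz_le k (Cg * (1 + norm \<xi>) ^ k * (1 + norm x0) ^ k / a ^ (k + 0)) (\<lambda>x. wave \<xi> x * gauss a x0 x)"
      unfolding a(3) .
    have s2: "(\<lambda>x. wave \<xi> x * gauss a x0 x) = (\<lambda>x. gaussian x0 N x * wave \<xi> x)"
      by (simp add: gaussian_eq_gauss a_def mult.commute)
    have "norm (loc_ft g x0 N \<xi>) \<le> C * (Cg * (1 + norm \<xi>) ^ k * (1 + norm x0) ^ k / a ^ (k + 0))"
      unfolding loc_ft_def by (rule C(2)[OF schwartz_fun_gaussian_wave[OF N] s1[unfolded s2]])
    also have "\<dots> = K * real N ^ k * (1 + norm \<xi>) ^ k"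
      using N by (simp add: K_def a_def power_divide power_mult_distrib)
    finally show ?thesis .
  qed
  moreover have "0 \<le> K" using C Cg by (simp add: K_def)
  ultimately show ?thesis using that by blast
qed

text \<open>The exponent 2 N r^2 is shared out: N r^2 goes to \<open>r ^ n\<close>, which is where
  \<open>n \<le> N\<close> enters, and N r^2 / 2 each to the power of \<open>N\<close>, by
  \<open>c \<le> r\<close>, and to the power of 1 + r.\<close>

lemma gaussian_tail_bound:
  assumes c: "0 < c"
  obtains K where "0 \<le> K" "\<And>N n r. 1 \<le> N \<Longrightarrow> n \<le> N \<Longrightarrow> c \<le> r \<Longrightarrow>
    (2 * real N) ^ q * (1 + r) ^ p * r ^ n * exp (- (2 * real N * r\<^sup>2)) \<le> K"
proof -
  define K1 where "K1 = (4 / c\<^sup>2) ^ q * real q ^ q"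
  define K2 where "K2 = (2 * real p) ^ p / min (1 / 2) 1 ^ p"
  have K: "0 \<le> K1" "0 \<le> K2" by (auto simp: K1_def K2_def)
  have "(2 * real N) ^ q * (1 + r) ^ p * r ^ n * exp (- (2 * real N * r\<^sup>2)) \<le> K1 * K2"
    if N: "1 \<le> N" and n: "n \<le> N" and r: "c \<le> r" for N n r
  proof -
    have r0: "0 < r" using c r by linarith
    \<comment> \<open>Chosen so that \<open>2 * real N\<close> is 4 t / c^2, while exp t still fits
      into a quarter of the exponent.\<close>
    define t where "t = real N * c\<^sup>2 / 2"
    have t0: "0 \<le> t" by (simp add: t_def)
    have "r \<le> 1 + r\<^sup>2"
      using sum_squares_ge_zero[of "2 * r - 1" 0] by (simp add: power2_eq_square algebra_simps)
    also have "\<dots> \<le> exp (r\<^sup>2)" by (rule exp_ge_add_one_self)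
    finally have "r ^ n \<le> exp (r\<^sup>2) ^ n" using r0 by (intro power_mono) auto
    also have "\<dots> = exp (real n * r\<^sup>2)" by (simp add: exp_of_nat_mult)
    also have "\<dots> \<le> exp (real N * r\<^sup>2)" using n by (simp add: mult_right_mono)
    finally have e1: "r ^ n \<le> exp (real N * r\<^sup>2)" .
    have "(2 * real N) ^ q \<le> ((4 / c\<^sup>2) * (1 + t)) ^ q"
      using c by (intro power_mono) (auto simp: t_def field_simps)
    also have "\<dots> = (4 / c\<^sup>2) ^ q * (1 + t) ^ q" by (rule power_mult_distrib)
    also have "\<dots> \<le> (4 / c\<^sup>2) ^ q * (real q ^ q * exp t)"
      by (intro mult_left_mono one_plus_power_le_exp t0) auto
    finally have e2: "(2 * real N) ^ q \<le> K1 * exp t" by (simp add: K1_def)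
    have "(1 + r) ^ p \<le> (1 + r) ^ (2 * p)" using r0 by (intro power_increasing) auto
    also have "\<dots> = (1 + r) ^ (2 * p) * exp (- (1 / 2) * r\<^sup>2) * exp (r\<^sup>2 / 2)"
      by (simp add: mult.assoc flip: exp_add)
    also have "\<dots> \<le> K2 * exp (r\<^sup>2 / 2)"
      unfolding K2_def using r0 by (intro mult_right_mono weight_gauss_le) auto
    finally have e3: "(1 + r) ^ p \<le> K2 * exp (r\<^sup>2 / 2)" .
    have "c\<^sup>2 \<le> r\<^sup>2" using c r by (intro power_mono) auto
    then have "t \<le> real N * r\<^sup>2 / 2" unfolding t_def by (simp add: divide_right_mono mult_left_mono)
    moreover have "r\<^sup>2 / 2 \<le> real N * r\<^sup>2 / 2" using N by (simp add: divide_right_mono mult_le_cancel_right1)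
    ultimately have e4: "t + r\<^sup>2 / 2 + real N * r\<^sup>2 \<le> 2 * real N * r\<^sup>2" by argo
    have "(2 * real N) ^ q * (1 + r) ^ p * r ^ n \<le> (K1 * exp t) * (K2 * exp (r\<^sup>2 / 2)) * exp (real N * r\<^sup>2)"
      by (intro mult_mono e1 e2 e3) (use K r0 in auto)
    also have "\<dots> = K1 * K2 * exp (t + r\<^sup>2 / 2 + real N * r\<^sup>2)" by (simp add: exp_add mult_ac)
    also have "\<dots> \<le> K1 * K2 * exp (2 * real N * r\<^sup>2)" using K e4 by (intro mult_left_mono) auto
    finally have "(2 * real N) ^ q * (1 + r) ^ p * r ^ n * exp (- (2 * real N * r\<^sup>2)) \<le>
        K1 * K2 * exp (2 * real N * r\<^sup>2) * exp (- (2 * real N * r\<^sup>2))" by (rule mult_right_mono) simp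
    also have "\<dots> = K1 * K2" by (simp add: mult.assoc flip: exp_add)
    finally show ?thesis .
  qed
  then show ?thesis using K by (intro that[of "K1 * K2"]) auto
qed

text \<open>The first term bounds the central part of a convolution, the second its tail. If
  \<open>f\<close> is not integrable, its integral is 0 by convention and the right-hand side is
  still nonnegative.\<close>

lemma integral_split_bound:
  fixes f W :: "real ^ 'n::finite \<Rightarrow> complex"
  assumes W: "integrable lborel W"
    and le: "AE \<eta> in lborel. norm (f \<eta>) \<le> X * norm (W \<eta>) + Y / (1 + norm \<eta>) ^ decay_deg TYPE('n)"
  shows "norm (LINT \<eta>|lborel. f \<eta>) \<le> X * (LINT \<eta>|lborel. norm (W \<eta>)) + Y * decay_mass TYPE('n)"
proof (cases "integrable lborel f")
  case True
  have i1: "integrable lborel (\<lambda>\<eta>. X * norm (W \<eta>))" by (intro integrable_mult_right integrable_norm W)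
  have i2: "integrable lborel (\<lambda>\<eta> :: real ^ 'n. Y / (1 + norm \<eta>) ^ decay_deg TYPE('n))"
    using integrable_mult_right[OF integrable_decay, of Y] by simp
  have "norm (LINT \<eta>|lborel. f \<eta>) \<le> (LINT \<eta>|lborel. norm (f \<eta>))" by (rule integral_norm_bound)
  also have "\<dots> \<le> (LINT \<eta>|lborel. X * norm (W \<eta>) + Y / (1 + norm \<eta>) ^ decay_deg TYPE('n))"
    by (intro integral_mono_AE le integrable_norm True Bochner_Integration.integrable_add i1 i2)
  also have "\<dots> = X * (LINT \<eta>|lborel. norm (W \<eta>)) + (LINT \<eta>::real ^ 'n|lborel. Y * (1 / (1 + norm \<eta>) ^ decay_deg TYPE('n)))"
    by (subst Bochner_Integration.integral_add[OF i1 i2]) simp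
  also have "(LINT \<eta>::real ^ 'n|lborel. Y * (1 / (1 + norm \<eta>) ^ decay_deg TYPE('n))) = Y * decay_mass TYPE('n)"
    unfolding decay_mass_def by (rule integral_mult_right_zero)
  finally show ?thesis .
next
  case False
  have i1: "integrable lborel (\<lambda>\<eta>. X * norm (W \<eta>))" by (intro integrable_mult_right integrable_norm W)
  have i2: "integrable lborel (\<lambda>\<eta> :: real ^ 'n. Y / (1 + norm \<eta>) ^ decay_deg TYPE('n))"
    using integrable_mult_right[OF integrable_decay, of Y] by simp
  have "0 \<le> (LINT \<eta>|lborel. X * norm (W \<eta>) + Y / (1 + norm \<eta>) ^ decay_deg TYPE('n))"
    by (rule integral_nonneg_AE) (use le in \<open>eventually_elim, use norm_ge_zero order_trans in blast\<close>)
  also have "\<dots> = X * (LINT \<eta>|lborel. norm (W \<eta>)) + (LINT \<eta>::real ^ 'n|lborel. Y * (1 / (1 + norm \<eta>) ^ decay_deg TYPE('n)))"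
    by (subst Bochner_Integration.integral_add[OF i1 i2]) simp
  also have "(LINT \<eta>::real ^ 'n|lborel. Y * (1 / (1 + norm \<eta>) ^ decay_deg TYPE('n))) = Y * decay_mass TYPE('n)"
    unfolding decay_mass_def by (rule integral_mult_right_zero)
  finally show ?thesis using False by (simp add: not_integrable_integral_eq)
qed

text \<open>One more power costs only a geometric factor, since (n + 1)^n \<le> (2n)^n for positive
  n and n + 1 \<le> 2^(n+1). The case \<open>n = 0\<close> relies on
  \<open>0 ^ 0 = 1\<close>.\<close>

lemma self_power_Suc:
  assumes "0 \<le> s" "s \<le> 1"
  shows "(real (n + 1) ^ (n + 1)) powr s \<le> 4 ^ (n + 1) * (real n ^ n) powr s"
proof -
  have "real (n + 1) ^ (n + 1) \<le> 4 ^ (n + 1) * real n ^ n"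
  proof (cases "n = 0")
    case False
    have "real (n + 1) ^ n \<le> (2 * real n) ^ n" using False by (intro power_mono) auto
    moreover have "real (n + 1) \<le> 2 ^ (n + 1)" using of_nat_less_two_power[of "n + 1", where 'a = real] by simp
    ultimately have "real (n + 1) ^ n * real (n + 1) \<le> (2 * real n) ^ n * 2 ^ (n + 1)" by (intro mult_mono) auto
    also have "\<dots> \<le> 2 * ((2 * real n) ^ n * 2 ^ (n + 1))" by simp
    also have "\<dots> = (2 * 2) ^ (n + 1) * real n ^ n" unfolding power_mult_distrib by simp
    finally show ?thesis by (simp add: mult.commute)
  qed auto
  then have "(real (n + 1) ^ (n + 1)) powr s \<le> (4 ^ (n + 1) * real n ^ n) powr s"
    using assms by (intro powr_mono2) auto
  also have "\<dots> = (4 ^ (n + 1)) powr s * (real n ^ n) powr s" by (rule powr_mult)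
  also have "\<dots> \<le> (4 ^ (n + 1)) powr 1 * (real n ^ n) powr s"
    using assms by (intro mult_right_mono powr_mono) (auto simp del: power_Suc)
  finally show ?thesis by simp
qed

section \<open>Differentiation of the witness\<close>

lemma eq_near_partial_deriv:
  assumes "eq_near f x0 g"
  shows "eq_near (\<lambda>\<psi>. f (partial_deriv i \<psi>)) x0 (\<lambda>\<psi>. g (partial_deriv i \<psi>))"
proof -
  obtain U where U: "open U" "x0 \<in> U" "\<And>\<psi>. test_fun \<psi> \<Longrightarrow> supp \<psi> \<subseteq> U \<Longrightarrow> f \<psi> = g \<psi>"
    using assms unfolding eq_near_def by blast
  show ?thesis unfolding eq_near_def
  proof (intro exI[of _ U] conjI allI impI U(1,2))
    fix \<psi> assume "test_fun \<psi> \<and> supp \<psi> \<subseteq> U"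
    then show "f (partial_deriv i \<psi>) = g (partial_deriv i \<psi>)"
      using test_fun_partial_derivs[of \<psi> "[i]"] supp_partial_deriv[of i \<psi>] by (intro U(3)) auto
  qed
qed

lemma tempered_partial_deriv:
  assumes g: "tempered_distribution g"
  shows "tempered_distribution (\<lambda>\<psi>. g (partial_deriv i \<psi>))"
proof -
  obtain C k where C: "0 \<le> C" "\<And>f B. schwartz_fun f \<Longrightarrow> schwartz_le k B f \<Longrightarrow> norm (g f) \<le> C * B"
    using tempered_distributionE[OF g] by blast
  show ?thesis
  proof (rule tempered_distributionI)
    show "linear_form_on schwartz_fun (\<lambda>\<psi>. g (partial_deriv i \<psi>))"
      unfolding linear_form_on_def
    proof (intro conjI allI impI)
      fix \<psi> \<eta> :: "real ^ 'a \<Rightarrow> complex" assume s: "schwartz_fun \<psi>" "schwartz_fun \<eta>"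
      have "partial_deriv i (\<lambda>x. \<psi> x + \<eta> x) = (\<lambda>x. partial_deriv i \<psi> x + partial_deriv i \<eta> x)"
        by (intro ext partial_deriv_add smooth_differentiable schwartz_fun_smooth s)
      then show "g (partial_deriv i (\<lambda>x. \<psi> x + \<eta> x)) = g (partial_deriv i \<psi>) + g (partial_deriv i \<eta>)"
        by (simp add: tempered_add[OF g schwartz_fun_partial_deriv[OF s(1)] schwartz_fun_partial_deriv[OF s(2)]])
    next
      fix c and \<psi> :: "real ^ 'a \<Rightarrow> complex" assume s: "schwartz_fun \<psi>"
      have "partial_deriv i (\<lambda>x. c * \<psi> x) = (\<lambda>x. c * partial_deriv i \<psi> x)"
        by (intro ext partial_deriv_cmult smooth_differentiable schwartz_fun_smooth s)
      then show "g (partial_deriv i (\<lambda>x. c * \<psi> x)) = c * g (partial_deriv i \<psi>)"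
        by (simp add: tempered_cmult[OF g schwartz_fun_partial_deriv[OF s]])
    qed
    fix f :: "real ^ 'a \<Rightarrow> complex" and B assume "schwartz_fun f" "schwartz_le (Suc k) B f"
    then show "norm (g (partial_deriv i f)) \<le> C * B"
      by (intro C schwartz_fun_partial_deriv schwartz_le_partial_deriv)
  qed
qed

text \<open>At low frequency there is no decay to exploit: moving the derivative to the Gaussian costs
  \<open>|x - x0| / (2N)\<close>, which \<open>tempered_direction_bound\<close> absorbs.\<close>

lemma loc_ft_partial_deriv_low:
  fixes g :: "'n::finite functional"
  assumes g: "tempered_distribution g" and \<tau>: "0 < \<tau>" and B: "0 \<le> B"
  obtains K where "0 \<le> K" "\<And>N \<xi>. 1 \<le> N \<Longrightarrow> norm \<xi> \<le> 1 \<Longrightarrow>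
    (\<And>v t. norm (v - \<xi>0) \<le> \<tau> \<Longrightarrow> 0 \<le> t \<Longrightarrow> norm (loc_ft g x0 N (\<xi> + t *\<^sub>R v)) \<le> B) \<Longrightarrow>
    norm (loc_ft (\<lambda>\<psi>. g (partial_deriv i \<psi>)) x0 N \<xi>) \<le> K"
proof -
  define V where "V = norm \<xi>0 + \<tau>"
  obtain K0 where K0: "0 \<le> K0" "\<And>N v \<xi> B. 1 \<le> N \<Longrightarrow> norm v \<le> V \<Longrightarrow> norm \<xi> \<le> 1 \<Longrightarrow>
    (\<And>l :: nat. norm (loc_ft g x0 N (\<xi> + real l *\<^sub>R ((1 / real N) *\<^sub>R v))) \<le> B) \<Longrightarrow>
    norm (g (\<lambda>x. complex_of_real ((x - x0) \<bullet> v) * (gaussian x0 N x * wave \<xi> x))) \<le> real N * (K0 + K0 * B)"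
    using tempered_direction_bound[OF g] by blast
  define K where "K = B + (1 / \<tau>) * (K0 + K0 * B)"
  show ?thesis
  proof (rule that)
    show "0 \<le> K" using B K0 \<tau> by (simp add: K_def)
    fix N :: nat and \<xi> :: "real ^ 'n"
    assume N: "1 \<le> N" and \<xi>: "norm \<xi> \<le> 1"
      and b: "\<And>v t. norm (v - \<xi>0) \<le> \<tau> \<Longrightarrow> 0 \<le> t \<Longrightarrow> norm (loc_ft g x0 N (\<xi> + t *\<^sub>R v)) \<le> B"
    define h where "h x = gaussian x0 N x * wave \<xi> x" for x
    have h: "schwartz_fun h" unfolding h_def[abs_def] by (rule schwartz_fun_gaussian_wave[OF N])
    define P where "P v = (\<lambda>x. complex_of_real ((x - x0) \<bullet> v) * h x)" for v
    have Ps: "schwartz_fun (P v)" for v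
    proof -
      have "P v = (\<lambda>x. \<i> * (log_rem 0 ((x - x0) \<bullet> v) * h x))" by (simp add: P_def fun_eq_iff mult.assoc[symmetric])
      then show ?thesis by (simp only:) (intro schwartz_fun_cmult schwartz_fun_mult poly_growth_log_rem h)
    qed
    have Pb: "norm (g (P v)) \<le> real N * (K0 + K0 * B)" if v: "norm (v - \<xi>0) \<le> \<tau>" for v
      unfolding P_def h_def
    proof (rule K0(2)[OF N _ \<xi>])
      show "norm v \<le> V" using v norm_triangle_ineq[of \<xi>0 "v - \<xi>0"] by (simp add: V_def)
      show "norm (loc_ft g x0 N (\<xi> + real l *\<^sub>R ((1 / real N) *\<^sub>R v))) \<le> B" for l :: nat
        using b[OF v, of "real l * (1 / real N)"] by simp
    qed
    \<comment> \<open>A coordinate direction need not lie near the cone, but it is, up to the factor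
      \<open>\<tau>\<close>, the difference of two directions close to \<open>\<xi>0\<close>, and
      the bound is available on half-lines in both.\<close>
    define v1 where "v1 = \<xi>0 + \<tau> *\<^sub>R axis i 1"
    have v1: "norm (v1 - \<xi>0) \<le> \<tau>" using \<tau> by (simp add: v1_def)
    define q1 where "q1 = complex_of_real (- (1 / (2 * real N)) * (1 / \<tau>))"
    define q2 where "q2 = - \<i> * complex_of_real (\<xi> $ i)"
    have "partial_deriv i h x = q1 * P v1 x - q1 * P \<xi>0 x + q2 * h x" for x
    proof -
      have d: "gaussian x0 N differentiable at x" unfolding gaussian_eq_gauss by (rule gauss_differentiable)
      have c: "coord (- 2 * (1 / (4 * real N))) i x0 x = q1 * complex_of_real ((x - x0) \<bullet> v1) - q1 * complex_of_real ((x - x0) \<bullet> \<xi>0)"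
      proof -
        have iv: "(x - x0) \<bullet> v1 = (x - x0) \<bullet> \<xi>0 + \<tau> * (x - x0) $ i" by (simp add: v1_def inner_add_right inner_axis)
        have "- 2 * (1 / (4 * real N)) * (x - x0) $ i = - (1 / (2 * real N)) * (1 / \<tau>) * ((x - x0) \<bullet> v1) - - (1 / (2 * real N)) * (1 / \<tau>) * ((x - x0) \<bullet> \<xi>0)"
        proof -
          have "- 2 * (1 / (4 * M)) * p = - (1 / (2 * M)) * (1 / \<tau>) * (q + \<tau> * p) - - (1 / (2 * M)) * (1 / \<tau>) * q"
            if "0 < M" for M p q :: real
            using that \<tau> by (simp add: field_simps)
          then show ?thesis unfolding iv using N by simp
        qed
        then show ?thesis unfolding coord_def q1_def by (simp only: of_real_diff of_real_mult)
      qed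
      have "partial_deriv i h x = gaussian x0 N x * partial_deriv i (wave \<xi>) x + partial_deriv i (gaussian x0 N) x * wave \<xi> x"
        unfolding h_def[abs_def] by (rule partial_deriv_mult[OF d wave_differentiable])
      also have "\<dots> = q2 * h x + coord (- 2 * (1 / (4 * real N))) i x0 x * h x"
        by (simp only: partial_deriv_wave gaussian_eq_gauss partial_deriv_gauss q2_def h_def mult_ac)
      finally show ?thesis unfolding c by (simp add: P_def algebra_simps)
    qed
    then have "partial_deriv i h = (\<lambda>x. (q1 * P v1 x - q1 * P \<xi>0 x) + q2 * h x)" by blast
    then have "g (partial_deriv i h) = (q1 * g (P v1) - q1 * g (P \<xi>0)) + q2 * g h"
      by (simp add: tempered_add[OF g] tempered_diff[OF g] tempered_cmult[OF g] schwartz_fun_diff schwartz_fun_cmult Ps h)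
    also have "norm \<dots> \<le> (norm q1 * norm (g (P v1)) + norm q1 * norm (g (P \<xi>0))) + norm q2 * norm (g h)"
      unfolding norm_mult[symmetric] by (intro order_trans[OF norm_triangle_ineq] add_mono norm_triangle_ineq4 order_refl)
    also have "\<dots> \<le> (norm q1 * (real N * (K0 + K0 * B)) + norm q1 * (real N * (K0 + K0 * B))) + 1 * B"
    proof (intro add_mono mult_left_mono mult_mono)
      show "norm (g (P v1)) \<le> real N * (K0 + K0 * B)" by (rule Pb[OF v1])
      show "norm (g (P \<xi>0)) \<le> real N * (K0 + K0 * B)" by (rule Pb) (use \<tau> in simp)
      show "norm q2 \<le> 1" using component_le_norm_cart[of \<xi> i] \<xi> by (simp add: q2_def norm_mult)
      show "norm (g h) \<le> B" using b[of \<xi>0 0] \<tau> by (simp add: loc_ft_def h_def[abs_def])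
    qed auto
    also have "\<dots> = K"
    proof -
      \<comment> \<open>The factor 1 / (2N) from differentiating the Gaussian cancels the
        \<open>N\<close> of the direction bound.\<close>
      have "norm q1 * real N = (1 / \<tau>) / 2" using \<tau> N unfolding q1_def norm_of_real by (simp add: abs_mult)
      then have "norm q1 * (real N * (K0 + K0 * B)) = (1 / \<tau>) / 2 * (K0 + K0 * B)" by (simp only: mult.assoc[symmetric])
      then show ?thesis by (simp add: K_def)
    qed
    finally show "norm (loc_ft (\<lambda>\<psi>. g (partial_deriv i \<psi>)) x0 N \<xi>) \<le> K"
      by (simp add: loc_ft_def h_def[abs_def])
  qed
qed

text \<open>At high frequency the window is split as the square of a wider one, and the Gaussian
  convolution kernel of one factor absorbs the power of the frequency.\<close>

lemma loc_ft_partial_deriv_kernel: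
  fixes g :: "'n::finite functional" and N :: nat and x0 :: "real ^ 'n"
  defines "W \<equiv> gauss_kernel (1 / (8 * real N)) x0"
  assumes g: "tempered_distribution g" and N: "1 \<le> N"
  shows "loc_ft (\<lambda>\<psi>. g (partial_deriv i \<psi>)) x0 N \<xi> = (LINT \<eta>|lborel.
     (2 * (- \<i> * complex_of_real (\<eta> $ i) * W \<eta>) + (- \<i> * complex_of_real (\<xi> $ i)) * W \<eta>) * loc_ft g x0 (2 * N) (\<xi> + \<eta>))"
proof -
  \<comment> \<open>Half of the exponent 1 / (4N) of the given window, and at the same time the
    exponent of the window of order \<open>2 * N\<close>.\<close>
  define a where "a = 1 / (8 * real N)"
  have a: "0 < a" using N by (simp add: a_def)
  define A where "A = gauss a x0"
  have AW: "fourier_int W = A" unfolding W_def A_def a_def[symmetric] using fourier_int_gauss_kernel[OF a] by blast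
  have Ws: "schwartz_fun W" unfolding W_def a_def[symmetric] by (rule schwartz_fun_gauss_kernel[OF a])
  have W: "rapid_L1 W" by (rule schwartz_fun_rapid_L1[OF Ws])
  have A2: "A = gaussian x0 (2 * N)" by (simp add: A_def a_def gaussian_eq_gauss)
  have AA: "gaussian x0 N x = A x * A x" for x
    using N by (simp add: A_def a_def gaussian_def gauss_def flip: of_real_mult exp_add)
  have As: "schwartz_fun A" unfolding A_def by (rule schwartz_fun_gauss[OF a])
  define h where "h = (\<lambda>x. A x * wave \<xi> x)"
  have h: "schwartz_fun h" unfolding h_def by (rule schwartz_fun_mult_wave[OF As])
  define W1 where "W1 = (\<lambda>\<eta>. - \<i> * complex_of_real (\<eta> $ i) * W \<eta>)"
  define q where "q = - \<i> * complex_of_real (\<xi> $ i)"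
  have W1: "rapid_L1 W1" unfolding W1_def by (rule rapid_L1_coord[OF W])
  \<comment> \<open>The product rule on \<open>A\<close> times \<open>A\<close> times the wave gives
    twice the derivative of \<open>A\<close>, hence the factor 2, and \<open>q\<close> from the
    wave.\<close>
  define W' where "W' = (\<lambda>\<eta>. 2 * W1 \<eta> + q * W \<eta>)"
  have W': "rapid_L1 W'"
  proof -
    have "W' = (\<lambda>\<eta>. (2 * (- \<i> * complex_of_real (\<eta> $ i)) + q) * W \<eta>)"
      by (simp add: W'_def W1_def fun_eq_iff algebra_simps)
    moreover have "rapid_L1 (\<lambda>\<eta>. (2 * (- \<i> * complex_of_real (\<eta> $ i)) + q) * W \<eta>)"
    proof (rule rapid_L1_mult[OF W, where C = "2 + norm q" and k = 1])
      fix \<eta> :: "real ^ 'n"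
      have "norm (2 * (- \<i> * complex_of_real (\<eta> $ i)) + q) \<le> 2 * \<bar>\<eta> $ i\<bar> + norm q"
        by (rule order_trans[OF norm_triangle_ineq]) (simp add: norm_mult)
      also have "\<dots> \<le> 2 * norm \<eta> + norm q" using component_le_norm_cart[of \<eta> i] by simp
      also have "\<dots> \<le> (2 + norm q) * (1 + norm \<eta>) ^ 1"
        using mult_nonneg_nonneg[OF norm_ge_zero[of q] norm_ge_zero[of \<eta>]] by (simp add: algebra_simps)
      finally show "norm (2 * (- \<i> * complex_of_real (\<eta> $ i)) + q) \<le> (2 + norm q) * (1 + norm \<eta>) ^ 1" .
    qed measurable
    ultimately show ?thesis by simp
  qed
  have FW': "fourier_int W' x = 2 * fourier_int W1 x + q * A x" for x
  proof -
    have "fourier_int W' x = (LINT \<eta>|lborel. 2 * (W1 \<eta> * wave \<eta> x) + q * (W \<eta> * wave \<eta> x))"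
      by (simp add: fourier_int_def W'_def algebra_simps)
    also have "\<dots> = 2 * fourier_int W1 x + q * fourier_int W x"
      unfolding fourier_int_def
      by (subst Bochner_Integration.integral_add[OF integrable_mult_right[OF rapid_L1_integrable_wave[OF W1]]
            integrable_mult_right[OF rapid_L1_integrable_wave[OF W]]])
        (simp only: integral_mult_right_zero)
    finally show ?thesis by (simp only: AW)
  qed
  have dA: "A differentiable at x" for x unfolding A_def by (rule gauss_differentiable)
  have dh: "h differentiable at x" for x by (rule smooth_differentiable[OF schwartz_fun_smooth[OF h]])
  have pA: "partial_deriv i A x = fourier_int W1 x" for x
    unfolding AW[symmetric] W1_def by (simp only: partial_deriv_fourier_int[OF W])
  have ph: "partial_deriv i h x = q * h x + fourier_int W1 x * wave \<xi> x" for x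
    unfolding h_def by (subst partial_deriv_mult[OF dA wave_differentiable]) (simp only: partial_deriv_wave pA q_def mult_ac)
  have "(\<lambda>x. gaussian x0 N x * wave \<xi> x) = (\<lambda>x. h x * A x)" by (simp add: AA h_def mult_ac)
  moreover have "partial_deriv i (\<lambda>x. h x * A x) = (\<lambda>x. h x * fourier_int W' x)"
  proof
    fix x
    have "partial_deriv i (\<lambda>x. h x * A x) x = h x * partial_deriv i A x + partial_deriv i h x * A x"
      by (rule partial_deriv_mult[OF dh dA])
    also have "\<dots> = h x * fourier_int W' x"
      unfolding pA ph FW' by (simp add: h_def algebra_simps)
    finally show "partial_deriv i (\<lambda>x. h x * A x) x = h x * fourier_int W' x" .
  qed
  ultimately have "loc_ft (\<lambda>\<psi>. g (partial_deriv i \<psi>)) x0 N \<xi> = g (\<lambda>x. h x * fourier_int W' x)"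
    by (simp add: loc_ft_def)
  also have "\<dots> = (LINT \<eta>|lborel. W' \<eta> * g (\<lambda>x. h x * wave \<eta> x))"
    by (rule tempered_mult_fourier_int[OF g h W'])
  also have "\<dots> = (LINT \<eta>|lborel. W' \<eta> * loc_ft g x0 (2 * N) (\<xi> + \<eta>))"
    by (simp add: loc_ft_def h_def A2 wave_add mult.assoc)
  finally show ?thesis unfolding W'_def W1_def q_def .
qed

lemma norm_triangle_half: "norm \<eta> \<le> norm \<xi> / 2 \<Longrightarrow> 1 + norm \<xi> \<le> 2 * (1 + norm (\<xi> + \<eta> :: 'a::real_normed_vector))"
  using norm_triangle_ineq4[of "\<xi> + \<eta>" \<eta>] norm_ge_zero[of "\<xi> + \<eta>"] by (simp add: field_simps)

lemma one_plus_norm_add_le: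
  assumes "0 < c" "norm (\<xi> :: 'a::real_normed_vector) \<le> norm \<eta> / c"
  shows "1 + norm (\<xi> + \<eta>) \<le> (1 + 1 / c) * (1 + norm \<eta>)"
proof -
  have "1 + norm (\<xi> + \<eta>) \<le> 1 + (norm \<eta> / c + norm \<eta>)" using norm_triangle_ineq[of \<xi> \<eta>] assms by simp
  also have "1 + (norm \<eta> / c + norm \<eta>) \<le> (1 + 1 / c) * (1 + norm \<eta>)"
    using assms(1) by (simp add: algebra_simps)
  finally show ?thesis .
qed

text \<open>Of the \<open>n + 1\<close> powers available near the centre, one compensates the
  frequency brought down by the derivative. In the far region the \<open>n\<close> powers of |\<xi>|
  are traded for powers of |\<eta>| and left to the Gaussian.\<close>

lemma loc_ft_partial_deriv_high:
  fixes g :: "'n::finite functional"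
  assumes g: "tempered_distribution g" and s: "0 \<le> s" "s \<le> 1"
    and d: "loc_decay s g x0 \<Gamma> C N0" and C: "0 < C" and N0: "1 \<le> N0"
    and c: "0 < c" "c \<le> 1 / 2"
  obtains P where "0 \<le> P" "\<And>N \<xi> n. N0 \<le> N \<Longrightarrow> n \<le> N \<Longrightarrow> 1 \<le> norm \<xi> \<Longrightarrow>
    (\<And>\<eta>. norm \<eta> \<le> c * norm \<xi> \<Longrightarrow> \<xi> + \<eta> \<in> \<Gamma>) \<Longrightarrow>
    (1 + norm \<xi>) ^ n * norm (loc_ft (\<lambda>\<psi>. g (partial_deriv i \<psi>)) x0 N \<xi>) \<le> P ^ (n + 1) * (real n ^ n) powr s"
proof -
  define dd where "dd = decay_deg TYPE('n)"
  define m where "m = decay_mass TYPE('n)"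
  have m0: "0 \<le> m" unfolding m_def by (rule decay_mass_nonneg)
  obtain C1 k where C1: "0 \<le> C1" "\<And>N \<xi>. 1 \<le> N \<Longrightarrow> norm (loc_ft g x0 N \<xi>) \<le> C1 * real N ^ k * (1 + norm \<xi>) ^ k"
    using loc_ft_growth[OF g] by blast
  \<comment> \<open>\<open>k + CARD('n)\<close> powers of \<open>N\<close> come from the growth of
    the localised transform and the normalisation of the kernel; of the powers of 1 + r,
    \<open>k\<close> come from that growth, one from the derivative, and \<open>dd\<close> ensure
    integrability.\<close>
  obtain K where K: "0 \<le> K" "\<And>N n r. 1 \<le> N \<Longrightarrow> n \<le> N \<Longrightarrow> c \<le> r \<Longrightarrow>
    (2 * real N) ^ (k + CARD('n)) * (1 + r) ^ (k + 1 + dd) * r ^ n * exp (- (2 * real N * r\<^sup>2)) \<le> K"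
    using gaussian_tail_bound[OF c(1)] by blast
  define Y0 where "Y0 = (2 + 1 / c) * C1 * (1 + 1 / c) ^ k * K"
  have Y0: "0 \<le> Y0" using c C1 K by (simp add: Y0_def)
  \<comment> \<open>Both constants have the shape produced by \<open>absorb_geometric\<close>,
    \<open>P1\<close> for the central part and \<open>P2\<close> for the tail.\<close>
  define P1 where "P1 = (1 + 16 * C\<^sup>2) * (1 + 8 * C * 2)"
  define P2 where "P2 = (1 + Y0 * m) * (1 + 2 / c)"
  have P12: "0 \<le> P1" "0 \<le> P2" using C c Y0 m0 by (auto simp: P1_def P2_def)
  show ?thesis
  proof (rule that)
    show "0 \<le> P1 + P2" using P12 by simp
    fix N n and \<xi> :: "real ^ 'n"
    assume N: "N0 \<le> N" and n: "n \<le> N" and \<xi>: "1 \<le> norm \<xi>"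
      and cone: "\<And>\<eta>. norm \<eta> \<le> c * norm \<xi> \<Longrightarrow> \<xi> + \<eta> \<in> \<Gamma>"
    have N1: "1 \<le> N" using N N0 by simp
    define a where "a = 1 / (8 * real N)"
    have a: "0 < a" using N1 by (simp add: a_def)
    define W where "W = gauss_kernel a x0"
    define f where "f \<eta> = (2 * (- \<i> * complex_of_real (\<eta> $ i) * W \<eta>) + (- \<i> * complex_of_real (\<xi> $ i)) * W \<eta>) * loc_ft g x0 (2 * N) (\<xi> + \<eta>)" for \<eta>
    define S where "S = (real n ^ n) powr s"
    have S: "1 \<le> S" unfolding S_def by (rule self_power_powr_ge_1[OF s(1)])
    define Q where "Q = C ^ (n + 2) * (real (n + 1) ^ (n + 1)) powr s"
    have Q: "0 \<le> Q" using C by (simp add: Q_def)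
    define T where "T = (1 + norm \<xi>) ^ n"
    have T: "0 < T" by (simp add: T_def)
    \<comment> \<open>The bounds for the two regions, divided by the weight \<open>T\<close> so that
      they refer to the localised transform itself.\<close>
    define X where "X = 2 * Q * 2 ^ (n + 1) / T"
    define Y where "Y = Y0 * (2 / c) ^ n / T"
    have X: "0 \<le> X" and Y: "0 \<le> Y" using Q T Y0 c by (auto simp: X_def Y_def)
    have W: "integrable lborel W"
      using rapid_L1_integrable_wave[OF schwartz_fun_rapid_L1[OF schwartz_fun_gauss_kernel[OF a]], of x0 0]
      by (simp add: W_def)
    \<comment> \<open>The prefactor is bounded crudely, since the tail bound absorbs any fixed power
      of \<open>N\<close>; the exponent is exact, with 1 / (4a) = 2N.\<close>
    have Wle: "norm (W \<eta>) \<le> (2 * real N) ^ CARD('n) * exp (- (2 * real N * (norm \<eta>)\<^sup>2))" for \<eta>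
    proof -
      have "1 / (4 * pi * a) = 2 * real N / pi" using N1 by (simp add: a_def)
      also have "\<dots> \<le> 2 * real N" using pi_ge_two N1 by (simp add: divide_le_eq mult_le_cancel_left1)
      also have "\<dots> \<le> (2 * real N)\<^sup>2" using N1 by (simp add: power2_eq_square mult_le_cancel_left1)
      finally have "sqrt (1 / (4 * pi * a)) \<le> 2 * real N" by (simp add: real_le_lsqrt)
      then have "sqrt (1 / (4 * pi * a)) ^ CARD('n) \<le> (2 * real N) ^ CARD('n)"
        using a by (intro power_mono) auto
      moreover have "- (norm \<eta>)\<^sup>2 / (4 * a) = - (2 * real N * (norm \<eta>)\<^sup>2)" using N1 by (simp add: a_def)
      ultimately show ?thesis unfolding W_def norm_gauss_kernel[OF a] by (simp add: mult_right_mono)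
    qed
    have W'le: "norm (2 * (- \<i> * complex_of_real (\<eta> $ i) * W \<eta>) + (- \<i> * complex_of_real (\<xi> $ i)) * W \<eta>) \<le> (2 * norm \<eta> + norm \<xi>) * norm (W \<eta>)" for \<eta>
    proof -
      have "norm (2 * (- \<i> * complex_of_real (\<eta> $ i) * W \<eta>) + (- \<i> * complex_of_real (\<xi> $ i)) * W \<eta>) \<le> 2 * \<bar>\<eta> $ i\<bar> * norm (W \<eta>) + \<bar>\<xi> $ i\<bar> * norm (W \<eta>)"
        by (rule order_trans[OF norm_triangle_ineq]) (simp add: norm_mult)
      also have "\<dots> \<le> 2 * norm \<eta> * norm (W \<eta>) + norm \<xi> * norm (W \<eta>)"
        by (intro add_mono mult_right_mono mult_left_mono component_le_norm_cart) auto
      finally show ?thesis by (simp add: distrib_right)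
    qed
    have "norm (f \<eta>) \<le> X * norm (W \<eta>) + Y / (1 + norm \<eta>) ^ dd" for \<eta>
    proof (cases "norm \<eta> \<le> c * norm \<xi>")
      case True
      have half: "norm \<eta> \<le> norm \<xi> / 2" using True mult_right_mono[OF c(2) norm_ge_zero[of \<xi>]] by simp
      have "(1 + norm (\<xi> + \<eta>)) ^ (n + 1) * norm (loc_ft g x0 (2 * N) (\<xi> + \<eta>)) \<le> C ^ (n + 1 + 1) * (real (n + 1) ^ (n + 1)) powr s"
        by (rule loc_decayD[OF d]) (use N n N1 cone[OF True] in auto)
      then have l: "(1 + norm (\<xi> + \<eta>)) ^ (n + 1) * norm (loc_ft g x0 (2 * N) (\<xi> + \<eta>)) \<le> Q" by (simp add: Q_def)
      have "(1 + norm \<xi>) ^ (n + 1) * norm (loc_ft g x0 (2 * N) (\<xi> + \<eta>)) \<le> (2 * (1 + norm (\<xi> + \<eta>))) ^ (n + 1) * norm (loc_ft g x0 (2 * N) (\<xi> + \<eta>))"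
        using norm_triangle_half[OF half] by (intro mult_right_mono power_mono) auto
      also have "\<dots> = 2 ^ (n + 1) * ((1 + norm (\<xi> + \<eta>)) ^ (n + 1) * norm (loc_ft g x0 (2 * N) (\<xi> + \<eta>)))"
        by (simp only: power_mult_distrib mult.assoc)
      also have "\<dots> \<le> 2 ^ (n + 1) * Q" by (rule mult_left_mono[OF l]) simp
      finally have l2: "(1 + norm \<xi>) ^ (n + 1) * norm (loc_ft g x0 (2 * N) (\<xi> + \<eta>)) \<le> 2 ^ (n + 1) * Q" .
      have "T * norm (f \<eta>) \<le> T * ((2 * norm \<eta> + norm \<xi>) * norm (W \<eta>) * norm (loc_ft g x0 (2 * N) (\<xi> + \<eta>)))"
        unfolding f_def norm_mult[of _ "loc_ft g x0 (2 * N) (\<xi> + \<eta>)"] using T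
        by (intro mult_left_mono mult_right_mono W'le) auto
      also have "\<dots> \<le> T * ((2 * (1 + norm \<xi>)) * norm (W \<eta>) * norm (loc_ft g x0 (2 * N) (\<xi> + \<eta>)))"
        using half T by (intro mult_left_mono mult_right_mono) auto
      also have "\<dots> = 2 * norm (W \<eta>) * ((1 + norm \<xi>) ^ (n + 1) * norm (loc_ft g x0 (2 * N) (\<xi> + \<eta>)))"
        by (simp add: T_def)
      also have "\<dots> \<le> 2 * norm (W \<eta>) * (2 ^ (n + 1) * Q)" by (rule mult_left_mono[OF l2]) simp
      also have "\<dots> = T * (X * norm (W \<eta>))" using T by (simp add: X_def)
      finally have "norm (f \<eta>) \<le> X * norm (W \<eta>)" using T by simp
      then show ?thesis using Y by (simp add: add_increasing2)
    next
      case False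
      then have far: "c * norm \<xi> < norm \<eta>" by simp
      then have \<xi>\<eta>: "norm \<xi> \<le> norm \<eta> / c" using c by (simp add: field_simps)
      define r where "r = norm \<eta>"
      \<comment> \<open>Frequencies of norm at least 1 keep the far region away from the origin,
        independently of \<open>N\<close>.\<close>
      have "c * 1 \<le> c * norm \<xi>" using c \<xi> by (intro mult_left_mono) auto
      then have rc: "c \<le> r" using far by (simp add: r_def)
      then have r0: "0 < r" using c by simp
      define E where "E = exp (- (2 * real N * r\<^sup>2))"
      have "norm (f \<eta>) \<le> ((2 * norm \<eta> + norm \<xi>) * norm (W \<eta>)) * norm (loc_ft g x0 (2 * N) (\<xi> + \<eta>))"
        unfolding f_def norm_mult[of _ "loc_ft g x0 (2 * N) (\<xi> + \<eta>)"] by (intro mult_right_mono W'le) auto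
      also have "\<dots> \<le> (((2 + 1 / c) * (1 + r)) * ((2 * real N) ^ CARD('n) * E)) * (C1 * (2 * real N) ^ k * ((1 + 1 / c) * (1 + r)) ^ k)"
      proof (intro mult_mono)
        have "2 * norm \<eta> + norm \<xi> \<le> (2 + 1 / c) * r" using \<xi>\<eta> by (simp add: r_def algebra_simps)
        also have "\<dots> \<le> (2 + 1 / c) * (1 + r)" using c by (intro mult_left_mono) auto
        finally show "2 * norm \<eta> + norm \<xi> \<le> (2 + 1 / c) * (1 + r)" .
        show "norm (W \<eta>) \<le> (2 * real N) ^ CARD('n) * E" unfolding E_def r_def by (rule Wle)
        have "norm (loc_ft g x0 (2 * N) (\<xi> + \<eta>)) \<le> C1 * real (2 * N) ^ k * (1 + norm (\<xi> + \<eta>)) ^ k"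
          by (rule C1(2)) (use N1 in simp)
        also have "\<dots> \<le> C1 * (2 * real N) ^ k * ((1 + 1 / c) * (1 + r)) ^ k"
          unfolding r_def using C1(1) one_plus_norm_add_le[OF c(1) \<xi>\<eta>] by (intro mult_mono power_mono) auto
        finally show "norm (loc_ft g x0 (2 * N) (\<xi> + \<eta>)) \<le> C1 * (2 * real N) ^ k * ((1 + 1 / c) * (1 + r)) ^ k" .
      qed (use c r0 in \<open>auto simp: E_def\<close>)
      also have "\<dots> = ((2 + 1 / c) * C1 * (1 + 1 / c) ^ k) * ((2 * real N) ^ (k + CARD('n)) * (1 + r) ^ (k + 1) * E)"
        by (simp add: power_mult_distrib power_add mult_ac)
      finally have fle: "norm (f \<eta>) \<le> ((2 + 1 / c) * C1 * (1 + 1 / c) ^ k) * ((2 * real N) ^ (k + CARD('n)) * (1 + r) ^ (k + 1) * E)" .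
      have cr: "(c / 2 * (1 + norm \<xi>)) ^ n \<le> r ^ n"
      proof (rule power_mono)
        have "c * (1 + norm \<xi>) \<le> c * (2 * norm \<xi>)" using c \<xi> by (intro mult_left_mono) auto
        also have "\<dots> \<le> 2 * r" using far by (simp add: r_def)
        finally show "c / 2 * (1 + norm \<xi>) \<le> r" by simp
      qed (use c in auto)
      have Tr: "T \<le> (2 / c) ^ n * r ^ n"
      proof -
        have "(2 / c) ^ n * ((c / 2) ^ n * T) \<le> (2 / c) ^ n * r ^ n"
          using c cr by (intro mult_left_mono) (simp_all only: T_def power_mult_distrib, simp)
        moreover have "(2 / c) ^ n * ((c / 2) ^ n * T) = T"
          using c by (simp add: mult.assoc[symmetric] flip: power_mult_distrib)
        ultimately show ?thesis by simp
      qed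
      have "T * norm (f \<eta>) * (1 + r) ^ dd \<le> ((2 / c) ^ n * r ^ n) * (((2 + 1 / c) * C1 * (1 + 1 / c) ^ k) * ((2 * real N) ^ (k + CARD('n)) * (1 + r) ^ (k + 1) * E)) * (1 + r) ^ dd"
        using c r0 C1(1) by (intro mult_mono Tr fle) (auto simp: E_def)
      also have "\<dots> = (2 / c) ^ n * ((2 + 1 / c) * C1 * (1 + 1 / c) ^ k) * ((2 * real N) ^ (k + CARD('n)) * (1 + r) ^ (k + 1 + dd) * r ^ n * E)"
        by (simp add: power_add mult_ac)
      also have "\<dots> \<le> (2 / c) ^ n * ((2 + 1 / c) * C1 * (1 + 1 / c) ^ k) * K"
        unfolding E_def using c C1(1) by (intro mult_left_mono K(2)[OF N1 n rc]) auto
      also have "\<dots> = T * Y" using T by (simp add: Y_def Y0_def)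
      finally have "T * (norm (f \<eta>) * (1 + r) ^ dd) \<le> T * Y" by (simp only: mult.assoc)
      then have "norm (f \<eta>) * (1 + r) ^ dd \<le> Y" using T by simp
      then have "norm (f \<eta>) \<le> Y / (1 + norm \<eta>) ^ dd" by (simp add: r_def pos_le_divide_eq)
      then show ?thesis using X by (simp add: add_increasing)
    qed
    then have "norm (LINT \<eta>|lborel. f \<eta>) \<le> X * (LINT \<eta>|lborel. norm (W \<eta>)) + Y * m"
      unfolding dd_def m_def by (intro integral_split_bound[OF W] AE_I2)
    moreover have "(LINT \<eta>|lborel. f \<eta>) = loc_ft (\<lambda>\<psi>. g (partial_deriv i \<psi>)) x0 N \<xi>"
      unfolding f_def W_def a_def by (rule loc_ft_partial_deriv_kernel[OF g N1, symmetric])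
    moreover have "(LINT \<eta>|lborel. norm (W \<eta>)) = 1" unfolding W_def by (rule integral_norm_gauss_kernel[OF a])
    ultimately have "norm (loc_ft (\<lambda>\<psi>. g (partial_deriv i \<psi>)) x0 N \<xi>) \<le> X + Y * m" by simp
    then have "T * norm (loc_ft (\<lambda>\<psi>. g (partial_deriv i \<psi>)) x0 N \<xi>) \<le> T * (X + Y * m)"
      using T by (intro mult_left_mono) auto
    also have "\<dots> = 2 * Q * 2 ^ (n + 1) + (Y0 * m) * (2 / c) ^ n"
      using T by (simp add: X_def Y_def field_simps)
    also have "\<dots> \<le> P1 ^ (n + 1) * S + P2 ^ (n + 1) * S"
    proof (rule add_mono)
      have "2 * Q * 2 ^ (n + 1) \<le> 2 * (C ^ (n + 2) * (4 ^ (n + 1) * S)) * 2 ^ (n + 1)"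
        unfolding Q_def S_def using C by (intro mult_right_mono mult_left_mono self_power_Suc s) auto
      also have "\<dots> = ((16 * C\<^sup>2) * (8 * C) ^ n) * S"
      proof -
        have "(8::real) ^ n = 2 ^ n * 4 ^ n" by (simp flip: power_mult_distrib)
        then show ?thesis by (simp add: power_mult_distrib power_add power2_eq_square)
      qed
      also have "\<dots> \<le> ((16 * C\<^sup>2) * (8 * C * 2) ^ n) * S"
        using C S by (intro mult_right_mono mult_left_mono power_mono) auto
      also have "\<dots> \<le> P1 ^ (n + 1) * S"
        unfolding P1_def using C S by (intro mult_right_mono absorb_geometric) auto
      finally show "2 * Q * 2 ^ (n + 1) \<le> P1 ^ (n + 1) * S" .
      have "(Y0 * m) * (2 / c) ^ n \<le> P2 ^ (n + 1) * 1"
        unfolding P2_def mult_1_right using Y0 m0 c by (intro absorb_geometric) auto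
      also have "\<dots> \<le> P2 ^ (n + 1) * S" using P12 S by (intro mult_left_mono) auto
      finally show "(Y0 * m) * (2 / c) ^ n \<le> P2 ^ (n + 1) * S" .
    qed
    also have "\<dots> \<le> (P1 + P2) ^ (n + 1) * S"
      unfolding distrib_right[symmetric] using P12 S by (intro mult_right_mono add_power_le) auto
    finally show "(1 + norm \<xi>) ^ n * norm (loc_ft (\<lambda>\<psi>. g (partial_deriv i \<psi>)) x0 N \<xi>) \<le> (P1 + P2) ^ (n + 1) * (real n ^ n) powr s"
      by (simp only: T_def S_def)
  qed
qed

text \<open>The two frequency ranges need different cone properties: relative perturbations for
  |\<xi>| \<ge> 1, half-lines below. In the low range a constant bound is enough, because the weight
  is at most 2^n.\<close>

proposition gevrey_regular_partial_deriv:
  fixes f :: "'n::finite functional"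
  assumes s: "0 \<le> s" "s \<le> 1" and f: "gevrey_regular s f x0 \<xi>0"
  shows "gevrey_regular s (\<lambda>\<psi>. f (partial_deriv i \<psi>)) x0 \<xi>0"
proof -
  obtain g \<Gamma> C N0 where g: "tempered_distribution g" and e: "eq_near f x0 g" and \<Gamma>: "open_cone \<Gamma>" "\<xi>0 \<in> \<Gamma>"
    and C: "C > 0" and N0: "N0 \<ge> 1" and d: "loc_decay s g x0 \<Gamma> C N0" using gevrey_regularE[OF f] .
  obtain \<Gamma>' c \<tau> where \<Gamma>': "open_cone \<Gamma>'" "\<xi>0 \<in> \<Gamma>'" and c: "0 < c" "c \<le> 1 / 2"
    and near: "\<And>\<xi> \<eta>. \<xi> \<in> \<Gamma>' \<Longrightarrow> norm \<eta> \<le> c * norm \<xi> \<Longrightarrow> \<xi> + \<eta> \<in> \<Gamma>" and \<tau>: "0 < \<tau>"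
    and ray: "\<And>\<xi> v t. \<xi> \<in> \<Gamma>' \<Longrightarrow> norm (v - \<xi>0) \<le> \<tau> \<Longrightarrow> 0 \<le> t \<Longrightarrow> \<xi> + t *\<^sub>R v \<in> \<Gamma>"
    using open_cone_shrink[OF \<Gamma>] by blast
  obtain P where P: "0 \<le> P" "\<And>N \<xi> n. N0 \<le> N \<Longrightarrow> n \<le> N \<Longrightarrow> 1 \<le> norm \<xi> \<Longrightarrow>
    (\<And>\<eta>. norm \<eta> \<le> c * norm \<xi> \<Longrightarrow> \<xi> + \<eta> \<in> \<Gamma>) \<Longrightarrow>
    (1 + norm \<xi>) ^ n * norm (loc_ft (\<lambda>\<psi>. g (partial_deriv i \<psi>)) x0 N \<xi>) \<le> P ^ (n + 1) * (real n ^ n) powr s"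
    using loc_ft_partial_deriv_high[OF g s d C N0 c] by blast
  obtain K where K: "0 \<le> K" "\<And>N \<xi>. 1 \<le> N \<Longrightarrow> norm \<xi> \<le> 1 \<Longrightarrow>
    (\<And>v t. norm (v - \<xi>0) \<le> \<tau> \<Longrightarrow> 0 \<le> t \<Longrightarrow> norm (loc_ft g x0 N (\<xi> + t *\<^sub>R v)) \<le> C) \<Longrightarrow>
    norm (loc_ft (\<lambda>\<psi>. g (partial_deriv i \<psi>)) x0 N \<xi>) \<le> K"
    using loc_ft_partial_deriv_low[OF g \<tau> less_imp_le[OF C]] by blast
  define R where "R = (1 + K) * (1 + 2)"
  have R: "1 \<le> R" using K by (simp add: R_def)
  show ?thesis
  proof (rule gevrey_regularI[OF tempered_partial_deriv[OF g] eq_near_partial_deriv[OF e] \<Gamma>'])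
    show "P + R > 0" using P R by simp
    show "N0 \<ge> 1" by (rule N0)
    show "loc_decay s (\<lambda>\<psi>. g (partial_deriv i \<psi>)) x0 \<Gamma>' (P + R) N0"
      unfolding loc_decay_def
    proof (intro allI impI ballI)
      fix N \<xi> n assume N: "N0 \<le> N" and \<xi>: "\<xi> \<in> \<Gamma>'" and n: "n \<le> N"
      let ?L = "norm (loc_ft (\<lambda>\<psi>. g (partial_deriv i \<psi>)) x0 N \<xi>)"
      have S: "1 \<le> (real n ^ n) powr s" by (rule self_power_powr_ge_1[OF s(1)])
      show "(1 + norm \<xi>) ^ n * ?L \<le> (P + R) ^ (n + 1) * (real n ^ n) powr s"
      proof (cases "1 \<le> norm \<xi>")
        case True
        have "(1 + norm \<xi>) ^ n * ?L \<le> P ^ (n + 1) * (real n ^ n) powr s"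
          by (rule P(2)[OF N n True near[OF \<xi>]])
        also have "\<dots> \<le> (P + R) ^ (n + 1) * (real n ^ n) powr s"
          using P R by (intro mult_right_mono power_mono) auto
        finally show ?thesis .
      next
        case False
        have "?L \<le> K"
        proof (rule K(2))
          show "1 \<le> N" "norm \<xi> \<le> 1" using N N0 False by auto
          fix v and t :: real assume v: "norm (v - \<xi>0) \<le> \<tau>" and t: "0 \<le> t"
          show "norm (loc_ft g x0 N (\<xi> + t *\<^sub>R v)) \<le> C"
            \<comment> \<open>For \<open>n = 0\<close> the decay bound reads \<open>C\<close>, again
              because \<open>0 ^ 0 = 1\<close>.\<close>
            using loc_decayD[OF d N ray[OF \<xi> v t], of 0] by simp
        qed
        then have "(1 + norm \<xi>) ^ n * ?L \<le> 2 ^ n * K"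
          using False by (intro mult_mono power_mono) auto
        also have "\<dots> \<le> R ^ (n + 1)" using absorb_geometric[of K 2 n] K by (simp add: R_def mult.commute)
        also have "\<dots> \<le> (P + R) ^ (n + 1)" using P R by (intro power_mono) auto
        also have "\<dots> \<le> (P + R) ^ (n + 1) * (real n ^ n) powr s"
          using mult_left_mono[OF S, of "(P + R) ^ (n + 1)"] P R by simp
        finally show ?thesis .
      qed
    qed
  qed
qed

corollary gevrey_regular_partial_derivs:
  assumes "0 \<le> s" "s \<le> 1" "gevrey_regular s f x0 \<xi>0"
  shows "gevrey_regular s (\<lambda>\<psi>. f (partial_derivs js \<psi>)) x0 \<xi>0"
  using assms(3)
proof (induction js arbitrary: f)
  case (Cons j js)
  from Cons.IH[OF gevrey_regular_partial_deriv[OF assms(1,2) Cons.prems]] show ?case by simp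
qed simp

text \<open>Signs and powers of the imaginary unit are constants, so closure under sums, multiples
  and iterated derivatives gives every polynomial.\<close>

theorem gevrey_regular_poly_D:
  fixes f :: "'n::finite functional"
  assumes s: "0 \<le> s" "s \<le> 1" and f: "gevrey_regular s f x0 \<xi>0" and \<xi>0: "\<xi>0 \<noteq> 0"
  shows "gevrey_regular s (poly_D P f) x0 \<xi>0"
proof -
  have "gevrey_regular s (\<lambda>\<psi>. \<Sum>\<alpha>\<in>I. Poly_Mapping.lookup P \<alpha> * ((- \<i>) ^ mi_length \<alpha> * deriv_dist \<alpha> f \<psi>)) x0 \<xi>0"
    if "finite I" for I
    using that
  proof induction
    case empty
    show ?case using gevrey_regular_zero[OF \<xi>0] by simp
  next
    case (insert \<alpha> I)
    have "gevrey_regular s (\<lambda>\<psi>. Poly_Mapping.lookup P \<alpha> * ((- \<i>) ^ mi_length \<alpha> * deriv_dist \<alpha> f \<psi>)) x0 \<xi>0"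
      unfolding deriv_dist_def mi_deriv_list_of_mi
      by (intro gevrey_regular_cmult gevrey_regular_partial_derivs s f)
    from gevrey_regular_add[OF this insert.IH] show ?case using insert.hyps by simp
  qed
  from this[OF finite_keys] show ?thesis unfolding poly_D_def .
qed

section \<open>Multiplication by functions in the class \<open>\<E>\<close>\<close>

text \<open>Local integrability makes the truncations to balls measurable, and these converge
  pointwise.\<close>

lemma given_by_measurable:
  assumes "given_by u G"
  shows "G \<in> borel_measurable borel"
proof (rule borel_measurable_LIMSEQ_metric)
  fix n :: nat
  have "set_integrable lborel (cball 0 (real n)) G" using assms by (simp add: given_by_def)
  then show "(\<lambda>x. indicator (cball 0 (real n)) x *\<^sub>R G x) \<in> borel_measurable borel"
    unfolding set_integrable_def using borel_measurable_integrable by fastforce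
next
  fix x
  have "\<forall>\<^sub>F n in sequentially. indicator (cball 0 (real n)) x *\<^sub>R G x = G x"
    using eventually_ge_at_top[of "nat \<lceil>norm x\<rceil>"]
    by eventually_elim (simp add: indicator_def nat_ceiling_le_eq)
  then show "(\<lambda>n. indicator (cball 0 (real n)) x *\<^sub>R G x) \<longlonglongrightarrow> G x"
    by (rule tendsto_eventually)
qed

section \<open>Densities of functions in the class\<close>

lemma mi_fact_single: "mi_fact (Poly_Mapping.single i k) = fact k"
proof -
  have "mi_fact (Poly_Mapping.single i k) = (\<Prod>j\<in>UNIV. if j = i then fact k else 1)"
    unfolding mi_fact_def by (rule prod.cong) (auto simp: lookup_single when_def)
  then show ?thesis by simp
qed

lemma Linf_norm_AE_le: "Linf_norm G \<le> ereal B \<Longrightarrow> AE \<eta> in lborel. norm (G \<eta>) \<le> B"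
  using esssup_AE[of "\<lambda>\<xi>. ereal (norm (G \<xi>))" lborel] unfolding Linf_norm_def
  by eventually_elim (metis ereal_less_eq(3) order_trans)

lemma less_infty_ereal_bound:
  assumes "x < (\<infinity> :: ereal)"
  obtains B where "0 \<le> B" "x \<le> ereal B"
proof (cases x)
  case (real r)
  then show ?thesis using that[of "max 0 r"] by simp
qed (use assms that[of 0] in auto)

lemma AE_lborel_reflect:
  assumes "AE x in (lborel :: (real ^ 'n::finite) measure). P x"
  shows "AE x in (lborel :: (real ^ 'n) measure). P (- x)"
proof -
  have "AE x in distr lborel borel uminus. P x" unfolding lborel_reflect by (rule assms)
  then show ?thesis by (rule AE_distrD[rotated]) simp
qed

lemma AE_lborel_shift:
  assumes "AE x in (lborel :: (real ^ 'n::finite) measure). P x"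
  shows "AE x in (lborel :: (real ^ 'n) measure). P (c + x)"
proof -
  have "AE x in distr lborel borel ((+) c). P x" unfolding lborel_distr_plus by (rule assms)
  then show ?thesis by (rule AE_distrD[rotated]) simp
qed

text \<open>\<open>given_by\<close> speaks about test functions only, whereas it will be applied to
  Fourier integrals of test functions and to translated Gaussian kernels; the growth bound allows
  the extension by \<open>fourier_int_density\<close>.\<close>

lemma fourier_dist_density:
  fixes u :: "'n::finite functional"
  assumes u: "tempered_distribution u" and G: "given_by (fourier_dist u) G"
    and le: "AE \<eta> in lborel. norm (G \<eta>) \<le> C * (1 + norm \<eta>) ^ m" and v: "schwartz_fun v"
  shows "complex_of_real ((2 * pi) powr (- (real CARD('n) / 2))) * u (fourier_int v) = (LINT \<eta>|lborel. G \<eta> * v \<eta>)"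
proof -
  define c where "c = complex_of_real ((2 * pi) powr (- (real CARD('n) / 2)))"
  have c: "c \<noteq> 0" by (simp add: c_def)
  note Gm [measurable] = given_by_measurable[OF G]
  have test: "u (fourier_int \<psi>) = (LINT \<eta>|lborel. (G \<eta> / c) * \<psi> \<eta>)" if "test_fun \<psi>" for \<psi>
  proof -
    have "c * u (fourier_int \<psi>) = u (fourier \<psi>)"
      unfolding fourier_eq[abs_def] c_def[symmetric]
      by (rule tempered_cmult[OF u schwartz_fun_fourier_int[OF test_fun_schwartz[OF that]], symmetric])
    also have "\<dots> = (LINT \<eta>|lborel. G \<eta> * \<psi> \<eta>)"
      using G that by (simp add: given_by_def fourier_dist_def)
    finally have "u (fourier_int \<psi>) = (LINT \<eta>|lborel. G \<eta> * \<psi> \<eta>) / c" using c by (simp add: field_simps)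
    then show ?thesis by (simp flip: integral_divide_zero)
  qed
  have "u (fourier_int v) = (LINT \<eta>|lborel. (G \<eta> / c) * v \<eta>)"
  proof (rule fourier_int_density[OF u _ _ test v])
    show "AE \<eta> in lborel. norm (G \<eta> / c) \<le> (C / norm c) * (1 + norm \<eta>) ^ m"
      using le by eventually_elim (simp add: norm_divide divide_right_mono)
  qed measurable
  also have "\<dots> = (LINT \<eta>|lborel. G \<eta> * v \<eta>) / c" by (simp flip: integral_divide_zero)
  finally show ?thesis using c by (simp add: c_def)
qed

text \<open>Fourier inversion on the distribution side: the pairing of \<phi> with a test function
  is moved to \<open>G\<close>, so \<phi> is the Fourier integral of \<open>G\<close> up to
  reflection and a constant. Multi-indices with a single nonzero entry give the decay, with
  \<open>fact k\<close> as their factorial.\<close>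

proposition gevrey_E_fourier_int:
  fixes \<phi> :: "real ^ 'n::finite \<Rightarrow> complex"
  assumes \<phi>: "\<phi> \<in> gevrey_E s"
  obtains \<Phi> A H where "rapid_L1 \<Phi>" "0 \<le> A" "0 \<le> H" "\<phi> = fourier_int \<Phi>"
    "\<And>k. AE \<eta> in lborel. norm (\<Phi> \<eta>) \<le> A * H ^ k * (fact k powr s) / (1 + norm \<eta>) ^ k"
proof -
  obtain u G h where sm: "smooth \<phi>" and u: "tempered_distribution u" and u\<phi>: "given_by u \<phi>"
    and G: "given_by (fourier_dist u) G" and h: "h > 0"
    and fin: "(SUP \<alpha> :: 'n multi_index. ereal (h ^ mi_length \<alpha>) *
                  Linf_norm (\<lambda>\<xi>. complex_of_real (bracket \<xi> ^ mi_length \<alpha>) * G \<xi>) /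
                  ereal (mi_fact \<alpha> powr s)) < \<infinity>"
    using \<phi> unfolding gevrey_E_def by blast
  obtain B where B: "0 \<le> B" and sup: "(SUP \<alpha> :: 'n multi_index. ereal (h ^ mi_length \<alpha>) *
                  Linf_norm (\<lambda>\<xi>. complex_of_real (bracket \<xi> ^ mi_length \<alpha>) * G \<xi>) /
                  ereal (mi_fact \<alpha> powr s)) \<le> ereal B"
    using less_infty_ereal_bound[OF fin] .
  note Gm [measurable] = given_by_measurable[OF G]
  \<comment> \<open>The 2 comes from replacing the bracket by 1 + |\<eta>|.\<close>
  define H where "H = 2 / h"
  have H: "0 \<le> H" using h by (simp add: H_def)
  have Gle: "AE \<eta> in lborel. norm (G \<eta>) \<le> B * H ^ k * (fact k powr s) / (1 + norm \<eta>) ^ k" for k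
  proof -
    define L where "L = Linf_norm (\<lambda>\<xi>. complex_of_real (bracket \<xi> ^ k) * G \<xi>)"
    define q where "q = (fact k :: real) powr s"
    have q: "0 < q" by (simp add: q_def)
    \<comment> \<open>The supremum is used at a multi-index of length \<open>k\<close> supported on
      one arbitrary variable.\<close>
    have "ereal (h ^ k) * L / ereal q \<le> ereal B"
      using SUP_le_iff[THEN iffD1, OF sup, rule_format, of "Poly_Mapping.single undefined k"]
      by (simp only: mi_length_single mi_fact_single L_def q_def UNIV_I)
    then have "L \<le> ereal (B * q / h ^ k)"
      using h q by (cases L) (simp_all add: field_simps)
    then have "AE \<eta> in lborel. norm (complex_of_real (bracket \<eta> ^ k) * G \<eta>) \<le> B * q / h ^ k"
      unfolding L_def by (rule Linf_norm_AE_le)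
    then show ?thesis
    proof eventually_elim
      case (elim \<eta>)
      have bp: "0 < bracket \<eta>" using bracket_bounds(1)[of \<eta>] by simp
      have "(1 + norm \<eta>) ^ k * norm (G \<eta>) \<le> (2 * bracket \<eta>) ^ k * norm (G \<eta>)"
        using bracket_bounds(3)[of \<eta>] by (intro mult_right_mono power_mono) auto
      also have "\<dots> = 2 ^ k * norm (complex_of_real (bracket \<eta> ^ k) * G \<eta>)"
        using bp by (simp add: norm_mult norm_power power_mult_distrib)
      also have "\<dots> \<le> 2 ^ k * (B * q / h ^ k)" using elim by (rule mult_left_mono) simp
      also have "\<dots> = B * H ^ k * q" by (simp add: H_def power_divide)
      finally show ?case by (simp add: q_def pos_le_divide_eq mult.commute)
    qed
  qed
  define c where "c = complex_of_real ((2 * pi) powr (- (real CARD('n) / 2)))"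
  have c: "c \<noteq> 0" by (simp add: c_def)
  define P where "P = complex_of_real ((2 * pi) ^ CARD('n))"
  have P: "P \<noteq> 0" by (simp add: P_def)
  \<comment> \<open>In dimension d the product of \<open>c\<close> and \<open>P\<close> is (2
    pi)^(d/2), so this is the constant of the inverse transform.\<close>
  define \<kappa> where "\<kappa> = 1 / (c * P)"
  have GL: "rapid_L1 G" by (rule rapid_L1I) (use Gle Gm in blast)+
  have Gi: "integrable lborel G" using rapid_L1_integrable_wave[OF GL, of 0] by simp
  have FGm [measurable]: "fourier_int G \<in> borel_measurable borel"
    by (rule smooth_measurable[OF smooth_fourier_int[OF GL]])
  have "\<phi> = (\<lambda>x. \<kappa> * fourier_int G (- x))"
  proof (rule continuous_eq_if_test_integrals_eq)
    show "continuous_on UNIV \<phi>" by (rule smooth_continuous[OF sm])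
    show "continuous_on UNIV (\<lambda>x. \<kappa> * fourier_int G (- x))"
      by (intro continuous_intros continuous_on_compose2[OF smooth_continuous[OF smooth_fourier_int[OF GL], of UNIV]]) auto
    fix \<theta> :: "real ^ 'n \<Rightarrow> complex" assume \<theta>: "test_fun \<theta>"
    note [measurable] = smooth_measurable[OF schwartz_fun_smooth[OF test_fun_schwartz[OF \<theta>]]]
    define \<theta>' where "\<theta>' x = \<theta> (- x)" for x
    have "test_fun \<theta>'" using test_fun_scale[OF \<theta>, of "-1"] by (simp add: \<theta>'_def[abs_def])
    then have \<theta>': "schwartz_fun \<theta>'" by (rule test_fun_schwartz)
    have \<theta>'i: "integrable lborel \<theta>'"
      using rapid_L1_integrable_wave[OF schwartz_fun_rapid_L1[OF \<theta>'], of 0] by simp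
    have v: "schwartz_fun (fourier_int \<theta>')" by (rule schwartz_fun_fourier_int[OF \<theta>'])
    \<comment> \<open>Up to \<open>P\<close>, every test function is the Fourier integral of a
      Schwartz function and thus accessible to \<open>fourier_dist_density\<close>.\<close>
    have FF: "fourier_int (fourier_int \<theta>') = (\<lambda>y. P * \<theta> y)"
      using fourier_inversion[OF \<theta>', of "- y" for y] by (simp add: P_def \<theta>'_def fun_eq_iff)
    have "c * (P * u \<theta>) = c * u (fourier_int (fourier_int \<theta>'))"
      unfolding FF by (simp add: tempered_cmult[OF u test_fun_schwartz[OF \<theta>]])
    also have "\<dots> = (LINT \<eta>|lborel. G \<eta> * fourier_int \<theta>' \<eta>)"
      unfolding c_def by (rule fourier_dist_density[OF u G _ v, of "B * H ^ 0 * (fact 0 powr s)" 0]) (use Gle[of 0] in simp)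
    also have "\<dots> = (LINT \<eta>|lborel. fourier_int G \<eta> * \<theta> (- \<eta>))"
      unfolding fourier_int_swap[OF Gi \<theta>'i] \<theta>'_def ..
    also have "\<dots> = (LINT \<eta>|lborel. fourier_int G (- \<eta>) * \<theta> (- (- \<eta>)))"
      by (rule lborel_integral_reflect[symmetric]) measurable
    finally have "u \<theta> = \<kappa> * (LINT \<eta>|lborel. fourier_int G (- \<eta>) * \<theta> \<eta>)"
      using c P by (simp add: \<kappa>_def field_simps)
    moreover have "u \<theta> = (LINT x|lborel. \<phi> x * \<theta> x)" using u\<phi> \<theta> by (simp add: given_by_def)
    ultimately show "(LINT x|lborel. \<phi> x * \<theta> x) = (LINT x|lborel. \<kappa> * fourier_int G (- x) * \<theta> x)"
      by (simp add: mult.assoc)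
  qed
  \<comment> \<open>The reflection gives the inverse transform the sign used by
    \<open>wave\<close>.\<close>
  define \<Phi> where "\<Phi> \<eta> = \<kappa> * G (- \<eta>)" for \<eta>
  have "fourier_int \<Phi> x = \<kappa> * fourier_int G (- x)" for x
  proof -
    have "fourier_int \<Phi> x = (LINT \<eta>|lborel. \<kappa> * (G (- \<eta>) * wave (- \<eta>) (- x)))"
      by (simp add: fourier_int_def \<Phi>_def wave_minus_swap mult.assoc)
    also have "\<dots> = \<kappa> * (LINT \<eta>|lborel. G (- \<eta>) * wave (- \<eta>) (- x))" by (rule integral_mult_right_zero)
    also have "(LINT \<eta>|lborel. G (- \<eta>) * wave (- \<eta>) (- x)) = fourier_int G (- x)"
      unfolding fourier_int_def by (rule lborel_integral_reflect) measurable
    finally show ?thesis .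
  qed
  with \<open>\<phi> = (\<lambda>x. \<kappa> * fourier_int G (- x))\<close> have \<phi>\<Phi>: "\<phi> = fourier_int \<Phi>" by (simp add: fun_eq_iff)
  have \<Phi>le: "AE \<eta> in lborel. norm (\<Phi> \<eta>) \<le> (norm \<kappa> * B) * H ^ k * (fact k powr s) / (1 + norm \<eta>) ^ k" for k
    using AE_lborel_reflect[OF Gle[of k]]
  proof eventually_elim
    case (elim \<eta>)
    from mult_left_mono[OF elim norm_ge_zero[of \<kappa>]] show ?case by (simp add: \<Phi>_def norm_mult mult.assoc)
  qed
  have "\<Phi> \<in> borel_measurable borel" unfolding \<Phi>_def by measurable
  then have "rapid_L1 \<Phi>" by (rule rapid_L1I) (use \<Phi>le in blast)
  from that[OF this _ H \<phi>\<Phi> \<Phi>le] B show ?thesis by simp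
qed

text \<open>Half of the exponent pays for the weight, the other half remains as the kernel of twice
  the variance. For \<open>a \<le> 1 / 4\<close> the first half is at least |z|^2 / 2, so the
  constant is independent of \<open>a\<close>.\<close>

lemma gauss_kernel_moment_le:
  assumes a: "0 < a" "a \<le> 1 / 4"
  shows "(1 + norm z) ^ m * norm (gauss_kernel a (y :: real ^ 'n::finite) z) \<le>
    (2 * real m) ^ m / (1 / 2) ^ m * sqrt 2 ^ CARD('n) * norm (gauss_kernel (2 * a) y z)"
proof -
  define r where "r = norm z"
  have r: "0 \<le> r" by (simp add: r_def)
  have sq: "sqrt (1 / (4 * pi * a)) = sqrt 2 * sqrt (1 / (4 * pi * (2 * a)))"
    using a by (simp flip: real_sqrt_mult)
  have "(1 + r) ^ m * exp (- r\<^sup>2 / (4 * (2 * a))) \<le> (1 + r) ^ (2 * m) * exp (- (1 / 2) * r\<^sup>2)"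
  proof (intro mult_mono power_increasing)
    have "(1 / 2) * r\<^sup>2 \<le> 1 / (4 * (2 * a)) * r\<^sup>2"
      using a by (intro mult_right_mono) (auto simp: field_simps)
    then show "exp (- r\<^sup>2 / (4 * (2 * a))) \<le> exp (- (1 / 2) * r\<^sup>2)" by simp
  qed (use r in auto)
  also have "\<dots> \<le> (2 * real m) ^ m / min (1 / 2) 1 ^ m"
    by (rule weight_gauss_le) (use r in auto)
  finally have 1: "(1 + r) ^ m * exp (- r\<^sup>2 / (4 * (2 * a))) \<le> (2 * real m) ^ m / (1 / 2) ^ m" by simp
  have a2: "0 < 2 * a" using a by simp
  have e: "exp (- r\<^sup>2 / (4 * a)) = exp (- r\<^sup>2 / (4 * (2 * a))) * exp (- r\<^sup>2 / (4 * (2 * a)))"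
    using a by (simp flip: exp_add)
  have "(1 + norm z) ^ m * norm (gauss_kernel a y z) =
     ((1 + r) ^ m * exp (- r\<^sup>2 / (4 * (2 * a)))) * (sqrt 2 ^ CARD('n) * norm (gauss_kernel (2 * a) y z))"
    unfolding norm_gauss_kernel[OF a(1)] norm_gauss_kernel[OF a2] sq power_mult_distrib r_def[symmetric] e
    by (simp only: mult_ac)
  also have "\<dots> \<le> ((2 * real m) ^ m / (1 / 2) ^ m) * (sqrt 2 ^ CARD('n) * norm (gauss_kernel (2 * a) y z))"
    by (rule mult_right_mono[OF 1]) simp
  finally show ?thesis by (simp only: mult.assoc)
qed

text \<open>Up to a constant, the localised transform is \<open>G\<close> averaged against a kernel
  whose weighted mass is bounded uniformly in \<open>N\<close>; polynomial growth of
  \<open>G\<close> is therefore inherited without a power of \<open>N\<close>, in contrast to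
  \<open>loc_ft_growth\<close>.\<close>

proposition loc_ft_uniform_growth:
  fixes g :: "'n::finite functional"
  assumes g: "tempered_distribution g" and G: "given_by (fourier_dist g) G"
    and le: "AE \<eta> in lborel. norm (G \<eta>) \<le> B * (1 + norm \<eta>) ^ m" and B: "0 \<le> B"
  obtains C where "0 \<le> C" "\<And>N \<xi>. 1 \<le> N \<Longrightarrow> norm (loc_ft g x0 N \<xi>) \<le> C * (1 + norm \<xi>) ^ m"
proof -
  define c where "c = complex_of_real ((2 * pi) powr (- (real CARD('n) / 2)))"
  have c: "c \<noteq> 0" by (simp add: c_def)
  define K where "K = (2 * real m) ^ m / (1 / 2) ^ m * sqrt 2 ^ CARD('n)"
  have K: "0 \<le> K" by (simp add: K_def)
  note Gm [measurable] = given_by_measurable[OF G]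
  have "norm (loc_ft g x0 N \<xi>) \<le> B * K / norm c * (1 + norm \<xi>) ^ m" if N: "1 \<le> N" for N \<xi>
  proof -
    define a where "a = 1 / (4 * real N)"
    have a: "0 < a" "a \<le> 1 / 4" using N by (auto simp: a_def field_simps)
    define W where "W = gauss_kernel a x0"
    have Ws: "schwartz_fun W" unfolding W_def by (rule schwartz_fun_gauss_kernel[OF a(1)])
    note [measurable] = smooth_measurable[OF schwartz_fun_smooth[OF Ws]]
    \<comment> \<open>The translated kernel, whose Fourier integral is the Gaussian times the wave
      of frequency \<open>\<xi>\<close>.\<close>
    define v where "v \<eta> = W (\<eta> - \<xi>)" for \<eta>
    have v: "schwartz_fun v"
    proof -
      define q where "q = complex_of_real (sqrt (1 / (4 * pi * a)) ^ CARD('n)) * wave (- \<xi>) (- x0)"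
      have "v = (\<lambda>\<eta>. q * (gauss (1 / (4 * a)) \<xi> \<eta> * wave (- x0) \<eta>))"
        using wave_add[of _ "- \<xi>" "- x0"]
        by (simp add: v_def W_def gauss_kernel_def gauss_def q_def fun_eq_iff wave_commute[of "- x0"] mult_ac)
      moreover have "schwartz_fun (\<lambda>\<eta>. gauss (1 / (4 * a)) \<xi> \<eta> * wave (- x0) \<eta>)"
        by (intro schwartz_fun_mult_wave schwartz_fun_gauss) (use a in simp)
      ultimately show ?thesis by (simp only: schwartz_fun_cmult)
    qed
    have Fv: "fourier_int v x = gaussian x0 N x * wave \<xi> x" for x
    proof -
      have "fourier_int v x = (LINT z|lborel. W (\<xi> + z - \<xi>) * wave (\<xi> + z) x)"
        unfolding fourier_int_def v_def by (rule lborel_integral_shift(1)[symmetric]) measurable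
      also have "\<dots> = (LINT z|lborel. wave \<xi> x * (W z * wave z x))"
        by (simp add: wave_add mult_ac)
      also have "\<dots> = wave \<xi> x * fourier_int W x"
        unfolding fourier_int_def by (rule integral_mult_right_zero)
      also have "fourier_int W x = gaussian x0 N x"
        unfolding W_def fourier_int_gauss_kernel[OF a(1)] by (simp add: a_def gaussian_eq_gauss)
      finally show ?thesis by simp
    qed
    have "c * loc_ft g x0 N \<xi> = c * g (fourier_int v)" by (simp add: loc_ft_def Fv[abs_def])
    also have "\<dots> = (LINT \<eta>|lborel. G \<eta> * v \<eta>)"
      unfolding c_def by (rule fourier_dist_density[OF g G le v])
    also have "\<dots> = (LINT z|lborel. G (\<xi> + z) * W (\<xi> + z - \<xi>))"
      unfolding v_def by (rule lborel_integral_shift(1)[symmetric]) measurable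
    finally have eq: "c * loc_ft g x0 N \<xi> = (LINT z|lborel. G (\<xi> + z) * W z)" by simp
    define W2 where "W2 = gauss_kernel (2 * a) x0"
    have W2: "integrable lborel W2"
      using rapid_L1_integrable_wave[OF schwartz_fun_rapid_L1[OF schwartz_fun_gauss_kernel[of "2 * a" x0]], of 0] a
      by (simp add: W2_def)
    \<comment> \<open>The tail term is 0, because the wider kernel dominates everywhere.\<close>
    have "norm (LINT z|lborel. G (\<xi> + z) * W z) \<le> (B * K * (1 + norm \<xi>) ^ m) * (LINT z|lborel. norm (W2 z)) + 0 * decay_mass TYPE('n)"
    proof (rule integral_split_bound[OF W2])
      show "AE z in lborel. norm (G (\<xi> + z) * W z) \<le> (B * K * (1 + norm \<xi>) ^ m) * norm (W2 z) + 0 / (1 + norm z) ^ decay_deg TYPE('n)"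
        using AE_lborel_shift[OF le, of \<xi>]
      proof eventually_elim
        case (elim z)
        have "1 + norm (\<xi> + z) \<le> (1 + norm \<xi>) * (1 + norm z)"
          using one_plus_norm_le_mult[of "\<xi> + z" \<xi>] by simp
        then have "(1 + norm (\<xi> + z)) ^ m \<le> ((1 + norm \<xi>) * (1 + norm z)) ^ m" by (intro power_mono) auto
        then have "B * (1 + norm (\<xi> + z)) ^ m \<le> B * ((1 + norm \<xi>) ^ m * (1 + norm z) ^ m)"
          using B by (simp add: power_mult_distrib mult_left_mono)
        with elim have "norm (G (\<xi> + z)) \<le> B * ((1 + norm \<xi>) ^ m * (1 + norm z) ^ m)" by linarith
        then have "norm (G (\<xi> + z) * W z) \<le> B * ((1 + norm \<xi>) ^ m * (1 + norm z) ^ m) * norm (W z)"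
          unfolding norm_mult by (intro mult_right_mono) auto
        also have "\<dots> = B * (1 + norm \<xi>) ^ m * ((1 + norm z) ^ m * norm (W z))" by simp
        also have "\<dots> \<le> B * (1 + norm \<xi>) ^ m * (K * norm (W2 z))"
          unfolding W_def W2_def K_def using B by (intro mult_left_mono gauss_kernel_moment_le a) auto
        finally show ?case by (simp add: mult_ac)
      qed
    qed
    also have "(LINT z|lborel. norm (W2 z)) = 1" unfolding W2_def using a by (intro integral_norm_gauss_kernel) simp
    finally have "norm c * norm (loc_ft g x0 N \<xi>) \<le> B * K * (1 + norm \<xi>) ^ m"
      unfolding eq[symmetric] by (simp add: norm_mult)
    then show ?thesis using c by (simp add: field_simps)
  qed
  then show ?thesis using B K by (intro that[of "B * K / norm c"]) auto
qed

text \<open>The binomial coefficient is at most 2^(n+K), so \<open>K\<close> extra orders of decay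
  cost only a geometric factor and a constant.\<close>

lemma fact_add_le: "fact (n + K) \<le> (2::real) ^ (n + K) * fact K * real n ^ n"
proof -
  have "real ((n + K) choose n) \<le> real (2 ^ (n + K))"
    unfolding of_nat_le_iff using binomial_le_pow2 by blast
  then have "(fact (n + K) :: real) / (fact n * fact K) \<le> 2 ^ (n + K)"
    by (subst (asm) binomial_fact) auto
  then have "fact (n + K) \<le> (2::real) ^ (n + K) * (fact n * fact K)" by (simp add: field_simps)
  also have "\<dots> \<le> 2 ^ (n + K) * (real n ^ n * fact K)"
  proof (intro mult_left_mono mult_right_mono)
    show "(fact n :: real) \<le> real n ^ n" using fact_le_power[of n] by simp
  qed auto
  finally show ?thesis by (simp add: mult_ac)
qed

lemma eq_near_mult:
  assumes "smooth a" "eq_near f x0 g"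
  shows "eq_near (mult_dist a f) x0 (mult_dist a g)"
proof -
  obtain U where U: "open U" "x0 \<in> U" "\<And>\<psi>. test_fun \<psi> \<Longrightarrow> supp \<psi> \<subseteq> U \<Longrightarrow> f \<psi> = g \<psi>"
    using assms(2) unfolding eq_near_def by blast
  show ?thesis unfolding eq_near_def mult_dist_def
  proof (intro exI[of _ U] conjI allI impI U(1,2))
    fix \<psi> assume "test_fun \<psi> \<and> supp \<psi> \<subseteq> U"
    then show "f (\<lambda>x. a x * \<psi> x) = g (\<lambda>x. a x * \<psi> x)"
      using test_fun_mult[OF assms(1)] supp_mult[of a \<psi>] by (intro U(3)) auto
  qed
qed

theorem gevrey_regular_mult:
  fixes f :: "'n::finite functional"
  assumes s: "0 \<le> s" "s \<le> 1" and \<phi>: "\<phi> \<in> gevrey_E s" and wit: "gevrey_witness s f x0 \<xi>0 g"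
    and G: "given_by (fourier_dist g) G"
    and le: "AE \<eta> in lborel. norm (G \<eta>) \<le> B * (1 + norm \<eta>) ^ m" and B: "0 \<le> B"
  shows "gevrey_regular s (mult_dist \<phi> f) x0 \<xi>0"
proof -
  define dd where "dd = decay_deg TYPE('n)"
  define \<mu> where "\<mu> = decay_mass TYPE('n)"
  have \<mu>: "0 \<le> \<mu>" unfolding \<mu>_def by (rule decay_mass_nonneg)
  obtain \<Phi> A H where \<Phi>: "rapid_L1 \<Phi>" and A: "0 \<le> A" and H: "0 \<le> H" and \<phi>\<Phi>: "\<phi> = fourier_int \<Phi>"
    and \<Phi>le: "\<And>k. AE \<eta> in lborel. norm (\<Phi> \<eta>) \<le> A * H ^ k * (fact k powr s) / (1 + norm \<eta>) ^ k"
    using gevrey_E_fourier_int[OF \<phi>] by blast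
  have \<Phi>i: "integrable lborel \<Phi>" using rapid_L1_integrable_wave[OF \<Phi>, of 0] by simp
  define I where "I = (LINT \<eta>|lborel. norm (\<Phi> \<eta>))"
  have I: "0 \<le> I" unfolding I_def by (intro integral_nonneg_AE AE_I2) simp
  obtain \<Gamma> C N0 where g: "tempered_distribution g" and e: "eq_near f x0 g" and \<Gamma>: "open_cone \<Gamma>" "\<xi>0 \<in> \<Gamma>"
    and C: "C > 0" and N0: "N0 \<ge> 1" and d: "loc_decay s g x0 \<Gamma> C N0"
    using wit unfolding gevrey_witness_iff by blast
  obtain \<Gamma>' c where \<Gamma>': "open_cone \<Gamma>'" "\<xi>0 \<in> \<Gamma>'" and c: "0 < c" "c \<le> 1 / 2"
    and near: "\<And>\<xi> \<eta>. \<xi> \<in> \<Gamma>' \<Longrightarrow> norm \<eta> \<le> c * norm \<xi> \<Longrightarrow> \<xi> + \<eta> \<in> \<Gamma>"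
    using open_cone_shrink[OF \<Gamma>] by metis
  obtain C1 where C1: "0 \<le> C1" "\<And>N \<xi>. 1 \<le> N \<Longrightarrow> norm (loc_ft g x0 N \<xi>) \<le> C1 * (1 + norm \<xi>) ^ m"
    using loc_ft_uniform_growth[OF g G le B] by blast
  \<comment> \<open>\<open>m\<close> orders against the growth of the localised transform and
    \<open>dd\<close> for integrability, on top of the \<open>n\<close> orders for the
    weight.\<close>
  define K where "K = m + dd"
  define Y0 where "Y0 = A * C1 * (1 + 1 / c) ^ m * (H ^ K * 2 ^ K * fact K) * \<mu>"
  have Y0: "0 \<le> Y0" using A C1 c H \<mu> by (simp add: Y0_def)
  define P1 where "P1 = (1 + C * I) * (1 + C * 2)"
  define P2 where "P2 = (1 + Y0) * (1 + 2 * H / c)"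
  have P12: "1 \<le> P1" "0 \<le> P2"
  proof -
    have "1 * 1 \<le> (1 + C * I) * (1 + C * 2)" using C I by (intro mult_mono) auto
    then show "1 \<le> P1" by (simp add: P1_def)
    show "0 \<le> P2" using Y0 H c by (simp add: P2_def)
  qed
  show ?thesis
  proof (rule gevrey_regularI[OF tempered_mult_dist[OF poly_growth_fourier_int[OF \<Phi>] g, folded \<phi>\<Phi>]
        eq_near_mult[OF smooth_fourier_int[OF \<Phi>] e, folded \<phi>\<Phi>] \<Gamma>'])
    show "P1 + P2 > 0" using P12 by simp
    show "N0 \<ge> 1" by (rule N0)
    show "loc_decay s (mult_dist \<phi> g) x0 \<Gamma>' (P1 + P2) N0"
      unfolding loc_decay_def
    proof (intro allI impI ballI)
      fix N \<xi> n assume N: "N0 \<le> N" and \<xi>: "\<xi> \<in> \<Gamma>'" and n: "n \<le> N"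
      have N1: "1 \<le> N" using N N0 by simp
      define S where "S = (real n ^ n) powr s"
      have S: "1 \<le> S" unfolding S_def by (rule self_power_powr_ge_1[OF s(1)])
      define T where "T = (1 + norm \<xi>) ^ n"
      have T: "0 < T" by (simp add: T_def)
      define X where "X = C ^ (n + 1) * 2 ^ n * S / T"
      define F where "F = A * H ^ (n + K) * (fact (n + K) powr s)"
      have F: "0 \<le> F" using A H by (simp add: F_def)
      define Y where "Y = F * (C1 * (1 + 1 / c) ^ m) * (1 / c) ^ n / T"
      have X: "0 \<le> X" and Y: "0 \<le> Y" using C S T F C1 c by (auto simp: X_def Y_def)
      have "loc_ft (mult_dist \<phi> g) x0 N \<xi> = g (\<lambda>x. (gaussian x0 N x * wave \<xi> x) * fourier_int \<Phi> x)"
        by (simp add: loc_ft_def mult_dist_def \<phi>\<Phi> mult_ac)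
      also have "\<dots> = (LINT \<eta>|lborel. \<Phi> \<eta> * g (\<lambda>x. gaussian x0 N x * wave \<xi> x * wave \<eta> x))"
        by (rule tempered_mult_fourier_int[OF g schwartz_fun_gaussian_wave[OF N1] \<Phi>])
      also have "\<dots> = (LINT \<eta>|lborel. \<Phi> \<eta> * loc_ft g x0 N (\<xi> + \<eta>))"
        by (simp add: loc_ft_def wave_add mult.assoc)
      also have "norm \<dots> \<le> X * I + Y * \<mu>"
        unfolding I_def \<mu>_def
      proof (rule integral_split_bound[OF \<Phi>i])
        show "AE \<eta> in lborel. norm (\<Phi> \<eta> * loc_ft g x0 N (\<xi> + \<eta>)) \<le> X * norm (\<Phi> \<eta>) + Y / (1 + norm \<eta>) ^ decay_deg TYPE('n)"
          using \<Phi>le[of "n + K"]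
        proof eventually_elim
          case (elim \<eta>)
          then have \<Phi>\<eta>: "norm (\<Phi> \<eta>) \<le> F / (1 + norm \<eta>) ^ (n + K)" by (simp add: F_def)
          show ?case
          proof (cases "norm \<eta> \<le> c * norm \<xi>")
            case True
            have half: "norm \<eta> \<le> norm \<xi> / 2" using True mult_right_mono[OF c(2) norm_ge_zero[of \<xi>]] by simp
            have l: "(1 + norm (\<xi> + \<eta>)) ^ n * norm (loc_ft g x0 N (\<xi> + \<eta>)) \<le> C ^ (n + 1) * S"
              unfolding S_def by (rule loc_decayD[OF d N near[OF \<xi> True] n])
            have "T * norm (loc_ft g x0 N (\<xi> + \<eta>)) \<le> (2 * (1 + norm (\<xi> + \<eta>))) ^ n * norm (loc_ft g x0 N (\<xi> + \<eta>))"
              unfolding T_def using norm_triangle_half[OF half] by (intro mult_right_mono power_mono) auto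
            also have "\<dots> = 2 ^ n * ((1 + norm (\<xi> + \<eta>)) ^ n * norm (loc_ft g x0 N (\<xi> + \<eta>)))"
              by (simp only: power_mult_distrib mult.assoc)
            also have "\<dots> \<le> 2 ^ n * (C ^ (n + 1) * S)" by (rule mult_left_mono[OF l]) simp
            finally have "norm (loc_ft g x0 N (\<xi> + \<eta>)) \<le> X" using T by (simp add: X_def pos_le_divide_eq mult_ac)
            then have "norm (\<Phi> \<eta> * loc_ft g x0 N (\<xi> + \<eta>)) \<le> norm (\<Phi> \<eta>) * X"
              unfolding norm_mult by (rule mult_left_mono) simp
            then show ?thesis using Y by (simp add: add_increasing2 mult.commute)
          next
            case False
            then have far: "c * norm \<xi> < norm \<eta>" by simp
            then have \<xi>\<eta>: "norm \<xi> \<le> norm \<eta> / c" using c by (simp add: field_simps)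
            have "norm (loc_ft g x0 N (\<xi> + \<eta>)) \<le> C1 * (1 + norm (\<xi> + \<eta>)) ^ m" by (rule C1(2)[OF N1])
            also have "\<dots> \<le> C1 * ((1 + 1 / c) * (1 + norm \<eta>)) ^ m"
              using C1(1) one_plus_norm_add_le[OF c(1) \<xi>\<eta>] by (intro mult_left_mono power_mono) auto
            finally have l: "norm (loc_ft g x0 N (\<xi> + \<eta>)) \<le> C1 * ((1 + 1 / c) * (1 + norm \<eta>)) ^ m" .
            have cT: "T \<le> (1 / c) ^ n * (1 + norm \<eta>) ^ n"
            proof -
              have "c + c * norm \<xi> \<le> 1 + norm \<eta>" using far c by simp
              then have "1 + norm \<xi> \<le> (1 / c) * (1 + norm \<eta>)" using c by (simp add: field_simps)
              then have "T \<le> ((1 / c) * (1 + norm \<eta>)) ^ n" unfolding T_def by (intro power_mono) auto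
              then show ?thesis by (simp only: power_mult_distrib)
            qed
            have "norm (\<Phi> \<eta> * loc_ft g x0 N (\<xi> + \<eta>)) \<le> F / (1 + norm \<eta>) ^ (n + K) * (C1 * ((1 + 1 / c) * (1 + norm \<eta>)) ^ m)"
              unfolding norm_mult by (intro mult_mono \<Phi>\<eta> l) (use F in auto)
            also have "\<dots> = F * (C1 * (1 + 1 / c) ^ m) / ((1 + norm \<eta>) ^ n * (1 + norm \<eta>) ^ dd)"
              by (simp add: K_def power_add power_mult_distrib)
            finally have "T * (norm (\<Phi> \<eta> * loc_ft g x0 N (\<xi> + \<eta>)) * (1 + norm \<eta>) ^ dd) \<le>
                ((1 / c) ^ n * (1 + norm \<eta>) ^ n) * (F * (C1 * (1 + 1 / c) ^ m) / ((1 + norm \<eta>) ^ n * (1 + norm \<eta>) ^ dd) * (1 + norm \<eta>) ^ dd)"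
              using c C1(1) F by (intro mult_mono cT) auto
            also have "\<dots> = T * Y" using T by (simp add: Y_def)
            finally have "norm (\<Phi> \<eta> * loc_ft g x0 N (\<xi> + \<eta>)) * (1 + norm \<eta>) ^ dd \<le> Y" using T by simp
            then have "norm (\<Phi> \<eta> * loc_ft g x0 N (\<xi> + \<eta>)) \<le> Y / (1 + norm \<eta>) ^ dd" by (simp add: pos_le_divide_eq)
            then show ?thesis using X by (simp add: add_increasing dd_def)
          qed
        qed
      qed
      finally have "T * norm (loc_ft (mult_dist \<phi> g) x0 N \<xi>) \<le> T * (X * I + Y * \<mu>)"
        using T by (intro mult_left_mono) auto
      also have "\<dots> = (C * I) * (C * 2) ^ n * S + F * (C1 * (1 + 1 / c) ^ m) * (1 / c) ^ n * \<mu>"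
        using T by (simp add: X_def Y_def field_simps power_mult_distrib)
      also have "\<dots> \<le> P1 ^ (n + 1) * S + P2 ^ (n + 1) * S"
      proof (rule add_mono)
        show "(C * I) * (C * 2) ^ n * S \<le> P1 ^ (n + 1) * S"
          unfolding P1_def using C I S by (intro mult_right_mono absorb_geometric) auto
        have "(fact (n + K) :: real) powr s \<le> (2 ^ (n + K) * fact K * real n ^ n) powr s"
          using s fact_add_le by (intro powr_mono2) auto
        also have "\<dots> = (2 ^ (n + K) * fact K) powr s * S" unfolding S_def by (rule powr_mult)
        also have "\<dots> \<le> (2 ^ (n + K) * fact K) powr 1 * S"
        proof (intro mult_right_mono powr_mono s(2))
          have "1 * 1 \<le> (2 ^ (n + K) * fact K :: real)"
            by (intro mult_mono one_le_power fact_ge_1) auto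
          then show "1 \<le> (2 ^ (n + K) * fact K :: real)" by simp
        qed (use S in auto)
        also have "\<dots> = 2 ^ (n + K) * fact K * S" by simp
        finally have "F \<le> A * H ^ (n + K) * (2 ^ (n + K) * fact K * S)"
          unfolding F_def using A H by (intro mult_left_mono) auto
        then have "F * (C1 * (1 + 1 / c) ^ m) * (1 / c) ^ n * \<mu> \<le> A * H ^ (n + K) * (2 ^ (n + K) * fact K * S) * (C1 * (1 + 1 / c) ^ m) * (1 / c) ^ n * \<mu>"
          using C1(1) c \<mu> by (intro mult_right_mono) auto
        also have "\<dots> = Y0 * (2 * H / c) ^ n * S"
          by (simp add: Y0_def power_add power_mult_distrib power_divide)
        also have "\<dots> \<le> P2 ^ (n + 1) * S"
          unfolding P2_def using Y0 H c S by (intro mult_right_mono absorb_geometric) auto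
        finally show "F * (C1 * (1 + 1 / c) ^ m) * (1 / c) ^ n * \<mu> \<le> P2 ^ (n + 1) * S" .
      qed
      also have "\<dots> \<le> (P1 + P2) ^ (n + 1) * S"
        unfolding distrib_right[symmetric] using P12 S by (intro mult_right_mono add_power_le) auto
      finally show "(1 + norm \<xi>) ^ n * norm (loc_ft (mult_dist \<phi> g) x0 N \<xi>) \<le> (P1 + P2) ^ (n + 1) * (real n ^ n) powr s"
        by (simp only: T_def S_def)
    qed
  qed
qed

lemma Linf_norm_weighted_AE:
  assumes "Linf_norm (\<lambda>\<xi>. G \<xi> * complex_of_real (bracket \<xi> powr (- M))) < \<infinity>" "M > 0"
  obtains B m where "0 \<le> B" "AE \<eta> in lborel. norm (G \<eta>) \<le> B * (1 + norm \<eta>) ^ m"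
proof -
  obtain B where B: "0 \<le> B" "Linf_norm (\<lambda>\<xi>. G \<xi> * complex_of_real (bracket \<xi> powr (- M))) \<le> ereal B"
    using less_infty_ereal_bound[OF assms(1)] .
  define m where "m = nat \<lceil>M\<rceil>"
  have "AE \<eta> in lborel. norm (G \<eta>) \<le> B * (1 + norm \<eta>) ^ m"
    using Linf_norm_AE_le[OF B(2)]
  proof eventually_elim
    case (elim \<eta>)
    have b: "1 \<le> bracket \<eta>" "bracket \<eta> \<le> 1 + norm \<eta>" by (rule bracket_bounds)+
    have "norm (G \<eta>) = norm (G \<eta> * complex_of_real (bracket \<eta> powr (- M))) * bracket \<eta> powr M"
      using b by (simp add: norm_mult mult.assoc flip: powr_add)
    also have "\<dots> \<le> B * bracket \<eta> powr M" using elim by (rule mult_right_mono) simp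
    also have "bracket \<eta> powr M \<le> bracket \<eta> powr real m"
      using b assms(2) by (intro powr_mono) (auto simp: m_def)
    also have "bracket \<eta> powr real m = bracket \<eta> ^ m" using b by (intro powr_realpow) simp
    also have "\<dots> \<le> (1 + norm \<eta>) ^ m" using b by (intro power_mono) auto
    finally show ?case using B(1) by (simp add: mult_left_mono)
  qed
  with B(1) show ?thesis by (rule that)
qed

theorem proposition2p16:
  fixes s :: real
    and f :: "'n::finite functional"
    and P :: "'n multi_index \<Rightarrow>\<^sub>0 complex"
    and \<phi> :: "real ^ 'n \<Rightarrow> complex"
    and x0 \<xi>0 :: "real ^ 'n"
  assumes "1 / 2 \<le> s" and "s < 1"
    and "distribution f"
    and "\<phi> \<in> gevrey_E s"
    and "\<xi>0 \<noteq> 0"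
  shows "((x0, \<xi>0) \<notin> WF s f \<and>
          (\<exists>g. gevrey_witness s f x0 \<xi>0 g \<and>
             (\<exists>M>0. \<exists>G. given_by (fourier_dist g) G \<and>
                Linf_norm (\<lambda>\<xi>. G \<xi> * complex_of_real (bracket \<xi> powr (- M))) < \<infinity>))
          \<longrightarrow> (x0, \<xi>0) \<notin> WF s (mult_dist \<phi> f))
         \<and> WF s (poly_D P f) \<subseteq> WF s f"
proof (intro conjI impI)
  assume "(x0, \<xi>0) \<notin> WF s f \<and>
          (\<exists>g. gevrey_witness s f x0 \<xi>0 g \<and>
             (\<exists>M>0. \<exists>G. given_by (fourier_dist g) G \<and>
                Linf_norm (\<lambda>\<xi>. G \<xi> * complex_of_real (bracket \<xi> powr (- M))) < \<infinity>))"
  then obtain g M G where g: "gevrey_witness s f x0 \<xi>0 g" and M: "M > 0" and G: "given_by (fourier_dist g) G"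
    and fin: "Linf_norm (\<lambda>\<xi>. G \<xi> * complex_of_real (bracket \<xi> powr (- M))) < \<infinity>"
    by blast
  obtain B m where B: "0 \<le> B" "AE \<eta> in lborel. norm (G \<eta>) \<le> B * (1 + norm \<eta>) ^ m"
    using Linf_norm_weighted_AE[OF fin M] .
  have "gevrey_regular s (mult_dist \<phi> f) x0 \<xi>0"
    by (rule gevrey_regular_mult[OF _ _ assms(4) g G B(2,1)]) (use assms in auto)
  then show "(x0, \<xi>0) \<notin> WF s (mult_dist \<phi> f)" by (simp add: WF_def)
next
  show "WF s (poly_D P f) \<subseteq> WF s f"
  proof
    fix z assume z: "z \<in> WF s (poly_D P f)"
    obtain a b where ab: "z = (a, b)" by (cases z)
    from z have b: "b \<noteq> 0" and "\<not> gevrey_regular s (poly_D P f) a b" by (auto simp: WF_def ab)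
    then have "\<not> gevrey_regular s f a b"
      using gevrey_regular_poly_D[of s f a b P] assms(1,2) by auto
    with b show "z \<in> WF s f" by (simp add: WF_def ab)
  qed
qed

end
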